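(* Let $(A,G,\alpha)$ be a C*-dynamical system with $G$ compact (not necessarily abelian) and $A$ prime. If $g_0\in G$ is such that $\alpha_{g_0}=\mathrm{Ad}\,u_0$ for some unitary $u_0\in M_{loc}(A)^\alpha$, then $g_0\in\Gamma_\omega(\alpha)^\perp$.
   Context: A C*-dynamical system $(A,G,\alpha)$ consists of a C*-algebra $A$, a locally compact group $G$ and a homomorphism $g\mapsto\alpha_g$ of $G$ into the automorphism group of $A$ such that $g\mapsto\alpha_g(a)$ is norm continuous for each $a\in A$. Ideals are closed and two-sided; an ideal is essential if it has nonzero intersection with every nonzero ideal. $A$ is prime if any two nonzero ideals of $A$ have nonzero intersection. Local multiplier algebra: $M_{loc}(A)$ is the C*-algebraic inductive limit of the multiplier algebras $M(I)$, where $I$ runs over the essential ideals of $A$ (directed by reverse inclusion), with connecting maps, for $I\subseteq J$, the injective restriction homomorphisms $M(J)\to M(I)$. Thus $A\subseteq M_{loc}(A)$. Each $\alpha_g$ extends canonically to an automorphism of $M_{loc}(A)$, and $M_{loc}(A)^\alpha$ is the fixed point algebra of $M_{loc}(A)$ under the extensions of all $\alpha_g$, $g\in G$. The condition $\alpha_{g_0}=\mathrm{Ad}\,u_0$ means $\alpha_{g_0}(a)=u_0au_0^*$ for all $a\in A$. Weak Connes spectrum: for $G$ compact, $dg$ is normalized Haar measure and $\widehat G$ is the set of unitary equivalence classes of irreducible unitary representations of $G$. For $\pi\in\widehat G$ with dimension $d_\pi$ and character $\chi_\pi$, put $$A_\pi=\Big\{\int_G d_\pi\,\overline{\chi_\pi(g)}\,\alpha_g(a)\,dg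 : a\in A\Big\},\qquad sp(\alpha)=\{\pi\in\widehat G: A_\pi\neq(0)\}.$$ Let $\mathcal H^\alpha(A)$ be the set of all nonzero $\alpha$-invariant hereditary C*-subalgebras of $A$. The weak Connes spectrum is $$\Gamma_\omega(\alpha)=\bigcap_{B\in\mathcal H^\alpha(A)}sp(\alpha|_B).$$ For $S\subseteq\widehat G$, $S^\perp=\{g\in G:\pi(g)=1\ \text{(the identity operator) for all }\pi\in S\}$. *)

theory Defs
  imports "HOL-Analysis.Analysis" "Jordan_Normal_Form.Schur_Decomposition"
begin

section \<open>C*-algebras\<close>

class scaleC =
  fixes scaleC :: "complex \<Rightarrow> 'a \<Rightarrow> 'a"  (infixr \<open>*\<^sub>C\<close> 75)

class involution =
  fixes star :: "'a \<Rightarrow> 'a"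

text \<open>Not necessarily unital; the zero algebra is included.\<close>

class cstar_algebra = real_normed_algebra + banach + scaleC + involution +
  assumes scaleC_add_right: "c *\<^sub>C (x + y) = c *\<^sub>C x + c *\<^sub>C y"
    and scaleC_add_left: "(c + d) *\<^sub>C x = c *\<^sub>C x + d *\<^sub>C x"
    and scaleC_scaleC: "c *\<^sub>C d *\<^sub>C x = (c * d) *\<^sub>C x"
    and scaleC_of_real: "complex_of_real r *\<^sub>C x = r *\<^sub>R x"
    and mult_scaleC_left: "(c *\<^sub>C x) * y = c *\<^sub>C (x * y)"
    and mult_scaleC_right: "x * (c *\<^sub>C y) = c *\<^sub>C (x * y)"
    and norm_scaleC: "norm (c *\<^sub>C x) = cmod c * norm x"
    and star_add: "star (x + y) = star x + star y"
    and star_scaleC: "star (c *\<^sub>C x) = cnj c *\<^sub>C star x"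
    and star_mult: "star (x * y) = star y * star x"
    and star_star: "star (star x) = x"
    and norm_star_mult: "norm (star x * x) = (norm x)\<^sup>2"

definition complex_subspace :: "'a::cstar_algebra set \<Rightarrow> bool" where
  "complex_subspace S \<longleftrightarrow>
     0 \<in> S \<and> (\<forall>x\<in>S. \<forall>y\<in>S. x + y \<in> S) \<and> (\<forall>c. \<forall>x\<in>S. c *\<^sub>C x \<in> S)"

definition closed_ideal :: "'a::cstar_algebra set \<Rightarrow> bool" where
  "closed_ideal I \<longleftrightarrow>
     complex_subspace I \<and> closed I \<and> (\<forall>a. \<forall>x\<in>I. a * x \<in> I \<and> x * a \<in> I)"

definition essential_ideal :: "'a::cstar_algebra set \<Rightarrow> bool" where
  "essential_ideal I \<longleftrightarrow>
     closed_ideal I \<and> (\<forall>J. closed_ideal J \<and> J \<noteq> {0} \<longrightarrow> I \<inter> J \<noteq> {0})"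

text \<open>
  As usual, a prime C*-algebra is nonzero. (The zero algebra has no nonzero hereditary
  subalgebra, so its weak Connes spectrum would be an intersection over the empty family.)
\<close>

definition prime_cstar_algebra :: "'a::cstar_algebra itself \<Rightarrow> bool" where
  "prime_cstar_algebra _ \<longleftrightarrow>
     (\<exists>a::'a. a \<noteq> 0) \<and>
     (\<forall>I J :: 'a set. closed_ideal I \<and> I \<noteq> {0} \<and> closed_ideal J \<and> J \<noteq> {0} \<longrightarrow> I \<inter> J \<noteq> {0})"

definition positive_element :: "'a::cstar_algebra \<Rightarrow> bool" where
  "positive_element a \<longleftrightarrow> (\<exists>x. a = star x * x)"

definition cstar_subalgebra :: "'a::cstar_algebra set \<Rightarrow> bool" where
  "cstar_subalgebra B \<longleftrightarrow>
     complex_subspace B \<and> closed B \<and> (\<forall>x\<in>B. star x \<in> B) \<and> (\<forall>x\<in>B. \<forall>y\<in>B. x * y \<in> B)"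

definition hereditary_subalgebra :: "'a::cstar_algebra set \<Rightarrow> bool" where
  "hereditary_subalgebra B \<longleftrightarrow>
     cstar_subalgebra B \<and>
     (\<forall>a. \<forall>b\<in>B. positive_element a \<and> positive_element (b - a) \<longrightarrow> a \<in> B)"

definition star_automorphism :: "('a::cstar_algebra \<Rightarrow> 'a) \<Rightarrow> bool" where
  "star_automorphism \<phi> \<longleftrightarrow>
     bij \<phi> \<and> (\<forall>x y. \<phi> (x + y) = \<phi> x + \<phi> y) \<and> (\<forall>c x. \<phi> (c *\<^sub>C x) = c *\<^sub>C \<phi> x) \<and>
     (\<forall>x y. \<phi> (x * y) = \<phi> x * \<phi> y) \<and> (\<forall>x. \<phi> (star x) = star (\<phi> x))"


section \<open>C*-dynamical systems\<close>

text \<open>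
  The group is written additively because the library's class of topological groups is
  \<^class>\<open>topological_group_add\<close>; that class does not assume commutativity.
\<close>

definition cstar_dynamical_system ::
    "('g::topological_group_add \<Rightarrow> 'a::cstar_algebra \<Rightarrow> 'a) \<Rightarrow> bool" where
  "cstar_dynamical_system \<alpha> \<longleftrightarrow>
     (\<forall>g. star_automorphism (\<alpha> g)) \<and>
     (\<forall>g h. \<alpha> (g + h) = \<alpha> g \<circ> \<alpha> h) \<and>
     (\<forall>a. continuous_on UNIV (\<lambda>g. \<alpha> g a))"


section \<open>Multiplier algebras\<close>

text \<open>
  \<open>M(I)\<close> is the algebra of double centralizers \<open>(L, R)\<close> of \<open>I\<close>; the multiplier \<open>m\<close> corresponds
  to \<open>L x = m x\<close> and \<open>R x = x m\<close>. The maps are normalized to be 0 outside \<open>I\<close>.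
\<close>

type_synonym 'a centralizer = "('a \<Rightarrow> 'a) \<times> ('a \<Rightarrow> 'a)"

definition bounded_operator_on :: "'a::cstar_algebra set \<Rightarrow> ('a \<Rightarrow> 'a) \<Rightarrow> bool" where
  "bounded_operator_on I T \<longleftrightarrow>
     (\<forall>x\<in>I. T x \<in> I) \<and> (\<forall>x. x \<notin> I \<longrightarrow> T x = 0) \<and>
     (\<forall>x\<in>I. \<forall>y\<in>I. T (x + y) = T x + T y) \<and> (\<forall>c. \<forall>x\<in>I. T (c *\<^sub>C x) = c *\<^sub>C T x) \<and>
     (\<exists>C. \<forall>x\<in>I. norm (T x) \<le> C * norm x)"

definition multiplier_algebra :: "'a::cstar_algebra set \<Rightarrow> 'a centralizer set" where
  "multiplier_algebra I =
     {(L, R). bounded_operator_on I L \<and> bounded_operator_on I R \<and>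
        (\<forall>x\<in>I. \<forall>y\<in>I. L (x * y) = L x * y \<and> R (x * y) = x * R y \<and> R x * y = x * L y)}"

definition restrict_centralizer :: "'a::cstar_algebra set \<Rightarrow> 'a centralizer \<Rightarrow> 'a centralizer" where
  "restrict_centralizer K = (\<lambda>(L, R). (\<lambda>x. if x \<in> K then L x else 0, \<lambda>x. if x \<in> K then R x else 0))"

definition centralizer_minus :: "'a::cstar_algebra centralizer \<Rightarrow> 'a centralizer \<Rightarrow> 'a centralizer" where
  "centralizer_minus = (\<lambda>(L, R) (L', R'). (\<lambda>x. L x - L' x, \<lambda>x. R x - R' x))"

definition centralizer_times :: "'a::cstar_algebra centralizer \<Rightarrow> 'a centralizer \<Rightarrow> 'a centralizer" where
  "centralizer_times = (\<lambda>(L, R) (L', R'). (L \<circ> L', R' \<circ> R))"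

definition centralizer_star :: "'a::cstar_algebra centralizer \<Rightarrow> 'a centralizer" where
  "centralizer_star = (\<lambda>(L, R). (\<lambda>x. star (R (star x)), \<lambda>x. star (L (star x))))"

text \<open>The operator norm of \<open>L\<close>, which for a double centralizer equals that of \<open>R\<close>.\<close>

definition centralizer_norm :: "'a::cstar_algebra set \<Rightarrow> 'a centralizer \<Rightarrow> real" where
  "centralizer_norm I = (\<lambda>(L, R). SUP x\<in>{x\<in>I. norm x \<le> 1}. norm (L x))"


section \<open>The local multiplier algebra\<close>

text \<open>
  The pairs \<open>(I, m)\<close> with \<open>m \<in> M(I)\<close> and \<open>I\<close> an essential ideal represent the elements of the
  union of the \<open>M(I)\<close> in the inductive limit. Algebraic operations on two such pairs are performed
  after mapping both into \<open>M(I \<inter> J)\<close>.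
\<close>

type_synonym 'a local_multiplier = "'a set \<times> 'a centralizer"

definition local_multipliers :: "'a::cstar_algebra local_multiplier set" where
  "local_multipliers = {(I, m). essential_ideal I \<and> m \<in> multiplier_algebra I}"

definition lm_minus :: "'a::cstar_algebra local_multiplier \<Rightarrow> 'a local_multiplier \<Rightarrow> 'a local_multiplier" where
  "lm_minus = (\<lambda>(I, m) (J, n). (I \<inter> J,
     centralizer_minus (restrict_centralizer (I \<inter> J) m) (restrict_centralizer (I \<inter> J) n)))"

definition lm_times :: "'a::cstar_algebra local_multiplier \<Rightarrow> 'a local_multiplier \<Rightarrow> 'a local_multiplier" where
  "lm_times = (\<lambda>(I, m) (J, n). (I \<inter> J,
     centralizer_times (restrict_centralizer (I \<inter> J) m) (restrict_centralizer (I \<inter> J) n)))"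

definition lm_star :: "'a::cstar_algebra local_multiplier \<Rightarrow> 'a local_multiplier" where
  "lm_star = (\<lambda>(I, m). (I, centralizer_star m))"

text \<open>The elements of \<open>M(A)\<close> given by an element of \<open>A\<close> and by the unit.\<close>

definition lm_of :: "'a::cstar_algebra \<Rightarrow> 'a local_multiplier" where
  "lm_of a = (UNIV, (\<lambda>x. a * x, \<lambda>x. x * a))"

definition lm_one :: "'a::cstar_algebra local_multiplier" where
  "lm_one = (UNIV, (\<lambda>x. x, \<lambda>x. x))"

text \<open>The isomorphism \<open>M(I) \<rightarrow> M(\<phi>(I))\<close> induced by an automorphism \<open>\<phi>\<close> of \<open>A\<close>.\<close>

definition lm_map :: "('a::cstar_algebra \<Rightarrow> 'a) \<Rightarrow> 'a local_multiplier \<Rightarrow> 'a local_multiplier" where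
  "lm_map \<phi> = (\<lambda>(I, (L, R)). (\<phi> ` I, (\<phi> \<circ> L \<circ> inv_into UNIV \<phi>, \<phi> \<circ> R \<circ> inv_into UNIV \<phi>)))"

text \<open>
  The C*-seminorm of the inductive limit: the limit of the decreasing net of the norms of the
  images of \<open>m\<close> in the \<open>M(K)\<close>, for \<open>K \<subseteq> I\<close>. (The connecting maps being isometric, this net is
  in fact constant.)
\<close>

definition lm_norm :: "'a::cstar_algebra local_multiplier \<Rightarrow> real" where
  "lm_norm = (\<lambda>(I, m). INF K\<in>{K. essential_ideal K \<and> K \<subseteq> I}.
     centralizer_norm K (restrict_centralizer K m))"

definition lm_dist :: "'a::cstar_algebra local_multiplier \<Rightarrow> 'a local_multiplier \<Rightarrow> real" where
  "lm_dist x y = lm_norm (lm_minus x y)"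

definition lm_cauchy :: "(nat \<Rightarrow> 'a::cstar_algebra local_multiplier) \<Rightarrow> bool" where
  "lm_cauchy s \<longleftrightarrow> (\<forall>n. s n \<in> local_multipliers) \<and>
     (\<forall>e>0. \<exists>N. \<forall>m\<ge>N. \<forall>n\<ge>N. lm_dist (s m) (s n) < e)"

definition mloc_rel ::
    "(nat \<Rightarrow> 'a::cstar_algebra local_multiplier) \<Rightarrow> (nat \<Rightarrow> 'a local_multiplier) \<Rightarrow> bool" where
  "mloc_rel s t \<longleftrightarrow> lm_cauchy s \<and> lm_cauchy t \<and> (\<lambda>n. lm_dist (s n) (t n)) \<longlonglongrightarrow> 0"

lemma closed_ideal_Int: "closed_ideal I \<Longrightarrow> closed_ideal J \<Longrightarrow> closed_ideal (I \<inter> J)"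
  unfolding closed_ideal_def complex_subspace_def by auto

lemma essential_ideal_Int: "essential_ideal I \<Longrightarrow> essential_ideal J \<Longrightarrow> essential_ideal (I \<inter> J)"
  unfolding essential_ideal_def by (metis closed_ideal_Int inf_assoc)

lemma closed_ideal_UNIV: "closed_ideal UNIV"
  unfolding closed_ideal_def complex_subspace_def by auto

lemma essential_ideal_UNIV: "essential_ideal UNIV"
  unfolding essential_ideal_def by (simp add: closed_ideal_UNIV)

lemma lm_dist_eq:
  "lm_dist (I, (L, R)) (J, (L', R')) = (INF K\<in>{K. essential_ideal K \<and> K \<subseteq> I \<inter> J}.
     SUP x\<in>{x\<in>K. norm x \<le> 1}. norm (L x - L' x))"
  unfolding lm_dist_def lm_minus_def lm_norm_def centralizer_norm_def restrict_centralizer_def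
    centralizer_minus_def
  by (auto intro!: INF_cong SUP_cong)

lemma local_multipliers_bound:
  assumes "(I, (L, R)) \<in> local_multipliers"
  shows "\<exists>C. \<forall>x\<in>I. norm x \<le> 1 \<longrightarrow> norm (L x) \<le> C"
proof -
  have "\<exists>C. \<forall>x\<in>I. norm (L x) \<le> C * norm x"
    using assms unfolding local_multipliers_def multiplier_algebra_def bounded_operator_on_def by auto
  then obtain C where C: "\<And>x. x \<in> I \<Longrightarrow> norm (L x) \<le> C * norm x" by blast
  have "norm (L x) \<le> \<bar>C\<bar>" if "x \<in> I" "norm x \<le> 1" for x
    using C[OF that(1)] mult_mono[of C "\<bar>C\<bar>" "norm x" 1] that(2) by force
  then show ?thesis by blast
qed

lemma lm_dist_less_iff:
  assumes x: "(I, (L, R)) \<in> local_multipliers" and y: "(J, (L', R')) \<in> local_multipliers"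
  shows "lm_dist (I, (L, R)) (J, (L', R')) < e \<longleftrightarrow>
    (\<exists>K e'. essential_ideal K \<and> K \<subseteq> I \<inter> J \<and> e' < e \<and>
       (\<forall>x\<in>K. norm x \<le> 1 \<longrightarrow> norm (L x - L' x) \<le> e'))"
    (is "?l \<longleftrightarrow> ?r")
    and "lm_dist (I, (L, R)) (J, (L', R')) \<ge> 0"
proof -
  let ?S = "{K. essential_ideal K \<and> K \<subseteq> I \<inter> J}"
  let ?f = "\<lambda>K. SUP x\<in>{x\<in>K. norm x \<le> 1}. norm (L x - L' x)"
  obtain C C' where C: "\<forall>x\<in>I. norm x \<le> 1 \<longrightarrow> norm (L x) \<le> C"
      "\<forall>x\<in>J. norm x \<le> 1 \<longrightarrow> norm (L' x) \<le> C'"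
    using local_multipliers_bound x y by metis
  have bd: "bdd_above ((\<lambda>x. norm (L x - L' x)) ` {x\<in>K. norm x \<le> 1})" if "K \<in> ?S" for K
  proof (rule bdd_aboveI2)
    fix x assume "x \<in> {x\<in>K. norm x \<le> 1}"
    then have "norm (L x) \<le> C" "norm (L' x) \<le> C'" using C that by auto
    then show "norm (L x - L' x) \<le> C + C'" using norm_triangle_ineq4[of "L x" "L' x"] by linarith
  qed
  have z: "0 \<in> {x\<in>K. norm x \<le> 1}" if "K \<in> ?S" for K
    using that by (auto simp: essential_ideal_def closed_ideal_def complex_subspace_def)
  have nn: "0 \<le> ?f K" if "K \<in> ?S" for K
    by (rule cSUP_upper2[OF bd[OF that] z[OF that]]) simp
  have ne: "I \<inter> J \<in> ?S"
    using x y essential_ideal_Int unfolding local_multipliers_def by auto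
  have bb: "bdd_below (?f ` ?S)"
    using nn by (rule bdd_belowI2)
  show "lm_dist (I, (L, R)) (J, (L', R')) \<ge> 0"
    unfolding lm_dist_eq using ne nn by (intro cINF_greatest) auto
  have sup_le: "?f K \<le> e' \<longleftrightarrow> (\<forall>x\<in>K. norm x \<le> 1 \<longrightarrow> norm (L x - L' x) \<le> e')" if "K \<in> ?S" for K e'
    using z[OF that] by (subst cSUP_le_iff[OF _ bd[OF that]]) auto
  have "?l \<longleftrightarrow> (\<exists>K\<in>?S. ?f K < e)"
    unfolding lm_dist_eq using ne by (intro cINF_less_iff[OF _ bb]) blast
  also have "\<dots> \<longleftrightarrow> (\<exists>K\<in>?S. \<exists>e'<e. ?f K \<le> e')"
    by (meson le_less_trans order_refl)
  also have "\<dots> \<longleftrightarrow> (\<exists>K\<in>?S. \<exists>e'<e. \<forall>x\<in>K. norm x \<le> 1 \<longrightarrow> norm (L x - L' x) \<le> e')"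
    using sup_le by auto
  finally show "?l \<longleftrightarrow> ?r" by auto
qed

lemma lm_dist_nonneg: "x \<in> local_multipliers \<Longrightarrow> y \<in> local_multipliers \<Longrightarrow> lm_dist x y \<ge> 0"
  by (cases x; cases y) (use lm_dist_less_iff(2) in fastforce)

lemma lm_dist_self:
  assumes "x \<in> local_multipliers"
  shows "lm_dist x x = 0"
proof -
  obtain I L R where x: "x = (I, (L, R))" by (cases x) auto
  have "lm_dist x x < e" if "e > 0" for e
    using assms that lm_dist_less_iff(1)[of I L R I L R e] unfolding x
    by (auto simp: local_multipliers_def)
  then show ?thesis using lm_dist_nonneg[OF assms assms] by (metis less_irrefl order_le_less)
qed

lemma lm_dist_sym: "lm_dist x y = lm_dist y x"
  by (cases x; cases y) (auto simp: lm_dist_eq norm_minus_commute Int_commute)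

lemma lm_dist_triangle:
  assumes "x \<in> local_multipliers" "y \<in> local_multipliers" "z \<in> local_multipliers"
  shows "lm_dist x z \<le> lm_dist x y + lm_dist y z"
proof -
  obtain I L R where x: "x = (I, (L, R))" by (cases x) auto
  obtain J M S where y: "y = (J, (M, S))" by (cases y) auto
  obtain H N T where z: "z = (H, (N, T))" by (cases z) auto
  show ?thesis
  proof (rule field_le_epsilon)
    fix e :: real assume "e > 0"
    then have 1: "lm_dist x y < lm_dist x y + e / 2" "lm_dist y z < lm_dist y z + e / 2" by auto
    obtain K a where K: "essential_ideal K" "K \<subseteq> I \<inter> J" "a < lm_dist x y + e / 2"
        "\<And>x. x \<in> K \<Longrightarrow> norm x \<le> 1 \<Longrightarrow> norm (L x - M x) \<le> a"
      using 1(1) assms lm_dist_less_iff(1)[of I L R J M S] unfolding x y by metis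
    obtain K' b where K': "essential_ideal K'" "K' \<subseteq> J \<inter> H" "b < lm_dist y z + e / 2"
        "\<And>x. x \<in> K' \<Longrightarrow> norm x \<le> 1 \<Longrightarrow> norm (M x - N x) \<le> b"
      using 1(2) assms lm_dist_less_iff(1)[of J M S H N T] unfolding y z by metis
    have "norm (L w - N w) \<le> a + b" if "w \<in> K \<inter> K'" "norm w \<le> 1" for w
      using K(4)[of w] K'(4)[of w] that norm_triangle_ineq[of "L w - M w" "M w - N w"] by auto
    then have "lm_dist x z < lm_dist x y + lm_dist y z + e"
      unfolding x z using assms(1,3) K K' essential_ideal_Int[OF K(1) K'(1)]
      unfolding x z
      by (subst lm_dist_less_iff(1)) (auto intro!: exI[of _ "K \<inter> K'"] exI[of _ "a + b"])
    then show "lm_dist x z \<le> lm_dist x y + lm_dist y z + e" by simp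
  qed
qed

lemma lm_one_in: "lm_one \<in> local_multipliers"
  unfolding lm_one_def local_multipliers_def multiplier_algebra_def bounded_operator_on_def
  by (auto simp: essential_ideal_UNIV intro: exI[of _ 1])

lemma part_equivp_mloc_rel: "part_equivp mloc_rel"
proof (rule part_equivpI)
  have "mloc_rel (\<lambda>_. lm_one) (\<lambda>_. lm_one :: 'a local_multiplier)"
    unfolding mloc_rel_def lm_cauchy_def by (simp add: lm_one_in lm_dist_self)
  then show "\<exists>s::nat \<Rightarrow> 'a local_multiplier. mloc_rel s s" by blast
  show "symp (mloc_rel :: (nat \<Rightarrow> 'a local_multiplier) \<Rightarrow> _)"
    by (rule sympI) (auto simp: mloc_rel_def lm_dist_sym)
  show "transp (mloc_rel :: (nat \<Rightarrow> 'a local_multiplier) \<Rightarrow> _)"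
  proof (rule transpI)
    fix s t r :: "nat \<Rightarrow> 'a local_multiplier"
    assume st: "mloc_rel s t" and tr: "mloc_rel t r"
    then have c: "\<And>n. s n \<in> local_multipliers" "\<And>n. t n \<in> local_multipliers"
        "\<And>n. r n \<in> local_multipliers"
      unfolding mloc_rel_def lm_cauchy_def by auto
    have "(\<lambda>n. lm_dist (s n) (t n) + lm_dist (t n) (r n)) \<longlonglongrightarrow> 0"
      using st tr tendsto_add[of _ 0 sequentially _ 0] unfolding mloc_rel_def by fastforce
    then have "(\<lambda>n. lm_dist (s n) (r n)) \<longlonglongrightarrow> 0"
      by (rule tendsto_sandwich[rotated 3, of _ _ _ "\<lambda>_. 0"])
        (auto simp: lm_dist_nonneg lm_dist_triangle c)
    then show "mloc_rel s r" using st tr unfolding mloc_rel_def by auto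
  qed
qed

text \<open>
  \<open>M\<^sub>l\<^sub>o\<^sub>c(A)\<close> is the completion of the algebraic direct limit: Cauchy sequences modulo null sequences.
  (Pairs that become equal in some \<open>M(K)\<close> have distance 0, so they are identified as well.)
\<close>

quotient_type (overloaded) 'a mloc =
  "nat \<Rightarrow> 'a::cstar_algebra local_multiplier" / partial: mloc_rel
  by (rule part_equivp_mloc_rel)

instantiation mloc :: (cstar_algebra) "{one, times, involution}"
begin

definition one_mloc :: "'a mloc" where
  "one_mloc = abs_mloc (\<lambda>_. lm_one)"

definition times_mloc :: "'a mloc \<Rightarrow> 'a mloc \<Rightarrow> 'a mloc" where
  "times_mloc u v = abs_mloc (\<lambda>n. lm_times (rep_mloc u n) (rep_mloc v n))"

definition star_mloc :: "'a mloc \<Rightarrow> 'a mloc" where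
  "star_mloc u = abs_mloc (\<lambda>n. lm_star (rep_mloc u n))"

instance ..

end

text \<open>The inclusion of \<open>A\<close>, and the canonical extension to \<open>M\<^sub>l\<^sub>o\<^sub>c(A)\<close> of an automorphism of \<open>A\<close>.\<close>

definition mloc_of :: "'a::cstar_algebra \<Rightarrow> 'a mloc" where
  "mloc_of a = abs_mloc (\<lambda>_. lm_of a)"

definition mloc_map :: "('a::cstar_algebra \<Rightarrow> 'a) \<Rightarrow> 'a mloc \<Rightarrow> 'a mloc" where
  "mloc_map \<phi> u = abs_mloc (\<lambda>n. lm_map \<phi> (rep_mloc u n))"

definition mloc_fixed :: "('g \<Rightarrow> 'a::cstar_algebra \<Rightarrow> 'a) \<Rightarrow> 'a mloc set" where
  "mloc_fixed \<alpha> = {u. \<forall>g. mloc_map (\<alpha> g) u = u}"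

definition mloc_unitary :: "'a::cstar_algebra mloc \<Rightarrow> bool" where
  "mloc_unitary u \<longleftrightarrow> star u * u = 1 \<and> u * star u = 1"


section \<open>The dual of a compact group\<close>

text \<open>
  Irreducible unitary representations of a compact group are finite-dimensional, so they are taken
  to be given by unitary matrices; the elements of the dual are equivalence classes of these.
\<close>

definition unitary_mat :: "nat \<Rightarrow> complex mat \<Rightarrow> bool" where
  "unitary_mat d U \<longleftrightarrow>
     U \<in> carrier_mat d d \<and> mat_adjoint U * U = 1\<^sub>m d \<and> U * mat_adjoint U = 1\<^sub>m d"

definition rep_dim :: "('g::zero \<Rightarrow> complex mat) \<Rightarrow> nat" where
  "rep_dim \<pi> = dim_row (\<pi> 0)"

definition unitary_rep :: "('g::topological_group_add \<Rightarrow> complex mat) \<Rightarrow> bool" where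
  "unitary_rep \<pi> \<longleftrightarrow>
     (\<forall>g. unitary_mat (rep_dim \<pi>) (\<pi> g)) \<and> (\<forall>g h. \<pi> (g + h) = \<pi> g * \<pi> h) \<and>
     (\<forall>i<rep_dim \<pi>. \<forall>j<rep_dim \<pi>. continuous_on UNIV (\<lambda>g. \<pi> g $$ (i, j)))"

definition invariant_subspace :: "('g::topological_group_add \<Rightarrow> complex mat) \<Rightarrow> complex vec set \<Rightarrow> bool" where
  "invariant_subspace \<pi> W \<longleftrightarrow>
     W \<subseteq> carrier_vec (rep_dim \<pi>) \<and> 0\<^sub>v (rep_dim \<pi>) \<in> W \<and>
     (\<forall>v\<in>W. \<forall>w\<in>W. v + w \<in> W) \<and> (\<forall>c. \<forall>v\<in>W. c \<cdot>\<^sub>v v \<in> W) \<and>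
     (\<forall>g. \<forall>v\<in>W. \<pi> g *\<^sub>v v \<in> W)"

definition irreducible_unitary_rep :: "('g::topological_group_add \<Rightarrow> complex mat) \<Rightarrow> bool" where
  "irreducible_unitary_rep \<pi> \<longleftrightarrow>
     unitary_rep \<pi> \<and> rep_dim \<pi> > 0 \<and>
     (\<forall>W. invariant_subspace \<pi> W \<longrightarrow> W = {0\<^sub>v (rep_dim \<pi>)} \<or> W = carrier_vec (rep_dim \<pi>))"

definition unitary_equivalence ::
    "(('g::topological_group_add \<Rightarrow> complex mat) \<times> ('g \<Rightarrow> complex mat)) set" where
  "unitary_equivalence = {(\<pi>, \<rho>).
     irreducible_unitary_rep \<pi> \<and> irreducible_unitary_rep \<rho> \<and>
     (\<exists>U. unitary_mat (rep_dim \<pi>) U \<and> (\<forall>g. \<rho> g = U * \<pi> g * mat_adjoint U))}"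

definition unitary_dual :: "('g::topological_group_add \<Rightarrow> complex mat) set set" where
  "unitary_dual = {\<pi>. irreducible_unitary_rep \<pi>} // unitary_equivalence"

definition rep_character :: "('g::topological_group_add \<Rightarrow> complex mat) \<Rightarrow> 'g \<Rightarrow> complex" where
  "rep_character \<pi> g = (\<Sum>i<rep_dim \<pi>. \<pi> g $$ (i, i))"

definition annihilator :: "('g::topological_group_add \<Rightarrow> complex mat) set set \<Rightarrow> 'g set" where
  "annihilator S = {g. \<forall>P\<in>S. \<forall>\<pi>\<in>P. \<pi> g = 1\<^sub>m (rep_dim \<pi>)}"


section \<open>The weak Connes spectrum\<close>

text \<open>
  Inner regularity is part of the definition since the group need not be metrizable. As the measure
  is finite, outer regularity follows by taking complements. The definition is used for compact
  groups only, where left invariance entails right invariance.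
\<close>

definition normalized_haar_measure :: "'g::{topological_group_add,t2_space} measure \<Rightarrow> bool" where
  "normalized_haar_measure \<mu> \<longleftrightarrow>
     sets \<mu> = sets borel \<and> emeasure \<mu> UNIV = 1 \<and>
     (\<forall>g. \<forall>B\<in>sets borel. emeasure \<mu> ((+) g ` B) = emeasure \<mu> B) \<and>
     (\<forall>B\<in>sets borel. emeasure \<mu> B = (SUP K\<in>{K. compact K \<and> K \<subseteq> B}. emeasure \<mu> K))"

text \<open>
  The library's \<^const>\<open>has_bochner_integral\<close> requires a second countable range, which would exclude
  nonseparable algebras. This is the same definition without that class constraint; it is only
  applied to norm continuous functions.
\<close>

definition has_vector_integral :: "'g measure \<Rightarrow> ('g \<Rightarrow> 'a::real_normed_vector) \<Rightarrow> 'a \<Rightarrow> bool" where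
  "has_vector_integral \<mu> f x \<longleftrightarrow>
     f \<in> borel_measurable \<mu> \<and>
     (\<exists>s. (\<forall>i. Bochner_Integration.simple_bochner_integrable \<mu> (s i)) \<and>
        (\<lambda>i. \<integral>\<^sup>+ g. norm (f g - s i g) \<partial>\<mu>) \<longlonglongrightarrow> 0 \<and>
        (\<lambda>i. Bochner_Integration.simple_bochner_integral \<mu> (s i)) \<longlonglongrightarrow> x)"

definition spectral_subspace ::
    "'g::topological_group_add measure \<Rightarrow> ('g \<Rightarrow> 'a::cstar_algebra \<Rightarrow> 'a) \<Rightarrow> 'a set \<Rightarrow>
     ('g \<Rightarrow> complex mat) \<Rightarrow> 'a set" where
  "spectral_subspace \<mu> \<alpha> B \<pi> = {x. \<exists>a\<in>B.
     has_vector_integral \<mu> (\<lambda>g. (of_nat (rep_dim \<pi>) * cnj (rep_character \<pi> g)) *\<^sub>C \<alpha> g a) x}"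

text \<open>
  \<open>sp(\<alpha>|\<^sub>B)\<close> for an invariant subalgebra \<open>B\<close>. The spectral subspace depends on the class of the
  representation only, so any representative may be used.
\<close>

definition action_spectrum ::
    "'g::topological_group_add measure \<Rightarrow> ('g \<Rightarrow> 'a::cstar_algebra \<Rightarrow> 'a) \<Rightarrow> 'a set \<Rightarrow>
     ('g \<Rightarrow> complex mat) set set" where
  "action_spectrum \<mu> \<alpha> B = {P \<in> unitary_dual. \<exists>\<pi>\<in>P. spectral_subspace \<mu> \<alpha> B \<pi> \<noteq> {0}}"

definition invariant_hereditary_subalgebras :: "('g \<Rightarrow> 'a::cstar_algebra \<Rightarrow> 'a) \<Rightarrow> 'a set set" where
  "invariant_hereditary_subalgebras \<alpha> =
     {B. hereditary_subalgebra B \<and> B \<noteq> {0} \<and> (\<forall>g. \<forall>x\<in>B. \<alpha> g x \<in> B)}"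

definition weak_connes_spectrum ::
    "'g::topological_group_add measure \<Rightarrow> ('g \<Rightarrow> 'a::cstar_algebra \<Rightarrow> 'a) \<Rightarrow>
     ('g \<Rightarrow> complex mat) set set" where
  "weak_connes_spectrum \<mu> \<alpha> = (\<Inter>B\<in>invariant_hereditary_subalgebras \<alpha>. action_spectrum \<mu> \<alpha> B)"

end

theory Submission
  imports Defs
begin

text \<open>
  Fix \<open>\<epsilon> > 0\<close> and let \<open>m \<in> M(I)\<close> approximate \<open>u\<^sub>0\<close>. Since \<open>G\<close> is compact and \<open>A\<close> is prime, \<open>I\<close>
  contains a nonzero \<open>\<alpha>\<close>-invariant ideal \<open>J\<close>. For an approximate eigenvalue \<open>\<zeta>\<close> of \<open>m\<close>, average
  \<open>(m - \<zeta>)\<^sup>*(m - \<zeta>)\<close> over \<open>G\<close>; its spectral subspace near 0 defines an invariant hereditary subalgebra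
  \<open>B\<close> on which \<open>m\<close> is almost the scalar \<open>\<zeta>\<close>, and so \<open>\<alpha>\<^bsub>g\<^sub>0\<^esub> = Ad u\<^sub>0\<close> is almost the identity on \<open>B\<close>. If
  \<open>\<pi>\<close> is in the spectrum of \<open>\<alpha>|\<^sub>B\<close>, the elements \<open>\<integral> \<pi>\<^sub>i\<^sub>j(g)\<^sup>* \<alpha>\<^sub>g(a) dg\<close> of \<open>B\<close> transform according to
  \<open>\<pi>\<close>. As \<open>u\<^sub>0\<close> is fixed by \<open>\<alpha>\<close>, the automorphism \<open>\<alpha>\<^bsub>g\<^sub>0\<^esub>\<close> commutes with \<open>\<alpha>\<close>; hence \<open>\<pi>(g\<^sub>0)\<close> is a scalar,
  and this scalar is within \<open>\<epsilon>\<close> of 1.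

  Functional calculus is replaced by square roots of \<open>1 - T\<close> for self-adjoint contractions \<open>T\<close>: they
  give absolute values, and thereby the positive and negative parts needed for spectral subspaces.
\<close>

section \<open>Self-adjoint operators on subspaces of a C*-algebra\<close>

text \<open>The local multipliers approximating \<open>u\<^sub>0\<close> are not elements of
  \<open>A\<close>, so spectral theory is done for operators on closed subspaces \<open>J\<close> of
  \<open>A\<close>, with \<open>star x * y\<close> as an \<open>A\<close>-valued inner product.
  Self-adjointness is a relation in this product, and order enters only through norm bounds
  certified by sums of commuting squares. Multipliers of ideals, left multiplications and averages
  over the group are all covered. Since \<open>u\<^sub>0\<close> is only a limit, an approximant is
  neither unitary nor fixed; every relation holds up to a multiple of \<epsilon>, uniformly in the
  group. This is why an average has to precede the cut (what is generated by it commutes with the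
  action) and why the subalgebra depends on \<epsilon>. The dependence is harmless: a class in the
  weak Connes spectrum lies in the spectrum of every invariant hereditary subalgebra, and the scalar
  \<open>\<pi> g\<^sub>0\<close> does not depend on the one chosen. Heredity is where order in
  \<open>A\<close> itself matters. It rests on positivity of \<open>star x * x\<close>, which is
  proved from the square roots alone.\<close>

lemma scaleC_zero_left [simp]: "0 *\<^sub>C x = (0::'a::cstar_algebra)"
  using scaleC_of_real[of 0 x] by simp

lemma scaleC_one [simp]: "1 *\<^sub>C x = (x::'a::cstar_algebra)"
  using scaleC_of_real[of 1 x] by simp

lemma scaleC_zero_right [simp]: "c *\<^sub>C 0 = (0::'a::cstar_algebra)"
  using scaleC_add_right[of c 0 "0::'a"] by simp

lemma scaleC_minus_left: "(- c) *\<^sub>C x = - (c *\<^sub>C x :: 'a::cstar_algebra)"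
  using scaleC_add_left[of c "- c" x] by (simp add: eq_neg_iff_add_eq_0 add.commute)

lemma scaleC_minus_right: "c *\<^sub>C (- x) = - (c *\<^sub>C x :: 'a::cstar_algebra)"
  using scaleC_add_right[of c x "- x"] by (simp add: eq_neg_iff_add_eq_0 add.commute)

lemma scaleC_diff_right: "c *\<^sub>C (x - y) = c *\<^sub>C x - (c *\<^sub>C y :: 'a::cstar_algebra)"
  using scaleC_add_right[of c x "- y"] by (simp add: scaleC_minus_right)

lemma scaleC_diff_left: "(c - d) *\<^sub>C x = c *\<^sub>C x - (d *\<^sub>C x :: 'a::cstar_algebra)"
  using scaleC_add_left[of c "- d" x] by (simp add: scaleC_minus_left)

lemma scaleC_scaleR: "c *\<^sub>C (r *\<^sub>R x) = r *\<^sub>R (c *\<^sub>C x :: 'a::cstar_algebra)"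
  by (metis mult.commute scaleC_of_real scaleC_scaleC)

lemma star_zero [simp]: "star 0 = (0::'a::cstar_algebra)"
  using star_add[of 0 "0::'a"] by simp

lemma star_minus: "star (- x) = - star (x::'a::cstar_algebra)"
  using star_add[of x "- x"] by (simp add: eq_neg_iff_add_eq_0 add.commute)

lemma star_diff: "star (x - y) = star x - star (y::'a::cstar_algebra)"
  using star_add[of x "- y"] by (simp add: star_minus)

lemma star_scaleR: "star (r *\<^sub>R x) = r *\<^sub>R star (x::'a::cstar_algebra)"
  using star_scaleC[of "of_real r" x] by (simp add: scaleC_of_real)

lemma norm_star [simp]: "norm (star x) = norm (x::'a::cstar_algebra)"
proof -
  have le: "norm y \<le> norm (star y)" for y :: 'a
  proof (cases "y = 0")
    case False
    have "norm y * norm y \<le> norm (star y) * norm y"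
      using norm_mult_ineq[of "star y" y] by (simp add: norm_star_mult power2_eq_square)
    then show ?thesis using False by simp
  qed simp
  from le[of x] le[of "star x"] show ?thesis by (simp add: star_star)
qed

lemma star_mult_self_eq_0 [simp]: "star x * x = 0 \<longleftrightarrow> x = (0::'a::cstar_algebra)"
  using norm_star_mult[of x] by auto

lemma star_eq_0_iff [simp]: "star x = 0 \<longleftrightarrow> x = (0::'a::cstar_algebra)"
  by (metis star_star star_zero)

lemma bounded_linear_star: "bounded_linear (star :: 'a::cstar_algebra \<Rightarrow> 'a)"
  by (rule bounded_linear_intro[of _ 1]) (auto simp: star_add star_scaleR)

lemma bounded_linear_scaleC: "bounded_linear (\<lambda>x::'a::cstar_algebra. c *\<^sub>C x)"
  by (rule bounded_linear_intro[of _ "cmod c"])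
    (auto simp: scaleC_add_right scaleC_scaleR norm_scaleC)

section \<open>Closed subspaces and adjointable operators\<close>

definition closed_subspace :: "'a::cstar_algebra set \<Rightarrow> bool" where
  "closed_subspace J \<longleftrightarrow> complex_subspace J \<and> closed J"

lemma closed_subspaceD:
  assumes "closed_subspace J"
  shows "0 \<in> J" "x \<in> J \<Longrightarrow> y \<in> J \<Longrightarrow> x + y \<in> J" "x \<in> J \<Longrightarrow> c *\<^sub>C x \<in> J"
    "x \<in> J \<Longrightarrow> r *\<^sub>R x \<in> J" "x \<in> J \<Longrightarrow> y \<in> J \<Longrightarrow> x - y \<in> J" "x \<in> J \<Longrightarrow> - x \<in> J"
proof -
  show 1: "0 \<in> J" "x \<in> J \<Longrightarrow> y \<in> J \<Longrightarrow> x + y \<in> J" "\<And>x c. x \<in> J \<Longrightarrow> c *\<^sub>C x \<in> J" for x y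
    using assms unfolding closed_subspace_def complex_subspace_def by auto
  show r: "x \<in> J \<Longrightarrow> r *\<^sub>R x \<in> J" for x r
    using 1(3)[of x "of_real r"] by (simp add: scaleC_of_real)
  show m: "x \<in> J \<Longrightarrow> - x \<in> J" for x
    using r[of x "-1"] by simp
  show "x \<in> J \<Longrightarrow> y \<in> J \<Longrightarrow> x - y \<in> J"
    using 1(2)[of x "- y"] m by simp
qed

lemma closed_subspace_lim:
  "closed_subspace J \<Longrightarrow> (\<And>n. f n \<in> J) \<Longrightarrow> f \<longlonglongrightarrow> l \<Longrightarrow> l \<in> J"
  unfolding closed_subspace_def by (meson closed_sequentially)

lemma closed_subspace_UNIV [simp]: "closed_subspace (UNIV :: 'a::cstar_algebra set)"
  unfolding closed_subspace_def complex_subspace_def by auto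

lemma closed_ideal_subspace: "closed_ideal I \<Longrightarrow> closed_subspace I"
  unfolding closed_ideal_def closed_subspace_def by auto

lemma closed_idealD: "closed_ideal I \<Longrightarrow> x \<in> I \<Longrightarrow> a * x \<in> I" "closed_ideal I \<Longrightarrow> x \<in> I \<Longrightarrow> x * a \<in> I"
  unfolding closed_ideal_def by auto

text \<open>\<open>J\<close> is treated like a Hilbert module with inner product
  \<open>star x * y\<close>, and \<open>S\<close> is the adjoint of \<open>T\<close>. On an ideal,
  left multiplication by a multiplier has left multiplication by its adjoint as \<open>S\<close>.
  Linearity is derived from the relation, not put into the definition.\<close>

definition adjoint_on :: "'a::cstar_algebra set \<Rightarrow> ('a \<Rightarrow> 'a) \<Rightarrow> ('a \<Rightarrow> 'a) \<Rightarrow> bool" where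
  "adjoint_on J T S \<longleftrightarrow>
     (\<forall>x\<in>J. T x \<in> J \<and> S x \<in> J) \<and> (\<forall>x\<in>J. \<forall>y\<in>J. star (T x) * y = star x * S y)"

definition bounded_by :: "'a::real_normed_vector set \<Rightarrow> ('a \<Rightarrow> 'a) \<Rightarrow> real \<Rightarrow> bool" where
  "bounded_by J T C \<longleftrightarrow> (\<forall>x\<in>J. norm (T x) \<le> C * norm x)"

definition selfadjoint_on :: "'a::cstar_algebra set \<Rightarrow> ('a \<Rightarrow> 'a) \<Rightarrow> bool" where
  "selfadjoint_on J T \<longleftrightarrow> adjoint_on J T T \<and> (\<exists>C. bounded_by J T C)"

lemma bounded_byD: "bounded_by J T C \<Longrightarrow> x \<in> J \<Longrightarrow> norm (T x) \<le> C * norm x"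
  unfolding bounded_by_def by auto

lemma bounded_by_subset: "bounded_by J T C \<Longrightarrow> K \<subseteq> J \<Longrightarrow> bounded_by K T C"
  unfolding bounded_by_def by auto

lemma bounded_by_nonneg:
  assumes "bounded_by J T C" obtains C' where "C' \<ge> 0" "C' \<ge> C" "bounded_by J T C'"
proof -
  have "bounded_by J T (max C 0)"
    using assms unfolding bounded_by_def
    by (metis max.cobounded1 mult_right_mono norm_ge_zero order_trans)
  then show ?thesis using that[of "max C 0"] by auto
qed

lemma adjoint_on_sym:
  assumes "adjoint_on J T S" shows "adjoint_on J S T"
proof -
  have "star (S x) * y = star x * T y" if "x \<in> J" "y \<in> J" for x y
  proof -
    have "star (star (T y) * x) = star (star y * S x)"
      using assms that unfolding adjoint_on_def by simp
    then show ?thesis by (simp add: star_mult star_star)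
  qed
  then show ?thesis using assms unfolding adjoint_on_def by auto
qed

lemma adjoint_onD:
  "adjoint_on J T S \<Longrightarrow> x \<in> J \<Longrightarrow> T x \<in> J"
  "adjoint_on J T S \<Longrightarrow> x \<in> J \<Longrightarrow> S x \<in> J"
  "adjoint_on J T S \<Longrightarrow> x \<in> J \<Longrightarrow> y \<in> J \<Longrightarrow> star (T x) * y = star x * S y"
  "adjoint_on J T S \<Longrightarrow> x \<in> J \<Longrightarrow> y \<in> J \<Longrightarrow> star (S x) * y = star x * T y"
  using adjoint_on_sym unfolding adjoint_on_def by blast+

text \<open>Nondegeneracy of the inner product: test with \<open>z = x - y\<close>.\<close>

lemma eq_by_star_mult:
  fixes x y :: "'a::cstar_algebra"
  assumes "closed_subspace J" "x \<in> J" "y \<in> J" "\<And>z. z \<in> J \<Longrightarrow> star z * x = star z * y"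
  shows "x = y"
proof -
  have "star (x - y) * (x - y) = 0"
    using assms(4)[of "x - y"] closed_subspaceD(5)[OF assms(1-3)]
    by (simp add: right_diff_distrib)
  then show ?thesis by simp
qed

lemma adjoint_on_linear:
  assumes J: "closed_subspace J" and T: "adjoint_on J T S"
  shows "x \<in> J \<Longrightarrow> y \<in> J \<Longrightarrow> T (x + y) = T x + T y"
    and "x \<in> J \<Longrightarrow> T (c *\<^sub>C x) = c *\<^sub>C T x"
    and "x \<in> J \<Longrightarrow> T (r *\<^sub>R x) = r *\<^sub>R T x"
    and "x \<in> J \<Longrightarrow> y \<in> J \<Longrightarrow> T (x - y) = T x - T y"
    and "T 0 = 0"
    and "x \<in> J \<Longrightarrow> x * a \<in> J \<Longrightarrow> T x * a \<in> J \<Longrightarrow> T (x * a) = T x * a"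
proof -
  note D = closed_subspaceD[OF J] adjoint_onD[OF T]
  show add: "x \<in> J \<Longrightarrow> y \<in> J \<Longrightarrow> T (x + y) = T x + T y" for x y
    by (rule eq_by_star_mult[OF J]) (auto simp: D(1-8) D(10)[symmetric] distrib_left)
  show sc: "x \<in> J \<Longrightarrow> T (c *\<^sub>C x) = c *\<^sub>C T x" for x c
    by (rule eq_by_star_mult[OF J]) (auto simp: D(1-8) D(10)[symmetric] mult_scaleC_right)
  show r: "x \<in> J \<Longrightarrow> T (r *\<^sub>R x) = r *\<^sub>R T x" for x r
    using sc[of x "of_real r"] by (simp add: scaleC_of_real)
  show "x \<in> J \<Longrightarrow> y \<in> J \<Longrightarrow> T (x - y) = T x - T y"
    using add[of x "- 1 *\<^sub>R y"] r[of y "-1"] D(4)[of y "-1"] by simp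
  show "T 0 = 0" using r[of 0 0] D(1) by simp
  show "x \<in> J \<Longrightarrow> x * a \<in> J \<Longrightarrow> T x * a \<in> J \<Longrightarrow> T (x * a) = T x * a"
    by (rule eq_by_star_mult[OF J]) (auto simp: D(1-8) D(10)[symmetric] mult.assoc[symmetric])
qed

lemma norm_adjoint_square:
  assumes "adjoint_on J T S" "x \<in> J"
  shows "(norm (T x))\<^sup>2 = norm (star x * S (T x))"
  using norm_star_mult[of "T x"] adjoint_onD[OF assms(1)] assms(2) by simp

lemma norm_adjoint_square_le:
  assumes "adjoint_on J T S" "x \<in> J"
  shows "(norm (T x))\<^sup>2 \<le> norm x * norm (S (T x))"
  using norm_adjoint_square[OF assms] norm_mult_ineq[of "star x" "S (T x)"] by simp

text \<open>\<open>norm (S x)^2 <= norm x * norm (T (S x))\<close>, and one factor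
  \<open>norm (S x)\<close> cancels.\<close>

lemma bounded_by_adjoint:
  assumes "adjoint_on J T S" "bounded_by J T C"
  shows "bounded_by J S C"
  unfolding bounded_by_def
proof
  fix x assume x: "x \<in> J"
  show "norm (S x) \<le> C * norm x"
  proof (cases "S x = 0")
    case True
    then show ?thesis using bounded_byD[OF assms(2) x] by (metis norm_ge_zero norm_zero order_trans)
  next
    case False
    have "(norm (S x))\<^sup>2 \<le> norm x * norm (T (S x))"
      by (rule norm_adjoint_square_le[OF adjoint_on_sym[OF assms(1)] x])
    also have "\<dots> \<le> norm x * (C * norm (S x))"
      using bounded_byD[OF assms(2), of "S x"] adjoint_onD[OF assms(1)] x
      by (simp add: mult_left_mono)
    finally show ?thesis using False by (simp add: power2_eq_square mult.commute mult.left_commute)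
  qed
qed

lemma selfadjoint_onD:
  assumes "closed_subspace J" "selfadjoint_on J T"
  shows "adjoint_on J T T"
    "x \<in> J \<Longrightarrow> T x \<in> J"
    "x \<in> J \<Longrightarrow> y \<in> J \<Longrightarrow> star (T x) * y = star x * T y"
    "x \<in> J \<Longrightarrow> y \<in> J \<Longrightarrow> T (x + y) = T x + T y"
    "x \<in> J \<Longrightarrow> y \<in> J \<Longrightarrow> T (x - y) = T x - T y"
    "x \<in> J \<Longrightarrow> T (r *\<^sub>R x) = r *\<^sub>R T x"
    "x \<in> J \<Longrightarrow> T (c *\<^sub>C x) = c *\<^sub>C T x"
    "T 0 = 0"
  using assms adjoint_on_linear[OF assms(1), of T T] adjoint_onD[of J T T]
  unfolding selfadjoint_on_def by auto

lemma selfadjoint_on_subspace: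
  "selfadjoint_on J T \<Longrightarrow> K \<subseteq> J \<Longrightarrow> T ` K \<subseteq> K \<Longrightarrow> selfadjoint_on K T"
  unfolding selfadjoint_on_def adjoint_on_def bounded_by_def image_subset_iff by (meson subsetD)

lemma selfadjoint_on_id: "selfadjoint_on J (\<lambda>x. x)"
  unfolding selfadjoint_on_def adjoint_on_def bounded_by_def by (auto intro: exI[of _ 1])

lemma selfadjoint_on_zero: "closed_subspace J \<Longrightarrow> selfadjoint_on J (\<lambda>x. 0)"
  unfolding selfadjoint_on_def adjoint_on_def bounded_by_def
  by (auto intro: exI[of _ 0] simp: closed_subspaceD(1))

lemma selfadjoint_on_add:
  assumes "closed_subspace J" "selfadjoint_on J S" "selfadjoint_on J T"
  shows "selfadjoint_on J (\<lambda>x. S x + T x)"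
proof -
  obtain C D where "bounded_by J S C" "bounded_by J T D" using assms selfadjoint_on_def by metis
  then have "bounded_by J (\<lambda>x. S x + T x) (C + D)"
    unfolding bounded_by_def by (auto intro!: norm_triangle_le simp: distrib_right add_mono)
  then show ?thesis
    using assms closed_subspaceD[OF assms(1)] unfolding selfadjoint_on_def adjoint_on_def
    by (auto simp: star_add distrib_left distrib_right)
qed

lemma selfadjoint_on_scaleR:
  assumes "closed_subspace J" "selfadjoint_on J T"
  shows "selfadjoint_on J (\<lambda>x. r *\<^sub>R T x)"
proof -
  obtain D where "bounded_by J T D" using assms selfadjoint_on_def by metis
  then have "bounded_by J (\<lambda>x. r *\<^sub>R T x) (\<bar>r\<bar> * D)"
    unfolding bounded_by_def by (auto simp: mult.assoc mult_left_mono)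
  then show ?thesis
    using assms closed_subspaceD[OF assms(1)] unfolding selfadjoint_on_def adjoint_on_def
    by (auto simp: star_scaleR)
qed

lemma selfadjoint_on_diff:
  assumes "closed_subspace J" "selfadjoint_on J S" "selfadjoint_on J T"
  shows "selfadjoint_on J (\<lambda>x. S x - T x)"
  using selfadjoint_on_add[OF assms(1,2) selfadjoint_on_scaleR[OF assms(1,3), of "-1"]] by simp

lemma bounded_by_comp:
  assumes "bounded_by J S C" "bounded_by J T D" "C \<ge> 0" "\<And>x. x \<in> J \<Longrightarrow> T x \<in> J"
  shows "bounded_by J (\<lambda>x. S (T x)) (C * D)"
  unfolding bounded_by_def
proof
  fix x assume x: "x \<in> J"
  have "norm (S (T x)) \<le> C * norm (T x)" using bounded_byD[OF assms(1)] assms(4) x by auto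
  also have "\<dots> \<le> C * (D * norm x)" using bounded_byD[OF assms(2) x] assms(3) by (rule mult_left_mono)
  finally show "norm (S (T x)) \<le> C * D * norm x" by (simp add: mult.assoc)
qed

lemma adjoint_on_comp_selfadjoint:
  assumes "adjoint_on J T S" "bounded_by J T C"
  shows "selfadjoint_on J (\<lambda>x. S (T x))"
proof -
  obtain C' where C: "C' \<ge> 0" "bounded_by J T C'" using bounded_by_nonneg[OF assms(2)] by blast
  have "bounded_by J (\<lambda>x. S (T x)) (C' * C')"
    by (rule bounded_by_comp[OF bounded_by_adjoint[OF assms(1) C(2)] C(2,1)])
      (use adjoint_onD[OF assms(1)] in auto)
  moreover have "adjoint_on J (\<lambda>x. S (T x)) (\<lambda>x. S (T x))"
    using adjoint_onD[OF assms(1)] unfolding adjoint_on_def by metis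
  ultimately show ?thesis unfolding selfadjoint_on_def by blast
qed

lemma selfadjoint_on_commuting:
  assumes "selfadjoint_on J S" "selfadjoint_on J T" "\<And>x. x \<in> J \<Longrightarrow> S (T x) = T (S x)"
  shows "selfadjoint_on J (\<lambda>x. S (T x))"
proof -
  obtain C D where CD: "bounded_by J S C" "bounded_by J T D" using assms selfadjoint_on_def by metis
  obtain C' where C: "C' \<ge> 0" "bounded_by J S C'" using bounded_by_nonneg[OF CD(1)] by blast
  have "bounded_by J (\<lambda>x. S (T x)) (C' * D)"
    by (rule bounded_by_comp[OF C(2) CD(2) C(1)])
      (use assms(2) in \<open>auto simp: selfadjoint_on_def adjoint_on_def\<close>)
  moreover have "adjoint_on J (\<lambda>x. S (T x)) (\<lambda>x. S (T x))"
    using assms unfolding adjoint_on_def selfadjoint_on_def by metis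
  ultimately show ?thesis unfolding selfadjoint_on_def by blast
qed

lemma selfadjoint_on_square:
  "selfadjoint_on J T \<Longrightarrow> selfadjoint_on J (\<lambda>x. T (T x))"
  by (rule selfadjoint_on_commuting) auto

lemma selfadjoint_on_mult:
  "star a = a \<Longrightarrow> selfadjoint_on UNIV (\<lambda>x. a * x)"
  unfolding selfadjoint_on_def adjoint_on_def bounded_by_def
  by (auto simp: star_mult mult.assoc intro: norm_mult_ineq)

text \<open>\<open>Sx + iTx\<close> and \<open>Sx - iTx\<close> have the same norm, and \<open>Sx\<close> is their mean.\<close>

lemma norm_le_sum_of_squares:
  assumes S: "adjoint_on J S S" and T: "adjoint_on J T T"
    and comm: "S (T x) = T (S x)" and x: "x \<in> J"
  shows "(norm (S x))\<^sup>2 \<le> norm (star x * (S (S x) + T (T x)))"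
proof -
  define p q where "p = S x + \<i> *\<^sub>C T x" and "q = S x - \<i> *\<^sub>C T x"
  note s = adjoint_onD[OF S] and t = adjoint_onD[OF T]
  have "star (S x) * S x = star x * S (S x)" "star (T x) * T x = star x * T (T x)"
    "star (S x) * T x = star x * T (S x)" "star (T x) * S x = star x * T (S x)"
    using s(1,3) t(1,3) x comm by auto
  then have "star p * p = star x * (S (S x) + T (T x))" "star q * q = star x * (S (S x) + T (T x))"
    unfolding p_def q_def
    by (simp_all add: star_add star_diff star_scaleC distrib_left distrib_right left_diff_distrib
        right_diff_distrib mult_scaleC_left mult_scaleC_right scaleC_scaleC scaleC_minus_left
        scaleC_diff_right scaleC_add_right)
  then have pq: "(norm p)\<^sup>2 = norm (star x * (S (S x) + T (T x)))"
      "(norm q)\<^sup>2 = norm (star x * (S (S x) + T (T x)))"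
    using norm_star_mult[of p] norm_star_mult[of q] by simp_all
  then have "norm p = norm q" by (metis norm_ge_zero power2_eq_iff_nonneg)
  moreover have "p + q = 2 *\<^sub>R S x" unfolding p_def q_def by (simp add: scaleR_2)
  then have "2 * norm (S x) \<le> norm p + norm q" by (metis norm_triangle_ineq norm_scaleR abs_numeral)
  ultimately have "norm (S x) \<le> norm p" by simp
  then show ?thesis using pq(1) power_mono[of "norm (S x)" "norm p" 2] by simp
qed

text \<open>The substitute for the order relation \<open>S^2 <= c^2\<close>: a square
  \<open>T^2\<close> making up the difference certifies it. Commutation and the identity of squares
  are required at the single vector \<open>x\<close>, so the lemma also applies on the kernel of a
  third operator, where the identity may hold without holding on all of \<open>J\<close>.\<close>

lemma norm_le_of_squares_eq:
  assumes "adjoint_on J S S" "adjoint_on J T T"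
    and "S (T x) = T (S x)" "x \<in> J" and "S (S x) + T (T x) = c\<^sup>2 *\<^sub>R x" "c \<ge> 0"
  shows "norm (S x) \<le> c * norm x"
proof -
  have "(norm (S x))\<^sup>2 \<le> norm (star x * (c\<^sup>2 *\<^sub>R x))"
    using norm_le_sum_of_squares[OF assms(1-4)] assms(5) by simp
  also have "\<dots> = (c * norm x)\<^sup>2" by (simp add: norm_star_mult power_mult_distrib)
  finally show ?thesis by (rule power2_le_imp_le) (use assms(6) in simp)
qed

text \<open>The operators \<open>V\<close> against which commutation is tested in
  \<open>generated_by\<close>. The class has to contain the self-adjoint operators and the
  automorphisms \<open>\<alpha> g\<close>; the latter have in general no adjoint for the inner
  product, so only additivity, real homogeneity and a bound are asked for.\<close>

definition bounded_linear_on :: "'a::cstar_algebra set \<Rightarrow> ('a \<Rightarrow> 'a) \<Rightarrow> bool" where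
  "bounded_linear_on J V \<longleftrightarrow>
     (\<forall>x\<in>J. V x \<in> J) \<and> (\<forall>x\<in>J. \<forall>y\<in>J. V (x + y) = V x + V y) \<and>
     (\<forall>r. \<forall>x\<in>J. V (r *\<^sub>R x) = r *\<^sub>R V x) \<and> (\<exists>C. bounded_by J V C)"

lemma bounded_linear_onD:
  assumes "bounded_linear_on J V"
  shows "x \<in> J \<Longrightarrow> V x \<in> J" "x \<in> J \<Longrightarrow> y \<in> J \<Longrightarrow> V (x + y) = V x + V y"
    "x \<in> J \<Longrightarrow> V (r *\<^sub>R x) = r *\<^sub>R V x" "\<exists>C. bounded_by J V C"
  using assms unfolding bounded_linear_on_def by auto

lemma selfadjoint_on_bounded_linear_on:
  "closed_subspace J \<Longrightarrow> selfadjoint_on J T \<Longrightarrow> bounded_linear_on J T"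
  using selfadjoint_onD[of J T] unfolding bounded_linear_on_def by (simp add: selfadjoint_on_def)

text \<open>Captures that \<open>Q\<close> is a norm limit of polynomials in \<open>T\<close>.\<close>

definition generated_by :: "'a::cstar_algebra set \<Rightarrow> ('a \<Rightarrow> 'a) \<Rightarrow> ('a \<Rightarrow> 'a) \<Rightarrow> bool" where
  "generated_by J T Q \<longleftrightarrow>
     (\<forall>V. bounded_linear_on J V \<longrightarrow> (\<forall>x\<in>J. V (T x) = T (V x)) \<longrightarrow> (\<forall>x\<in>J. V (Q x) = Q (V x))) \<and>
     (\<forall>K. closed_subspace K \<longrightarrow> K \<subseteq> J \<longrightarrow> (\<forall>x\<in>K. T x \<in> K) \<longrightarrow> (\<forall>x\<in>K. Q x \<in> K))"

lemma generated_byI: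
  assumes "\<And>V x. bounded_linear_on J V \<Longrightarrow> (\<And>x. x \<in> J \<Longrightarrow> V (T x) = T (V x)) \<Longrightarrow> x \<in> J \<Longrightarrow> V (Q x) = Q (V x)"
    and "\<And>K x. closed_subspace K \<Longrightarrow> K \<subseteq> J \<Longrightarrow> (\<And>x. x \<in> K \<Longrightarrow> T x \<in> K) \<Longrightarrow> x \<in> K \<Longrightarrow> Q x \<in> K"
  shows "generated_by J T Q"
  using assms unfolding generated_by_def by simp

lemma generated_by_commute:
  assumes "generated_by J T Q" "bounded_linear_on J V" "\<And>x. x \<in> J \<Longrightarrow> V (T x) = T (V x)" "x \<in> J"
  shows "V (Q x) = Q (V x)"
  using assms(1)[unfolded generated_by_def, THEN conjunct1, rule_format, of V x] assms(2-) by simp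

lemma generated_by_preserves:
  assumes "generated_by J T Q" "closed_subspace K" "K \<subseteq> J" "\<And>x. x \<in> K \<Longrightarrow> T x \<in> K" "x \<in> K"
  shows "Q x \<in> K"
  using assms(1)[unfolded generated_by_def, THEN conjunct2, rule_format, of K x] assms(2-) by simp

lemma generated_by_selfadjoint:
  assumes "generated_by J T Q" "closed_subspace J" "selfadjoint_on J V"
    "\<And>x. x \<in> J \<Longrightarrow> V (T x) = T (V x)" "x \<in> J"
  shows "V (Q x) = Q (V x)"
  by (rule generated_by_commute[OF assms(1) selfadjoint_on_bounded_linear_on[OF assms(2,3)] assms(4,5)])

lemma generated_by_refl: "generated_by J T T"
  by (rule generated_byI) simp_all

lemma generated_by_trans:
  assumes "generated_by J T Q" "generated_by J Q R" shows "generated_by J T R"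
  by (rule generated_byI)
    (rule generated_by_commute[OF assms(2)] generated_by_preserves[OF assms(2)]
      generated_by_commute[OF assms(1)] generated_by_preserves[OF assms(1)] | assumption)+

lemma generated_by_id: "generated_by J T (\<lambda>x. x)"
  by (rule generated_byI) simp_all

lemma generated_by_comp:
  assumes "generated_by J T Q" "generated_by J T R" "\<And>x. x \<in> J \<Longrightarrow> R x \<in> J"
  shows "generated_by J T (\<lambda>x. Q (R x))"
proof (rule generated_byI)
  fix V x assume V: "bounded_linear_on J V" "\<And>x. x \<in> J \<Longrightarrow> V (T x) = T (V x)" and x: "x \<in> J"
  show "V (Q (R x)) = Q (R (V x))"
    using generated_by_commute[OF assms(1) V assms(3)[OF x]] generated_by_commute[OF assms(2) V x]
    by simp
next
  fix K x assume K: "closed_subspace K" "K \<subseteq> J" "\<And>x. x \<in> K \<Longrightarrow> T x \<in> K" "x \<in> K"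
  show "Q (R x) \<in> K"
    by (rule generated_by_preserves[OF assms(1) K(1-3) generated_by_preserves[OF assms(2) K]])
qed

lemma generated_by_lincomb:
  assumes J: "closed_subspace J" and "generated_by J T Q" "generated_by J T R"
    "\<And>x. x \<in> J \<Longrightarrow> Q x \<in> J" "\<And>x. x \<in> J \<Longrightarrow> R x \<in> J"
  shows "generated_by J T (\<lambda>x. r *\<^sub>R Q x + s *\<^sub>R R x)"
proof (rule generated_byI)
  fix V x assume V: "bounded_linear_on J V" "\<And>x. x \<in> J \<Longrightarrow> V (T x) = T (V x)" and x: "x \<in> J"
  show "V (r *\<^sub>R Q x + s *\<^sub>R R x) = r *\<^sub>R Q (V x) + s *\<^sub>R R (V x)"
    using generated_by_commute[OF assms(2) V x] generated_by_commute[OF assms(3) V x]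
      bounded_linear_onD[OF V(1)] assms(4,5)[OF x] closed_subspaceD(4)[OF J] by simp
next
  fix K x assume K: "closed_subspace K" "K \<subseteq> J" "\<And>x. x \<in> K \<Longrightarrow> T x \<in> K" "x \<in> K"
  show "r *\<^sub>R Q x + s *\<^sub>R R x \<in> K"
    by (intro closed_subspaceD(2,4)[OF K(1)] generated_by_preserves[OF assms(2) K]
        generated_by_preserves[OF assms(3) K])
qed

section \<open>Square roots by iteration\<close>

fun sqrt_iter_real :: "nat \<Rightarrow> real" where
  "sqrt_iter_real 0 = 0"
| "sqrt_iter_real (Suc n) = (1 + (sqrt_iter_real n)\<^sup>2) / 2"

text \<open>A limit \<open>b\<close> satisfies \<open>2 b = T + b^2\<close>, that is
  \<open>(1 - b)^2 = 1 - T\<close>, so \<open>1 - b\<close> is the root sought. The scalar sequence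
  above is the same iteration with \<open>T\<close> replaced by its norm bound 1; it increases,
  stays below 1, and its increments majorize those of the operators.\<close>

fun sqrt_iter :: "('a \<Rightarrow> 'a) \<Rightarrow> nat \<Rightarrow> 'a \<Rightarrow> 'a::real_vector" where
  "sqrt_iter T 0 x = 0"
| "sqrt_iter T (Suc n) x = (1 / 2) *\<^sub>R (T x + sqrt_iter T n (sqrt_iter T n x))"

lemma sqrt_iter_real_bounds: "0 \<le> sqrt_iter_real n" "sqrt_iter_real n \<le> 1"
  by (induction n) (auto simp: power_le_one)

lemma sqrt_iter_real_Suc_le: "sqrt_iter_real n \<le> sqrt_iter_real (Suc n)"
proof -
  have "0 \<le> (1 - sqrt_iter_real n)\<^sup>2" by simp
  then show ?thesis by (simp add: power2_diff)
qed

lemma sqrt_iter_real_Cauchy: "Cauchy sqrt_iter_real"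
proof -
  have "convergent sqrt_iter_real"
    by (rule Bseq_monoseq_convergent)
      (auto intro!: BseqI'[of _ 1] incseq_imp_monoseq incseq_SucI sqrt_iter_real_Suc_le
        simp: sqrt_iter_real_bounds)
  then show ?thesis by (simp add: convergent_Cauchy)
qed

declare sqrt_iter_real.simps(2) [simp del]

context
  fixes J :: "'a::cstar_algebra set" and T
  assumes J: "closed_subspace J" and T: "selfadjoint_on J T" and T1: "bounded_by J T 1"
begin

lemma sqrt_iter_selfadjoint: "selfadjoint_on J (sqrt_iter T n)"
proof (induction n)
  case 0
  then show ?case using selfadjoint_on_zero[OF J] by (simp cong: if_cong add: fun_eq_iff)
next
  case (Suc n)
  have "selfadjoint_on J (\<lambda>x. (1 / 2) *\<^sub>R (T x + sqrt_iter T n (sqrt_iter T n x)))"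
    by (intro selfadjoint_on_scaleR selfadjoint_on_add J T selfadjoint_on_square Suc)
  then show ?case by (simp cong: if_cong)
qed

lemma sqrt_iter_bound: "bounded_by J (sqrt_iter T n) (sqrt_iter_real n)"
proof (induction n)
  case (Suc n)
  show ?case unfolding bounded_by_def
  proof
    fix x assume x: "x \<in> J"
    have "bounded_by J (\<lambda>x. sqrt_iter T n (sqrt_iter T n x)) (sqrt_iter_real n * sqrt_iter_real n)"
      by (rule bounded_by_comp[OF Suc Suc])
        (use sqrt_iter_real_bounds selfadjoint_onD(2)[OF J sqrt_iter_selfadjoint] in auto)
    then have "norm (sqrt_iter T n (sqrt_iter T n x)) \<le> (sqrt_iter_real n)\<^sup>2 * norm x"
      using x by (auto simp: bounded_by_def power2_eq_square)
    moreover have "norm (T x) \<le> norm x" using bounded_byD[OF T1 x] by simp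
    ultimately show "norm (sqrt_iter T (Suc n) x) \<le> sqrt_iter_real (Suc n) * norm x"
      using norm_triangle_ineq[of "T x" "sqrt_iter T n (sqrt_iter T n x)"]
      by (simp add: sqrt_iter_real.simps(2) distrib_right)
  qed
qed (auto simp: bounded_by_def)

lemma sqrt_iter_step:
  "x \<in> J \<Longrightarrow> norm (sqrt_iter T (Suc n) x - sqrt_iter T n x)
     \<le> (sqrt_iter_real (Suc n) - sqrt_iter_real n) * norm x"
proof (induction n arbitrary: x)
  case 0
  then show ?case using bounded_byD[OF T1] by (auto simp: sqrt_iter_real.simps(2))
next
  case (Suc n)
  let ?b = "sqrt_iter T n" and ?b' = "sqrt_iter T (Suc n)"
  let ?\<beta> = "sqrt_iter_real n" and ?\<beta>' = "sqrt_iter_real (Suc n)"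
  note s = selfadjoint_onD[OF J sqrt_iter_selfadjoint]
  have b: "?b x \<in> J" "?b' x \<in> J" by (rule s(2)[OF Suc.prems])+
  \<comment> \<open>Splits \<open>b'^2 - b^2\<close> as \<open>b' (b' - b) + (b' - b) b\<close>. The
    scalar bounds of the two terms add up to \<open>\<beta>'^2 - \<beta>^2\<close>, which is twice
    the next scalar increment.\<close>
  have eq: "sqrt_iter T (Suc (Suc n)) x - ?b' x = (1 / 2) *\<^sub>R (?b' (?b' x - ?b x) + (?b' (?b x) - ?b (?b x)))"
  proof -
    have "?b' (?b' x - ?b x) = ?b' (?b' x) - ?b' (?b x)" by (rule s(5)[OF b(2,1)])
    moreover have "sqrt_iter T (Suc (Suc n)) x = (1 / 2) *\<^sub>R (T x + ?b' (?b' x))"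
      "?b' x = (1 / 2) *\<^sub>R (T x + ?b (?b x))"
      by (subst sqrt_iter.simps; simp)+
    ultimately show ?thesis by (simp only: scaleR_add_right scaleR_diff_right) simp
  qed
  have "norm (?b' (?b' x - ?b x)) \<le> ?\<beta>' * norm (?b' x - ?b x)"
    by (rule bounded_byD[OF sqrt_iter_bound]) (rule closed_subspaceD(5)[OF J b(2,1)])
  also have "\<dots> \<le> ?\<beta>' * ((?\<beta>' - ?\<beta>) * norm x)"
    using Suc sqrt_iter_real_bounds by (intro mult_left_mono) auto
  finally have 1: "norm (?b' (?b' x - ?b x)) \<le> ?\<beta>' * ((?\<beta>' - ?\<beta>) * norm x)" .
  have "norm (?b' (?b x) - ?b (?b x)) \<le> (?\<beta>' - ?\<beta>) * norm (?b x)"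
    by (rule Suc.IH[OF b(1)])
  also have "\<dots> \<le> (?\<beta>' - ?\<beta>) * (?\<beta> * norm x)"
    using bounded_byD[OF sqrt_iter_bound Suc.prems] sqrt_iter_real_Suc_le by (intro mult_left_mono) auto
  finally have 2: "norm (?b' (?b x) - ?b (?b x)) \<le> (?\<beta>' - ?\<beta>) * (?\<beta> * norm x)" .
  have "norm (sqrt_iter T (Suc (Suc n)) x - ?b' x)
      \<le> (?\<beta>' * ((?\<beta>' - ?\<beta>) * norm x) + (?\<beta>' - ?\<beta>) * (?\<beta> * norm x)) / 2"
    unfolding eq norm_scaleR
    using norm_triangle_ineq[of "?b' (?b' x - ?b x)" "?b' (?b x) - ?b (?b x)"] 1 2 by simp
  also have "\<dots> = (?\<beta>'\<^sup>2 - ?\<beta>\<^sup>2) / 2 * norm x"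
    by (simp add: power2_eq_square algebra_simps)
  also have "(?\<beta>'\<^sup>2 - ?\<beta>\<^sup>2) / 2 = sqrt_iter_real (Suc (Suc n)) - ?\<beta>'"
    by (simp add: sqrt_iter_real.simps(2)[of "Suc n"] sqrt_iter_real.simps(2)[of n] field_simps)
  finally show ?case .
qed

lemma sqrt_iter_diff:
  assumes x: "x \<in> J" and "n \<le> m"
  shows "norm (sqrt_iter T m x - sqrt_iter T n x) \<le> (sqrt_iter_real m - sqrt_iter_real n) * norm x"
  using assms(2)
proof (induction m rule: dec_induct)
  case (step m)
  have "norm (sqrt_iter T (Suc m) x - sqrt_iter T n x)
      \<le> norm (sqrt_iter T (Suc m) x - sqrt_iter T m x) + norm (sqrt_iter T m x - sqrt_iter T n x)"
    using norm_triangle_ineq[of "sqrt_iter T (Suc m) x - sqrt_iter T m x" "sqrt_iter T m x - sqrt_iter T n x"]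
    by (simp del: sqrt_iter.simps)
  then show ?case using step.IH sqrt_iter_step[OF x, of m] by (simp add: algebra_simps)
qed simp

lemma sqrt_iter_diff_abs:
  assumes x: "x \<in> J"
  shows "norm (sqrt_iter T m x - sqrt_iter T n x) \<le> \<bar>sqrt_iter_real m - sqrt_iter_real n\<bar> * norm x"
proof (cases "n \<le> m")
  case True
  then show ?thesis using sqrt_iter_diff[OF x True] by (meson abs_ge_self mult_right_mono norm_ge_zero order_trans)
next
  case False
  then have "norm (sqrt_iter T n x - sqrt_iter T m x) \<le> (sqrt_iter_real n - sqrt_iter_real m) * norm x"
    using sqrt_iter_diff[OF x, of m n] by simp
  also have "\<dots> \<le> \<bar>sqrt_iter_real m - sqrt_iter_real n\<bar> * norm x"
    by (intro mult_right_mono) auto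
  finally show ?thesis by (simp add: norm_minus_commute)
qed

lemma sqrt_iter_Cauchy:
  assumes x: "x \<in> J" shows "Cauchy (\<lambda>n. sqrt_iter T n x)"
proof (rule CauchyI)
  fix e :: real assume e: "e > 0"
  have "e / (norm x + 1) > 0" using e by (simp add: add_nonneg_pos)
  then obtain M where M: "\<And>m n. m \<ge> M \<Longrightarrow> n \<ge> M \<Longrightarrow> norm (sqrt_iter_real m - sqrt_iter_real n) < e / (norm x + 1)"
    using CauchyD[OF sqrt_iter_real_Cauchy] by blast
  have "norm (sqrt_iter T m x - sqrt_iter T n x) < e" if "m \<ge> M" "n \<ge> M" for m n
  proof -
    have "norm (sqrt_iter T m x - sqrt_iter T n x) \<le> \<bar>sqrt_iter_real m - sqrt_iter_real n\<bar> * norm x"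
      by (rule sqrt_iter_diff_abs[OF x])
    also have "\<dots> \<le> e / (norm x + 1) * norm x"
      using M[OF that] by (intro mult_right_mono) auto
    also have "\<dots> < e" using e by (simp add: divide_less_eq add_nonneg_pos distrib_left)
    finally show ?thesis .
  qed
  then show "\<exists>M. \<forall>m\<ge>M. \<forall>n\<ge>M. norm (sqrt_iter T m x - sqrt_iter T n x) < e" by blast
qed

lemma sqrt_iter_commute:
  assumes V: "\<And>x. x \<in> J \<Longrightarrow> V x \<in> J"
    "\<And>x y. x \<in> J \<Longrightarrow> y \<in> J \<Longrightarrow> V (x + y) = V x + V y"
    "\<And>r x. x \<in> J \<Longrightarrow> V (r *\<^sub>R x) = r *\<^sub>R V x"
    "\<And>x. x \<in> J \<Longrightarrow> V (T x) = T (V x)"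
  shows "x \<in> J \<Longrightarrow> V (sqrt_iter T n x) = sqrt_iter T n (V x)"
proof (induction n arbitrary: x)
  case 0
  then show ?case using V(3)[of 0 0] closed_subspaceD(1)[OF J] by simp
next
  case (Suc n)
  have "sqrt_iter T n y \<in> J" "T y \<in> J" if "y \<in> J" for y
    using selfadjoint_onD(2)[OF J sqrt_iter_selfadjoint] selfadjoint_onD(2)[OF J T] that by auto
  then show ?case using Suc V closed_subspaceD[OF J] by simp
qed

lemma sqrt_iter_preserves:
  assumes "closed_subspace K" "K \<subseteq> J" "\<And>x. x \<in> K \<Longrightarrow> T x \<in> K"
  shows "x \<in> K \<Longrightarrow> sqrt_iter T n x \<in> K"
  by (induction n arbitrary: x) (use assms closed_subspaceD[OF assms(1)] in auto)

text \<open>\<open>Q\<close> is \<open>1 - b\<close> for the limit \<open>b\<close> of the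
  iteration. The bound on \<open>x - Q x\<close> records that \<open>Q\<close> is nonnegative: it
  makes \<open>Q = 1 - (1 - Q)\<close> with \<open>1 - Q\<close> a contraction, so that
  \<open>Q\<close> has a square root by the same lemma.\<close>

lemma sqrt_one_minus:
  obtains Q where "selfadjoint_on J Q" "\<And>x. x \<in> J \<Longrightarrow> Q (Q x) = x - T x"
    "bounded_by J (\<lambda>x. x - Q x) 1" "generated_by J T Q"
proof -
  define b where "b x = lim (\<lambda>n. sqrt_iter T n x)" for x
  have lim: "(\<lambda>n. sqrt_iter T n x) \<longlonglongrightarrow> b x" if "x \<in> J" for x
    using Cauchy_convergent[OF sqrt_iter_Cauchy[OF that]] unfolding b_def
    by (simp add: convergent_LIMSEQ_iff)
  note s = selfadjoint_onD[OF J sqrt_iter_selfadjoint]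
  have bJ: "b x \<in> J" if "x \<in> J" for x
    by (rule closed_subspace_lim[OF J _ lim[OF that]]) (rule s(2)[OF that])
  have bb: "norm (b x) \<le> norm x" if "x \<in> J" for x
  proof (rule Lim_bounded[OF tendsto_norm[OF lim[OF that]]])
    show "\<forall>n\<ge>0. norm (sqrt_iter T n x) \<le> norm x"
      using bounded_byD[OF sqrt_iter_bound that] sqrt_iter_real_bounds(2) mult_right_mono
      by (metis mult_cancel_right1 mult_1 norm_ge_zero order_trans)
  qed
  have bsa: "selfadjoint_on J b"
  proof -
    have "star (b x) * y = star x * b y" if "x \<in> J" "y \<in> J" for x y
    proof (rule LIMSEQ_unique)
      show "(\<lambda>n. star (sqrt_iter T n x) * y) \<longlonglongrightarrow> star (b x) * y"
        by (intro tendsto_intros bounded_linear.tendsto[OF bounded_linear_star] lim that)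
      have "(\<lambda>n. star x * sqrt_iter T n y) \<longlonglongrightarrow> star x * b y"
        by (intro tendsto_intros lim that)
      then show "(\<lambda>n. star (sqrt_iter T n x) * y) \<longlonglongrightarrow> star x * b y"
        using s(3)[OF that] by simp
    qed
    then show ?thesis unfolding selfadjoint_on_def adjoint_on_def bounded_by_def
      using bJ bb by (auto intro: exI[of _ 1])
  qed
  note sb = selfadjoint_onD[OF J bsa]
  have fixpt: "b x = (1 / 2) *\<^sub>R (T x + b (b x))" if x: "x \<in> J" for x
  proof -
    \<comment> \<open>Pointwise convergence alone does not pass through the composition; it does
      because all iterates are contractions.\<close>
    have "(\<lambda>n. sqrt_iter T n (sqrt_iter T n x) - b (b x)) \<longlonglongrightarrow> 0"
    proof (rule Lim_null_comparison)
      show "\<forall>\<^sub>F n in sequentially. norm (sqrt_iter T n (sqrt_iter T n x) - b (b x))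
          \<le> norm (sqrt_iter T n x - b x) + norm (sqrt_iter T n (b x) - b (b x))"
      proof (rule always_eventually, rule allI)
        fix n
        have "norm (sqrt_iter T n (sqrt_iter T n x - b x)) \<le> norm (sqrt_iter T n x - b x)"
          using bounded_byD[OF sqrt_iter_bound, of "sqrt_iter T n x - b x" n] sqrt_iter_real_bounds(2)
            closed_subspaceD(5)[OF J s(2)[OF x] bJ[OF x]]
          by (meson mult_left_le_one_le norm_ge_zero order_trans sqrt_iter_real_bounds(1))
        then show "norm (sqrt_iter T n (sqrt_iter T n x) - b (b x))
          \<le> norm (sqrt_iter T n x - b x) + norm (sqrt_iter T n (b x) - b (b x))"
          using s(5)[OF s(2)[OF x] bJ[OF x], of n n]
            norm_triangle_ineq[of "sqrt_iter T n (sqrt_iter T n x) - sqrt_iter T n (b x)" "sqrt_iter T n (b x) - b (b x)"]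
          by simp
      qed
      have "(\<lambda>n. norm (sqrt_iter T n x - b x)) \<longlonglongrightarrow> 0" "(\<lambda>n. norm (sqrt_iter T n (b x) - b (b x))) \<longlonglongrightarrow> 0"
        using lim[OF x] lim[OF bJ[OF x]] by (simp_all add: LIM_zero tendsto_norm_zero)
      then show "(\<lambda>n. norm (sqrt_iter T n x - b x) + norm (sqrt_iter T n (b x) - b (b x))) \<longlonglongrightarrow> 0"
        using tendsto_add[of _ 0 sequentially _ 0] by fastforce
    qed
    then have "(\<lambda>n. (1 / 2) *\<^sub>R (T x + sqrt_iter T n (sqrt_iter T n x))) \<longlonglongrightarrow> (1 / 2) *\<^sub>R (T x + b (b x))"
      by (intro tendsto_intros) (simp add: LIM_zero_iff)
    moreover have "(\<lambda>n. (1 / 2) *\<^sub>R (T x + sqrt_iter T n (sqrt_iter T n x))) \<longlonglongrightarrow> b x"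
      using LIMSEQ_Suc[OF lim[OF x]] by simp
    ultimately show ?thesis by (rule LIMSEQ_unique[symmetric])
  qed
  define Q where "Q x = x - b x" for x
  have Qeq: "Q = (\<lambda>x. x - b x)" by (simp add: fun_eq_iff Q_def)
  have 1: "selfadjoint_on J Q"
    unfolding Qeq by (intro selfadjoint_on_diff J selfadjoint_on_id bsa)
  have 2: "Q (Q x) = x - T x" if x: "x \<in> J" for x
  proof -
    have "2 *\<^sub>R b x = T x + b (b x)" using arg_cong[OF fixpt[OF x], of "\<lambda>z. 2 *\<^sub>R z"] by simp
    then have "T x = b x + b x - b (b x)" by (simp add: scaleR_2)
    then show ?thesis unfolding Q_def by (simp add: sb(5)[OF x bJ[OF x]])
  qed
  have 3: "bounded_by J (\<lambda>x. x - Q x) 1" using bb by (auto simp: bounded_by_def Q_def)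
  have 4: "generated_by J T Q"
  proof (rule generated_byI)
    fix V x assume V: "bounded_linear_on J V" "\<And>x. x \<in> J \<Longrightarrow> V (T x) = T (V x)" and x: "x \<in> J"
    note v = bounded_linear_onD[OF V(1)]
    obtain C where C: "bounded_by J V C" using v(4) by blast
    have Vd: "V (y - z) = V y - V z" if "y \<in> J" "z \<in> J" for y z
      using v(2)[OF that(1), of "-1 *\<^sub>R z"] v(3)[OF that(2), of "-1"]
        closed_subspaceD(4)[OF J that(2), of "-1"] by simp
    have "(\<lambda>n. V (sqrt_iter T n x) - V (b x)) \<longlonglongrightarrow> 0"
    proof (rule Lim_null_comparison)
      have "norm (V (sqrt_iter T n x) - V (b x)) \<le> C * norm (sqrt_iter T n x - b x)" for n
        using bounded_byD[OF C closed_subspaceD(5)[OF J s(2)[OF x] bJ[OF x]]] Vd[OF s(2)[OF x] bJ[OF x]]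
        by metis
      then show "\<forall>\<^sub>F n in sequentially. norm (V (sqrt_iter T n x) - V (b x)) \<le> C * norm (sqrt_iter T n x - b x)"
        by simp
      show "(\<lambda>n. C * norm (sqrt_iter T n x - b x)) \<longlonglongrightarrow> 0"
        using lim[OF x] by (intro tendsto_mult_right_zero tendsto_norm_zero LIM_zero)
    qed
    then have "(\<lambda>n. V (sqrt_iter T n x)) \<longlonglongrightarrow> V (b x)" by (rule LIM_zero_cancel)
    moreover have "V (sqrt_iter T n x) = sqrt_iter T n (V x)" for n
      by (rule sqrt_iter_commute[OF v(1-3) V(2) x])
    ultimately have "(\<lambda>n. sqrt_iter T n (V x)) \<longlonglongrightarrow> V (b x)" by simp
    then have "V (b x) = b (V x)" using lim[OF v(1)[OF x]] by (rule LIMSEQ_unique)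
    then show "V (Q x) = Q (V x)" unfolding Q_def using Vd[OF x bJ[OF x]] by simp
  next
    fix K x assume K: "closed_subspace K" "K \<subseteq> J" "\<And>x. x \<in> K \<Longrightarrow> T x \<in> K" and x: "x \<in> K"
    have "b x \<in> K"
      by (rule closed_subspace_lim[OF K(1) sqrt_iter_preserves[OF K x] lim[OF subsetD[OF K(2) x]]])
    then show "Q x \<in> K" unfolding Q_def using closed_subspaceD(5)[OF K(1) x] by blast
  qed
  show ?thesis by (rule that[OF 1 2 3 4])
qed

end

section \<open>Absolute values and spectral cuts\<close>

lemma norm_sqrt_le:
  assumes "closed_subspace J" "selfadjoint_on J T" "selfadjoint_on J Q"
    "\<And>x. x \<in> J \<Longrightarrow> Q (Q x) = x - T (T x)" "\<And>x. x \<in> J \<Longrightarrow> Q (T x) = T (Q x)"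
  shows "bounded_by J Q 1"
  unfolding bounded_by_def
proof
  fix x assume x: "x \<in> J"
  show "norm (Q x) \<le> 1 * norm x"
    by (rule norm_le_of_squares_eq[of J Q T]) (use assms x in \<open>auto simp: selfadjoint_on_def\<close>)
qed

text \<open>\<open>l\<^sup>2\<close> is the absolute value of \<open>T\<close>.\<close>

lemma abs_operator:
  fixes J :: "'a::cstar_algebra set"
  assumes J: "closed_subspace J" and T: "selfadjoint_on J T" and T1: "bounded_by J T 1"
  obtains l where "selfadjoint_on J l" "\<And>x. x \<in> J \<Longrightarrow> l (l (l (l x))) = T (T x)"
    "bounded_by J (\<lambda>x. x - l (l x)) 1" "generated_by J T l" "\<And>x. x \<in> J \<Longrightarrow> l (T x) = T (l x)"
proof -
  note sT = selfadjoint_onD[OF J T]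
  have T2: "selfadjoint_on J (\<lambda>x. T (T x))" by (rule selfadjoint_on_square[OF T])
  have "bounded_by J (\<lambda>x. T (T x)) (1 * 1)" by (rule bounded_by_comp[OF T1 T1]) (use sT in auto)
  \<comment> \<open>Three roots are taken: \<open>Q\<close> of \<open>1 - T^2\<close>, then
    \<open>M\<close> of \<open>1 - Q^2 = T^2\<close>, then \<open>l\<close> of
    \<open>M = 1 - (1 - M)\<close>. Here \<open>M\<close> is the absolute value; the last root
    exhibits it as a square, the form in which it can enter a norm certificate.\<close>
  then obtain Q where Q: "selfadjoint_on J Q" "\<And>x. x \<in> J \<Longrightarrow> Q (Q x) = x - T (T x)"
      "generated_by J (\<lambda>x. T (T x)) Q"
    using sqrt_one_minus[OF J T2] by auto
  have TT: "generated_by J T (\<lambda>x. T (T x))"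
    by (rule generated_by_comp[OF generated_by_refl generated_by_refl]) (rule sT)
  have gQ: "generated_by J T Q" by (rule generated_by_trans[OF TT Q(3)])
  have QT: "Q (T x) = T (Q x)" if "x \<in> J" for x
    using generated_by_selfadjoint[OF gQ J T _ that] by simp
  note sQ = selfadjoint_onD[OF J Q(1)]
  have Q1: "bounded_by J Q 1" by (rule norm_sqrt_le[OF J T Q(1,2) QT])
  have "bounded_by J (\<lambda>x. Q (Q x)) (1 * 1)" by (rule bounded_by_comp[OF Q1 Q1]) (use sQ in auto)
  then obtain M where M: "selfadjoint_on J M" "\<And>x. x \<in> J \<Longrightarrow> M (M x) = x - Q (Q x)"
      "bounded_by J (\<lambda>x. x - M x) 1" "generated_by J (\<lambda>x. Q (Q x)) M"
    using sqrt_one_minus[OF J selfadjoint_on_square[OF Q(1)]] by auto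
  have gM: "generated_by J T M"
    by (rule generated_by_trans[OF gQ generated_by_trans[OF generated_by_comp[OF generated_by_refl generated_by_refl] M(4)]])
      (rule sQ)
  note sM = selfadjoint_onD[OF J M(1)]
  have gB: "generated_by J T (\<lambda>x. x - M x)"
    using generated_by_lincomb[OF J generated_by_id gM, of 1 "-1"] sM(2) by simp
  obtain l where l: "selfadjoint_on J l" "\<And>x. x \<in> J \<Longrightarrow> l (l x) = x - (x - M x)"
      "generated_by J (\<lambda>x. x - M x) l"
    using sqrt_one_minus[OF J selfadjoint_on_diff[OF J selfadjoint_on_id M(1)] M(3)] by auto
  have gl: "generated_by J T l" by (rule generated_by_trans[OF gB l(3)])
  show ?thesis
  proof (rule that[OF l(1) _ _ gl])
    show "l (l (l (l x))) = T (T x)" if "x \<in> J" for x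
      using that l(2) sM(2) M(2) Q(2) by simp
    show "bounded_by J (\<lambda>x. x - l (l x)) 1"
      using M(3) l(2) unfolding bounded_by_def by simp
    show "l (T x) = T (l x)" if "x \<in> J" for x
      using generated_by_selfadjoint[OF gl J T _ that] by simp
  qed
qed

text \<open>For the root \<open>Q\<close> of \<open>1 - T^2\<close>, the identity
  \<open>Q^2 + T^2 = 1\<close> makes \<open>Q\<close> a contraction, hence also
  \<open>Q^2 = 1 - T^2\<close>.\<close>

lemma one_minus_square_contractive:
  assumes "closed_subspace J" "selfadjoint_on J T" "bounded_by J T 1"
  shows "bounded_by J (\<lambda>x. x - T (T x)) 1"
proof -
  note sT = selfadjoint_onD[OF assms(1,2)]
  have "bounded_by J (\<lambda>x. T (T x)) (1 * 1)" by (rule bounded_by_comp[OF assms(3,3)]) (use sT in auto)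
  then obtain Q where Q: "selfadjoint_on J Q" "\<And>x. x \<in> J \<Longrightarrow> Q (Q x) = x - T (T x)"
      "generated_by J (\<lambda>x. T (T x)) Q"
    using sqrt_one_minus[OF assms(1) selfadjoint_on_square[OF assms(2)]] by auto
  have "T (Q x) = Q (T x)" if "x \<in> J" for x
    by (rule generated_by_selfadjoint[OF Q(3) assms(1,2) _ that]) simp
  then have "bounded_by J Q 1" by (intro norm_sqrt_le[OF assms(1,2) Q(1,2)]) auto
  then have "bounded_by J (\<lambda>x. Q (Q x)) (1 * 1)"
    using bounded_by_comp[of J Q 1 Q 1] selfadjoint_onD[OF assms(1) Q(1)] by auto
  then show ?thesis using Q(2) by (simp add: bounded_by_def)
qed

lemma generated_by_abs_parts:
  assumes J: "closed_subspace J" and k: "generated_by J k T" "generated_by J k l"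
    and "\<And>x. x \<in> J \<Longrightarrow> T x \<in> J" "\<And>x. x \<in> J \<Longrightarrow> l x \<in> J"
  shows "generated_by J k (\<lambda>x. l (l x) + T x)" "generated_by J k (\<lambda>x. l (l x) - T x)"
  using generated_by_lincomb[OF J generated_by_comp[OF k(2,2)] k(1), of 1 1]
    generated_by_lincomb[OF J generated_by_comp[OF k(2,2)] k(1), of 1 "-1"] assms(4,5) by auto

text \<open>\<open>D\<close> and \<open>E\<close> are twice the positive and the negative part of \<open>T\<close>.\<close>

lemma abs_parts_orthogonal:
  assumes J: "closed_subspace J" and T: "selfadjoint_on J T" and l: "selfadjoint_on J l"
    and "\<And>x. x \<in> J \<Longrightarrow> l (l (l (l x))) = T (T x)" "\<And>x. x \<in> J \<Longrightarrow> l (T x) = T (l x)" "x \<in> J"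
  defines "D \<equiv> (\<lambda>x. l (l x) + T x)" and "E \<equiv> (\<lambda>x. l (l x) - T x)"
  shows "E (D x) = 0" "D (E x) = 0"
  using assms(4-6) selfadjoint_onD[OF J T] selfadjoint_onD[OF J l] unfolding D_def E_def
  by simp_all

text \<open>With \<open>T = (k^2 - s) / 2\<close> and \<open>l^2\<close> its absolute value,
  \<open>D\<close> and \<open>E\<close> are \<open>l^2 + T\<close> and \<open>l^2 - T\<close>. The
  range of \<open>D\<close> lies in the kernel of \<open>E\<close>, where
  \<open>k^2 - s = 2 l^2\<close>, so \<open>k^2\<close> is at least \<open>s\<close> there. The
  vector \<open>x0\<close> guarantees that the cut is nonzero.\<close>

lemma spectral_cut_above:
  assumes J: "closed_subspace J" and k: "selfadjoint_on J k" and k1: "bounded_by J k 1"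
    and s: "0 \<le> s" "s \<le> 1" and x0: "x0 \<in> J" "s * (norm x0)\<^sup>2 < (norm (k x0))\<^sup>2"
  obtains D E l where "selfadjoint_on J D" "selfadjoint_on J E" "selfadjoint_on J l"
    "generated_by J k D" "generated_by J k E" "generated_by J k l"
    "\<And>x. x \<in> J \<Longrightarrow> E x = l (l x) - (1 / 2) *\<^sub>R (k (k x) - s *\<^sub>R x)"
    "bounded_by J (\<lambda>x. x - l (l x)) 1" "\<And>x. x \<in> J \<Longrightarrow> E (D x) = 0" "\<exists>x\<in>J. D x \<noteq> 0"
proof -
  note sk = selfadjoint_onD[OF J k]
  define T where "T x = (1 / 2) *\<^sub>R (k (k x) - s *\<^sub>R x)" for x
  have Teq: "T = (\<lambda>x. (1 / 2) *\<^sub>R (k (k x) - s *\<^sub>R x))" by (simp add: fun_eq_iff T_def)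
  have T: "selfadjoint_on J T"
    unfolding Teq by (intro selfadjoint_on_scaleR[OF J] selfadjoint_on_diff[OF J] selfadjoint_on_square[OF k] selfadjoint_on_id)
  note sT = selfadjoint_onD[OF J T]
  have T1: "bounded_by J T 1"
    unfolding bounded_by_def
  proof
    fix x assume x: "x \<in> J"
    have "norm (k (k x)) \<le> norm x"
      using bounded_byD[OF k1 sk(2)[OF x]] bounded_byD[OF k1 x] by simp
    moreover have "norm (s *\<^sub>R x) \<le> norm x" using s by (simp add: mult_left_le_one_le)
    ultimately show "norm (T x) \<le> 1 * norm x"
      unfolding T_def using norm_triangle_ineq4[of "k (k x)" "s *\<^sub>R x"] by simp
  qed
  have gT: "generated_by J k T"
    using generated_by_lincomb[OF J generated_by_comp[OF generated_by_refl generated_by_refl] generated_by_id,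
        of k "1 / 2" "- s / 2"] sk(2)
    unfolding Teq by (simp add: scaleR_diff_right)
  obtain l where l: "selfadjoint_on J l" "\<And>x. x \<in> J \<Longrightarrow> l (l (l (l x))) = T (T x)"
    "bounded_by J (\<lambda>x. x - l (l x)) 1" "generated_by J T l" "\<And>x. x \<in> J \<Longrightarrow> l (T x) = T (l x)"
    by (rule abs_operator[OF J T T1]) blast
  note sl = selfadjoint_onD[OF J l(1)]
  have gl: "generated_by J k l" by (rule generated_by_trans[OF gT l(4)])
  have kl: "k (l x) = l (k x)" if "x \<in> J" for x
    using generated_by_selfadjoint[OF gl J k _ that] by simp
  show ?thesis
  proof (rule that[OF _ _ l(1) generated_by_abs_parts[OF J gT gl sT(2) sl(2)] gl _ l(3)])
    show "selfadjoint_on J (\<lambda>x. l (l x) + T x)" "selfadjoint_on J (\<lambda>x. l (l x) - T x)"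
      by (intro selfadjoint_on_add[OF J] selfadjoint_on_diff[OF J] selfadjoint_on_square[OF l(1)] T)+
    show "l (l (l (l x) + T x)) - T (l (l x) + T x) = 0" if "x \<in> J" for x
      by (rule abs_parts_orthogonal(1)[OF J T l(1,2,5) that])
    show "\<exists>x\<in>J. l (l x) + T x \<noteq> 0"
    proof (rule ccontr)
      assume "\<not> ?thesis"
      then have "l (l x0) + T x0 = 0" using x0 by auto
      then have *: "2 *\<^sub>R (l (l x0) + T x0) = 0" by simp
      \<comment> \<open>If \<open>D\<close> vanished at \<open>x0\<close>, then
        \<open>k^2 + m^2 = s\<close> would hold there, which certifies
        \<open>norm (k x0) <= sqrt s * norm x0\<close>.\<close>
      define m where "m x = sqrt 2 *\<^sub>R l x" for x
      have "m (m x0) = 2 *\<^sub>R l (l x0)" unfolding m_def using sl(2,6) x0 by simp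
      then have "k (k x0) + m (m x0) - s *\<^sub>R x0 = 2 *\<^sub>R (l (l x0) + T x0)"
        unfolding T_def by (simp add: scaleR_add_right)
      then have eq: "k (k x0) + m (m x0) = (sqrt s)\<^sup>2 *\<^sub>R x0" using * s by simp
      have "norm (k x0) \<le> sqrt s * norm x0"
      proof (rule norm_le_of_squares_eq[of J])
        show "adjoint_on J k k" by (rule sk(1))
        show "adjoint_on J m m"
          using selfadjoint_on_scaleR[OF J l(1), of "sqrt 2"] unfolding m_def selfadjoint_on_def by blast
        show "k (m x0) = m (k x0)" unfolding m_def using kl sk(6) sl(2) x0 by simp
      qed (use x0 s eq in auto)
      then have "(norm (k x0))\<^sup>2 \<le> (sqrt s * norm x0)\<^sup>2" by (intro power_mono) auto
      then show False using x0 s by (simp add: power_mult_distrib)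
    qed
  qed (simp_all add: T_def)
qed

text \<open>Here \<open>T\<close> is a multiple of \<open>\<nu>^2 - P^2\<close>, and on the kernel
  of \<open>E\<close> one has \<open>P^2 + m^2 = \<nu>^2\<close> with \<open>m\<close> a multiple of
  \<open>l\<close>. The vector \<open>z\<close> keeps \<open>D\<close> from vanishing: otherwise
  \<open>P^2 = \<nu>^2 + m^2\<close> at \<open>z\<close>, which would give
  \<open>norm (P z) >= \<nu> * norm z\<close>.\<close>

lemma spectral_cut_below:
  assumes J: "closed_subspace J" and P: "selfadjoint_on J P"
    and \<nu>: "\<nu> > 0" and z: "z \<in> J" "norm (P z) < \<nu> * norm z"
  obtains D E where "selfadjoint_on J D" "selfadjoint_on J E" "generated_by J P D" "generated_by J P E"
    "\<And>x. x \<in> J \<Longrightarrow> E (D x) = 0" "\<exists>x\<in>J. D x \<noteq> 0"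
    "\<And>x. x \<in> J \<Longrightarrow> E x = 0 \<Longrightarrow> norm (P x) \<le> \<nu> * norm x"
proof -
  note sP = selfadjoint_onD[OF J P]
  obtain C0 where C0: "C0 \<ge> 0" "bounded_by J P C0"
    using P bounded_by_nonneg unfolding selfadjoint_on_def by metis
  \<comment> \<open>Chosen so that \<open>r * (C0^2 + \<nu>^2) <= 1\<close>, which makes
    \<open>T\<close> a contraction.\<close>
  define r where "r = 1 / ((C0 + \<nu>)\<^sup>2 + 1)"
  have r: "r > 0" unfolding r_def by (simp add: add_nonneg_pos)
  have r1: "r * (C0\<^sup>2 + \<nu>\<^sup>2) \<le> 1"
    unfolding r_def using C0(1) \<nu> by (simp add: divide_le_eq add_nonneg_pos power2_sum)
  define T where "T x = r *\<^sub>R (\<nu>\<^sup>2 *\<^sub>R x - P (P x))" for x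
  have Teq: "T = (\<lambda>x. r *\<^sub>R (\<nu>\<^sup>2 *\<^sub>R x - P (P x)))" by (simp add: fun_eq_iff T_def)
  have T: "selfadjoint_on J T"
    unfolding Teq by (intro selfadjoint_on_scaleR[OF J] selfadjoint_on_diff[OF J] selfadjoint_on_square[OF P] selfadjoint_on_id)
  note sT = selfadjoint_onD[OF J T]
  have T1: "bounded_by J T 1"
    unfolding bounded_by_def
  proof
    fix x assume x: "x \<in> J"
    have "norm (P (P x)) \<le> C0 * norm (P x)" using bounded_byD[OF C0(2) sP(2)[OF x]] .
    also have "\<dots> \<le> C0 * (C0 * norm x)" using bounded_byD[OF C0(2) x] C0(1) by (rule mult_left_mono)
    finally have "norm (\<nu>\<^sup>2 *\<^sub>R x - P (P x)) \<le> (C0\<^sup>2 + \<nu>\<^sup>2) * norm x"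
      using norm_triangle_ineq4[of "\<nu>\<^sup>2 *\<^sub>R x" "P (P x)"] by (simp add: power2_eq_square algebra_simps)
    then have "norm (T x) \<le> r * ((C0\<^sup>2 + \<nu>\<^sup>2) * norm x)"
      unfolding T_def using r by (simp add: mult_left_mono)
    also have "\<dots> \<le> 1 * norm x" using mult_right_mono[OF r1 norm_ge_zero[of x]] by (simp add: mult.assoc)
    finally show "norm (T x) \<le> 1 * norm x" .
  qed
  have gT: "generated_by J P T"
    using generated_by_lincomb[OF J generated_by_id generated_by_comp[OF generated_by_refl generated_by_refl],
        of P "r * \<nu>\<^sup>2" "- r"] sP(2)
    unfolding Teq by (simp add: scaleR_diff_right)
  obtain l where l: "selfadjoint_on J l" "\<And>x. x \<in> J \<Longrightarrow> l (l (l (l x))) = T (T x)"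
    "bounded_by J (\<lambda>x. x - l (l x)) 1" "generated_by J T l" "\<And>x. x \<in> J \<Longrightarrow> l (T x) = T (l x)"
    by (rule abs_operator[OF J T T1]) blast
  note sl = selfadjoint_onD[OF J l(1)]
  have gl: "generated_by J P l" by (rule generated_by_trans[OF gT l(4)])
  have Pl: "P (l x) = l (P x)" if "x \<in> J" for x
    using generated_by_selfadjoint[OF gl J P _ that] by simp
  define m where "m x = (1 / sqrt r) *\<^sub>R l x" for x
  have m: "selfadjoint_on J m"
    using selfadjoint_on_scaleR[OF J l(1), of "1 / sqrt r"] unfolding m_def .
  have mm: "r *\<^sub>R m (m x) = l (l x)" if "x \<in> J" for x
    unfolding m_def using sl(2,6) that r by (simp add: field_simps)
  have Pm: "P (m x) = m (P x)" if "x \<in> J" for x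
    unfolding m_def using Pl sP(6) sl(2) that by simp
  show ?thesis
  proof (rule that[OF _ _ generated_by_abs_parts[OF J gT gl sT(2) sl(2)]])
    show "selfadjoint_on J (\<lambda>x. l (l x) + T x)" "selfadjoint_on J (\<lambda>x. l (l x) - T x)"
      by (intro selfadjoint_on_add[OF J] selfadjoint_on_diff[OF J] selfadjoint_on_square[OF l(1)] T)+
    show "l (l (l (l x) + T x)) - T (l (l x) + T x) = 0" if "x \<in> J" for x
      by (rule abs_parts_orthogonal(1)[OF J T l(1,2,5) that])
    show "\<exists>x\<in>J. l (l x) + T x \<noteq> 0"
    proof (rule ccontr)
      assume "\<not> ?thesis"
      then have "l (l z) + T z = 0" using z by auto
      then have "r *\<^sub>R (m (m z) + (\<nu>\<^sup>2 *\<^sub>R z - P (P z))) = 0"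
        using mm[OF z(1)] unfolding T_def by (simp add: scaleR_add_right)
      then have "m (m z) + (\<nu>\<^sup>2 *\<^sub>R z - P (P z)) = 0" using r by simp
      then have eq: "P (P z) = \<nu>\<^sup>2 *\<^sub>R z + m (m z)" by (simp add: algebra_simps)
      have "(norm (\<nu> *\<^sub>R z))\<^sup>2 \<le> norm (star z * (\<nu> *\<^sub>R \<nu> *\<^sub>R z + m (m z)))"
      proof (rule norm_le_sum_of_squares[of J "\<lambda>x. \<nu> *\<^sub>R x"])
        show "adjoint_on J ((*\<^sub>R) \<nu>) ((*\<^sub>R) \<nu>)"
          using selfadjoint_on_scaleR[OF J selfadjoint_on_id, of \<nu>] unfolding selfadjoint_on_def by blast
        show "adjoint_on J m m" using m unfolding selfadjoint_on_def by blast
        show "\<nu> *\<^sub>R m z = m (\<nu> *\<^sub>R z)" using selfadjoint_onD(6)[OF J m z(1)] by simp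
      qed (rule z)
      also have "\<dots> = norm (star z * P (P z))" using eq by (simp add: power2_eq_square)
      also have "\<dots> = (norm (P z))\<^sup>2" using norm_adjoint_square[OF sP(1) z(1)] by simp
      also have "\<dots> < (\<nu> * norm z)\<^sup>2" using z(2) by (intro power_strict_mono) auto
      finally show False using \<nu> by (simp add: power_mult_distrib)
    qed
    show "norm (P x) \<le> \<nu> * norm x" if x: "x \<in> J" and E: "l (l x) - T x = 0" for x
    proof -
      have "r *\<^sub>R (m (m x) - (\<nu>\<^sup>2 *\<^sub>R x - P (P x))) = 0"
        using mm[OF x] E unfolding T_def by (simp add: scaleR_diff_right)
      then have "m (m x) - (\<nu>\<^sup>2 *\<^sub>R x - P (P x)) = 0" using r by simp
      then have eq: "P (P x) + m (m x) = \<nu>\<^sup>2 *\<^sub>R x" by (simp add: algebra_simps)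
      show ?thesis
        by (rule norm_le_of_squares_eq[of J P m])
          (use sP(1) m Pm[OF x] x eq \<nu> in \<open>auto simp: selfadjoint_on_def\<close>)
    qed
  qed
qed

text \<open>The spectral radius of \<open>H\<close> or its negative is an approximate eigenvalue.\<close>

lemma approximate_eigenvalue:
  assumes J: "closed_subspace J" and H: "selfadjoint_on J H" and ne: "J \<noteq> {0}" and \<delta>: "\<delta> > 0"
  obtains r y where "y \<in> J" "y \<noteq> 0" "norm (H y - r *\<^sub>R y) \<le> \<delta> * norm y"
proof (cases "bounded_by J H \<delta>")
  case True
  obtain y where "y \<in> J" "y \<noteq> 0" using ne closed_subspaceD(1)[OF J] by blast
  then show ?thesis using that[of y 0] bounded_byD[OF True] by simp
next
  case False
  note sH = selfadjoint_onD[OF J H]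
  obtain C0 where C0: "C0 \<ge> 0" "bounded_by J H C0"
    using H bounded_by_nonneg unfolding selfadjoint_on_def by metis
  have C0\<delta>: "C0 > \<delta>"
  proof (rule ccontr)
    assume "\<not> ?thesis"
    then have "bounded_by J H \<delta>"
      using C0(2) unfolding bounded_by_def by (meson mult_right_mono norm_ge_zero not_le order_trans)
    then show False using False by simp
  qed
  \<comment> \<open>After scaling \<open>H\<close> to a contraction \<open>k\<close>, the cut at
    \<open>k^2 >= 1 - c^2\<close> produces vectors that are eigenvectors up to \<open>c\<close>;
    scaling back multiplies the error by at most \<open>C0\<close>, whence
    \<open>c = \<delta> / C0\<close>. The ratio \<open>q\<close> is the value of \<open>k\<close> at
    the threshold.\<close>
  define c where "c = \<delta> / C0"
  have c: "0 < c" "c < 1" unfolding c_def using C0\<delta> \<delta> by auto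
  define q where "q = sqrt (1 - c\<^sup>2)"
  have c2: "0 < c\<^sup>2" "c\<^sup>2 < 1" using c by (auto simp: abs_square_less_1)
  have q: "0 \<le> q" "q < 1" "q\<^sup>2 = 1 - c\<^sup>2" unfolding q_def using c2 by auto
  have "(\<lambda>n. C0 * q ^ n) \<longlonglongrightarrow> C0 * 0" by (intro tendsto_intros LIMSEQ_power_zero) (use q in auto)
  then have "\<forall>\<^sub>F n in sequentially. C0 * q ^ n < \<delta>" using \<delta> by (intro order_tendstoD) auto
  then obtain n0 where n0: "C0 * q ^ n0 < \<delta>" by (auto simp: eventually_sequentially)
  have "\<not> bounded_by J H (C0 * q ^ n0)"
    using False n0 unfolding bounded_by_def by (meson less_imp_le mult_right_mono norm_ge_zero order_trans)
  \<comment> \<open>A scale at which the bound holds while the next smaller one fails. It replaces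
    the exact norm of \<open>H\<close>: \<open>C\<close> is a bound, and some \<open>x0\<close>
    exceeds \<open>C * q\<close>.\<close>
  then obtain n where n: "bounded_by J H (C0 * q ^ n)" "\<not> bounded_by J H (C0 * q ^ Suc n)"
    using C0(2) nat_induct[of "\<lambda>n. bounded_by J H (C0 * q ^ n)" n0] by auto
  define C where "C = C0 * q ^ n"
  have C: "bounded_by J H C" "\<not> bounded_by J H (C * q)"
    using n unfolding C_def by (simp_all add: mult.assoc mult.commute[of q])
  have "q ^ n \<le> 1" using q by (intro power_le_one) auto
  then have CC0: "C \<le> C0" unfolding C_def using C0(1) by (simp add: mult_left_le)
  have Cnn: "C \<ge> 0" unfolding C_def using C0(1) q by simp
  have "C \<noteq> 0"
  proof
    assume "C = 0" then show False using C by simp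
  qed
  then have Cpos: "C > 0" using Cnn by simp
  define k where "k x = (1 / C) *\<^sub>R H x" for x
  have k: "selfadjoint_on J k" unfolding k_def by (rule selfadjoint_on_scaleR[OF J H])
  note sk = selfadjoint_onD[OF J k]
  have k1: "bounded_by J k 1"
    using C(1) Cpos unfolding bounded_by_def k_def by (simp add: field_simps)
  obtain x0 where x0: "x0 \<in> J" "C * q * norm x0 < norm (H x0)"
    using C(2) unfolding bounded_by_def by (auto simp: not_le)
  have "q * norm x0 < norm (k x0)" unfolding k_def using x0(2) Cpos by (simp add: field_simps)
  then have "(q * norm x0)\<^sup>2 < (norm (k x0))\<^sup>2" using q by (intro power_strict_mono) auto
  then have x0s: "(1 - c\<^sup>2) * (norm x0)\<^sup>2 < (norm (k x0))\<^sup>2" by (simp add: power_mult_distrib q)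
  obtain D E l where DE: "selfadjoint_on J D" "selfadjoint_on J E" "selfadjoint_on J l"
    "generated_by J k D" "generated_by J k E" "generated_by J k l"
    "\<And>x. x \<in> J \<Longrightarrow> E x = l (l x) - (1 / 2) *\<^sub>R (k (k x) - (1 - c\<^sup>2) *\<^sub>R x)"
    "bounded_by J (\<lambda>x. x - l (l x)) 1" "\<And>x. x \<in> J \<Longrightarrow> E (D x) = 0" "\<exists>x\<in>J. D x \<noteq> 0"
    by (rule spectral_cut_above[OF J k k1 _ _ x0(1) x0s]) (use c2 in auto)
  note sl = selfadjoint_onD[OF J DE(3)] and sE = selfadjoint_onD[OF J DE(2)]
  obtain x where x: "x \<in> J" "D x \<noteq> 0" using DE(10) by blast
  define w where "w = D x"
  have w: "w \<in> J" "w \<noteq> 0" "E w = 0" unfolding w_def using x DE(9) selfadjoint_onD(2)[OF J DE(1)] by auto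
  have "bounded_by J (\<lambda>x. k (k x)) (1 * 1)" by (rule bounded_by_comp[OF k1 k1]) (use sk in auto)
  then obtain Q where Q: "selfadjoint_on J Q" "\<And>x. x \<in> J \<Longrightarrow> Q (Q x) = x - k (k x)"
      "generated_by J (\<lambda>x. k (k x)) Q"
    using sqrt_one_minus[OF J selfadjoint_on_square[OF k]] by auto
  note sQ = selfadjoint_onD[OF J Q(1)]
  have kl: "k (l x) = l (k x)" if "x \<in> J" for x
    using generated_by_selfadjoint[OF DE(6) J k _ that] by simp
  have kE: "k (E x) = E (k x)" if "x \<in> J" for x
    using generated_by_selfadjoint[OF DE(5) J k _ that] by simp
  have lQ: "l (Q x) = Q (l x)" if "x \<in> J" for x
    by (rule generated_by_selfadjoint[OF Q(3) J DE(3) _ that]) (use kl sk in auto)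
  have EQ: "E (Q x) = Q (E x)" if "x \<in> J" for x
    by (rule generated_by_selfadjoint[OF Q(3) J DE(2) _ that]) (use kE sk in auto)
  \<comment> \<open>On the kernel of \<open>E\<close> the cut says
    \<open>k^2 - (1 - c^2) = 2 l^2\<close>; since \<open>Q^2 = 1 - k^2\<close>, this reads
    \<open>Q^2 + (sqrt 2 l)^2 = c^2\<close>. As \<open>Q\<close> commutes with \<open>E\<close>, the
    bound can be used twice, giving \<open>c^2\<close> for \<open>1 - k^2\<close> at
    \<open>w\<close>.\<close>
  have Qc: "norm (Q v) \<le> c * norm v" if v: "v \<in> J" "E v = 0" for v
  proof -
    define m where "m x = sqrt 2 *\<^sub>R l x" for x
    have m: "selfadjoint_on J m" unfolding m_def by (rule selfadjoint_on_scaleR[OF J DE(3)])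
    have "m (m v) = 2 *\<^sub>R l (l v)" unfolding m_def using sl(2,6) v by simp
    moreover have "2 *\<^sub>R l (l v) = k (k v) - (1 - c\<^sup>2) *\<^sub>R v" using DE(7)[OF v(1)] v(2) by simp
    ultimately have eq: "Q (Q v) + m (m v) = c\<^sup>2 *\<^sub>R v"
      using Q(2)[OF v(1)] by (simp add: scaleR_diff_left)
    show ?thesis
    proof (rule norm_le_of_squares_eq[of J Q m])
      show "Q (m v) = m (Q v)" unfolding m_def using lQ[OF v(1)] sQ(6) sl(2) v by simp
    qed (use sQ(1) m v eq c in \<open>auto simp: selfadjoint_on_def\<close>)
  qed
  have "norm (Q (Q w)) \<le> c * norm (Q w)"
    by (rule Qc) (use sQ(2) EQ w sQ(8) in auto)
  also have "\<dots> \<le> c * (c * norm w)" using Qc[OF w(1,3)] c by (intro mult_left_mono) auto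
  finally have kkw: "norm (w - k (k w)) \<le> c * (c * norm w)" using Q(2)[OF w(1)] by simp
  have Hk: "H v = C *\<^sub>R k v" for v unfolding k_def using Cpos by simp
  have Cc: "C * c \<le> \<delta>" using CC0 C0\<delta> \<delta> unfolding c_def by (simp add: field_simps)
  \<comment> \<open>\<open>(k - 1) (k + 1) w\<close> has norm at most \<open>c^2 * norm w\<close>.
    Either \<open>(k + 1) w\<close> is small and \<open>- C\<close> is an approximate eigenvalue at
    \<open>w\<close>, or \<open>(k + 1) w\<close> is large enough to serve as approximate
    eigenvector for \<open>C\<close>.\<close>
  show ?thesis
  proof (cases "norm (k w + w) \<le> c * norm w")
    case True
    have "norm (H w - (- C) *\<^sub>R w) = C * norm (k w + w)"
      unfolding Hk using Cpos by (simp flip: scaleR_add_right)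
    also have "\<dots> \<le> C * (c * norm w)" using True Cpos by (intro mult_left_mono) auto
    also have "\<dots> \<le> \<delta> * norm w" using mult_right_mono[OF Cc norm_ge_zero[of w]] by (simp add: mult.assoc)
    finally show ?thesis by (rule that[OF w(1,2)])
  next
    case False
    define y where "y = k w + w"
    have y: "y \<in> J" "y \<noteq> 0" unfolding y_def
      using closed_subspaceD(2)[OF J] sk(2) w(1) False c by auto
    have "H y - C *\<^sub>R y = C *\<^sub>R (k (k w) - w)"
      unfolding Hk y_def using sk(4)[OF sk(2)[OF w(1)] w(1)] by (simp add: algebra_simps)
    then have "norm (H y - C *\<^sub>R y) = C * norm (w - k (k w))"
      using Cpos by (simp add: norm_minus_commute)
    also have "\<dots> \<le> C * (c * norm y)"
      using kkw False c Cpos unfolding y_def by (intro mult_left_mono) (auto intro: order_trans[OF kkw] mult_left_mono)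
    also have "\<dots> \<le> \<delta> * norm y" using mult_right_mono[OF Cc norm_ge_zero[of y]] by (simp add: mult.assoc)
    finally show ?thesis by (rule that[OF y])
  qed
qed

section \<open>Automorphisms, ideals and positivity\<close>

lemma star_automorphismD:
  assumes "star_automorphism \<phi>"
  shows "bij \<phi>" "\<phi> (x + y) = \<phi> x + \<phi> y" "\<phi> (c *\<^sub>C x) = c *\<^sub>C \<phi> x" "\<phi> (x * y) = \<phi> x * \<phi> y"
    "\<phi> (star x) = star (\<phi> x)" "\<phi> 0 = 0" "\<phi> (r *\<^sub>R x) = r *\<^sub>R \<phi> x" "\<phi> (x - y) = \<phi> x - \<phi> y"
    "\<phi> (- x) = - \<phi> x"
proof -
  show 1: "bij \<phi>" "\<And>x y. \<phi> (x + y) = \<phi> x + \<phi> y" "\<And>c x. \<phi> (c *\<^sub>C x) = c *\<^sub>C \<phi> x"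
    "\<phi> (x * y) = \<phi> x * \<phi> y" "\<phi> (star x) = star (\<phi> x)"
    using assms unfolding star_automorphism_def by auto
  show r: "\<phi> (r *\<^sub>R x) = r *\<^sub>R \<phi> x" for r x
    using 1(3)[of "of_real r" x] by (simp add: scaleC_of_real)
  show "\<phi> 0 = 0" using r[of 0 0] by simp
  show "\<phi> (x - y) = \<phi> x - \<phi> y" "\<phi> (- x) = - \<phi> x"
    using 1(2)[of x "-1 *\<^sub>R y"] r[of "-1" y] r[of "-1" x] by simp_all
qed

lemma star_automorphism_inv:
  assumes "star_automorphism \<phi>" shows "star_automorphism (inv_into UNIV \<phi>)"
proof -
  note p = star_automorphismD[OF assms]
  have i: "inv_into UNIV \<phi> (\<phi> x) = x" "\<phi> (inv_into UNIV \<phi> x) = x" for x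
    using p(1) by (simp_all add: bij_is_inj bij_is_surj surj_f_inv_f)
  have e: "inv_into UNIV \<phi> x = y \<longleftrightarrow> x = \<phi> y" for x y using i by metis
  show ?thesis unfolding star_automorphism_def
    by (simp add: e p(2,3,4,5) i bij_imp_bij_inv p(1))
qed

text \<open>
  A square root of \<open>1 - a\<^sup>2\<close> is transported by the automorphism, so contractions go to contractions.
\<close>

lemma star_automorphism_contractive:
  fixes \<phi> :: "'a::cstar_algebra \<Rightarrow> 'a"
  assumes \<phi>: "star_automorphism \<phi>"
  shows "norm (\<phi> x) \<le> norm x"
proof -
  note p = star_automorphismD[OF \<phi>] and pi = star_automorphismD[OF star_automorphism_inv[OF \<phi>]]
  have i: "inv_into UNIV \<phi> (\<phi> x) = x" "\<phi> (inv_into UNIV \<phi> x) = x" for x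
    using p(1) by (simp_all add: bij_is_inj bij_is_surj surj_f_inv_f)
  have 1: "norm (\<phi> a) \<le> 1" if a: "star a = a" "norm a \<le> 1" for a
  proof -
    define k where "k x = a * x" for x
    have k: "selfadjoint_on UNIV k" unfolding k_def by (rule selfadjoint_on_mult[OF a(1)])
    have k1: "bounded_by UNIV k 1" unfolding bounded_by_def k_def
      using a(2) norm_mult_ineq order_trans by (metis mult_right_mono norm_ge_zero)
    have "bounded_by UNIV (\<lambda>x. k (k x)) (1 * 1)" by (rule bounded_by_comp[OF k1 k1]) auto
    then obtain Q where Q: "selfadjoint_on UNIV Q" "\<And>x. Q (Q x) = x - k (k x)"
        "generated_by UNIV (\<lambda>x. k (k x)) Q"
      using sqrt_one_minus[OF closed_subspace_UNIV selfadjoint_on_square[OF k]] by auto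
    have kQ: "k (Q x) = Q (k x)" for x
      by (rule generated_by_selfadjoint[OF Q(3) closed_subspace_UNIV k]) auto
    have Qs: "star (Q x) * y = star x * Q y" for x y
      using selfadjoint_onD(3)[OF closed_subspace_UNIV Q(1)] by simp
    define R where "R x = \<phi> (Q (inv_into UNIV \<phi> x))" for x
    have R: "adjoint_on UNIV R R"
      unfolding adjoint_on_def R_def using Qs i p(4,5) pi(4,5) by (metis UNIV_I)
    have k': "adjoint_on UNIV (\<lambda>x. \<phi> a * x) (\<lambda>x. \<phi> a * x)"
      using selfadjoint_on_mult[of "\<phi> a"] a(1) p(5)[of a] unfolding selfadjoint_on_def by simp
    \<comment> \<open>The certificate is evaluated at the vector \<open>\<phi> a\<close> itself, so
      its left side is \<open>norm (\<phi> a)^2\<close>.\<close>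
    have "norm (\<phi> a * \<phi> a) \<le> 1 * norm (\<phi> a)"
    proof (rule norm_le_of_squares_eq[of UNIV "\<lambda>x. \<phi> a * x" R])
      show "\<phi> a * R (\<phi> a) = R (\<phi> a * \<phi> a)"
        unfolding R_def using kQ[of a] by (simp add: i pi(4) k_def flip: p(4))
      show "\<phi> a * (\<phi> a * \<phi> a) + R (R (\<phi> a)) = 1\<^sup>2 *\<^sub>R \<phi> a"
        unfolding R_def using Q(2)[of a] by (simp add: i k_def p(8) flip: p(4))
    qed (use R k' in auto)
    moreover have "norm (\<phi> a * \<phi> a) = (norm (\<phi> a))\<^sup>2"
      using norm_star_mult[of "\<phi> a"] a(1) by (simp flip: p(5))
    ultimately show ?thesis by (cases "\<phi> a = 0") (simp_all add: power2_eq_square)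
  qed
  show ?thesis
  proof (cases "x = 0")
    case False
    define a where "a = (1 / (norm x)\<^sup>2) *\<^sub>R (star x * x)"
    have "norm a \<le> 1" "star a = a"
      unfolding a_def using False by (simp_all add: norm_star_mult star_scaleR star_mult star_star)
    then have "norm (\<phi> a) \<le> 1" by (rule 1[rotated])
    then have "norm (star (\<phi> x) * \<phi> x) \<le> (norm x)\<^sup>2"
      unfolding a_def using False by (simp add: p(4,5,7) divide_le_eq)
    then have "(norm (\<phi> x))\<^sup>2 \<le> (norm x)\<^sup>2" by (simp add: norm_star_mult)
    then show ?thesis by (simp add: power2_le_iff_abs_le)
  qed (simp add: p)
qed

lemma star_automorphism_isometric:
  assumes "star_automorphism \<phi>" shows "norm (\<phi> x) = norm x"
proof (rule antisym[OF star_automorphism_contractive[OF assms]])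
  have "inv_into UNIV \<phi> (\<phi> x) = x" using star_automorphismD(1)[OF assms] by (simp add: bij_is_inj)
  then show "norm x \<le> norm (\<phi> x)"
    using star_automorphism_contractive[OF star_automorphism_inv[OF assms], of "\<phi> x"] by simp
qed

section \<open>Approximate units and closed ideals\<close>

lemma selfadjoint_on_UNIV_mult:
  assumes "selfadjoint_on UNIV T" shows "T (x * y) = T x * y"
  using assms adjoint_on_linear(6)[OF closed_subspace_UNIV, of T T x y]
  unfolding selfadjoint_on_def by simp

lemma bounded_by_mult_left: "norm a \<le> 1 \<Longrightarrow> bounded_by UNIV (\<lambda>x. a * x) (1::real)"
  for a :: "'a::cstar_algebra"
  unfolding bounded_by_def
  by (metis mult_right_mono norm_ge_zero norm_mult_ineq order_trans)

text \<open>Meant for \<open>{x \<in> I. star x \<in> I}\<close> with \<open>I\<close> a closed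
  ideal. This set is closed under \<open>star\<close> by construction, and approximate units taken
  from it show that \<open>I\<close> is closed under \<open>star\<close> too.\<close>

definition star_subring :: "'a::cstar_algebra set \<Rightarrow> bool" where
  "star_subring S \<longleftrightarrow> (\<forall>x\<in>S. \<forall>y\<in>S. x + y \<in> S \<and> x * y \<in> S) \<and> (\<forall>x\<in>S. star x \<in> S) \<and>
     (\<forall>r. \<forall>x\<in>S. r *\<^sub>R x \<in> S)"

lemma star_subringD:
  assumes "star_subring S" "x \<in> S"
  shows "y \<in> S \<Longrightarrow> x + y \<in> S" "y \<in> S \<Longrightarrow> x * y \<in> S" "star x \<in> S" "r *\<^sub>R x \<in> S"
    "y \<in> S \<Longrightarrow> x - y \<in> S"
proof -
  show 1: "y \<in> S \<Longrightarrow> x + y \<in> S" "y \<in> S \<Longrightarrow> x * y \<in> S" "star x \<in> S" "r *\<^sub>R x \<in> S" for y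
    using assms unfolding star_subring_def by auto
  assume "y \<in> S"
  then have "- 1 *\<^sub>R y \<in> S" using assms unfolding star_subring_def by blast
  then show "x - y \<in> S" using 1(1) by fastforce
qed

text \<open>With \<open>a = z\<^sup>* z\<close> of norm 1, the numerical estimate is \<open>a (1 - a\<^sup>2)\<^sup>2 \<le> 1 / 2\<close>.\<close>

lemma approximate_right_unit_step:
  fixes z :: "'a::cstar_algebra"
  assumes S: "star_subring S" and aS: "star z * z \<in> S"
  shows "\<exists>y\<in>S. norm (z - z * y) \<le> 3 / 4 * norm z"
proof (cases "z = 0")
  case True
  then show ?thesis using aS by auto
next
  case False
  define b where "b = (1 / (norm z)\<^sup>2) *\<^sub>R (star z * z)"
  have b: "norm b = 1" "star b = b" "b \<in> S"
    unfolding b_def using False aS S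
    by (simp_all add: norm_star_mult star_scaleR star_mult star_star star_subring_def)
  define y where "y = b * b"
  have y: "y \<in> S" "star y = y" unfolding y_def using b S by (auto simp: star_subring_def star_mult)
  define k where "k x = b * x" for x
  have k: "selfadjoint_on UNIV k" unfolding k_def by (rule selfadjoint_on_mult[OF b(2)])
  have k1: "bounded_by UNIV k 1" unfolding k_def by (rule bounded_by_mult_left) (simp add: b)
  have "bounded_by UNIV (\<lambda>x. k (k x)) (1 * 1)" by (rule bounded_by_comp[OF k1 k1]) auto
  then obtain Q where Q: "selfadjoint_on UNIV Q" "\<And>x. Q (Q x) = x - k (k x)"
      "generated_by UNIV (\<lambda>x. k (k x)) Q"
    using sqrt_one_minus[OF closed_subspace_UNIV selfadjoint_on_square[OF k]] by auto
  note sQ = selfadjoint_onD[OF closed_subspace_UNIV Q(1), simplified]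
  have kQ: "k (Q x) = Q (k x)" for x
    by (rule generated_by_selfadjoint[OF Q(3) closed_subspace_UNIV k]) auto
  have Q1: "norm (Q x) \<le> norm x" for x
    using bounded_byD[OF norm_sqrt_le[OF closed_subspace_UNIV k Q(1)]] Q(2) kQ by force
  \<comment> \<open>The certificate for \<open>norm (k (Q x)) <= norm x / 2\<close> is
    \<open>k^2 (1 - k^2) + (1/2 - k^2)^2 = 1/4\<close>.\<close>
  define h where "h x = (1 / 2) *\<^sub>R x - k (k x)" for x
  have h: "selfadjoint_on UNIV h" unfolding h_def
    by (intro selfadjoint_on_diff[OF closed_subspace_UNIV] selfadjoint_on_square[OF k]
        selfadjoint_on_scaleR[OF closed_subspace_UNIV selfadjoint_on_id])
  have kQsa: "selfadjoint_on UNIV (\<lambda>x. k (Q x))"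
    by (rule selfadjoint_on_commuting[OF k Q(1)]) (rule kQ)
  have half: "norm (k (Q x)) \<le> 1 / 2 * norm x" for x
  proof (rule norm_le_of_squares_eq[of UNIV "\<lambda>x. k (Q x)" h])
    have kd: "k (x - y) = k x - k y" "k (r *\<^sub>R x) = r *\<^sub>R k x" for x y r
      unfolding k_def by (simp_all add: right_diff_distrib)
    have "k (Q (k (Q x))) = k (k x) - k (k (k (k x)))"
      using kQ Q(2) kd by metis
    moreover have "h (h x) = (1 / 4) *\<^sub>R x - k (k x) + k (k (k (k x)))"
    proof -
      have "h (h x) = (1 / 4) *\<^sub>R x - (1 / 2) *\<^sub>R k (k x) - ((1 / 2) *\<^sub>R k (k x) - k (k (k (k x))))"
        unfolding h_def kd by (simp add: scaleR_diff_right)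
      moreover have "(1 / 2) *\<^sub>R k (k x) + (1 / 2) *\<^sub>R k (k x) = k (k x)"
        by (simp flip: scaleR_add_left)
      ultimately show ?thesis by (simp add: algebra_simps)
    qed
    ultimately show "k (Q (k (Q x))) + h (h x) = (1 / 2)\<^sup>2 *\<^sub>R x"
      by (simp add: power2_eq_square)
    show "k (Q (h x)) = h (k (Q x))"
      unfolding h_def sQ(5) kd sQ(6) kQ by simp
  qed (use kQsa h in \<open>auto simp: selfadjoint_on_def\<close>)
  \<comment> \<open>\<open>e\<close> is \<open>b (1 - b^2)^2\<close>, and the remainder
    \<open>w = z - z * y\<close> satisfies \<open>star w * w = (norm z)^2 e\<close>. The bound 1/2
    for \<open>e\<close> is weakened to 9/16 below in order to have the rational root 3/4.\<close>
  define e where "e = Q (Q (Q (Q b)))"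
  have ex: "norm (e * x) \<le> 1 / 2 * norm x" for x
  proof -
    have "e * x = Q (Q (Q (k (Q x))))"
      unfolding e_def by (simp add: k_def[symmetric] kQ flip: selfadjoint_on_UNIV_mult[OF Q(1)])
    then show ?thesis using Q1 half by (metis order_trans)
  qed
  have "(norm e)\<^sup>2 \<le> 1 / 2 * norm e"
    using ex[of "star e"] norm_star_mult[of "star e"] by (simp add: star_star)
  then have e: "norm e \<le> 1 / 2" by (cases "e = 0") (simp_all add: power2_eq_square)
  have eq: "e = b - b * y - (y * b - y * (b * y))"
    unfolding e_def Q(2) k_def y_def by (simp add: mult.assoc right_diff_distrib)
  have "star (z - z * y) * (z - z * y) = (norm z)\<^sup>2 *\<^sub>R e"
    unfolding eq b_def using False
    by (simp add: star_diff star_mult y(2) left_diff_distrib right_diff_distrib scaleR_diff_right mult.assoc)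
  then have "(norm (z - z * y))\<^sup>2 = (norm z)\<^sup>2 * norm e"
    using norm_star_mult[of "z - z * y"] by simp
  also have "\<dots> \<le> (norm z)\<^sup>2 * (9 / 16)" using e by (intro mult_left_mono) auto
  also have "\<dots> = (3 / 4 * norm z)\<^sup>2" by (simp add: power_mult_distrib power2_eq_square)
  finally have "norm (z - z * y) \<le> 3 / 4 * norm z" by (rule power2_le_imp_le) simp
  then show ?thesis using y by blast
qed

text \<open>The step is iterated on the remainder:
  \<open>(1 - y) (1 - y') = 1 - (y + y' - y y')\<close>. Only \<open>star z * z\<close> has to lie
  in \<open>S\<close>, a condition that the remainders inherit; this allows \<open>z\<close> to be
  an element not yet known to belong to an ideal.\<close>

lemma approximate_right_unit:
  fixes z :: "'a::cstar_algebra"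
  assumes S: "star_subring S" and aS: "star z * z \<in> S" and "\<epsilon> > 0"
  obtains y where "y \<in> S" "norm (z - z * y) < \<epsilon>"
proof -
  have "\<exists>y\<in>S. norm (z - z * y) \<le> (3 / 4) ^ n * norm z" for n
  proof (induction n)
    case 0
    have "0 \<in> S" using S aS unfolding star_subring_def by (metis scaleR_zero_left)
    then show ?case by (intro bexI[of _ 0]) auto
  next
    case (Suc n)
    then obtain y where y: "y \<in> S" "norm (z - z * y) \<le> (3 / 4) ^ n * norm z" by blast
    let ?w = "z - z * y"
    have "star ?w * ?w = star z * z - (star z * z) * y - star y * (star z * z - (star z * z) * y)"
      by (simp add: star_diff star_mult left_diff_distrib right_diff_distrib mult.assoc)
    moreover have "star z * z - (star z * z) * y - star y * (star z * z - (star z * z) * y) \<in> S"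
      by (intro star_subringD[OF S] aS y(1))
    ultimately obtain y' where y': "y' \<in> S" "norm (?w - ?w * y') \<le> 3 / 4 * norm ?w"
      using approximate_right_unit_step[OF S, of ?w] by auto
    have "y + y' - y * y' \<in> S"
      by (intro star_subringD[OF S] y(1) y'(1))
    moreover have "z - z * (y + y' - y * y') = ?w - ?w * y'"
      by (simp add: left_diff_distrib right_diff_distrib distrib_left mult.assoc)
    moreover have "norm (?w - ?w * y') \<le> (3 / 4) ^ Suc n * norm z" using y(2) y'(2) by simp
    ultimately show ?case by metis
  qed
  moreover have "(\<lambda>n. (3 / 4) ^ n * norm z) \<longlonglongrightarrow> 0 * norm z"
    by (intro tendsto_intros LIMSEQ_power_zero) auto
  then have "\<forall>\<^sub>F n in sequentially. (3 / 4) ^ n * norm z < \<epsilon>" using assms(3) by (intro order_tendstoD) auto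
  then obtain n where "(3 / 4) ^ n * norm z < \<epsilon>" by (auto simp: eventually_sequentially)
  ultimately show ?thesis using that by (meson le_less_trans)
qed

lemma closed_approachable_mem:
  fixes z :: "'a::real_normed_vector"
  assumes "closed K" "\<And>\<epsilon>. \<epsilon> > 0 \<Longrightarrow> \<exists>y\<in>K. norm (z - y) < \<epsilon>"
  shows "z \<in> K"
  using assms closed_approachable[OF assms(1), of z] by (metis dist_norm norm_minus_commute)

lemma star_subring_ideal_part:
  assumes "closed_ideal I" shows "star_subring {x \<in> I. star x \<in> I}"
  using closed_subspaceD[OF closed_ideal_subspace[OF assms]] closed_idealD[OF assms]
  unfolding star_subring_def by (auto simp: star_add star_mult star_scaleR star_star)

text \<open>\<open>z\<close> is approximated by \<open>z * y\<close> with both \<open>y\<close> and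
  \<open>star y\<close> in \<open>I\<close>; then \<open>star y * star z\<close> lies in
  \<open>I\<close> through its left factor and approximates \<open>star z\<close>.\<close>

lemma closed_ideal_star:
  assumes I: "closed_ideal I" and z: "z \<in> I" shows "star z \<in> I"
proof (rule closed_approachable_mem)
  show "closed I" using I unfolding closed_ideal_def by blast
  fix \<epsilon> :: real assume "\<epsilon> > 0"
  have "star z * z \<in> {x \<in> I. star x \<in> I}" using closed_idealD(1)[OF I z] by (simp add: star_mult star_star)
  then obtain y where y: "y \<in> {x \<in> I. star x \<in> I}" "norm (z - z * y) < \<epsilon>"
    using approximate_right_unit[OF star_subring_ideal_part[OF I] _ \<open>\<epsilon> > 0\<close>] by blast
  have "norm (star z - star y * star z) < \<epsilon>"
    using y(2) norm_star[of "z - z * y"] by (simp add: star_diff star_mult)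
  moreover have "star y * star z \<in> I" using closed_idealD(2)[OF I, of "star y"] y by auto
  ultimately show "\<exists>y\<in>I. norm (star z - y) < \<epsilon>" by blast
qed

text \<open>The approximate right units of \<open>z\<close> are obtained from
  \<open>star z * z\<close> and hence lie in \<open>I\<close>, so \<open>z\<close> is a limit of
  elements \<open>z * y\<close> of \<open>I\<close>.\<close>

lemma star_mult_self_in_ideal:
  assumes I: "closed_ideal I" and z: "star z * z \<in> I" shows "z \<in> I"
proof (rule closed_approachable_mem)
  show "closed I" using I unfolding closed_ideal_def by blast
  fix \<epsilon> :: real assume "\<epsilon> > 0"
  have "star z * z \<in> {x \<in> I. star x \<in> I}" using z by (simp add: star_mult star_star)
  then obtain y where y: "y \<in> {x \<in> I. star x \<in> I}" "norm (z - z * y) < \<epsilon>"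
    using approximate_right_unit[OF star_subring_ideal_part[OF I] _ \<open>\<epsilon> > 0\<close>] by blast
  then show "\<exists>y\<in>I. norm (z - y) < \<epsilon>" using closed_idealD(1)[OF I] by blast
qed

text \<open>\<open>star (T x) * T x = star x * S (T x)\<close> lies in \<open>K\<close> through its
  left factor. This is what makes restriction of multipliers to smaller ideals possible.\<close>

lemma adjoint_on_preserves_ideal:
  assumes I: "closed_ideal I" and K: "closed_ideal K" "K \<subseteq> I" and T: "adjoint_on I T S" and x: "x \<in> K"
  shows "T x \<in> K"
proof (rule star_mult_self_in_ideal[OF K(1)])
  have xI: "x \<in> I" using x K by blast
  have "star x * S (T x) \<in> K"
    by (rule closed_idealD(2)[OF K(1) closed_ideal_star[OF K(1) x]])
  then show "star (T x) * T x \<in> K" using adjoint_onD[OF T] xI by simp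
qed

text \<open>The elements annihilating \<open>K\<close> from the left form a closed ideal. An element
  \<open>z\<close> of it that lies in \<open>K\<close> satisfies \<open>z * star z = 0\<close>,
  since \<open>star z\<close> is in \<open>K\<close>; so this ideal meets \<open>K\<close>
  trivially.\<close>

lemma essential_ideal_annihilator:
  assumes K: "essential_ideal K" and x: "\<And>y. y \<in> K \<Longrightarrow> x * y = 0"
  shows "x = 0"
proof -
  have Ki: "closed_ideal K" using K unfolding essential_ideal_def by blast
  define N where "N = {x. \<forall>y\<in>K. x * y = 0}"
  have "closed N"
  proof -
    have "N = (\<Inter>y\<in>K. {x. x * y = 0})" unfolding N_def by auto
    then show ?thesis by (auto intro!: closed_INT closed_Collect_eq continuous_intros)
  qed
  moreover have "complex_subspace N"
    unfolding complex_subspace_def N_def by (auto simp: distrib_right mult_scaleC_left)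
  ultimately have N: "closed_ideal N"
    unfolding closed_ideal_def N_def using closed_idealD[OF Ki] by (auto simp: mult.assoc)
  have "z = 0" if z: "z \<in> K \<inter> N" for z
  proof -
    have "z * star z = 0" using closed_ideal_star[OF Ki] z unfolding N_def by blast
    then have "star (star z) * star z = 0" by (simp add: star_star)
    then show "z = 0" by simp
  qed
  then have "K \<inter> N = {0}" using closed_subspaceD(1)[OF closed_ideal_subspace] N Ki by blast
  then have "N = {0}" using K N unfolding essential_ideal_def by blast
  then show ?thesis using x unfolding N_def by blast
qed

section \<open>Positivity of \<open>star x * x\<close>\<close>

lemma one_minus_square_le:
  fixes h x :: "'a::cstar_algebra"
  assumes "star h = h" "(norm h)\<^sup>2 \<le> M" "M > 0"
  shows "norm (M *\<^sub>R x - h * (h * x)) \<le> M * norm x"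
proof -
  define k where "k = (1 / sqrt M) *\<^sub>R h"
  have "norm k \<le> 1" unfolding k_def using assms by (simp add: real_le_rsqrt)
  moreover have "star k = k" unfolding k_def using assms(1) by (simp add: star_scaleR)
  ultimately have "norm (x - k * (k * x)) \<le> norm x"
    using bounded_byD[OF one_minus_square_contractive[OF closed_subspace_UNIV selfadjoint_on_mult bounded_by_mult_left], of k x]
    by simp
  moreover have "M *\<^sub>R x - h * (h * x) = M *\<^sub>R (x - k * (k * x))"
    unfolding k_def using assms(3) by (simp add: scaleR_diff_right)
  ultimately show ?thesis using assms(3) by (simp add: mult_left_mono)
qed

text \<open>Self-adjointness gives \<open>norm (Z^m w)^2 <= norm w * norm (Z^(2 m) w)\<close>. A
  growth ratio \<open>\<rho> > 1\<close> at \<open>w\<close> is therefore squared whenever the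
  exponent doubles, and the powers would be unbounded.\<close>

lemma norm_le_of_bounded_powers:
  assumes J: "closed_subspace J" and Z: "selfadjoint_on J Z" and w: "w \<in> J"
    and C: "\<And>n. norm ((Z ^^ n) w) \<le> C"
  shows "norm (Z w) \<le> norm w"
proof (rule ccontr)
  assume "\<not> ?thesis"
  then have gt: "norm w < norm (Z w)" by simp
  have w0: "w \<noteq> 0" using gt selfadjoint_onD(8)[OF J Z] by auto
  define \<rho> where "\<rho> = norm (Z w) / norm w"
  have \<rho>: "\<rho> > 1" unfolding \<rho>_def using gt w0 by (simp add: less_divide_eq)
  have ZJ: "(Z ^^ n) x \<in> J" if "x \<in> J" for n x
    by (induction n) (use selfadjoint_onD(2)[OF J Z] that in auto)
  have Zs: "x \<in> J \<Longrightarrow> y \<in> J \<Longrightarrow> star ((Z ^^ n) x) * y = star x * (Z ^^ n) y" for n x y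
  proof (induction n arbitrary: y)
    case (Suc n)
    then show ?case
      using selfadjoint_onD(3)[OF J Z ZJ[of x n] Suc.prems(2)] selfadjoint_onD(2)[OF J Z]
      by (simp add: funpow_swap1)
  qed simp
  have low: "\<rho> ^ (2 ^ k) * norm w \<le> norm ((Z ^^ (2 ^ k)) w)" for k
  proof (induction k)
    case 0
    then show ?case using w0 by (simp add: \<rho>_def)
  next
    case (Suc k)
    let ?u = "(Z ^^ (2 ^ k)) w"
    have "(\<rho> ^ (2 ^ k) * norm w)\<^sup>2 \<le> (norm ?u)\<^sup>2" using Suc \<rho> w0 by (intro power_mono) auto
    also have "\<dots> = norm (star w * (Z ^^ (2 ^ k)) ?u)"
      using norm_star_mult[of ?u] Zs[OF w ZJ[OF w]] by simp
    also have "\<dots> \<le> norm w * norm ((Z ^^ (2 ^ k)) ?u)"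
      using norm_mult_ineq[of "star w"] by simp
    also have "(Z ^^ (2 ^ k)) ?u = (Z ^^ (2 ^ Suc k)) w"
      by (simp add: mult_2 funpow_add)
    finally have "norm w * (\<rho> ^ (2 ^ Suc k) * norm w) \<le> norm w * norm ((Z ^^ (2 ^ Suc k)) w)"
      by (simp add: power_mult_distrib power_add mult_2 power2_eq_square mult.commute mult.left_commute)
    then show ?case using w0 by simp
  qed
  obtain n where n: "C / norm w < \<rho> ^ n" using real_arch_pow[OF \<rho>] by blast
  have "\<rho> ^ n \<le> \<rho> ^ (2 ^ n)" using \<rho> by (intro power_increasing) (auto intro: less_imp_le less_exp)
  then have "C < \<rho> ^ (2 ^ n) * norm w"
    using n w0 by (smt (verit) divide_less_eq zero_less_norm_iff)
  then show False using low[of n] C[of "2 ^ n"] by linarith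
qed

lemma complex_subspace_closure:
  assumes "complex_subspace S" shows "closed_subspace (closure S)"
proof -
  have "x + y \<in> closure S" if "x \<in> closure S" "y \<in> closure S" for x y
  proof -
    obtain f g where "\<forall>n. f n \<in> S" "f \<longlonglongrightarrow> x" "\<forall>n. g n \<in> S" "g \<longlonglongrightarrow> y"
      using \<open>x \<in> closure S\<close> \<open>y \<in> closure S\<close> unfolding closure_sequential by blast
    then show ?thesis unfolding closure_sequential
      using assms tendsto_add unfolding complex_subspace_def by (metis (mono_tags, lifting))
  qed
  moreover have "c *\<^sub>C x \<in> closure S" if "x \<in> closure S" for c x
  proof -
    obtain f where f: "\<forall>n. f n \<in> S" "f \<longlonglongrightarrow> x"
      using \<open>x \<in> closure S\<close> unfolding closure_sequential by blast
    then show ?thesis unfolding closure_sequential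
      using assms bounded_linear.tendsto[OF bounded_linear_scaleC f(2)] unfolding complex_subspace_def
      by (intro exI[of _ "\<lambda>n. c *\<^sub>C f n"]) auto
  qed
  moreover have "0 \<in> closure S" using assms closure_subset unfolding complex_subspace_def by blast
  ultimately show ?thesis unfolding closed_subspace_def complex_subspace_def by auto
qed

text \<open>
  The argument behind \<open>sp(v\<^sup>* v) \<subseteq> sp(v v\<^sup>*) \<union> {0}\<close>: by \<open>v\<^sup>* (N - v v\<^sup>*)\<^sup>n v = (N - v\<^sup>* v)\<^sup>n v\<^sup>* v\<close>, the
  powers of \<open>1 + c\<^sup>2 / N\<close> are bounded on the range of \<open>c\<^sup>2\<close>.
\<close>

lemma star_mult_self_eq_minus_square:
  fixes v c :: "'a::cstar_algebra"
  assumes v: "star v * v = - (c * c)" and c: "star c = c"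
  shows "v = 0"
proof -
  \<comment> \<open>Real and imaginary part of \<open>v\<close>. Because \<open>star v * v\<close>
    is \<open>- c^2\<close>, they express \<open>v * star v\<close> as
    \<open>2 s^2 + 2 t^2 + c^2\<close>; such a sum of squares allows the bound \<open>N\<close> for
    \<open>W = N - v * star v\<close>.\<close>
  define s where "s = (1 / 2) *\<^sub>R (v + star v)"
  define t where "t = (- \<i> / 2) *\<^sub>C (v - star v)"
  have st: "star s = s" "star t = t"
    unfolding s_def t_def
    by (simp_all add: star_scaleR star_add star_star star_scaleC star_diff add.commute
        scaleC_diff_right scaleC_minus_left)
  have ss: "2 *\<^sub>R (s * s) = (1 / 2) *\<^sub>R (v * v + v * star v + star v * v + star v * star v)"
    unfolding s_def by (simp add: distrib_left distrib_right add.assoc scaleR_add_right)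
  have tt: "2 *\<^sub>R (t * t) = (1 / 2) *\<^sub>R (- (v * v) + v * star v + star v * v - star v * star v)"
  proof -
    have "t * t = ((- \<i> / 2) * (- \<i> / 2)) *\<^sub>C ((v - star v) * (v - star v))"
      unfolding t_def by (simp only: mult_scaleC_left mult_scaleC_right scaleC_scaleC)
    also have "(- \<i> / 2) * (- \<i> / 2) = complex_of_real (- 1 / 4)" by simp
    finally have "t * t = (- 1 / 4) *\<^sub>R ((v - star v) * (v - star v))" by (simp only: scaleC_of_real)
    then have "2 *\<^sub>R (t * t) = (- 1 / 2) *\<^sub>R ((v - star v) * (v - star v))" by simp
    also have "\<dots> = (1 / 2) *\<^sub>R (- ((v - star v) * (v - star v)))" by simp
    also have "- ((v - star v) * (v - star v)) = - (v * v) + v * star v + star v * v - star v * star v"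
      by (simp add: left_diff_distrib right_diff_distrib)
    finally show ?thesis .
  qed
  have "2 *\<^sub>R (s * s) + 2 *\<^sub>R (t * t) = (1 / 2) *\<^sub>R
      ((v * v + v * star v + star v * v + star v * star v) + (- (v * v) + v * star v + star v * v - star v * star v))"
    unfolding ss tt by (simp only: scaleR_add_right[symmetric])
  also have "(v * v + v * star v + star v * v + star v * star v) + (- (v * v) + v * star v + star v * v - star v * star v)
      = 2 *\<^sub>R (v * star v + star v * v)"
    by (simp add: scaleR_2)
  finally have vv: "v * star v = 2 *\<^sub>R (s * s) + 2 *\<^sub>R (t * t) + c * c"
    using v by simp
  define A B G where "A = (norm s)\<^sup>2 + 1" and "B = (norm t)\<^sup>2 + 1" and "G = (norm c)\<^sup>2 + 1"
  have pos: "A > 0" "B > 0" "G > 0" unfolding A_def B_def G_def by (simp_all add: add_nonneg_pos)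
  define N where "N = 2 * A + 2 * B + G"
  have N: "N > 0" unfolding N_def using pos by simp
  define W where "W x = N *\<^sub>R x - v * (star v * x)" for x
  have W: "norm (W x) \<le> N * norm x" for x
  proof -
    have "W x = 2 *\<^sub>R (A *\<^sub>R x - s * (s * x)) + 2 *\<^sub>R (B *\<^sub>R x - t * (t * x)) + (G *\<^sub>R x - c * (c * x))"
      unfolding W_def N_def using arg_cong[OF vv, of "\<lambda>y. y * x"]
      by (simp add: mult.assoc distrib_right scaleR_diff_right scaleR_add_left)
    also have "norm \<dots> \<le> norm (2 *\<^sub>R (A *\<^sub>R x - s * (s * x))) + norm (2 *\<^sub>R (B *\<^sub>R x - t * (t * x)))
        + norm (G *\<^sub>R x - c * (c * x))"
      by (rule norm_triangle_mono[OF norm_triangle_ineq order_refl])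
    also have "\<dots> = 2 * norm (A *\<^sub>R x - s * (s * x)) + 2 * norm (B *\<^sub>R x - t * (t * x)) + norm (G *\<^sub>R x - c * (c * x))"
      by (simp only: norm_scaleR abs_numeral)
    also have "\<dots> \<le> 2 * (A * norm x) + 2 * (B * norm x) + G * norm x"
      using one_minus_square_le[OF st(1) _ pos(1), of x] one_minus_square_le[OF st(2) _ pos(2), of x]
        one_minus_square_le[OF c _ pos(3), of x] unfolding A_def B_def G_def by simp
    finally show ?thesis unfolding N_def by (simp add: algebra_simps)
  qed
  have Wn: "norm ((W ^^ n) x) \<le> N ^ n * norm x" for n x
  proof (induction n)
    case (Suc n)
    have "norm ((W ^^ Suc n) x) \<le> N * norm ((W ^^ n) x)" using W by simp
    also have "\<dots> \<le> N * (N ^ n * norm x)" using Suc N by (intro mult_left_mono) auto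
    finally show ?case by (simp add: mult.assoc)
  qed simp
  \<comment> \<open>\<open>N * Z\<close> is \<open>N - star v * v\<close>, so multiplication by
    \<open>star v\<close> carries powers of \<open>W\<close> to powers of
    \<open>N * Z\<close>.\<close>
  define Z where "Z x = x + (1 / N) *\<^sub>R (c * (c * x))" for x
  have Zadd: "Z (r *\<^sub>R x) = r *\<^sub>R Z x" for r x unfolding Z_def by (simp add: scaleR_add_right)
  have vW: "star v * W y = N *\<^sub>R Z (star v * y)" for y
  proof -
    have "star v * W y = N *\<^sub>R (star v * y) - (star v * v) * (star v * y)"
      unfolding W_def by (simp add: right_diff_distrib mult.assoc)
    also have "\<dots> = N *\<^sub>R (star v * y) + c * (c * (star v * y))" unfolding v by (simp add: mult.assoc)
    finally show ?thesis unfolding Z_def using N by (simp add: scaleR_add_right)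
  qed
  have Zr: "(Z ^^ n) (r *\<^sub>R x) = r *\<^sub>R (Z ^^ n) x" for n r x
    by (induction n) (simp_all add: Zadd)
  have vWn: "star v * (W ^^ n) y = N ^ n *\<^sub>R (Z ^^ n) (star v * y)" for n y
  proof (induction n)
    case (Suc n)
    have "star v * (W ^^ Suc n) y = N *\<^sub>R Z (star v * (W ^^ n) y)" using vW by simp
    then show ?case using Suc by (simp add: Zadd)
  qed simp
  have Zsa: "selfadjoint_on UNIV Z"
    unfolding Z_def
    by (intro selfadjoint_on_add[OF closed_subspace_UNIV] selfadjoint_on_id
        selfadjoint_on_scaleR[OF closed_subspace_UNIV] selfadjoint_on_square[OF selfadjoint_on_mult[OF c]])
  have contr: "norm (Z (c * (c * x))) \<le> norm (c * (c * x))" for x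
  proof (rule norm_le_of_bounded_powers[OF closed_subspace_UNIV Zsa])
    fix n
    have "N ^ n *\<^sub>R (Z ^^ n) (- (c * (c * x))) = star v * (W ^^ n) (v * x)"
      unfolding vWn using arg_cong[OF v, of "\<lambda>y. y * x"] by (simp add: mult.assoc)
    then have "norm (N ^ n *\<^sub>R (Z ^^ n) (- (c * (c * x)))) \<le> norm v * norm ((W ^^ n) (v * x))"
      using norm_mult_ineq[of "star v" "(W ^^ n) (v * x)"] by simp
    also have "\<dots> \<le> norm v * (N ^ n * norm (v * x))" using Wn by (intro mult_left_mono) auto
    finally have "norm (N ^ n *\<^sub>R (Z ^^ n) (- 1 *\<^sub>R (c * (c * x)))) \<le> norm v * (N ^ n * norm (v * x))"
      by simp
    then have "N ^ n * norm ((Z ^^ n) (c * (c * x))) \<le> N ^ n * (norm v * norm (v * x))"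
      unfolding Zr using N by (simp add: mult.left_commute)
    then show "norm ((Z ^^ n) (c * (c * x))) \<le> norm v * norm (v * x)"
      using N by simp
  qed simp
  \<comment> \<open>\<open>Z\<close> is known to be contractive on the range of \<open>c^2\<close>,
    hence on its closure. There the root \<open>Q\<close> of \<open>1 - Z = - c^2 / N\<close>
    exists, so \<open>(c / sqrt N)^2 + Q^2 = 0\<close>, and the certificate with constant 0 gives
    \<open>c w = 0\<close> for \<open>w\<close> in that closure.\<close>
  define S where "S = range (\<lambda>x. c * (c * x))"
  have "complex_subspace S"
    unfolding complex_subspace_def S_def
    by (auto simp: image_iff simp flip: distrib_left mult_scaleC_right intro: exI[of _ 0])
  then have K: "closed_subspace (closure S)" by (rule complex_subspace_closure)
  have "continuous_on (closure S) (\<lambda>x. norm x - norm (Z x))" "continuous_on UNIV Z"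
    unfolding Z_def by (intro continuous_intros)+
  note cont = this
  have Z1: "bounded_by (closure S) Z 1"
    unfolding bounded_by_def
  proof
    fix x assume "x \<in> closure S"
    then have "0 \<le> norm x - norm (Z x)"
      by (rule continuous_ge_on_closure[OF cont(1)]) (use contr S_def in auto)
    then show "norm (Z x) \<le> 1 * norm x" by simp
  qed
  have ZK: "Z ` closure S \<subseteq> closure S"
  proof (rule image_closure_subset[OF continuous_on_subset[OF cont(2)]])
    show "Z ` S \<subseteq> closure S"
    proof -
      have "Z (c * (c * x)) = c * (c * Z x)" for x
        unfolding Z_def by (simp add: distrib_left mult.assoc)
      then show ?thesis unfolding S_def using closure_subset[of "range (\<lambda>x. c * (c * x))"] by blast
    qed
  qed auto
  have cK: "(\<lambda>x. c * x) ` closure S \<subseteq> closure S"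
  proof (rule image_closure_subset)
    show "continuous_on (closure S) (\<lambda>x. c * x)" by (intro continuous_intros)
    show "(\<lambda>x. c * x) ` S \<subseteq> closure S" unfolding S_def using closure_subset[of "range (\<lambda>x. c * (c * x))"] by blast
  qed auto
  have ZsaK: "selfadjoint_on (closure S) Z" by (rule selfadjoint_on_subspace[OF Zsa _ ZK]) simp
  have csaK: "selfadjoint_on (closure S) (\<lambda>x. c * x)"
    by (rule selfadjoint_on_subspace[OF selfadjoint_on_mult[OF c] _ cK]) simp
  obtain Q where Q: "selfadjoint_on (closure S) Q" "\<And>x. x \<in> closure S \<Longrightarrow> Q (Q x) = x - Z x"
    "generated_by (closure S) Z Q"
    using sqrt_one_minus[OF K ZsaK Z1] by blast
  have Qc: "c * Q x = Q (c * x)" if "x \<in> closure S" for x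
    by (rule generated_by_selfadjoint[OF Q(3) K csaK _ that]) (simp add: Z_def distrib_left)
  define d where "d x = (1 / sqrt N) *\<^sub>R (c * x)" for x
  have d: "adjoint_on (closure S) d d"
    using selfadjoint_on_scaleR[OF K csaK, of "1 / sqrt N"] unfolding d_def selfadjoint_on_def by blast
  define w where "w = c * (c * c)"
  have "w \<in> S" unfolding w_def S_def by (rule rangeI)
  then have w: "w \<in> closure S" by (rule subsetD[OF closure_subset])
  have "norm (d w) \<le> 0 * norm w"
  proof (rule norm_le_of_squares_eq[OF d _ _ w])
    show "adjoint_on (closure S) Q Q" using Q(1) unfolding selfadjoint_on_def by blast
    show "d (d w) + Q (Q w) = 0\<^sup>2 *\<^sub>R w" using Q(2)[OF w] N unfolding d_def Z_def by simp
    have "c * w \<in> closure S" using cK w by blast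
    then show "d (Q w) = Q (d w)"
      using Qc[OF w] selfadjoint_onD(6)[OF K Q(1)] unfolding d_def by simp
  qed simp
  then have "d w = 0" by simp
  then have "c * (c * (c * c)) = 0" using N unfolding d_def w_def by simp
  then have "star (c * c) * (c * c) = 0" using c by (simp add: star_mult mult.assoc)
  then have "c * c = 0" by simp
  then show "v = 0" using v by simp
qed

lemma eq_zero_by_mult: "(\<And>x. a * x = 0) \<Longrightarrow> a = (0::'a::cstar_algebra)"
  by (metis star_eq_0_iff star_mult_self_eq_0 star_star)

text \<open>With \<open>k = star X * X\<close> and \<open>l^2\<close> its absolute value,
  \<open>E = l^2 - k\<close> is twice the negative part of \<open>k\<close>, and the point is that
  it vanishes. Roots are operators on \<open>A\<close> rather than elements, since \<open>A\<close>
  need not have a unit.\<close>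

lemma star_mult_self_sqrt:
  fixes X :: "'a::cstar_algebra"
  assumes X: "norm X \<le> 1"
  obtains l where "selfadjoint_on UNIV l" "\<And>x. l (l x) = star X * X * x"
    "generated_by UNIV (\<lambda>x. star X * X * x) l"
proof -
  define k where "k = star X * X"
  have k: "star k = k" unfolding k_def by (simp add: star_mult star_star)
  have "norm k \<le> 1" unfolding k_def using X by (simp add: norm_star_mult power_le_one)
  then have k1: "bounded_by UNIV (\<lambda>x. k * x) 1" by (rule bounded_by_mult_left)
  have ksa: "selfadjoint_on UNIV (\<lambda>x. k * x)" by (rule selfadjoint_on_mult[OF k])
  note U = closed_subspace_UNIV
  obtain l where l: "selfadjoint_on UNIV l" "\<And>x. l (l (l (l x))) = k * (k * x)"
    "generated_by UNIV (\<lambda>x. k * x) l" "\<And>x. l (k * x) = k * l x"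
    by (rule abs_operator[OF U ksa k1]) simp
  define E where "E x = l (l x) - k * x" for x
  have E: "selfadjoint_on UNIV E"
    unfolding E_def by (intro selfadjoint_on_diff[OF U] selfadjoint_on_square[OF l(1)] ksa)
  note sE = selfadjoint_onD[OF U E, simplified] and sl = selfadjoint_onD[OF U l(1), simplified]
  have Ek: "E (k * x) = k * E x" for x
    unfolding E_def by (simp add: l(4) right_diff_distrib)
  have El: "E (l x) = l (E x)" for x
    unfolding E_def by (simp add: l(4) sl(5))
  have kE: "k * E x = - l (l (E x))" for x
  proof -
    have "l (l (E x)) + k * E x = l (l (l (l x))) - k * (k * x)"
      unfolding E_def by (simp add: l(4) sl(5) right_diff_distrib)
    then show ?thesis by (simp add: l(2) eq_neg_iff_add_eq_0 add.commute)
  qed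
  have Em: "E (x * y) = E x * y" "l (x * y) = l x * y" for x y
    using selfadjoint_on_UNIV_mult E l(1) by blast+
  \<comment> \<open>Evaluated at \<open>k\<close>, a self-adjoint operator commuting with
    multiplication by \<open>k\<close> yields a self-adjoint element of \<open>A\<close>. In this
    way \<open>l E\<close> becomes the element \<open>c\<close> with
    \<open>star v * v = - c^2\<close>.\<close>
  have star_elem: "star (F k) = F k"
    if F: "selfadjoint_on UNIV F" "\<And>x. F (k * x) = k * F x" for F
  proof -
    have "(star (F k) - F k) * x = 0" for x
    proof -
      have "star (F k) * x = star k * F x"
        using selfadjoint_onD(3)[OF U F(1)] by simp
      also have "\<dots> = F k * x" using k F(2) selfadjoint_on_UNIV_mult[OF F(1), of k x] by simp
      finally show ?thesis by (simp add: left_diff_distrib)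
    qed
    then have "star (F k) - F k = 0" by (rule eq_zero_by_mult)
    then show ?thesis by simp
  qed
  have Ekst: "star (E k) = E k" by (rule star_elem[OF E Ek])
  define c where "c = l (E k)"
  have c: "star c = c"
    unfolding c_def
    by (rule star_elem) (use selfadjoint_on_commuting[OF l(1) E] El Ek l(4) in auto)
  define v where "v = X * E k"
  have "star v * v = E k * (k * E k)"
    unfolding v_def k_def using Ekst by (simp add: star_mult mult.assoc k_def)
  also have "\<dots> = E (k * (k * E k))" by (simp only: Em)
  also have "\<dots> = k * E (E (k * k))" by (simp only: Ek)
  also have "\<dots> = - l (l (E (E (k * k))))" by (rule kE)
  also have "l (l (E (E (k * k)))) = c * c"
    unfolding c_def by (simp only: Em(2)[symmetric] Em(1)[symmetric] Ek l(4) El)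
  finally have "v = 0" using c by (rule star_mult_self_eq_minus_square)
  then have "k * E k = 0" unfolding v_def k_def by (simp add: mult.assoc)
  then have "E (k * k) * x = 0" for x by (simp add: Ek)
  then have Ekk: "E (k * (k * x)) = 0" for x using Em(1)[of "k * k" x] by (simp add: mult.assoc)
  \<comment> \<open>From \<open>l^2 E = - k E\<close> follows \<open>E^2 = - 2 k E\<close>, so
    \<open>E^4 = 4 k^2 E^2\<close>, which is 0 because \<open>E k^2 = 0\<close>. A nilpotent
    self-adjoint operator vanishes.\<close>
  have EE: "E (E x) = - 2 *\<^sub>R (k * E x)" for x
  proof -
    have "E (E x) = l (l (E x)) - k * E x" by (simp only: E_def[of "E x"])
    also have "l (l (E x)) = - (k * E x)" using kE[of x] by simp
    finally show ?thesis by (simp add: scaleR_2)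
  qed
  have "E (E (E (E x))) = 4 *\<^sub>R E (E (k * (k * x)))" for x
    by (simp only: EE Ek sE(6)) (simp add: Ek[symmetric] EE[symmetric] sE)
  then have E4: "E (E (E (E x))) = 0" for x using Ekk sE(8) by simp
  have nil: "F x = 0" if "selfadjoint_on UNIV F" "F (F x) = 0" for F x
    using norm_adjoint_square[of UNIV F F x] that unfolding selfadjoint_on_def by simp
  have "E (E x) = 0" for x using nil[OF selfadjoint_on_square[OF E]] E4 by blast
  then have "E x = 0" for x using nil[OF E] by blast
  then have "l (l x) = k * x" for x unfolding E_def by simp
  then show ?thesis using that[OF l(1)] l(3) unfolding k_def by blast
qed

text \<open>After scaling, both summands are squares of commuting self-adjoint operators
  \<open>l\<close> and \<open>m\<close>, and \<open>l^2 + m^2 = 0\<close> forces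
  \<open>l = 0\<close>. Heredity of an annihilator is deduced from this.\<close>

lemma sum_star_mult_self_eq_0:
  fixes X Y :: "'a::cstar_algebra"
  assumes "star X * X + star Y * Y = 0"
  shows "X = 0"
proof -
  define r where "r = 1 / (norm X + norm Y + 1)"
  have r: "r > 0" "norm (r *\<^sub>R X) \<le> 1" "norm (r *\<^sub>R Y) \<le> 1"
    unfolding r_def by (simp_all add: add_nonneg_pos divide_le_eq_1 add_nonneg_eq_0_iff)
  define k where "k = star (r *\<^sub>R X) * (r *\<^sub>R X)"
  have kX: "star (r *\<^sub>R X) * (r *\<^sub>R X) = k" by (simp add: k_def)
  have "star (r *\<^sub>R X) * (r *\<^sub>R X) + star (r *\<^sub>R Y) * (r *\<^sub>R Y) = r\<^sup>2 *\<^sub>R (star X * X + star Y * Y)"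
    by (simp add: star_scaleR scaleR_add_right power2_eq_square)
  then have kY: "star (r *\<^sub>R Y) * (r *\<^sub>R Y) = - k"
    using assms unfolding k_def by (simp add: eq_neg_iff_add_eq_0 add.commute)
  obtain l where l: "selfadjoint_on UNIV l" "\<And>x. l (l x) = k * x" "generated_by UNIV (\<lambda>x. k * x) l"
    using star_mult_self_sqrt[OF r(2)] unfolding kX by blast
  obtain m where m: "selfadjoint_on UNIV m" "\<And>x. m (m x) = - k * x" "generated_by UNIV (\<lambda>x. - k * x) m"
    using star_mult_self_sqrt[OF r(3)] unfolding kY by blast
  have st: "star k = k" unfolding k_def by (simp add: star_mult star_star star_scaleR)
  have "k * m x = m (k * x)" for x
    by (rule generated_by_selfadjoint[OF m(3) closed_subspace_UNIV selfadjoint_on_mult[OF st]]) auto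
  then have ml: "m (l x) = l (m x)" for x
    using generated_by_selfadjoint[OF l(3) closed_subspace_UNIV m(1)] by simp
  have "l x = 0" for x
  proof -
    have "norm (l x) \<le> 0 * norm x"
      by (rule norm_le_of_squares_eq[of UNIV l m]) (use l m ml in \<open>auto simp: selfadjoint_on_def\<close>)
    then show ?thesis by simp
  qed
  then have "k * x = 0" for x using l(2)[of x] by simp
  then have "k = 0" by (rule eq_zero_by_mult)
  then have "r *\<^sub>R X = 0" unfolding k_def by (simp only: star_mult_self_eq_0)
  then show ?thesis using r(1) by simp
qed

text \<open>
  The spectral part of \<open>T\<^sup>* T\<close> above \<open>c\<^sup>2\<close> vanishes on \<open>K\<close>, hence everywhere.
\<close>

lemma bounded_by_essential_ideal:
  assumes J: "closed_ideal J" and T: "adjoint_on J T S" and C0: "bounded_by J T C0"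
    and K: "essential_ideal K" "K \<subseteq> J" and c: "bounded_by K T c" "c \<ge> 0"
  shows "bounded_by J T c"
proof (rule ccontr)
  assume "\<not> ?thesis"
  then obtain x0 where x0: "x0 \<in> J" "c * norm x0 < norm (T x0)"
    unfolding bounded_by_def by (auto simp: not_le)
  note Js = closed_ideal_subspace[OF J]
  have Ki: "closed_ideal K" using K unfolding essential_ideal_def by blast
  note Ks = closed_ideal_subspace[OF Ki]
  have "T 0 = 0" by (rule adjoint_on_linear(5)[OF Js T])
  then have x0n: "norm x0 > 0" using x0 by auto
  define C where "C = \<bar>C0\<bar> + c + 1"
  have C: "C > 0" "c \<le> C" unfolding C_def using c by auto
  have TC: "bounded_by J T C"
    unfolding bounded_by_def
  proof
    fix x assume "x \<in> J"
    then have "norm (T x) \<le> C0 * norm x" by (rule bounded_byD[OF C0])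
    also have "\<dots> \<le> C * norm x" by (rule mult_right_mono) (use c(2) in \<open>auto simp: C_def\<close>)
    finally show "norm (T x) \<le> C * norm x" .
  qed
  have SC: "bounded_by J S C" by (rule bounded_by_adjoint[OF T TC])
  define k where "k x = (1 / C\<^sup>2) *\<^sub>R S (T x)" for x
  have ksa: "selfadjoint_on J k"
    unfolding k_def by (rule selfadjoint_on_scaleR[OF Js adjoint_on_comp_selfadjoint[OF T TC]])
  note sk = selfadjoint_onD[OF Js ksa]
  have k1: "bounded_by J k 1"
  proof -
    have "bounded_by J (\<lambda>x. S (T x)) (C * C)"
      by (rule bounded_by_comp[OF SC TC]) (use C adjoint_onD[OF T] in auto)
    then show ?thesis
      using C(1) unfolding bounded_by_def k_def by (simp add: power2_eq_square field_simps)
  qed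
  define q where "q = (c / C)\<^sup>2"
  have q: "0 \<le> q" unfolding q_def by simp
  have TK: "T y \<in> K" "S y \<in> K" if "y \<in> K" for y
    using adjoint_on_preserves_ideal[OF J Ki K(2)] T adjoint_on_sym[OF T] that by blast+
  have TKa: "adjoint_on K T S"
    using T TK K(2) unfolding adjoint_on_def by blast
  have kK: "norm (k y) \<le> q * norm y" "k y \<in> K" if "y \<in> K" for y
  proof -
    have "bounded_by K (\<lambda>x. S (T x)) (c * c)"
      by (rule bounded_by_comp[OF bounded_by_adjoint[OF TKa c(1)] c]) (rule TK)
    then have "norm (S (T y)) \<le> c * c * norm y" using that by (rule bounded_byD)
    then show "norm (k y) \<le> q * norm y"
      unfolding k_def q_def using C(1) by (simp add: power2_eq_square field_simps)
    show "k y \<in> K" unfolding k_def using closed_subspaceD(4)[OF Ks] TK that by blast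
  qed
  have "c\<^sup>2 * (norm x0)\<^sup>2 < (norm (T x0))\<^sup>2"
    using power_strict_mono[OF x0(2), of 2] c(2) by (simp add: power_mult_distrib)
  also have "\<dots> \<le> norm x0 * norm (S (T x0))" by (rule norm_adjoint_square_le[OF T x0(1)])
  finally have "c\<^sup>2 * norm x0 < norm (S (T x0))" using x0n by (simp add: power2_eq_square)
  then have kx0: "q * norm x0 < norm (k x0)"
    unfolding q_def k_def using C(1) by (simp add: power_divide field_simps)
  define p where "p = norm (k x0) / norm x0"
  have p: "q < p" "p \<le> 1"
    unfolding p_def using kx0 x0n bounded_byD[OF k1 x0(1)] by (simp_all add: field_simps)
  have pq: "q\<^sup>2 < p\<^sup>2" "p\<^sup>2 \<le> 1" using p q by (auto intro: power_strict_mono power_le_one)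
  \<comment> \<open>A threshold strictly between \<open>q^2\<close>, which bounds \<open>k^2\<close>
    on \<open>K\<close>, and \<open>p^2\<close>, the squared growth of \<open>k\<close> at
    \<open>x0\<close>.\<close>
  define s where "s = (q\<^sup>2 + p\<^sup>2) / 2"
  have s: "q\<^sup>2 < s" "s < p\<^sup>2" "s \<le> 1" "0 \<le> s" unfolding s_def using pq by auto
  have "s * (norm x0)\<^sup>2 < p\<^sup>2 * (norm x0)\<^sup>2" using s x0n by simp
  also have "\<dots> = (norm (k x0))\<^sup>2" unfolding p_def using x0n by (simp add: power_divide)
  finally have x0s: "s * (norm x0)\<^sup>2 < (norm (k x0))\<^sup>2" .
  obtain D E l where DE: "selfadjoint_on J D" "selfadjoint_on J E" "selfadjoint_on J l"
    "generated_by J k D" "generated_by J k E" "generated_by J k l"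
    "\<And>x. x \<in> J \<Longrightarrow> E x = l (l x) - (1 / 2) *\<^sub>R (k (k x) - s *\<^sub>R x)"
    "bounded_by J (\<lambda>x. x - l (l x)) 1" "\<And>x. x \<in> J \<Longrightarrow> E (D x) = 0" "\<exists>x\<in>J. D x \<noteq> 0"
    by (rule spectral_cut_above[OF Js ksa k1 s(4,3) x0(1) x0s]) blast
  have DK: "D y = 0" if y: "y \<in> K" for y
  proof -
    define w where "w = D y"
    have w: "w \<in> K" unfolding w_def by (rule generated_by_preserves[OF DE(4) Ks K(2) kK(2) y])
    have wJ: "w \<in> J" using w K(2) by blast
    have "l (l w) - (1 / 2) *\<^sub>R (k (k w) - s *\<^sub>R w) = 0"
      using DE(7)[OF wJ] DE(9)[of y] y K(2) unfolding w_def by auto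
    \<comment> \<open>The right side has norm at most \<open>(1 + q^2 / 2) * norm w\<close>; since
      \<open>q^2 < s\<close>, only \<open>w = 0\<close> is possible.\<close>
    then have "(1 + s / 2) *\<^sub>R w = (w - l (l w)) + (1 / 2) *\<^sub>R k (k w)"
      by (simp add: algebra_simps)
    then have "(1 + s / 2) * norm w \<le> norm (w - l (l w)) + norm ((1 / 2) *\<^sub>R k (k w))"
      using norm_triangle_ineq[of "w - l (l w)" "(1 / 2) *\<^sub>R k (k w)"] norm_scaleR[of "1 + s / 2" w] s(4)
      by simp
    also have "norm (w - l (l w)) \<le> norm w" using bounded_byD[OF DE(8) wJ] by simp
    also have "norm ((1 / 2) *\<^sub>R k (k w)) \<le> (1 / 2) * (q\<^sup>2 * norm w)"
    proof -
      have "norm (k (k w)) \<le> q * norm (k w)" by (rule kK(1)[OF kK(2)[OF w]])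
      also have "\<dots> \<le> q * (q * norm w)" using kK(1)[OF w] q by (rule mult_left_mono)
      finally show ?thesis by (simp add: power2_eq_square mult.assoc)
    qed
    finally have "(s - q\<^sup>2) * norm w \<le> 0" by (simp add: algebra_simps)
    then show ?thesis unfolding w_def using s(1) by (simp add: mult_le_0_iff)
  qed
  obtain x where x: "x \<in> J" "D x \<noteq> 0" using DE(10) by blast
  have "D x * y = 0" if "y \<in> K" for y
  proof -
    have "D (x * y) = D x * y"
      by (rule adjoint_on_linear(6)[OF Js selfadjoint_onD(1)[OF Js DE(1)] x(1)])
        (use closed_idealD[OF J] x selfadjoint_onD(2)[OF Js DE(1)] in auto)
    then show ?thesis using DK[of "x * y"] closed_idealD(1)[OF Ki that] by simp
  qed
  then show False using essential_ideal_annihilator[OF K(1)] x(2) by blast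
qed

text \<open>Brings estimates made on an ideal back to elements of \<open>A\<close>: the bound
  extends to all of \<open>A\<close> and is then evaluated at \<open>star a\<close>.\<close>

lemma norm_mult_left_le_essential_ideal:
  assumes K: "essential_ideal K" and c: "\<And>y. y \<in> K \<Longrightarrow> norm (a * y) \<le> c * norm y" "c \<ge> 0"
  shows "norm a \<le> c"
proof -
  have "bounded_by UNIV (\<lambda>x. a * x) c"
  proof (rule bounded_by_essential_ideal[OF closed_ideal_UNIV _ _ K])
    show "adjoint_on UNIV (\<lambda>x. a * x) (\<lambda>x. star a * x)"
      unfolding adjoint_on_def by (simp add: star_mult mult.assoc)
    show "bounded_by UNIV (\<lambda>x. a * x) (norm a)" unfolding bounded_by_def by (simp add: norm_mult_ineq)
  qed (use c in \<open>auto simp: bounded_by_def\<close>)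
  then have "norm (a * star a) \<le> c * norm (star a)" unfolding bounded_by_def by blast
  moreover have "norm (a * star a) = (norm a)\<^sup>2" using norm_star_mult[of "star a"] by (simp add: star_star)
  ultimately show ?thesis using c(2) by (cases "a = 0") (simp_all add: power2_eq_square)
qed

section \<open>Invariant ideals\<close>

lemma cstar_dynamical_systemD:
  assumes "cstar_dynamical_system \<alpha>"
  shows "star_automorphism (\<alpha> g)" "\<alpha> (g + h) x = \<alpha> g (\<alpha> h x)" "continuous_on UNIV (\<lambda>g. \<alpha> g a)"
    "\<alpha> 0 x = x" "\<alpha> (- g) (\<alpha> g x) = x" "\<alpha> g (\<alpha> (- g) x) = x" "norm (\<alpha> g x) = norm x"
proof -
  show 1: "star_automorphism (\<alpha> g)" "\<And>g h x. \<alpha> (g + h) x = \<alpha> g (\<alpha> h x)"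
    "continuous_on UNIV (\<lambda>g. \<alpha> g a)" for g a
    using assms unfolding cstar_dynamical_system_def by (auto simp: fun_eq_iff)
  show z: "\<alpha> 0 x = x" for x
    using 1(2)[of 0 0 x] star_automorphismD(1)[OF 1(1)[of 0]] by (simp add: bij_is_inj inj_eq)
  show "\<alpha> (- g) (\<alpha> g x) = x" "\<alpha> g (\<alpha> (- g) x) = x"
    using 1(2)[of "- g" g x] 1(2)[of g "- g" x] z by simp_all
  show "norm (\<alpha> g x) = norm x" by (rule star_automorphism_isometric[OF 1(1)])
qed

lemma star_automorphism_continuous:
  assumes "star_automorphism \<phi>" shows "continuous_on UNIV \<phi>"
proof -
  have "bounded_linear \<phi>"
    by (rule bounded_linear_intro[of _ 1])
      (auto simp: star_automorphismD[OF assms] star_automorphism_isometric[OF assms])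
  then show ?thesis by (rule bounded_linear.continuous_on) (rule continuous_on_id)
qed

lemma closed_ideal_vimage:
  assumes \<phi>: "star_automorphism \<phi>" and I: "closed_ideal I"
  shows "closed_ideal {x. \<phi> x \<in> I}"
proof -
  have "closed (\<phi> -` I)"
    by (rule closed_vimage[OF _ star_automorphism_continuous[OF \<phi>]]) (use I in \<open>auto simp: closed_ideal_def\<close>)
  then show ?thesis
    using closed_subspaceD[OF closed_ideal_subspace[OF I]] closed_idealD[OF I] star_automorphismD[OF \<phi>]
    unfolding closed_ideal_def complex_subspace_def vimage_def by auto
qed

lemma closed_ideal_INT: "(\<And>i. i \<in> A \<Longrightarrow> closed_ideal (I i)) \<Longrightarrow> closed_ideal (\<Inter>i\<in>A. I i)"
  unfolding closed_ideal_def complex_subspace_def by (auto intro!: closed_INT)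

lemma prime_essential_ideal:
  assumes "prime_cstar_algebra TYPE('a::cstar_algebra)" "closed_ideal (I :: 'a set)" "I \<noteq> {0}"
  shows "essential_ideal I"
  using assms unfolding prime_cstar_algebra_def essential_ideal_def by blast

lemma prime_finite_Inter_ideals:
  assumes "prime_cstar_algebra TYPE('a::cstar_algebra)" "finite A"
    "\<And>i. i \<in> A \<Longrightarrow> closed_ideal (I i :: 'a set) \<and> I i \<noteq> {0}"
  shows "(\<Inter>i\<in>A. I i) \<noteq> {0}"
  using assms(2,3)
proof (induction A rule: finite_induct)
  case empty
  then show ?case using assms(1) unfolding prime_cstar_algebra_def by auto
next
  case (insert i A)
  have "closed_ideal (\<Inter>i\<in>A. I i)" using insert by (intro closed_ideal_INT) auto
  then have "I i \<inter> (\<Inter>i\<in>A. I i) \<noteq> {0}"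
    using insert assms(1) unfolding prime_cstar_algebra_def by (metis insertCI)
  then show ?case by simp
qed

text \<open>Every approximant of \<open>w\<close> in \<open>K\<close> can be improved by the factor
  \<open>c\<close>, so the distance from \<open>w\<close> to \<open>K\<close> is 0.\<close>

lemma mem_closed_by_contraction:
  fixes w :: "'a::real_normed_vector"
  assumes "closed K" "y0 \<in> K" "0 \<le> c" "c < 1"
    and step: "\<And>y. y \<in> K \<Longrightarrow> \<exists>z\<in>K. norm (w - z) \<le> c * norm (w - y)"
  shows "w \<in> K"
proof (rule closed_approachable_mem[OF assms(1)])
  fix \<epsilon> :: real assume \<epsilon>: "\<epsilon> > 0"
  have "\<exists>z\<in>K. norm (w - z) \<le> c ^ n * norm (w - y0)" for n
  proof (induction n)
    case (Suc n)
    then obtain z where z: "z \<in> K" "norm (w - z) \<le> c ^ n * norm (w - y0)" by blast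
    then obtain z' where "z' \<in> K" "norm (w - z') \<le> c * norm (w - z)" using step[OF z(1)] by blast
    moreover have "c * norm (w - z) \<le> c ^ Suc n * norm (w - y0)"
      using mult_left_mono[OF z(2) assms(3)] by (simp add: mult.assoc)
    ultimately show ?case by (meson order_trans)
  qed (use assms in auto)
  moreover have "(\<lambda>n. c ^ n * norm (w - y0)) \<longlonglongrightarrow> 0 * norm (w - y0)"
    by (intro tendsto_intros LIMSEQ_power_zero) (use assms in auto)
  then have "\<forall>\<^sub>F n in sequentially. c ^ n * norm (w - y0) < \<epsilon>" using \<epsilon> by (intro order_tendstoD) auto
  then obtain n where "c ^ n * norm (w - y0) < \<epsilon>" by (auto simp: eventually_sequentially)
  ultimately show "\<exists>y\<in>K. norm (w - y) < \<epsilon>" by (meson le_less_trans)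
qed

text \<open>
  Let \<open>h \<in> I\<close> be positive of norm 1. Whenever \<open>\<alpha>\<^sub>g(h)\<close> is close to \<open>h\<close>, the norm of \<open>h\<close> modulo
  \<open>\<alpha>\<^sub>g(I)\<close> is small, and so \<open>\<alpha>\<^sub>g(I)\<close> contains the nonzero element \<open>(h - 1/2)\<^sub>+\<close>.
\<close>

lemma ideal_neighbourhood_Inter:
  fixes \<alpha> :: "'g::topological_group_add \<Rightarrow> 'a::cstar_algebra \<Rightarrow> 'a"
  assumes \<alpha>: "cstar_dynamical_system \<alpha>" and I: "closed_ideal I" "I \<noteq> {0}"
  obtains N w where "open N" "0 \<in> N" "w \<noteq> 0" "\<And>g. g \<in> N \<Longrightarrow> \<alpha> (- g) w \<in> I"
proof -
  note a = cstar_dynamical_systemD[OF \<alpha>] and U = closed_subspace_UNIV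
  obtain x where x: "x \<in> I" "x \<noteq> 0" using I closed_subspaceD(1)[OF closed_ideal_subspace[OF I(1)]] by blast
  define b where "b = (1 / (norm x)\<^sup>2) *\<^sub>R (star x * x)"
  have b: "norm b = 1" "star b = b" "b \<in> I"
    unfolding b_def using x closed_subspaceD(4)[OF closed_ideal_subspace[OF I(1)]] closed_idealD[OF I(1)]
    by (simp_all add: norm_star_mult star_scaleR star_mult star_star)
  define h where "h = b * b"
  have h: "h \<in> I" "norm h = 1"
    unfolding h_def using closed_idealD[OF I(1) b(3)] norm_star_mult[of b] b by simp_all
  define k where "k x = b * x" for x
  have ksa: "selfadjoint_on UNIV k" unfolding k_def by (rule selfadjoint_on_mult[OF b(2)])
  have k1: "bounded_by UNIV k 1" unfolding k_def by (rule bounded_by_mult_left) (simp add: b)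
  have kb: "1 / 2 * (norm b)\<^sup>2 < (norm (k b))\<^sup>2" unfolding k_def using h b by (simp add: h_def)
  obtain D E l where DE: "selfadjoint_on UNIV D" "selfadjoint_on UNIV E" "selfadjoint_on UNIV l"
    "generated_by UNIV k D" "generated_by UNIV k E" "generated_by UNIV k l"
    "\<And>x. x \<in> UNIV \<Longrightarrow> E x = l (l x) - (1 / 2) *\<^sub>R (k (k x) - (1 / 2) *\<^sub>R x)"
    "bounded_by UNIV (\<lambda>x. x - l (l x)) 1" "\<And>x. x \<in> UNIV \<Longrightarrow> E (D x) = 0" "\<exists>x\<in>UNIV. D x \<noteq> 0"
    by (rule spectral_cut_above[OF U ksa k1 _ _ UNIV_I kb]) auto
  note sl = selfadjoint_onD[OF U DE(3), simplified]
  obtain x1 where x1: "D x1 \<noteq> 0" using DE(10) by blast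
  define w where "w = D x1"
  have "E w = 0" unfolding w_def using DE(9) by simp
  then have lw: "l (l w) - (1 / 2) *\<^sub>R (h * w - (1 / 2) *\<^sub>R w) = 0"
    using DE(7)[of w] unfolding k_def h_def by (simp add: mult.assoc)
  define N where "N = {g. norm (h - \<alpha> g h) < 1 / 4}"
  have "open N"
    unfolding N_def by (intro open_Collect_less continuous_intros a(3))
  moreover have "0 \<in> N" unfolding N_def by (simp add: a(4))
  moreover have "\<alpha> (- g) w \<in> I" if g: "g \<in> N" for g
  proof -
    define I' where "I' = {x. \<alpha> (- g) x \<in> I}"
    have I': "closed_ideal I'" unfolding I'_def by (rule closed_ideal_vimage[OF a(1) I(1)])
    note I's = closed_ideal_subspace[OF I']
    define y where "y = \<alpha> g h"
    have y: "y \<in> I'" unfolding y_def I'_def using h by (simp add: a(5))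
    have hy: "norm (h - y) < 1 / 4" using g unfolding N_def y_def by simp
    have lI: "l x \<in> I'" if "x \<in> I'" for x
      by (rule generated_by_preserves[OF DE(6) I's _ _ that])
        (auto simp: k_def closed_idealD[OF I'])
    have "w \<in> I'"
    proof (rule mem_closed_by_contraction[of I' 0 "9 / 10"])
      show "closed I'" using I' unfolding closed_ideal_def by blast
      show "0 \<in> I'" by (rule closed_subspaceD(1)[OF I's])
      fix i assume i: "i \<in> I'"
      \<comment> \<open>The relation for \<open>w\<close> reads
        \<open>(5/4) w = (w - l^2 w) + (1/2) h w\<close>. Here \<open>h\<close> is split into
        \<open>(h - y) + y\<close> and \<open>w\<close> is replaced by \<open>i\<close> except in
        \<open>y w\<close>, which lies in \<open>I'\<close> anyway. The error contracts by
        \<open>(4/5) (1 + 1/8) = 9/10\<close>, where 1/8 is half the bound for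
        \<open>h - y\<close>.\<close>
      define z where "z = (4 / 5) *\<^sub>R ((i - l (l i)) + (1 / 2) *\<^sub>R ((h - y) * i) + (1 / 2) *\<^sub>R (y * w))"
      have "z \<in> I'" unfolding z_def
        by (intro closed_subspaceD[OF I's] lI i closed_idealD[OF I'] y)
      moreover have "norm (w - z) \<le> 9 / 10 * norm (w - i)"
      proof -
        have "(5 / 4) *\<^sub>R w = (w - l (l w)) + (1 / 2) *\<^sub>R (h * w)"
        proof -
          have "(5 / 4) *\<^sub>R w = (1 + 1 / 4) *\<^sub>R w" by simp
          also have "\<dots> = w + (1 / 4) *\<^sub>R w" by (simp only: scaleR_add_left scaleR_one)
          finally show ?thesis using lw by (simp add: scaleR_diff_right)
        qed
        moreover have "w = (4 / 5) *\<^sub>R ((5 / 4) *\<^sub>R w)" by simp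
        ultimately have "w = (4 / 5) *\<^sub>R ((w - l (l w)) + (1 / 2) *\<^sub>R (h * w))" by (simp only:)
        then have "w - z = (4 / 5) *\<^sub>R ((w - l (l w)) + (1 / 2) *\<^sub>R (h * w)) - z" by simp
        also have "\<dots> = (4 / 5) *\<^sub>R (((w - i) - l (l (w - i))) + (1 / 2) *\<^sub>R ((h - y) * (w - i)))"
          unfolding z_def scaleR_diff_right[symmetric]
          by (simp add: sl(5) algebra_simps)
        finally have "norm (w - z) = (4 / 5) * norm (((w - i) - l (l (w - i))) + (1 / 2) *\<^sub>R ((h - y) * (w - i)))"
          by simp
        also have "\<dots> \<le> (4 / 5) * (norm ((w - i) - l (l (w - i))) + norm ((1 / 2) *\<^sub>R ((h - y) * (w - i))))"
          by (intro mult_left_mono norm_triangle_ineq) simp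
        also have "norm ((w - i) - l (l (w - i))) \<le> norm (w - i)" using bounded_byD[OF DE(8), of "w - i"] by simp
        also have "norm ((1 / 2) *\<^sub>R ((h - y) * (w - i))) \<le> (1 / 8) * norm (w - i)"
          using norm_mult_ineq[of "h - y" "w - i"] mult_right_mono[OF less_imp_le[OF hy] norm_ge_zero[of "w - i"]]
          by simp
        finally show ?thesis by simp
      qed
      ultimately show "\<exists>z\<in>I'. norm (w - z) \<le> 9 / 10 * norm (w - i)" by blast
    qed auto
    then show ?thesis unfolding I'_def by simp
  qed
  ultimately show ?thesis using that x1 unfolding w_def by blast
qed

text \<open>Primeness controls finite intersections only. A nonzero \<open>w\<close> lies in all
  translates of \<open>I\<close> by group elements near 0, so their intersection \<open>V\<close> is
  nonzero. By compactness finitely many translates of the neighbourhood cover the group, hence the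
  intersection \<open>J\<close> of all translates of \<open>I\<close> contains that of finitely many
  translates of \<open>V\<close>.\<close>

lemma invariant_ideal:
  fixes \<alpha> :: "'g::topological_group_add \<Rightarrow> 'a::cstar_algebra \<Rightarrow> 'a"
  assumes G: "compact (UNIV :: 'g set)" and \<alpha>: "cstar_dynamical_system \<alpha>"
    and prime: "prime_cstar_algebra TYPE('a)" and I: "closed_ideal I" "I \<noteq> {0}"
  obtains J where "closed_ideal J" "J \<noteq> {0}" "J \<subseteq> I" "\<And>g x. x \<in> J \<Longrightarrow> \<alpha> g x \<in> J"
proof -
  note a = cstar_dynamical_systemD[OF \<alpha>]
  obtain N w where N: "open N" "0 \<in> N" and w: "w \<noteq> 0" "\<And>g. g \<in> N \<Longrightarrow> \<alpha> (- g) w \<in> I"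
    by (rule ideal_neighbourhood_Inter[OF \<alpha> I]) blast
  define V where "V = (\<Inter>u\<in>N. {x. \<alpha> (- u) x \<in> I})"
  have V: "closed_ideal V"
    unfolding V_def by (intro closed_ideal_INT closed_ideal_vimage a I)
  have wV: "w \<in> V" unfolding V_def using w by blast
  define J where "J = (\<Inter>g. {x. \<alpha> (- g) x \<in> I})"
  have J: "closed_ideal J"
    unfolding J_def by (intro closed_ideal_INT closed_ideal_vimage a I)
  define W where "W f = {g. - f + g \<in> N}" for f
  have "open (W f)" for f
  proof -
    have "open ((\<lambda>g. - f + g) -` N)" by (intro open_vimage N continuous_intros)
    then show ?thesis unfolding W_def vimage_def .
  qed
  moreover have "UNIV \<subseteq> (\<Union>f. W f)" unfolding W_def using N(2) by (auto intro: exI[of _ _])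
  ultimately obtain F where F: "finite F" "UNIV \<subseteq> (\<Union>f\<in>F. W f)"
    using compactE_image[OF G, of UNIV W] by (metis subset_UNIV)
  have "(\<Inter>f\<in>F. {x. \<alpha> (- f) x \<in> V}) \<noteq> {0}"
  proof (rule prime_finite_Inter_ideals[OF prime F(1)])
    fix f
    have "\<alpha> f w \<in> {x. \<alpha> (- f) x \<in> V}" using wV by (simp add: a(5))
    moreover have "\<alpha> f w \<noteq> 0" using w(1) a(7)[of f w] by (metis norm_eq_zero)
    ultimately show "closed_ideal {x. \<alpha> (- f) x \<in> V} \<and> {x. \<alpha> (- f) x \<in> V} \<noteq> {0}"
      using closed_ideal_vimage[OF a(1) V] by blast
  qed
  moreover have "0 \<in> (\<Inter>f\<in>F. {x. \<alpha> (- f) x \<in> V})"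
    using closed_subspaceD(1)[OF closed_ideal_subspace[OF V]] star_automorphismD(6)[OF a(1)] by simp
  ultimately obtain x where x: "x \<noteq> 0" "\<And>f. f \<in> F \<Longrightarrow> \<alpha> (- f) x \<in> V" by blast
  have "x \<in> J"
    unfolding J_def
  proof (intro INT_I CollectI)
    fix g
    obtain f where f: "f \<in> F" "- f + g \<in> N" using F(2) unfolding W_def by blast
    have "\<alpha> (- (- f + g)) (\<alpha> (- f) x) \<in> I" using x(2)[OF f(1)] f(2) unfolding V_def by blast
    then show "\<alpha> (- g) x \<in> I" by (simp flip: a(2) add: minus_add add.assoc)
  qed
  then have "J \<noteq> {0}" using x by blast
  moreover have "J \<subseteq> I"
  proof
    fix y assume "y \<in> J"
    then have "\<alpha> (- 0) y \<in> I" unfolding J_def by blast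
    then show "y \<in> I" by (simp add: a(4))
  qed
  moreover have "\<alpha> g x \<in> J" if "x \<in> J" for g x
    unfolding J_def
  proof (intro INT_I CollectI)
    fix h
    have "\<alpha> (- (- g + h)) x \<in> I" using that unfolding J_def by blast
    then show "\<alpha> (- h) (\<alpha> g x) \<in> I" by (simp flip: a(2) add: minus_add)
  qed
  ultimately show ?thesis using that J by blast
qed

section \<open>Calculus of local multipliers\<close>

definition lm_dom :: "'a::cstar_algebra local_multiplier \<Rightarrow> 'a set" where
  "lm_dom x = fst x"

definition lm_op :: "'a::cstar_algebra local_multiplier \<Rightarrow> 'a \<Rightarrow> 'a" where
  "lm_op x = fst (snd x)"

text \<open>The left action of the adjoint multiplier:
  \<open>star m * z = star (star z * m)\<close>. Together with \<open>lm_op\<close> it turns a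
  double centralizer into an operator and its adjoint.\<close>

definition lm_adj :: "'a::cstar_algebra local_multiplier \<Rightarrow> 'a \<Rightarrow> 'a" where
  "lm_adj x = (\<lambda>z. star (snd (snd x) (star z)))"

lemma bounded_operator_onD:
  assumes "bounded_operator_on I T"
  shows "z \<in> I \<Longrightarrow> T z \<in> I" "z \<notin> I \<Longrightarrow> T z = 0" "\<exists>C. bounded_by I T C"
  using assms unfolding bounded_operator_on_def bounded_by_def by auto

lemma local_multipliersD:
  assumes x: "x \<in> local_multipliers"
  shows "essential_ideal (lm_dom x)" "closed_ideal (lm_dom x)" "adjoint_on (lm_dom x) (lm_op x) (lm_adj x)"
    "\<exists>C. bounded_by (lm_dom x) (lm_op x) C" "z \<notin> lm_dom x \<Longrightarrow> lm_op x z = 0"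
    "z \<notin> lm_dom x \<Longrightarrow> lm_adj x z = 0"
proof -
  obtain I L R where xe: "x = (I, (L, R))" by (cases x) auto
  have e: "essential_ideal I" and L: "bounded_operator_on I L" and R: "bounded_operator_on I R"
    and LR: "\<And>x y. x \<in> I \<Longrightarrow> y \<in> I \<Longrightarrow> R x * y = x * L y"
    using x unfolding xe local_multipliers_def multiplier_algebra_def by auto
  have I: "closed_ideal I" using e unfolding essential_ideal_def by blast
  have st: "star z \<in> I \<longleftrightarrow> z \<in> I" for z using closed_ideal_star[OF I] by (metis star_star)
  note l = bounded_operator_onD[OF L] and r = bounded_operator_onD[OF R]
  show "essential_ideal (lm_dom x)" "closed_ideal (lm_dom x)" "\<exists>C. bounded_by (lm_dom x) (lm_op x) C"
    "z \<notin> lm_dom x \<Longrightarrow> lm_op x z = 0" "z \<notin> lm_dom x \<Longrightarrow> lm_adj x z = 0"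
    using e I l r st unfolding lm_dom_def lm_op_def lm_adj_def xe by auto
  have "star (L v) * w = star v * star (R (star w))" if "v \<in> I" "w \<in> I" for v w
    using arg_cong[OF LR[of "star w" v], of star] that st by (simp add: star_mult star_star)
  then show "adjoint_on (lm_dom x) (lm_op x) (lm_adj x)"
    using l(1) r(1) st unfolding adjoint_on_def lm_dom_def lm_op_def lm_adj_def xe by simp
qed

text \<open>Converse to \<open>local_multipliersD\<close>: a bounded adjointable operator on an
  essential ideal is a double centralizer. The module identities follow from the adjoint relation,
  and the right action is recovered from \<open>S\<close> by conjugating with
  \<open>star\<close>.\<close>

lemma local_multipliersI:
  assumes K: "essential_ideal K" and T: "adjoint_on K T S" and C: "bounded_by K T C"
    and L: "\<And>z. L z = (if z \<in> K then T z else 0)"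
    and R: "\<And>z. R z = (if z \<in> K then star (S (star z)) else 0)"
  shows "(K, (L, R)) \<in> local_multipliers" "lm_dom (K, (L, R)) = K"
    "z \<in> K \<Longrightarrow> lm_op (K, (L, R)) z = T z" "z \<in> K \<Longrightarrow> lm_adj (K, (L, R)) z = S z"
proof -
  have Ki: "closed_ideal K" using K unfolding essential_ideal_def by blast
  note Ks = closed_ideal_subspace[OF Ki]
  have st: "star z \<in> K \<longleftrightarrow> z \<in> K" for z using closed_ideal_star[OF Ki] by (metis star_star)
  note t = adjoint_onD[OF T] and k = closed_subspaceD[OF Ks]
  note tl = adjoint_on_linear[OF Ks T] and sl = adjoint_on_linear[OF Ks adjoint_on_sym[OF T]]
  have S: "bounded_by K S C" by (rule bounded_by_adjoint[OF T C])
  have 1: "bounded_operator_on K L"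
    unfolding bounded_operator_on_def
  proof (intro conjI ballI allI impI)
    show "\<exists>C. \<forall>z\<in>K. norm (L z) \<le> C * norm z" using C L unfolding bounded_by_def by auto
  qed (simp_all add: L k t(1) tl)
  have 2: "bounded_operator_on K R"
    unfolding bounded_operator_on_def
  proof (intro conjI ballI allI impI)
    have "norm (R z) \<le> C * norm z" if "z \<in> K" for z
      using bounded_byD[OF S, of "star z"] that st by (simp add: R)
    then show "\<exists>C. \<forall>z\<in>K. norm (R z) \<le> C * norm z" by blast
  qed (simp_all add: R k t(2) sl st star_add star_scaleC)
  have "L (v * w) = L v * w \<and> R (v * w) = v * R w \<and> R v * w = v * L w" if v: "v \<in> K" and w: "w \<in> K" for v w
  proof (intro conjI)
    show "L (v * w) = L v * w"
      using tl(6)[OF v] closed_idealD[OF Ki] v t(1) by (simp add: L)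
    have "S (star w * star v) = S (star w) * star v"
      by (rule sl(6)) (use w closed_idealD[OF Ki] st t(2) in auto)
    then show "R (v * w) = v * R w"
      using closed_idealD[OF Ki] v w by (simp add: R star_mult star_star)
    have "star (T w) * star v = star w * S (star v)" by (rule t(3)) (use v w st in auto)
    then have "star (star (T w) * star v) = star (star w * S (star v))" by simp
    then show "R v * w = v * L w" using v w by (simp add: R L star_mult star_star)
  qed
  then show "(K, (L, R)) \<in> local_multipliers"
    using K 1 2 unfolding local_multipliers_def multiplier_algebra_def by simp
  show "lm_dom (K, (L, R)) = K" "z \<in> K \<Longrightarrow> lm_op (K, (L, R)) z = T z"
    "z \<in> K \<Longrightarrow> lm_adj (K, (L, R)) z = S z"
    using st unfolding lm_dom_def lm_op_def lm_adj_def by (simp_all add: L R star_star)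
qed

lemma adjoint_on_lm_Int:
  assumes x: "x \<in> local_multipliers" and K: "closed_ideal K" "K \<subseteq> lm_dom x"
  shows "adjoint_on K (lm_op x) (lm_adj x)"
proof -
  note d = local_multipliersD[OF x]
  have "lm_op x z \<in> K" "lm_adj x z \<in> K" if "z \<in> K" for z
    using adjoint_on_preserves_ideal[OF d(2) K] d(3) adjoint_on_sym that by blast+
  then show ?thesis using d(3) K(2) unfolding adjoint_on_def by blast
qed

lemma lm_times:
  assumes x: "x \<in> local_multipliers" and y: "y \<in> local_multipliers"
  shows "lm_times x y \<in> local_multipliers" "lm_dom (lm_times x y) = lm_dom x \<inter> lm_dom y"
    "z \<in> lm_dom x \<inter> lm_dom y \<Longrightarrow> lm_op (lm_times x y) z = lm_op x (lm_op y z)"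
    "z \<in> lm_dom x \<inter> lm_dom y \<Longrightarrow> lm_adj (lm_times x y) z = lm_adj y (lm_adj x z)"
proof -
  note dx = local_multipliersD[OF x] and dy = local_multipliersD[OF y]
  define K where "K = lm_dom x \<inter> lm_dom y"
  have Ke: "essential_ideal K" unfolding K_def by (rule essential_ideal_Int[OF dx(1) dy(1)])
  have Ki: "closed_ideal K" using Ke unfolding essential_ideal_def by blast
  have ax: "adjoint_on K (lm_op x) (lm_adj x)" and ay: "adjoint_on K (lm_op y) (lm_adj y)"
    unfolding K_def by (rule adjoint_on_lm_Int[OF x closed_ideal_Int[OF dx(2) dy(2)]]
        adjoint_on_lm_Int[OF y closed_ideal_Int[OF dx(2) dy(2)]]; blast)+
  note adx = adjoint_onD[OF ax] and ady = adjoint_onD[OF ay]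
  have T: "adjoint_on K (\<lambda>z. lm_op x (lm_op y z)) (\<lambda>z. lm_adj y (lm_adj x z))"
    using adx ady unfolding adjoint_on_def by simp
  obtain C D where "bounded_by (lm_dom x) (lm_op x) C" "bounded_by (lm_dom y) (lm_op y) D"
    using dx(4) dy(4) by blast
  then have CD: "bounded_by K (lm_op x) C" "bounded_by K (lm_op y) D"
    unfolding K_def by (auto intro: bounded_by_subset)
  obtain C' where C': "C' \<ge> 0" "bounded_by K (lm_op x) C'" using bounded_by_nonneg[OF CD(1)] by blast
  have B: "bounded_by K (\<lambda>z. lm_op x (lm_op y z)) (C' * D)"
    by (rule bounded_by_comp[OF C'(2) CD(2) C'(1)]) (rule ady)
  obtain I L R where xe: "x = (I, (L, R))" by (cases x) auto
  obtain J M N where ye: "y = (J, (M, N))" by (cases y) auto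
  have st: "star z \<in> K \<longleftrightarrow> z \<in> K" for z using closed_ideal_star[OF Ki] by (metis star_star)
  have Rz: "R z = star (lm_adj x (star z))" "N z = star (lm_adj y (star z))" for z
    unfolding xe ye lm_adj_def by (simp_all add: star_star)
  have K0: "0 \<in> K" by (rule closed_subspaceD(1)[OF closed_ideal_subspace[OF Ki]])
  have z0: "lm_op x 0 = 0" "lm_adj y 0 = 0"
    using adjoint_on_linear(5)[OF closed_ideal_subspace[OF Ki]] ax ay adjoint_on_sym by blast+
  have te: "lm_times x y = (K, ((\<lambda>z. if z \<in> K then L z else 0) \<circ> (\<lambda>z. if z \<in> K then M z else 0),
      (\<lambda>z. if z \<in> K then N z else 0) \<circ> (\<lambda>z. if z \<in> K then R z else 0)))"
    unfolding xe ye lm_times_def centralizer_times_def restrict_centralizer_def K_def lm_dom_def by simp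
  have L': "((\<lambda>z. if z \<in> K then L z else 0) \<circ> (\<lambda>z. if z \<in> K then M z else 0)) z
      = (if z \<in> K then lm_op x (lm_op y z) else 0)" for z
    using ady(1)[of z] z0 unfolding xe ye lm_op_def by simp
  have R': "((\<lambda>z. if z \<in> K then N z else 0) \<circ> (\<lambda>z. if z \<in> K then R z else 0)) z
      = (if z \<in> K then star (lm_adj y (lm_adj x (star z))) else 0)" for z
    using adx(2)[of "star z"] st z0(2) unfolding comp_def Rz by (simp add: star_star)
  note r = local_multipliersI[OF Ke T B L' R', folded te]
  show "lm_times x y \<in> local_multipliers" "lm_dom (lm_times x y) = lm_dom x \<inter> lm_dom y"
    "z \<in> lm_dom x \<inter> lm_dom y \<Longrightarrow> lm_op (lm_times x y) z = lm_op x (lm_op y z)"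
    "z \<in> lm_dom x \<inter> lm_dom y \<Longrightarrow> lm_adj (lm_times x y) z = lm_adj y (lm_adj x z)"
    using r unfolding K_def by blast+
qed

lemma lm_star:
  assumes x: "x \<in> local_multipliers"
  shows "lm_star x \<in> local_multipliers" "lm_dom (lm_star x) = lm_dom x"
    "z \<in> lm_dom x \<Longrightarrow> lm_op (lm_star x) z = lm_adj x z" "z \<in> lm_dom x \<Longrightarrow> lm_adj (lm_star x) z = lm_op x z"
proof -
  note dx = local_multipliersD[OF x]
  obtain C where C: "bounded_by (lm_dom x) (lm_op x) C" using dx(4) by blast
  obtain I L R where xe: "x = (I, (L, R))" by (cases x) auto
  have st: "star z \<in> lm_dom x \<longleftrightarrow> z \<in> lm_dom x" for z
    using closed_ideal_star[OF dx(2)] by (metis star_star)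
  have se: "lm_star x = (lm_dom x, (\<lambda>z. star (R (star z)), \<lambda>z. star (L (star z))))"
    unfolding xe lm_star_def centralizer_star_def lm_dom_def by simp
  have L': "star (R (star z)) = (if z \<in> lm_dom x then lm_adj x z else 0)" for z
    using dx(6)[of z] unfolding xe lm_adj_def by simp
  have R': "star (L (star z)) = (if z \<in> lm_dom x then star (lm_op x (star z)) else 0)" for z
    using dx(5)[of "star z"] st unfolding xe lm_op_def by simp
  note r = local_multipliersI[OF dx(1) adjoint_on_sym[OF dx(3)] bounded_by_adjoint[OF dx(3) C] L' R', folded se]
  show "lm_star x \<in> local_multipliers" "lm_dom (lm_star x) = lm_dom x"
    "z \<in> lm_dom x \<Longrightarrow> lm_op (lm_star x) z = lm_adj x z" "z \<in> lm_dom x \<Longrightarrow> lm_adj (lm_star x) z = lm_op x z"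
    using r by blast+
qed

lemma essential_ideal_image:
  assumes \<phi>: "star_automorphism \<phi>" and I: "essential_ideal I"
  shows "essential_ideal (\<phi> ` I)"
proof -
  have i: "inv_into UNIV \<phi> (\<phi> x) = x" "\<phi> (inv_into UNIV \<phi> x) = x" for x
    using star_automorphismD(1)[OF \<phi>] by (simp_all add: bij_is_inj bij_is_surj surj_f_inv_f)
  have im: "\<phi> ` I = {x. inv_into UNIV \<phi> x \<in> I}" for I
    using i by (auto simp: image_iff) metis
  have Ii: "closed_ideal I" using I unfolding essential_ideal_def by blast
  have "\<phi> ` I \<inter> J \<noteq> {0}" if J: "closed_ideal J" "J \<noteq> {0}" for J
  proof
    assume *: "\<phi> ` I \<inter> J = {0}"
    define J' where "J' = {x. \<phi> x \<in> J}"
    have J': "closed_ideal J'" unfolding J'_def by (rule closed_ideal_vimage[OF \<phi> J(1)])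
    have "\<phi> x = 0 \<longleftrightarrow> x = 0" for x using star_automorphism_isometric[OF \<phi>] by (metis norm_eq_zero)
    then have "I \<inter> J' \<subseteq> {0}" using * unfolding J'_def by blast
    moreover have "0 \<in> I" "0 \<in> J'" using Ii J' closed_subspaceD(1)[OF closed_ideal_subspace] by blast+
    ultimately have "I \<inter> J' = {0}" by blast
    then have "J' = {0}" using I J' unfolding essential_ideal_def by blast
    have "x = 0" if "x \<in> J" for x
    proof -
      have "inv_into UNIV \<phi> x \<in> J'" unfolding J'_def using that i by simp
      then show ?thesis using \<open>J' = {0}\<close> i(2)[of x] star_automorphismD(6)[OF \<phi>] by simp
    qed
    then show False using J closed_subspaceD(1)[OF closed_ideal_subspace[OF J(1)]] by blast
  qed
  moreover have "closed_ideal (\<phi> ` I)"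
    unfolding im by (rule closed_ideal_vimage[OF star_automorphism_inv[OF \<phi>] Ii])
  ultimately show ?thesis unfolding essential_ideal_def by blast
qed

lemma lm_map:
  assumes \<phi>: "star_automorphism \<phi>" and x: "x \<in> local_multipliers"
  shows "lm_map \<phi> x \<in> local_multipliers" "lm_dom (lm_map \<phi> x) = \<phi> ` lm_dom x"
    "z \<in> lm_dom x \<Longrightarrow> lm_op (lm_map \<phi> x) (\<phi> z) = \<phi> (lm_op x z)"
proof -
  note dx = local_multipliersD[OF x] and p = star_automorphismD[OF \<phi>]
  have i: "inv_into UNIV \<phi> (\<phi> x) = x" "\<phi> (inv_into UNIV \<phi> x) = x" for x
    using p(1) by (simp_all add: bij_is_inj bij_is_surj surj_f_inv_f)
  note pi = star_automorphismD[OF star_automorphism_inv[OF \<phi>]]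
  let ?j = "inv_into UNIV \<phi>"
  obtain C where C: "bounded_by (lm_dom x) (lm_op x) C" using dx(4) by blast
  obtain I L R where xe: "x = (I, (L, R))" by (cases x) auto
  have me: "lm_map \<phi> x = (\<phi> ` lm_dom x, (\<phi> \<circ> L \<circ> ?j, \<phi> \<circ> R \<circ> ?j))"
    unfolding xe lm_map_def lm_dom_def by simp
  have mem: "z \<in> \<phi> ` lm_dom x \<longleftrightarrow> ?j z \<in> lm_dom x" for z
    using i by (metis image_iff)
  have L': "(\<phi> \<circ> L \<circ> ?j) z = (if z \<in> \<phi> ` lm_dom x then (\<phi> \<circ> lm_op x \<circ> ?j) z else 0)" for z
    using dx(5)[of "?j z"] p(6) unfolding mem by (simp add: xe lm_op_def)
  have Rz: "R z = star (lm_adj x (star z))" for z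
    unfolding xe lm_adj_def by (simp add: star_star)
  have st: "star z \<in> lm_dom x \<longleftrightarrow> z \<in> lm_dom x" for z
    using closed_ideal_star[OF dx(2)] by (metis star_star)
  have R': "(\<phi> \<circ> R \<circ> ?j) z = (if z \<in> \<phi> ` lm_dom x then star ((\<phi> \<circ> lm_adj x \<circ> ?j) (star z)) else 0)" for z
    using dx(6)[of "star (?j z)"] p(6) st unfolding mem comp_def Rz by (simp add: pi(5) p(5))
  have T: "adjoint_on (\<phi> ` lm_dom x) (\<phi> \<circ> lm_op x \<circ> ?j) (\<phi> \<circ> lm_adj x \<circ> ?j)"
    using adjoint_onD[OF dx(3)] unfolding adjoint_on_def by (simp add: i flip: p(4,5))
  have B: "bounded_by (\<phi> ` lm_dom x) (\<phi> \<circ> lm_op x \<circ> ?j) C"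
    using C unfolding bounded_by_def by (simp add: i star_automorphism_isometric[OF \<phi>])
  note r = local_multipliersI[OF essential_ideal_image[OF \<phi> dx(1)] T B L' R', folded me]
  show "lm_map \<phi> x \<in> local_multipliers" "lm_dom (lm_map \<phi> x) = \<phi> ` lm_dom x" using r by blast+
  show "z \<in> lm_dom x \<Longrightarrow> lm_op (lm_map \<phi> x) (\<phi> z) = \<phi> (lm_op x z)"
    using r(3)[of "\<phi> z"] by (simp add: i)
qed

lemma lm_of:
  "lm_of a \<in> local_multipliers" "lm_dom (lm_of a) = UNIV" "lm_op (lm_of a) z = a * z"
  "lm_adj (lm_of a) z = star a * z"
proof -
  have a: "adjoint_on UNIV (\<lambda>x. a * x) (\<lambda>x. star a * x)"
    unfolding adjoint_on_def by (simp add: star_mult mult.assoc)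
  have b: "bounded_by UNIV (\<lambda>x. a * x) (norm a)" unfolding bounded_by_def by (simp add: norm_mult_ineq)
  show "lm_of a \<in> local_multipliers"
    unfolding lm_of_def
    by (rule local_multipliersI(1)[OF essential_ideal_UNIV a b]) (simp_all add: star_mult star_star)
  show "lm_dom (lm_of a) = UNIV" "lm_op (lm_of a) z = a * z" "lm_adj (lm_of a) z = star a * z"
    unfolding lm_of_def lm_dom_def lm_op_def lm_adj_def by (simp_all add: star_mult star_star)
qed

lemma lm_one: "lm_dom lm_one = UNIV" "lm_op lm_one z = z"
  unfolding lm_one_def lm_dom_def lm_op_def by auto

lemma adjoint_on_lm_diff:
  assumes x: "x \<in> local_multipliers" and y: "y \<in> local_multipliers"
  shows "adjoint_on (lm_dom x \<inter> lm_dom y) (\<lambda>z. lm_op x z - lm_op y z) (\<lambda>z. lm_adj x z - lm_adj y z)"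
    and "\<exists>C. bounded_by (lm_dom x \<inter> lm_dom y) (\<lambda>z. lm_op x z - lm_op y z) C"
proof -
  note dx = local_multipliersD[OF x] and dy = local_multipliersD[OF y]
  define K where "K = lm_dom x \<inter> lm_dom y"
  have Ki: "closed_ideal K" unfolding K_def by (rule closed_ideal_Int[OF dx(2) dy(2)])
  have ax: "adjoint_on K (lm_op x) (lm_adj x)" and ay: "adjoint_on K (lm_op y) (lm_adj y)"
    by (rule adjoint_on_lm_Int[OF x Ki] adjoint_on_lm_Int[OF y Ki]; simp add: K_def)+
  show "adjoint_on (lm_dom x \<inter> lm_dom y) (\<lambda>z. lm_op x z - lm_op y z) (\<lambda>z. lm_adj x z - lm_adj y z)"
    using adjoint_onD[OF ax] adjoint_onD[OF ay] closed_subspaceD(5)[OF closed_ideal_subspace[OF Ki]]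
    unfolding adjoint_on_def K_def[symmetric] by (simp add: star_diff left_diff_distrib right_diff_distrib)
  obtain C D where CD: "bounded_by (lm_dom x) (lm_op x) C" "bounded_by (lm_dom y) (lm_op y) D"
    using dx(4) dy(4) by blast
  have "norm (lm_op x z - lm_op y z) \<le> (C + D) * norm z" if "z \<in> lm_dom x \<inter> lm_dom y" for z
    using bounded_byD[OF CD(1), of z] bounded_byD[OF CD(2), of z] that
      norm_triangle_ineq4[of "lm_op x z" "lm_op y z"] by (simp add: distrib_right)
  then show "\<exists>C. bounded_by (lm_dom x \<inter> lm_dom y) (\<lambda>z. lm_op x z - lm_op y z) C"
    unfolding bounded_by_def by blast
qed

text \<open>A bound on an essential ideal extends to the whole domain, so shrinking the ideal does
  not lower the norm, and the infimum in \<open>lm_dist\<close> can be read off on the common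
  domain.\<close>

lemma lm_dist_le_iff:
  assumes x: "x \<in> local_multipliers" and y: "y \<in> local_multipliers" and e: "e \<ge> 0"
  shows "lm_dist x y \<le> e \<longleftrightarrow> bounded_by (lm_dom x \<inter> lm_dom y) (\<lambda>z. lm_op x z - lm_op y z) e"
proof -
  note dx = local_multipliersD[OF x] and dy = local_multipliersD[OF y]
  obtain I L R where xe: "x = (I, (L, R))" by (cases x) auto
  obtain J M N where ye: "y = (J, (M, N))" by (cases y) auto
  have d: "lm_dom x = I" "lm_dom y = J" "lm_op x = L" "lm_op y = M"
    unfolding xe ye lm_dom_def lm_op_def by auto
  define T where "T z = lm_op x z - lm_op y z" for z
  define K0 where "K0 = lm_dom x \<inter> lm_dom y"
  have K0: "essential_ideal K0" "closed_ideal K0"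
    unfolding K0_def using essential_ideal_Int[OF dx(1) dy(1)] closed_ideal_Int[OF dx(2) dy(2)] by blast+
  have Ta: "adjoint_on K0 T (\<lambda>z. lm_adj x z - lm_adj y z)"
    unfolding T_def K0_def by (rule adjoint_on_lm_diff[OF x y])
  obtain C where C: "bounded_by K0 T C"
    using adjoint_on_lm_diff(2)[OF x y] unfolding T_def K0_def by blast
  have less: "lm_dist x y < e' \<longleftrightarrow> (\<exists>K e''. essential_ideal K \<and> K \<subseteq> K0 \<and> e'' < e' \<and>
       (\<forall>x\<in>K. norm x \<le> 1 \<longrightarrow> norm (T x) \<le> e''))" for e'
    using lm_dist_less_iff(1)[of I L R J M N e'] x y d unfolding xe ye T_def K0_def by simp
  have "bounded_by K0 T e" if le: "lm_dist x y \<le> e"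
  proof -
    \<comment> \<open>The infimum supplies an ideal only for each \<open>e'\<close> above
      \<open>e\<close>; afterwards \<open>e'\<close> decreases to \<open>e\<close> at every single
      vector.\<close>
    have e': "bounded_by K0 T e'" if "e' > e" for e'
    proof -
      have "lm_dist x y < e'" using le that by simp
      then obtain K e'' where K: "essential_ideal K" "K \<subseteq> K0" "e'' < e'"
          "\<And>x. x \<in> K \<Longrightarrow> norm x \<le> 1 \<Longrightarrow> norm (T x) \<le> e''"
        unfolding less by blast
      have Ks: "closed_subspace K" using K(1) closed_ideal_subspace unfolding essential_ideal_def by blast
      have "norm (T z) \<le> e' * norm z" if z: "z \<in> K" for z
      proof (cases "z = 0")
        case True
        then show ?thesis using adjoint_on_linear(5)[OF closed_ideal_subspace[OF K0(2)] Ta] by simp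
      next
        case False
        have "norm (T ((1 / norm z) *\<^sub>R z)) \<le> e''"
          using False by (intro K(4) closed_subspaceD(4)[OF Ks z]) simp
        moreover have "T ((1 / norm z) *\<^sub>R z) = (1 / norm z) *\<^sub>R T z"
          using adjoint_on_linear(3)[OF closed_ideal_subspace[OF K0(2)] Ta] K(2) z by blast
        ultimately have "norm (T z) \<le> e'' * norm z" using False by (simp add: divide_le_eq)
        also have "\<dots> \<le> e' * norm z" using K(3) by (intro mult_right_mono) auto
        finally show ?thesis .
      qed
      then have "bounded_by K T e'" unfolding bounded_by_def by blast
      then show ?thesis
        by (rule bounded_by_essential_ideal[OF K0(2) Ta C K(1,2)]) (use e that in simp)
    qed
    show ?thesis
      unfolding bounded_by_def
    proof
      fix z assume z: "z \<in> K0"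
      have "((\<lambda>e'. e' * norm z) \<longlongrightarrow> e * norm z) (at_right e)" by (intro tendsto_intros)
      moreover have "\<forall>\<^sub>F e' in at_right e. norm (T z) \<le> e' * norm z"
        unfolding eventually_at_right_field using bounded_byD[OF e' z] by (auto intro!: exI[of _ "e + 1"])
      ultimately show "norm (T z) \<le> e * norm z"
        by (rule tendsto_lowerbound) simp
    qed
  qed
  moreover have "lm_dist x y \<le> e" if b: "bounded_by K0 T e"
  proof (rule dense_ge)
    fix e' assume "e < e'"
    moreover have "norm (T z) \<le> e" if "z \<in> K0" "norm z \<le> 1" for z
      using bounded_byD[OF b that(1)] mult_left_le[OF that(2) e] by linarith
    ultimately have "lm_dist x y < e'" unfolding less using K0(1) by blast
    then show "lm_dist x y \<le> e'" by simp
  qed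
  ultimately show ?thesis unfolding T_def K0_def by blast
qed

lemma lm_dist_bound:
  assumes "x \<in> local_multipliers" "y \<in> local_multipliers" "z \<in> lm_dom x" "z \<in> lm_dom y"
  shows "norm (lm_op x z - lm_op y z) \<le> lm_dist x y * norm z"
  using lm_dist_le_iff[OF assms(1,2) lm_dist_nonneg[OF assms(1,2)]] assms(3,4)
  unfolding bounded_by_def by blast

text \<open>From \<open>x y - x' y' = x (y - y') + (x - x') y'\<close>, evaluated on the
  intersection of all four domains.\<close>

lemma lm_dist_times_le:
  assumes LM: "x \<in> local_multipliers" "x' \<in> local_multipliers" "y \<in> local_multipliers" "y' \<in> local_multipliers"
    and A: "bounded_by (lm_dom x) (lm_op x) A" "A \<ge> 0" and B: "bounded_by (lm_dom y') (lm_op y') B" "B \<ge> 0"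
  shows "lm_dist (lm_times x y) (lm_times x' y') \<le> A * lm_dist y y' + lm_dist x x' * B"
proof -
  note t = lm_times[OF LM(1,3)] and t' = lm_times[OF LM(2,4)]
  have nn: "lm_dist y y' \<ge> 0" "lm_dist x x' \<ge> 0" using LM lm_dist_nonneg by blast+
  show ?thesis
    unfolding lm_dist_le_iff[OF t(1) t'(1) add_nonneg_nonneg[OF mult_nonneg_nonneg[OF A(2) nn(1)] mult_nonneg_nonneg[OF nn(2) B(2)]]]
    unfolding bounded_by_def
  proof
    fix z assume "z \<in> lm_dom (lm_times x y) \<inter> lm_dom (lm_times x' y')"
    define K where "K = lm_dom x \<inter> lm_dom y \<inter> (lm_dom x' \<inter> lm_dom y')"
    have z: "z \<in> K" unfolding K_def using \<open>z \<in> _\<close> t(2) t'(2) by simp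
    have Ki: "closed_ideal K" unfolding K_def using LM local_multipliersD(2) by (intro closed_ideal_Int)
    have sub: "K \<subseteq> lm_dom x" "K \<subseteq> lm_dom y" "K \<subseteq> lm_dom x'" "K \<subseteq> lm_dom y'" unfolding K_def by auto
    note ax = adjoint_on_lm_Int[OF LM(1) Ki sub(1)] and ay = adjoint_on_lm_Int[OF LM(3) Ki sub(2)]
      and ay' = adjoint_on_lm_Int[OF LM(4) Ki sub(4)]
    have yz: "lm_op y z \<in> K" "lm_op y' z \<in> K" using adjoint_onD(1) ay ay' z by blast+
    have "lm_op (lm_times x y) z - lm_op (lm_times x' y') z
        = lm_op x (lm_op y z) - lm_op x' (lm_op y' z)"
      using t(3)[of z] t'(3)[of z] subsetD[OF sub(1) z] subsetD[OF sub(2) z] subsetD[OF sub(3) z]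
        subsetD[OF sub(4) z] by simp
    also have "\<dots> = lm_op x (lm_op y z - lm_op y' z) + (lm_op x (lm_op y' z) - lm_op x' (lm_op y' z))"
      using adjoint_on_linear(4)[OF closed_ideal_subspace[OF Ki] ax yz] by simp
    also have "norm \<dots> \<le> norm (lm_op x (lm_op y z - lm_op y' z)) + norm (lm_op x (lm_op y' z) - lm_op x' (lm_op y' z))"
      by (rule norm_triangle_ineq)
    also have "norm (lm_op x (lm_op y z - lm_op y' z)) \<le> A * norm (lm_op y z - lm_op y' z)"
      using bounded_byD[OF A(1)] closed_subspaceD(5)[OF closed_ideal_subspace[OF Ki] yz] sub by blast
    also have "\<dots> \<le> A * (lm_dist y y' * norm z)"
      by (rule mult_left_mono[OF lm_dist_bound A(2)]) (use LM z sub in auto)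
    also have "norm (lm_op x (lm_op y' z) - lm_op x' (lm_op y' z)) \<le> lm_dist x x' * norm (lm_op y' z)"
      by (rule lm_dist_bound) (use LM yz sub in auto)
    also have "\<dots> \<le> lm_dist x x' * (B * norm z)"
      using bounded_byD[OF B(1), of z] z sub nn by (intro mult_left_mono) auto
    finally show "norm (lm_op (lm_times x y) z - lm_op (lm_times x' y') z) \<le> (A * lm_dist y y' + lm_dist x x' * B) * norm z"
      by (simp add: algebra_simps)
  qed
qed

lemma lm_dist_star_le:
  assumes x: "x \<in> local_multipliers" and y: "y \<in> local_multipliers"
  shows "lm_dist (lm_star x) (lm_star y) \<le> lm_dist x y"
proof -
  note s = lm_star[OF x] and t = lm_star[OF y]
  have "bounded_by (lm_dom x \<inter> lm_dom y) (\<lambda>z. lm_op x z - lm_op y z) (lm_dist x y)"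
    using lm_dist_le_iff[OF x y lm_dist_nonneg[OF x y]] by blast
  then have "bounded_by (lm_dom x \<inter> lm_dom y) (\<lambda>z. lm_adj x z - lm_adj y z) (lm_dist x y)"
    by (rule bounded_by_adjoint[OF adjoint_on_lm_diff(1)[OF x y]])
  then show ?thesis
    unfolding lm_dist_le_iff[OF s(1) t(1) lm_dist_nonneg[OF x y]] s(2) t(2) bounded_by_def
    by (simp add: s(3) t(3))
qed

lemma lm_dist_map_le:
  assumes \<phi>: "star_automorphism \<phi>" and x: "x \<in> local_multipliers" and y: "y \<in> local_multipliers"
  shows "lm_dist (lm_map \<phi> x) (lm_map \<phi> y) \<le> lm_dist x y"
proof -
  note s = lm_map[OF \<phi> x] and t = lm_map[OF \<phi> y]
  show ?thesis
    unfolding lm_dist_le_iff[OF s(1) t(1) lm_dist_nonneg[OF x y]] s(2) t(2) bounded_by_def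
  proof
    fix v assume "v \<in> \<phi> ` lm_dom x \<inter> \<phi> ` lm_dom y"
    then obtain z z' where z: "z \<in> lm_dom x" "v = \<phi> z" "z' \<in> lm_dom y" "v = \<phi> z'" by blast
    then have "z = z'" using star_automorphismD(1)[OF \<phi>] by (simp add: bij_is_inj inj_eq)
    then have "norm (lm_op (lm_map \<phi> x) v - lm_op (lm_map \<phi> y) v) = norm (\<phi> (lm_op x z - lm_op y z))"
      using s(3)[of z] t(3)[of z] z star_automorphismD(8)[OF \<phi>] by simp
    also have "\<dots> = norm (lm_op x z - lm_op y z)" by (rule star_automorphism_isometric[OF \<phi>])
    also have "\<dots> \<le> lm_dist x y * norm z" using lm_dist_bound[OF x y] z \<open>z = z'\<close> by blast
    finally show "norm (lm_op (lm_map \<phi> x) v - lm_op (lm_map \<phi> y) v) \<le> lm_dist x y * norm v"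
      using z(2) star_automorphism_isometric[OF \<phi>] by simp
  qed
qed

lemma lm_bounded_by_dist:
  assumes x: "x \<in> local_multipliers" and y: "y \<in> local_multipliers"
    and B: "bounded_by (lm_dom y) (lm_op y) B" "B \<ge> 0"
  shows "bounded_by (lm_dom x) (lm_op x) (B + lm_dist x y)"
proof -
  note dx = local_multipliersD[OF x] and dy = local_multipliersD[OF y]
  obtain C where C: "bounded_by (lm_dom x) (lm_op x) C" using dx(4) by blast
  have "bounded_by (lm_dom x \<inter> lm_dom y) (lm_op x) (B + lm_dist x y)"
    unfolding bounded_by_def
  proof
    fix z assume z: "z \<in> lm_dom x \<inter> lm_dom y"
    then have "norm (lm_op x z - lm_op y z) \<le> lm_dist x y * norm z" "norm (lm_op y z) \<le> B * norm z"
      using lm_dist_bound[OF x y] bounded_byD[OF B(1)] by blast+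
    then show "norm (lm_op x z) \<le> (B + lm_dist x y) * norm z"
      using norm_triangle_ineq[of "lm_op x z - lm_op y z" "lm_op y z"] by (simp add: distrib_right)
  qed
  then show ?thesis
    using B lm_dist_nonneg[OF x y]
    by (intro bounded_by_essential_ideal[OF dx(2,3) C essential_ideal_Int[OF dx(1) dy(1)]]) auto
qed

lemma lm_bounded_by_star:
  assumes x: "x \<in> local_multipliers" and "bounded_by (lm_dom x) (lm_op x) B"
  shows "bounded_by (lm_dom (lm_star x)) (lm_op (lm_star x)) B"
  using bounded_by_adjoint[OF local_multipliersD(3)[OF x] assms(2)] lm_star[OF x]
  unfolding bounded_by_def by simp

section \<open>Passage to the completion\<close>

lemma lm_cauchyD: "lm_cauchy s \<Longrightarrow> s n \<in> local_multipliers"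
  unfolding lm_cauchy_def by blast

lemma lm_cauchy_bounded:
  assumes s: "lm_cauchy s"
  obtains A where "A \<ge> 0" "\<And>n. bounded_by (lm_dom (s n)) (lm_op (s n)) A"
proof -
  note LM = lm_cauchyD[OF s]
  have "\<exists>C. C \<ge> 0 \<and> bounded_by (lm_dom (s n)) (lm_op (s n)) C" for n
    using local_multipliersD(4)[OF LM[of n]] bounded_by_nonneg by metis
  then obtain f where f: "\<And>n. f n \<ge> 0" "\<And>n. bounded_by (lm_dom (s n)) (lm_op (s n)) (f n)" by metis
  obtain N where N: "\<And>m n. m \<ge> N \<Longrightarrow> n \<ge> N \<Longrightarrow> lm_dist (s m) (s n) < 1"
    using s[unfolded lm_cauchy_def, THEN conjunct2, rule_format, of 1] by auto
  define A where "A = (\<Sum>n\<le>N. f n) + 1"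
  have le: "f n \<le> A - 1" if "n \<le> N" for n
    unfolding A_def using member_le_sum[of n "{..N}" f] f(1) that by simp
  have "bounded_by (lm_dom (s n)) (lm_op (s n)) A" for n
  proof (cases "n \<le> N")
    case True
    then show ?thesis using f(2)[of n] le[of n] unfolding bounded_by_def
      by (meson diff_le_eq le_add_same_cancel1 mult_right_mono norm_ge_zero order_trans zero_le_one)
  next
    case False
    then have "f N + lm_dist (s n) (s N) \<le> A" using N[of n N] le[of N] by simp
    moreover have "bounded_by (lm_dom (s n)) (lm_op (s n)) (f N + lm_dist (s n) (s N))"
      by (rule lm_bounded_by_dist[OF LM LM f(2,1)])
    ultimately show ?thesis unfolding bounded_by_def
      by (meson mult_right_mono norm_ge_zero order_trans)
  qed
  moreover have "A \<ge> 0" unfolding A_def using f(1) by (simp add: sum_nonneg add_nonneg_nonneg)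
  ultimately show ?thesis using that by blast
qed

lemma mloc_relI:
  assumes s: "lm_cauchy s" and t: "\<And>n. t n \<in> local_multipliers"
    and lim: "(\<lambda>n. lm_dist (s n) (t n)) \<longlonglongrightarrow> 0"
  shows "mloc_rel s t"
proof -
  have "\<exists>N. \<forall>m\<ge>N. \<forall>n\<ge>N. lm_dist (t m) (t n) < e" if e: "e > 0" for e
  proof -
    obtain N where N: "\<And>m n. m \<ge> N \<Longrightarrow> n \<ge> N \<Longrightarrow> lm_dist (s m) (s n) < e / 3"
      using s[unfolded lm_cauchy_def, THEN conjunct2, rule_format, of "e / 3"] e by auto
    have "\<forall>\<^sub>F n in sequentially. lm_dist (s n) (t n) < e / 3"
      using lim e by (intro order_tendstoD) auto
    then obtain M where M: "\<And>n. n \<ge> M \<Longrightarrow> lm_dist (s n) (t n) < e / 3"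
      by (auto simp: eventually_sequentially)
    have "lm_dist (t m) (t n) < e" if "m \<ge> max M N" "n \<ge> max M N" for m n
      using lm_dist_triangle[OF t[of m] lm_cauchyD[OF s, of m] t[of n]]
        lm_dist_triangle[OF lm_cauchyD[OF s, of m] lm_cauchyD[OF s, of n] t[of n]]
        M[of m] M[of n] N[of m n] that lm_dist_sym[of "t m" "s m"] by simp
    then show ?thesis by blast
  qed
  then show ?thesis using s t lim unfolding mloc_rel_def lm_cauchy_def by blast
qed

lemma mloc_relD:
  assumes "mloc_rel s t"
  shows "lm_cauchy s" "lm_cauchy t" "(\<lambda>n. lm_dist (s n) (t n)) \<longlonglongrightarrow> 0"
  using assms unfolding mloc_rel_def by blast+

lemma mloc_rel_refl: "lm_cauchy s \<Longrightarrow> mloc_rel s s"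
  by (rule mloc_relI) (auto simp: lm_dist_self lm_cauchyD)

lemma mloc_rel_trans: "mloc_rel s t \<Longrightarrow> mloc_rel t r \<Longrightarrow> mloc_rel s r"
  using part_equivp_mloc_rel by (metis part_equivp_transp)

lemma mloc_rel_sym: "mloc_rel s t \<Longrightarrow> mloc_rel t s"
  using part_equivp_mloc_rel by (metis part_equivp_symp)

lemma lm_cauchy_const: "x \<in> local_multipliers \<Longrightarrow> lm_cauchy (\<lambda>_. x)"
  unfolding lm_cauchy_def by (simp add: lm_dist_self)

lemma lm_cauchy_times:
  assumes s: "lm_cauchy s" and t: "lm_cauchy t"
  shows "lm_cauchy (\<lambda>n. lm_times (s n) (t n))"
proof -
  note S = lm_cauchyD[OF s] and T = lm_cauchyD[OF t]
  obtain A where A: "A \<ge> 0" "\<And>n. bounded_by (lm_dom (s n)) (lm_op (s n)) A" using lm_cauchy_bounded[OF s] by blast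
  obtain B where B: "B \<ge> 0" "\<And>n. bounded_by (lm_dom (t n)) (lm_op (t n)) B" using lm_cauchy_bounded[OF t] by blast
  have "\<exists>N. \<forall>m\<ge>N. \<forall>n\<ge>N. lm_dist (lm_times (s m) (t m)) (lm_times (s n) (t n)) < e" if e: "e > 0" for e
  proof -
    define d where "d = e / (A + B + 1)"
    have d: "d > 0" unfolding d_def using e A(1) B(1) by simp
    obtain N where N: "\<And>m n. m \<ge> N \<Longrightarrow> n \<ge> N \<Longrightarrow> lm_dist (s m) (s n) < d"
      using s[unfolded lm_cauchy_def, THEN conjunct2, rule_format, OF d] by auto
    obtain M where M: "\<And>m n. m \<ge> M \<Longrightarrow> n \<ge> M \<Longrightarrow> lm_dist (t m) (t n) < d"
      using t[unfolded lm_cauchy_def, THEN conjunct2, rule_format, OF d] by auto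
    have "lm_dist (lm_times (s m) (t m)) (lm_times (s n) (t n)) < e" if mn: "m \<ge> max M N" "n \<ge> max M N" for m n
    proof -
      have "lm_dist (lm_times (s m) (t m)) (lm_times (s n) (t n)) \<le> A * lm_dist (t m) (t n) + lm_dist (s m) (s n) * B"
        by (rule lm_dist_times_le[OF S S T T A(2,1) B(2,1)])
      also have "\<dots> \<le> A * d + d * B"
        using N[of m n] M[of m n] mn A(1) B(1) by (intro add_mono mult_left_mono mult_right_mono) auto
      also have "\<dots> < (A + B + 1) * d" using d by (simp add: algebra_simps)
      also have "\<dots> = e" unfolding d_def using A(1) B(1) by simp
      finally show ?thesis .
    qed
    then show ?thesis by blast
  qed
  then show ?thesis unfolding lm_cauchy_def using lm_times(1)[OF S T] by blast
qed

lemma mloc_rel_times: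
  assumes s: "mloc_rel s s'" and t: "mloc_rel t t'"
  shows "mloc_rel (\<lambda>n. lm_times (s n) (t n)) (\<lambda>n. lm_times (s' n) (t' n))"
proof (rule mloc_relI)
  note S = mloc_relD[OF s] and T = mloc_relD[OF t]
  note LM = lm_cauchyD[OF S(1)] lm_cauchyD[OF S(2)] lm_cauchyD[OF T(1)] lm_cauchyD[OF T(2)]
  obtain A where A: "A \<ge> 0" "\<And>n. bounded_by (lm_dom (s n)) (lm_op (s n)) A" using lm_cauchy_bounded[OF S(1)] by blast
  obtain B where B: "B \<ge> 0" "\<And>n. bounded_by (lm_dom (t' n)) (lm_op (t' n)) B" using lm_cauchy_bounded[OF T(2)] by blast
  show "lm_cauchy (\<lambda>n. lm_times (s n) (t n))" by (rule lm_cauchy_times[OF S(1) T(1)])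
  show "lm_times (s' n) (t' n) \<in> local_multipliers" for n by (rule lm_times(1)[OF LM(2,4)])
  have "(\<lambda>n. A * lm_dist (t n) (t' n) + lm_dist (s n) (s' n) * B) \<longlonglongrightarrow> A * 0 + 0 * B"
    by (intro tendsto_intros S T)
  then have lim: "(\<lambda>n. A * lm_dist (t n) (t' n) + lm_dist (s n) (s' n) * B) \<longlonglongrightarrow> 0" by simp
  have le: "lm_dist (lm_times (s n) (t n)) (lm_times (s' n) (t' n)) \<le> A * lm_dist (t n) (t' n) + lm_dist (s n) (s' n) * B" for n
    by (rule lm_dist_times_le[OF LM A(2,1) B(2,1)])
  show "(\<lambda>n. lm_dist (lm_times (s n) (t n)) (lm_times (s' n) (t' n))) \<longlonglongrightarrow> 0"
    by (rule tendsto_sandwich[OF _ _ tendsto_const lim])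
      (auto intro!: always_eventually le lm_dist_nonneg lm_times LM)
qed

lemma mloc_rel_star:
  assumes "mloc_rel s t"
  shows "mloc_rel (\<lambda>n. lm_star (s n)) (\<lambda>n. lm_star (t n))"
proof (rule mloc_relI)
  note S = mloc_relD[OF assms]
  note LM = lm_cauchyD[OF S(1)] lm_cauchyD[OF S(2)]
  show "lm_cauchy (\<lambda>n. lm_star (s n))"
    using S(1) lm_dist_star_le[OF LM(1) LM(1)] lm_star(1)[OF LM(1)]
    unfolding lm_cauchy_def by (meson le_less_trans)
  show "lm_star (t n) \<in> local_multipliers" for n by (rule lm_star(1)[OF LM(2)])
  show "(\<lambda>n. lm_dist (lm_star (s n)) (lm_star (t n))) \<longlonglongrightarrow> 0"
    by (rule tendsto_sandwich[OF _ _ tendsto_const S(3)])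
      (auto intro!: always_eventually lm_dist_star_le lm_dist_nonneg lm_star LM)
qed

lemma mloc_rel_map:
  assumes \<phi>: "star_automorphism \<phi>" and "mloc_rel s t"
  shows "mloc_rel (\<lambda>n. lm_map \<phi> (s n)) (\<lambda>n. lm_map \<phi> (t n))"
proof (rule mloc_relI)
  note S = mloc_relD[OF assms(2)]
  note LM = lm_cauchyD[OF S(1)] lm_cauchyD[OF S(2)]
  show "lm_cauchy (\<lambda>n. lm_map \<phi> (s n))"
    using S(1) lm_dist_map_le[OF \<phi> LM(1) LM(1)] lm_map(1)[OF \<phi> LM(1)]
    unfolding lm_cauchy_def by (meson le_less_trans)
  show "lm_map \<phi> (t n) \<in> local_multipliers" for n by (rule lm_map(1)[OF \<phi> LM(2)])
  show "(\<lambda>n. lm_dist (lm_map \<phi> (s n)) (lm_map \<phi> (t n))) \<longlonglongrightarrow> 0"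
    by (rule tendsto_sandwich[OF _ _ tendsto_const S(3)])
      (auto intro!: always_eventually lm_dist_map_le[OF \<phi>] lm_dist_nonneg lm_map[OF \<phi>] LM)
qed

lemma mloc_rep_abs: "lm_cauchy s \<Longrightarrow> mloc_rel (rep_mloc (abs_mloc s)) s"
  by (rule Quotient3_rep_abs[OF Quotient3_mloc mloc_rel_refl])

lemma mloc_rep_refl: "mloc_rel (rep_mloc u) (rep_mloc u)"
  by (rule Quotient3_rep_reflp[OF Quotient3_mloc])

lemma mloc_rep_one: "mloc_rel (rep_mloc 1) (\<lambda>_. lm_one)"
  unfolding one_mloc_def by (rule mloc_rep_abs[OF lm_cauchy_const[OF lm_one_in]])

lemma mloc_rep_of: "mloc_rel (rep_mloc (mloc_of a)) (\<lambda>_. lm_of a)"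
  unfolding mloc_of_def by (rule mloc_rep_abs[OF lm_cauchy_const[OF lm_of(1)]])

lemma mloc_rep_times:
  assumes "mloc_rel (rep_mloc u) s" "mloc_rel (rep_mloc v) t"
  shows "mloc_rel (rep_mloc (u * v)) (\<lambda>n. lm_times (s n) (t n))"
  unfolding times_mloc_def
  by (rule mloc_rel_trans[OF mloc_rep_abs[OF mloc_relD(1)[OF mloc_rel_times[OF assms]]] mloc_rel_times[OF assms]])

lemma mloc_rep_star:
  assumes "mloc_rel (rep_mloc u) s"
  shows "mloc_rel (rep_mloc (star u)) (\<lambda>n. lm_star (s n))"
  unfolding star_mloc_def
  by (rule mloc_rel_trans[OF mloc_rep_abs[OF mloc_relD(1)[OF mloc_rel_star[OF assms]]] mloc_rel_star[OF assms]])

lemma mloc_rep_map: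
  assumes "star_automorphism \<phi>"
  shows "mloc_rel (rep_mloc (mloc_map \<phi> u)) (\<lambda>n. lm_map \<phi> (rep_mloc u n))"
  unfolding mloc_map_def by (rule mloc_rep_abs[OF mloc_relD(1)[OF mloc_rel_map[OF assms mloc_rep_refl]]])

text \<open>One approximant has to serve all \<open>g\<close> and all \<open>a\<close>, although
  each relation is a limit whose speed depends on \<open>g\<close> or \<open>a\<close>. Late terms
  of the sequence are mutually close, and the operations enlarge distances by bounded factors at
  most; so the relation is compared at \<open>s N\<close> and \<open>s n\<close>, and
  \<open>n\<close> tends to infinity.\<close>

lemma unitary_mloc_approximation:
  fixes \<alpha> :: "'g::topological_group_add \<Rightarrow> 'a::cstar_algebra \<Rightarrow> 'a"
  assumes \<alpha>: "cstar_dynamical_system \<alpha>" and u: "mloc_unitary u" "u \<in> mloc_fixed \<alpha>"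
    and inner: "\<forall>a. mloc_of (\<alpha> g\<^sub>0 a) = u * mloc_of a * star u" and \<epsilon>: "\<epsilon> > 0"
  obtains x where "x \<in> local_multipliers" "lm_dist (lm_times (lm_star x) x) lm_one \<le> \<epsilon>"
    "lm_dist (lm_times x (lm_star x)) lm_one \<le> \<epsilon>" "\<And>g. lm_dist (lm_map (\<alpha> g) x) x \<le> \<epsilon>"
    "\<And>a. lm_dist (lm_times (lm_times x (lm_of a)) (lm_star x)) (lm_of (\<alpha> g\<^sub>0 a)) \<le> \<epsilon> * norm a"
proof -
  define s where "s = rep_mloc u"
  have ss: "mloc_rel (rep_mloc u) s" unfolding s_def by (rule mloc_rep_refl)
  have sc: "lm_cauchy s" by (rule mloc_relD(2)[OF ss])
  note S = lm_cauchyD[OF sc]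
  note aut = cstar_dynamical_systemD(1)[OF \<alpha>]
  have 1: "(\<lambda>n. lm_dist (lm_times (lm_star (s n)) (s n)) lm_one) \<longlonglongrightarrow> 0"
  proof -
    have "star u * u = 1" using u(1) unfolding mloc_unitary_def by blast
    then have "mloc_rel (rep_mloc 1) (\<lambda>n. lm_times (lm_star (s n)) (s n))"
      using mloc_rep_times[OF mloc_rep_star[OF ss] ss] by simp
    then show ?thesis using mloc_relD(3)[OF mloc_rel_trans[OF mloc_rel_sym mloc_rep_one]] by blast
  qed
  have 2: "(\<lambda>n. lm_dist (lm_times (s n) (lm_star (s n))) lm_one) \<longlonglongrightarrow> 0"
  proof -
    have "u * star u = 1" using u(1) unfolding mloc_unitary_def by blast
    then have "mloc_rel (rep_mloc 1) (\<lambda>n. lm_times (s n) (lm_star (s n)))"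
      using mloc_rep_times[OF ss mloc_rep_star[OF ss]] by simp
    then show ?thesis using mloc_relD(3)[OF mloc_rel_trans[OF mloc_rel_sym mloc_rep_one]] by blast
  qed
  have 3: "(\<lambda>n. lm_dist (lm_map (\<alpha> g) (s n)) (s n)) \<longlonglongrightarrow> 0" for g
  proof -
    have "mloc_map (\<alpha> g) u = u" using u(2) unfolding mloc_fixed_def by blast
    then have "mloc_rel s (\<lambda>n. lm_map (\<alpha> g) (s n))"
      using mloc_rep_map[OF aut, of g u] unfolding s_def by simp
    then show ?thesis using mloc_relD(3)[OF mloc_rel_sym] by blast
  qed
  have 4: "(\<lambda>n. lm_dist (lm_times (lm_times (s n) (lm_of a)) (lm_star (s n))) (lm_of (\<alpha> g\<^sub>0 a))) \<longlonglongrightarrow> 0" for a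
  proof -
    have "mloc_rel (rep_mloc (mloc_of (\<alpha> g\<^sub>0 a))) (\<lambda>n. lm_times (lm_times (s n) (lm_of a)) (lm_star (s n)))"
      using mloc_rep_times[OF mloc_rep_times[OF ss mloc_rep_of[of a]] mloc_rep_star[OF ss]] inner by simp
    then show ?thesis using mloc_relD(3)[OF mloc_rel_trans[OF mloc_rel_sym mloc_rep_of]] by blast
  qed
  obtain A where A: "A \<ge> 0" "\<And>n. bounded_by (lm_dom (s n)) (lm_op (s n)) A" using lm_cauchy_bounded[OF sc] by blast
  \<comment> \<open>\<open>2 * \<eta>\<close> pays for replacing \<open>s N\<close> by
    \<open>s n\<close> twice in the invariance estimate, and \<open>2 * A * \<eta>\<close> for doing
    so in both outer factors of the conjugation.\<close>
  define \<eta> where "\<eta> = \<epsilon> / (2 * A + 2)"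
  have \<eta>: "\<eta> > 0" "2 * \<eta> \<le> \<epsilon>" "2 * A * \<eta> \<le> \<epsilon>"
    unfolding \<eta>_def using \<epsilon> A(1) by (simp_all add: field_simps)
  obtain N0 where N0: "\<And>m n. m \<ge> N0 \<Longrightarrow> n \<ge> N0 \<Longrightarrow> lm_dist (s m) (s n) < \<eta>"
    using sc[unfolded lm_cauchy_def, THEN conjunct2, rule_format, OF \<eta>(1)] by auto
  have "\<forall>\<^sub>F n in sequentially. lm_dist (lm_times (lm_star (s n)) (s n)) lm_one < \<epsilon>
      \<and> lm_dist (lm_times (s n) (lm_star (s n))) lm_one < \<epsilon>"
    using \<epsilon> by (intro eventually_conj order_tendstoD(2)[OF 1] order_tendstoD(2)[OF 2])
  then obtain N1 where N1: "\<And>n. n \<ge> N1 \<Longrightarrow> lm_dist (lm_times (lm_star (s n)) (s n)) lm_one < \<epsilon>"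
    "\<And>n. n \<ge> N1 \<Longrightarrow> lm_dist (lm_times (s n) (lm_star (s n))) lm_one < \<epsilon>"
    by (auto simp: eventually_sequentially)
  define N where "N = max N0 N1"
  have near: "lm_dist (s N) (s n) \<le> \<eta>" "lm_dist (s n) (s N) \<le> \<eta>" if "n \<ge> N" for n
    using N0[of N n] N0[of n N] that unfolding N_def by (auto intro: less_imp_le)
  show ?thesis
  proof (rule that[OF S[of N]])
    show "lm_dist (lm_times (lm_star (s N)) (s N)) lm_one \<le> \<epsilon>"
      "lm_dist (lm_times (s N) (lm_star (s N))) lm_one \<le> \<epsilon>"
      using N1[of N] unfolding N_def by (auto intro: less_imp_le)
    show "lm_dist (lm_map (\<alpha> g) (s N)) (s N) \<le> \<epsilon>" for g
    proof -
      note M = lm_map(1)[OF aut[of g] S]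
      have "lm_dist (lm_map (\<alpha> g) (s N)) (s N) \<le> 2 * \<eta> + lm_dist (lm_map (\<alpha> g) (s n)) (s n)" if n: "n \<ge> N" for n
      proof -
        have "lm_dist (lm_map (\<alpha> g) (s N)) (s N) \<le> lm_dist (lm_map (\<alpha> g) (s N)) (lm_map (\<alpha> g) (s n))
            + lm_dist (lm_map (\<alpha> g) (s n)) (s N)" by (rule lm_dist_triangle[OF M M S])
        moreover have "lm_dist (lm_map (\<alpha> g) (s n)) (s N) \<le> lm_dist (lm_map (\<alpha> g) (s n)) (s n) + lm_dist (s n) (s N)"
          by (rule lm_dist_triangle[OF M S S])
        moreover have "lm_dist (lm_map (\<alpha> g) (s N)) (lm_map (\<alpha> g) (s n)) \<le> lm_dist (s N) (s n)"
          by (rule lm_dist_map_le[OF aut S S])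
        ultimately show ?thesis using near[OF n] by linarith
      qed
      moreover have "(\<lambda>n. 2 * \<eta> + lm_dist (lm_map (\<alpha> g) (s n)) (s n)) \<longlonglongrightarrow> 2 * \<eta> + 0"
        by (intro tendsto_intros 3)
      ultimately have "lm_dist (lm_map (\<alpha> g) (s N)) (s N) \<le> 2 * \<eta> + 0"
        by (intro LIMSEQ_le_const) blast+
      then show ?thesis using \<eta> by simp
    qed
    show "lm_dist (lm_times (lm_times (s N) (lm_of a)) (lm_star (s N))) (lm_of (\<alpha> g\<^sub>0 a)) \<le> \<epsilon> * norm a" for a
    proof -
      let ?c = "\<lambda>n. lm_times (lm_times (s n) (lm_of a)) (lm_star (s n))"
      have T: "lm_times (s n) (lm_of a) \<in> local_multipliers" for n by (rule lm_times(1)[OF S lm_of(1)])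
      have St: "lm_star (s n) \<in> local_multipliers" for n by (rule lm_star(1)[OF S])
      have C: "?c n \<in> local_multipliers" for n by (rule lm_times(1)[OF T St])
      have oa: "bounded_by (lm_dom (lm_of a)) (lm_op (lm_of a)) (norm a)"
        unfolding bounded_by_def lm_of by (simp add: norm_mult_ineq)
      have bT: "bounded_by (lm_dom (lm_times (s N) (lm_of a))) (lm_op (lm_times (s N) (lm_of a))) (A * norm a)"
        unfolding bounded_by_def
      proof
        fix z assume "z \<in> lm_dom (lm_times (s N) (lm_of a))"
        then have z: "z \<in> lm_dom (s N)" "z \<in> lm_dom (s N) \<inter> lm_dom (lm_of a)"
          unfolding lm_times(2)[OF S lm_of(1)] lm_of(2) by auto
        have "norm (lm_op (s N) (a * z)) \<le> A * norm (a * z)"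
          by (rule bounded_byD[OF A(2) closed_idealD(1)[OF local_multipliersD(2)[OF S] z(1)]])
        also have "\<dots> \<le> A * (norm a * norm z)" by (intro mult_left_mono norm_mult_ineq A)
        finally show "norm (lm_op (lm_times (s N) (lm_of a)) z) \<le> A * norm a * norm z"
          by (simp add: lm_times(3)[OF S lm_of(1) z(2)] lm_of(3) mult.assoc)
      qed
      have "lm_dist (?c N) (lm_of (\<alpha> g\<^sub>0 a)) \<le> 2 * A * \<eta> * norm a + lm_dist (?c n) (lm_of (\<alpha> g\<^sub>0 a))" if n: "n \<ge> N" for n
      proof -
        have "lm_dist (lm_times (s N) (lm_of a)) (lm_times (s n) (lm_of a))
            \<le> A * lm_dist (lm_of a) (lm_of a) + lm_dist (s N) (s n) * norm a"
          by (rule lm_dist_times_le[OF S S lm_of(1) lm_of(1) A(2,1) oa norm_ge_zero])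
        also have "\<dots> \<le> \<eta> * norm a" using near[OF n] by (simp add: lm_dist_self lm_of mult_right_mono)
        finally have d1: "lm_dist (lm_times (s N) (lm_of a)) (lm_times (s n) (lm_of a)) \<le> \<eta> * norm a" .
        have "lm_dist (?c N) (?c n) \<le> (A * norm a) * lm_dist (lm_star (s N)) (lm_star (s n))
            + lm_dist (lm_times (s N) (lm_of a)) (lm_times (s n) (lm_of a)) * A"
          by (rule lm_dist_times_le[OF T T St St bT _ lm_bounded_by_star[OF S A(2)] A(1)]) (simp add: A)
        also have "(A * norm a) * lm_dist (lm_star (s N)) (lm_star (s n)) \<le> (A * norm a) * \<eta>"
          using order_trans[OF lm_dist_star_le[OF S S] near(1)[OF n]] A(1) by (intro mult_left_mono) auto
        finally have "lm_dist (?c N) (?c n) \<le> (A * norm a) * \<eta> + (\<eta> * norm a) * A"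
          using mult_right_mono[OF d1 A(1)] by linarith
        moreover have "lm_dist (?c N) (lm_of (\<alpha> g\<^sub>0 a)) \<le> lm_dist (?c N) (?c n) + lm_dist (?c n) (lm_of (\<alpha> g\<^sub>0 a))"
          by (rule lm_dist_triangle[OF C C lm_of(1)])
        ultimately show ?thesis by (simp add: algebra_simps)
      qed
      moreover have "(\<lambda>n. 2 * A * \<eta> * norm a + lm_dist (?c n) (lm_of (\<alpha> g\<^sub>0 a))) \<longlonglongrightarrow> 2 * A * \<eta> * norm a + 0"
        by (intro tendsto_intros 4)
      ultimately have "lm_dist (?c N) (lm_of (\<alpha> g\<^sub>0 a)) \<le> 2 * A * \<eta> * norm a + 0"
        by (intro LIMSEQ_le_const) blast+
      also have "\<dots> \<le> \<epsilon> * norm a" using mult_right_mono[OF \<eta>(3) norm_ge_zero[of a]] by simp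
      finally show ?thesis .
    qed
  qed
qed

text \<open>
  The operators \<open>L\<close> and \<open>M\<close> are multiplication by the approximating multiplier and by its adjoint,
  restricted to an invariant ideal.
\<close>

lemma approximately_inner_on_invariant_ideal:
  fixes \<alpha> :: "'g::topological_group_add \<Rightarrow> 'a::cstar_algebra \<Rightarrow> 'a"
  assumes G: "compact (UNIV :: 'g set)" and \<alpha>: "cstar_dynamical_system \<alpha>"
    and prime: "prime_cstar_algebra TYPE('a)" and u: "mloc_unitary u" "u \<in> mloc_fixed \<alpha>"
    and inner: "\<forall>a. mloc_of (\<alpha> g\<^sub>0 a) = u * mloc_of a * star u" and \<epsilon>: "\<epsilon> > 0"
  obtains J L M where "closed_ideal J" "J \<noteq> {0}" "\<And>g x. x \<in> J \<Longrightarrow> \<alpha> g x \<in> J" "adjoint_on J L M"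
    "\<exists>C. bounded_by J L C" "\<And>x. x \<in> J \<Longrightarrow> norm (M (L x) - x) \<le> \<epsilon> * norm x"
    "\<And>x. x \<in> J \<Longrightarrow> norm (L (M x) - x) \<le> \<epsilon> * norm x"
    "\<And>g x. x \<in> J \<Longrightarrow> norm (\<alpha> g (L (\<alpha> (- g) x)) - L x) \<le> \<epsilon> * norm x"
    "\<And>a x. x \<in> J \<Longrightarrow> norm (L (a * M x) - \<alpha> g\<^sub>0 a * x) \<le> \<epsilon> * norm a * norm x"
proof -
  note aut = cstar_dynamical_systemD(1)[OF \<alpha>]
  obtain x where x: "x \<in> local_multipliers" "lm_dist (lm_times (lm_star x) x) lm_one \<le> \<epsilon>"
    "lm_dist (lm_times x (lm_star x)) lm_one \<le> \<epsilon>" "\<And>g. lm_dist (lm_map (\<alpha> g) x) x \<le> \<epsilon>"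
    "\<And>a. lm_dist (lm_times (lm_times x (lm_of a)) (lm_star x)) (lm_of (\<alpha> g\<^sub>0 a)) \<le> \<epsilon> * norm a"
    by (rule unitary_mloc_approximation[OF \<alpha> u inner \<epsilon>]) blast
  note d = local_multipliersD[OF x(1)] and s = lm_star[OF x(1)]
  have "lm_dom x \<noteq> {0}"
  proof
    assume "lm_dom x = {0}"
    moreover obtain a :: 'a where "a \<noteq> 0" using prime unfolding prime_cstar_algebra_def by blast
    ultimately show False using essential_ideal_annihilator[OF d(1), of a] by simp
  qed
  then obtain J where J: "closed_ideal J" "J \<noteq> {0}" "J \<subseteq> lm_dom x" "\<And>g x. x \<in> J \<Longrightarrow> \<alpha> g x \<in> J"
    by (rule invariant_ideal[OF G \<alpha> prime d(2)]) blast
  have LM: "adjoint_on J (lm_op x) (lm_adj x)" by (rule adjoint_on_lm_Int[OF x(1) J(1,3)])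
  note lm = adjoint_onD[OF LM]
  have bound: "norm (lm_op y z - lm_op w z) \<le> c * norm z"
    if "y \<in> local_multipliers" "w \<in> local_multipliers" "lm_dist y w \<le> c" "z \<in> lm_dom y" "z \<in> lm_dom w" for y w c z
    using lm_dist_bound[OF that(1,2,4,5)] mult_right_mono[OF that(3) norm_ge_zero[of z]] by linarith
  show ?thesis
  proof (rule that[OF J(1,2,4) LM])
    show "\<exists>C. bounded_by J (lm_op x) C" using d(4) bounded_by_subset[OF _ J(3)] by blast
    fix z assume z: "z \<in> J"
    then have zx: "z \<in> lm_dom x" using J(3) by blast
    have mx: "lm_adj x z \<in> lm_dom x" "lm_op x z \<in> lm_dom x" using lm z J(3) by blast+
    note t = lm_times[OF s(1) x(1)]
    have "z \<in> lm_dom (lm_star x) \<inter> lm_dom x" using zx s(2) by simp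
    then show "norm (lm_adj x (lm_op x z) - z) \<le> \<epsilon> * norm z"
      using bound[OF t(1) lm_one_in x(2), of z] t(2) t(3)[of z] s(3) mx by (simp add: lm_one)
    note t' = lm_times[OF x(1) s(1)]
    have "z \<in> lm_dom x \<inter> lm_dom (lm_star x)" using zx s(2) by simp
    then show "norm (lm_op x (lm_adj x z) - z) \<le> \<epsilon> * norm z"
      using bound[OF t'(1) lm_one_in x(3), of z] t'(2) t'(3)[of z] s(3) zx by (simp add: lm_one)
    show "norm (\<alpha> g (lm_op x (\<alpha> (- g) z)) - lm_op x z) \<le> \<epsilon> * norm z" for g
    proof -
      note m = lm_map[OF aut[of g] x(1)]
      have y: "\<alpha> (- g) z \<in> lm_dom x" using J(3,4) z by blast
      have zz: "\<alpha> g (\<alpha> (- g) z) = z" by (rule cstar_dynamical_systemD(6)[OF \<alpha>])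
      have "z \<in> lm_dom (lm_map (\<alpha> g) x)" unfolding m(2) using y zz by (metis imageI)
      then have "norm (lm_op (lm_map (\<alpha> g) x) z - lm_op x z) \<le> \<epsilon> * norm z"
        by (rule bound[OF m(1) x(1) x(4) _ zx])
      then show ?thesis using m(3)[OF y] zz by simp
    qed
    show "norm (lm_op x (a * lm_adj x z) - \<alpha> g\<^sub>0 a * z) \<le> \<epsilon> * norm a * norm z" for a
    proof -
      note ta = lm_times[OF x(1) lm_of(1)[of a]]
      note tb = lm_times[OF ta(1) s(1)]
      have zd: "z \<in> lm_dom (lm_times x (lm_of a)) \<inter> lm_dom (lm_star x)" using zx s(2) ta(2) lm_of(2) by blast
      have "lm_adj x z \<in> lm_dom x \<inter> lm_dom (lm_of a)" using mx lm_of(2) by blast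
      then have "lm_op (lm_times (lm_times x (lm_of a)) (lm_star x)) z = lm_op x (a * lm_adj x z)"
        using tb(3)[OF zd] ta(3)[of "lm_adj x z"] s(3)[OF zx] by (simp add: lm_of(3))
      then show ?thesis
        using bound[OF tb(1) lm_of(1) x(5)[of a], of z] zd tb(2) by (simp add: lm_of)
    qed
  qed
qed

section \<open>Integration of continuous functions over the group\<close>

abbreviation simple_integral :: "'g measure \<Rightarrow> ('g \<Rightarrow> 'b::real_normed_vector) \<Rightarrow> 'b" where
  "simple_integral \<equiv> Bochner_Integration.simple_bochner_integral"

abbreviation simple_integrable :: "'g measure \<Rightarrow> ('g \<Rightarrow> 'b::real_normed_vector) \<Rightarrow> bool" where
  "simple_integrable \<equiv> Bochner_Integration.simple_bochner_integrable"

text \<open>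
  Uniform approximation by simple functions with values in the range of \<open>f\<close>, so that integrals of
  functions with values in a closed subspace stay in that subspace.
\<close>

definition has_uniform_integral :: "'g measure \<Rightarrow> ('g \<Rightarrow> 'b::real_normed_vector) \<Rightarrow> 'b \<Rightarrow> bool" where
  "has_uniform_integral \<mu> f x \<longleftrightarrow> (\<forall>\<delta>>0. \<exists>s. simple_integrable \<mu> s \<and> range s \<subseteq> range f \<and>
     (\<forall>g. norm (f g - s g) \<le> \<delta>) \<and> norm (simple_integral \<mu> s - x) \<le> \<delta>)"

lemma has_uniform_integralE:
  assumes "has_uniform_integral \<mu> f x" "\<delta> > 0"
  obtains s where "simple_integrable \<mu> s" "range s \<subseteq> range f" "\<And>g. norm (f g - s g) \<le> \<delta>"
    "norm (simple_integral \<mu> s - x) \<le> \<delta>"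
  using assms(1)[unfolded has_uniform_integral_def, rule_format, OF assms(2)] by (elim exE conjE) simp

lemma normalized_haar_measureD:
  assumes "normalized_haar_measure \<mu>"
  shows "sets \<mu> = sets borel" "space \<mu> = UNIV" "emeasure \<mu> UNIV = 1" "finite_measure \<mu>"
    "B \<in> sets borel \<Longrightarrow> emeasure \<mu> ((+) g ` B) = emeasure \<mu> B"
proof -
  note h = assms[unfolded normalized_haar_measure_def]
  show 1: "sets \<mu> = sets borel" by (rule conjunct1[OF h])
  show 2: "emeasure \<mu> UNIV = 1" by (rule conjunct1[OF conjunct2[OF h]])
  show "B \<in> sets borel \<Longrightarrow> emeasure \<mu> ((+) g ` B) = emeasure \<mu> B"
    using conjunct1[OF conjunct2[OF conjunct2[OF h]]] by blast
  show sp: "space \<mu> = UNIV" using sets_eq_imp_space_eq[OF 1] by simp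
  show "finite_measure \<mu>" by (rule finite_measureI) (simp add: sp 2)
qed

lemma simple_integrableI:
  assumes "normalized_haar_measure \<mu>" "simple_function \<mu> s"
  shows "simple_integrable \<mu> s"
  using assms(2) finite_measure.emeasure_finite[OF normalized_haar_measureD(4)[OF assms(1)]]
  by (auto intro: Bochner_Integration.simple_bochner_integrable.intros)

lemma simple_integrableD: "simple_integrable \<mu> s \<Longrightarrow> simple_function \<mu> s"
  by (auto elim: Bochner_Integration.simple_bochner_integrable.cases)

lemma simple_integrable_diff:
  "simple_integrable \<mu> s \<Longrightarrow> simple_integrable \<mu> t \<Longrightarrow> simple_integrable \<mu> (\<lambda>g. s g - t g)"
  by (rule Bochner_Integration.simple_bochner_integrable_compose2[where p = "\<lambda>x y. x - y"]) auto

lemma norm_simple_integral_diff_le: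
  assumes s: "simple_integrable \<mu> s" and t: "simple_integrable \<mu> t"
  shows "ennreal (norm (simple_integral \<mu> s - simple_integral \<mu> t)) \<le> (\<integral>\<^sup>+ g. norm (s g - t g) \<partial>\<mu>)"
proof -
  note d = simple_integrable_diff[OF s t]
  have n: "simple_integrable \<mu> (\<lambda>g. norm (s g - t g))"
    using d simple_integrableD[OF d]
    by (auto elim!: Bochner_Integration.simple_bochner_integrable.cases
        intro!: Bochner_Integration.simple_bochner_integrable.intros simple_function_compose1[where g = norm])
  have "norm (simple_integral \<mu> s - simple_integral \<mu> t) \<le> simple_integral \<mu> (\<lambda>g. norm (s g - t g))"
    using Bochner_Integration.simple_bochner_integral_norm_bound[OF d]
    by (simp add: Bochner_Integration.simple_bochner_integral_diff[OF s t])
  then have "ennreal (norm (simple_integral \<mu> s - simple_integral \<mu> t)) \<le> ennreal (simple_integral \<mu> (\<lambda>g. norm (s g - t g)))"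
    by (rule ennreal_leI)
  also have "\<dots> = (\<integral>\<^sup>+ g. norm (s g - t g) \<partial>\<mu>)"
    by (rule Bochner_Integration.simple_bochner_integral_eq_nn_integral[OF n]) simp
  finally show ?thesis .
qed

lemma norm_simple_integral_diff_le_uniform:
  assumes \<mu>: "normalized_haar_measure \<mu>" and s: "simple_integrable \<mu> s" and t: "simple_integrable \<mu> t"
    and c: "\<And>g. norm (s g - t g) \<le> c"
  shows "norm (simple_integral \<mu> s - simple_integral \<mu> t) \<le> c"
proof -
  have c0: "0 \<le> c" using c[of undefined] norm_ge_zero order_trans by blast
  have "ennreal (norm (simple_integral \<mu> s - simple_integral \<mu> t)) \<le> (\<integral>\<^sup>+ g. norm (s g - t g) \<partial>\<mu>)"
    by (rule norm_simple_integral_diff_le[OF s t])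
  also have "\<dots> \<le> (\<integral>\<^sup>+ g. ennreal c \<partial>\<mu>)" by (intro nn_integral_mono ennreal_leI c)
  also have "\<dots> = ennreal c" using normalized_haar_measureD[OF \<mu>] by simp
  finally show ?thesis using c0 by simp
qed

lemma has_uniform_integral_unique:
  assumes \<mu>: "normalized_haar_measure \<mu>" and f: "has_uniform_integral \<mu> f x" "has_uniform_integral \<mu> f y"
  shows "x = y"
proof -
  have "norm (x - y) \<le> e" if e: "e > 0" for e
  proof -
    have d: "e / 4 > 0" using e by simp
    obtain s where s: "simple_integrable \<mu> s" "range s \<subseteq> range f" "\<And>g. norm (f g - s g) \<le> e / 4" "norm (simple_integral \<mu> s - x) \<le> e / 4"
      by (rule has_uniform_integralE[OF f(1) d]) (rule that)
    obtain t where t: "simple_integrable \<mu> t" "range t \<subseteq> range f" "\<And>g. norm (f g - t g) \<le> e / 4" "norm (simple_integral \<mu> t - y) \<le> e / 4"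
      by (rule has_uniform_integralE[OF f(2) d]) (rule that)
    have "norm (s g - t g) \<le> e / 2" for g
      using norm_triangle_ineq4[of "f g - t g" "f g - s g"] s(3)[of g] t(3)[of g] by simp
    then have "norm (simple_integral \<mu> s - simple_integral \<mu> t) \<le> e / 2"
      by (rule norm_simple_integral_diff_le_uniform[OF \<mu> s(1) t(1)])
    moreover have "x - y = (simple_integral \<mu> s - simple_integral \<mu> t) - (simple_integral \<mu> s - x) + (simple_integral \<mu> t - y)"
      by simp
    ultimately show ?thesis
      using s(4) t(4) norm_triangle_ineq[of "(simple_integral \<mu> s - simple_integral \<mu> t) - (simple_integral \<mu> s - x)" "simple_integral \<mu> t - y"]
        norm_triangle_ineq4[of "simple_integral \<mu> s - simple_integral \<mu> t" "simple_integral \<mu> s - x"] by simp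
  qed
  then have "norm (x - y) \<le> 0" by (rule field_le_epsilon[of _ 0, simplified])
  then show ?thesis by simp
qed

text \<open>The range is compact, so it has a finite net of values of \<open>f\<close>; the least
  index of a net point close to \<open>f g\<close> is a measurable choice because the conditions are
  open.\<close>

lemma continuous_simple_approximation:
  fixes f :: "'g::{topological_group_add,t2_space} \<Rightarrow> 'b::real_normed_vector"
  assumes G: "compact (UNIV :: 'g set)" and \<mu>: "normalized_haar_measure \<mu>"
    and f: "continuous_on UNIV f" and \<delta>: "\<delta> > 0"
  obtains s where "simple_integrable \<mu> s" "range s \<subseteq> range f" "\<And>g. norm (f g - s g) \<le> \<delta>"
proof -
  have c: "compact (range f)" by (rule compact_continuous_image[OF f G])
  have "range f \<subseteq> (\<Union>x\<in>range f. ball x \<delta>)" using \<delta> by auto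
  then obtain k where k: "finite k" "k \<subseteq> range f" "range f \<subseteq> (\<Union>x\<in>k. ball x \<delta>)"
    by (rule compactE_image[OF c, of "range f" "\<lambda>x. ball x \<delta>", rotated]) (simp, blast)
  obtain n and d :: "nat \<Rightarrow> 'b" where d: "k = d ` {i. i < n}"
    using finite_imp_nat_seg_image_inj_on[OF k(1)] by blast
  define P where "P i g \<longleftrightarrow> i < n \<and> dist (d i) (f g) < \<delta>" for i g
  define N where "N g = (LEAST i. P i g)" for g
  have ex: "\<exists>i. P i g" for g
  proof -
    have "f g \<in> (\<Union>x\<in>k. ball x \<delta>)" using k(3) by blast
    then show ?thesis unfolding d P_def by auto
  qed
  have PN: "P (N g) g" for g unfolding N_def using ex by (rule LeastI_ex)
  have Pm: "Measurable.pred \<mu> (P i)" for i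
  proof -
    have "open {g. dist (d i) (f g) < \<delta>}" by (intro open_Collect_less continuous_intros f)
    then have "{g. P i g} \<in> sets \<mu>"
      unfolding P_def normalized_haar_measureD(1)[OF \<mu>] by (cases "i < n") auto
    then show ?thesis unfolding pred_def normalized_haar_measureD(2)[OF \<mu>] by simp
  qed
  have Nm: "N \<in> measurable \<mu> (count_space UNIV)" unfolding N_def by (rule measurable_Least[OF Pm])
  have "simple_function \<mu> N"
    unfolding simple_function_def
  proof
    have "N ` space \<mu> \<subseteq> {..<n}" using PN unfolding P_def by auto
    then show "finite (N ` space \<mu>)" by (rule finite_subset) simp
    show "\<forall>x\<in>N ` space \<mu>. N -` {x} \<inter> space \<mu> \<in> sets \<mu>"
      using measurable_sets[OF Nm] by auto
  qed
  then have "simple_function \<mu> (d \<circ> N)" by (rule simple_function_compose)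
  then have "simple_integrable \<mu> (d \<circ> N)" by (rule simple_integrableI[OF \<mu>])
  moreover have "range (d \<circ> N) \<subseteq> range f" using PN k(2) unfolding d P_def by auto
  moreover have "norm (f g - (d \<circ> N) g) \<le> \<delta>" for g
    using PN[of g] unfolding P_def by (simp add: dist_norm norm_minus_commute)
  ultimately show ?thesis by (rule that)
qed

lemma has_uniform_integral_exists:
  fixes f :: "'g::{topological_group_add,t2_space} \<Rightarrow> 'b::banach"
  assumes G: "compact (UNIV :: 'g set)" and \<mu>: "normalized_haar_measure \<mu>" and f: "continuous_on UNIV f"
  shows "\<exists>x. has_uniform_integral \<mu> f x"
proof -
  have "\<exists>s. simple_integrable \<mu> s \<and> range s \<subseteq> range f \<and> (\<forall>g. norm (f g - s g) \<le> 1 / Suc n)" for n :: nat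
    by (rule continuous_simple_approximation[OF G \<mu> f, of "1 / Suc n"]) (simp, blast)
  then obtain s where s: "\<And>n. simple_integrable \<mu> (s n)" "\<And>n. range (s n) \<subseteq> range f"
      "\<And>n g. norm (f g - s n g) \<le> 1 / Suc n" by metis
  have diff: "norm (simple_integral \<mu> (s m) - simple_integral \<mu> (s n)) \<le> 1 / Suc m + 1 / Suc n" for m n
  proof (rule norm_simple_integral_diff_le_uniform[OF \<mu> s(1) s(1)])
    show "norm (s m g - s n g) \<le> 1 / Suc m + 1 / Suc n" for g
      using norm_triangle_ineq4[of "f g - s n g" "f g - s m g"] s(3)[of g n] s(3)[of g m] by simp
  qed
  have small: "\<exists>M. \<forall>n\<ge>M. 1 / real (Suc n) < e" if e: "e > 0" for e
  proof -
    obtain M where M: "inverse (real (Suc M)) < e" using reals_Archimedean[OF e] by blast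
    have "1 / real (Suc n) < e" if "n \<ge> M" for n
      using M frac_le[of 1 1 "real (Suc M)" "real (Suc n)"] that by (simp add: inverse_eq_divide)
    then show ?thesis by blast
  qed
  have "Cauchy (\<lambda>n. simple_integral \<mu> (s n))"
  proof (rule CauchyI)
    fix e :: real assume "e > 0"
    then obtain M where M: "\<And>n. n \<ge> M \<Longrightarrow> 1 / real (Suc n) < e / 2" using small[of "e / 2"] by auto
    show "\<exists>M. \<forall>m\<ge>M. \<forall>n\<ge>M. norm (simple_integral \<mu> (s m) - simple_integral \<mu> (s n)) < e"
      using M diff by (intro exI[of _ M]) (smt (verit) field_sum_of_halves)
  qed
  then obtain x where x: "(\<lambda>n. simple_integral \<mu> (s n)) \<longlonglongrightarrow> x"
    using Cauchy_convergent unfolding convergent_def by blast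
  have "has_uniform_integral \<mu> f x"
    unfolding has_uniform_integral_def
  proof (intro allI impI)
    fix e :: real assume e: "e > 0"
    obtain M where M: "\<And>n. n \<ge> M \<Longrightarrow> 1 / real (Suc n) < e" using small[OF e] by auto
    obtain M' where M': "\<And>n. n \<ge> M' \<Longrightarrow> norm (simple_integral \<mu> (s n) - x) < e" using LIMSEQ_D[OF x e] by blast
    let ?n = "max M M'"
    have "norm (f g - s ?n g) \<le> e" for g using s(3)[of g ?n] M[of ?n] by simp
    then show "\<exists>s. simple_integrable \<mu> s \<and> range s \<subseteq> range f \<and> (\<forall>g. norm (f g - s g) \<le> e) \<and>
        norm (simple_integral \<mu> s - x) \<le> e"
      using s(1,2)[of ?n] M'[of ?n] by (intro exI[of _ "s ?n"]) auto
  qed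
  then show ?thesis ..
qed

lemma has_uniform_integral_linear:
  assumes T: "bounded_linear T" and f: "has_uniform_integral \<mu> f x"
  shows "has_uniform_integral \<mu> (\<lambda>g. T (f g)) (T x)"
  unfolding has_uniform_integral_def
proof (intro allI impI)
  fix \<delta> :: real assume \<delta>: "\<delta> > 0"
  obtain K where K: "K > 0" "\<And>y. norm (T y) \<le> norm y * K" using bounded_linear.pos_bounded[OF T] by blast
  obtain s where s: "simple_integrable \<mu> s" "range s \<subseteq> range f" "\<And>g. norm (f g - s g) \<le> \<delta> / K"
      "norm (simple_integral \<mu> s - x) \<le> \<delta> / K"
    by (rule has_uniform_integralE[OF f divide_pos_pos[OF \<delta> K(1)]]) (rule that)
  have le: "norm (T a - T b) \<le> \<delta>" if "norm (a - b) \<le> \<delta> / K" for a b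
    using K(2)[of "a - b"] mult_right_mono[OF that, of K] K(1) linear_diff[OF bounded_linear.linear[OF T], of a b]
    by simp
  have T0: "T 0 = 0" using linear_0[OF bounded_linear.linear[OF T]] .
  have "simple_integrable \<mu> (\<lambda>g. T (s g))"
    by (rule Bochner_Integration.simple_bochner_integrable_compose2[where p = "\<lambda>x y. T x", OF T0 s(1) s(1)])
  moreover have "simple_integral \<mu> (\<lambda>g. T (s g)) = T (simple_integral \<mu> s)"
    by (rule Bochner_Integration.simple_bochner_integral_linear[OF bounded_linear.linear[OF T] s(1)])
  moreover have "range (\<lambda>g. T (s g)) \<subseteq> range (\<lambda>g. T (f g))"
  proof
    fix y assume "y \<in> range (\<lambda>g. T (s g))"
    then obtain g where y: "y = T (s g)" by (rule rangeE)
    have "s g \<in> range f" by (rule subsetD[OF s(2) rangeI])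
    then obtain g' where "s g = f g'" by (rule rangeE)
    then show "y \<in> range (\<lambda>g. T (f g))" unfolding y by (intro image_eqI[of _ _ g']) auto
  qed
  ultimately show "\<exists>s. simple_integrable \<mu> s \<and> range s \<subseteq> range (\<lambda>g. T (f g)) \<and>
      (\<forall>g. norm (T (f g) - s g) \<le> \<delta>) \<and> norm (simple_integral \<mu> s - T x) \<le> \<delta>"
    using le s(3,4) by (intro exI[of _ "\<lambda>g. T (s g)"]) simp
qed

lemma has_uniform_integral_translate:
  fixes f :: "'g::{topological_group_add,t2_space} \<Rightarrow> 'b::real_normed_vector"
  assumes \<mu>: "normalized_haar_measure \<mu>" and f: "has_uniform_integral \<mu> f x"
  shows "has_uniform_integral \<mu> (\<lambda>g. f (h + g)) x"
  unfolding has_uniform_integral_def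
proof (intro allI impI)
  fix \<delta> :: real assume \<delta>: "\<delta> > 0"
  note m = normalized_haar_measureD[OF \<mu>]
  obtain s where s: "simple_integrable \<mu> s" "range s \<subseteq> range f" "\<And>g. norm (f g - s g) \<le> \<delta>"
      "norm (simple_integral \<mu> s - x) \<le> \<delta>"
    by (rule has_uniform_integralE[OF f \<delta>]) (rule that)
  have sf: "finite (range s)" "\<And>v. s -` {v} \<in> sets borel"
  proof -
    show "finite (range s)" using simple_integrableD[OF s(1)] m(2) unfolding simple_function_def by simp
    show "s -` {v} \<in> sets borel" for v
    proof (cases "v \<in> range s")
      case True
      then show ?thesis using simple_integrableD[OF s(1)] m(1,2) unfolding simple_function_def by auto
    next
      case False
      then have "s -` {v} = {}" by auto
      then show ?thesis by simp
    qed
  qed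
  have tr: "(\<lambda>g. s (h + g)) -` {v} = (+) (- h) ` (s -` {v})" for v
  proof -
    have "g \<in> (+) (- h) ` (s -` {v})" if "s (h + g) = v" for g
      using that by (intro image_eqI[of _ _ "h + g"]) (auto simp flip: add.assoc)
    then show ?thesis by (auto simp flip: add.assoc)
  qed
  have "((+) h) -` (s -` {v}) \<inter> space borel \<in> sets borel" for v
    by (rule measurable_sets[OF borel_measurable_continuous_onI[OF continuous_on_add[OF continuous_on_const continuous_on_id]] sf(2)])
  then have tm: "(\<lambda>g. s (h + g)) -` {v} \<in> sets borel" for v by (simp add: vimage_def)
  have rng: "range (\<lambda>g. s (h + g)) = range s"
  proof -
    have "s g \<in> range (\<lambda>g. s (h + g))" for g
      by (rule image_eqI[of _ _ "- h + g"]) (simp_all flip: add.assoc)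
    then show ?thesis by blast
  qed
  have "simple_function \<mu> (\<lambda>g. s (h + g))"
    unfolding simple_function_def m(1,2) using rng sf(1) tm by auto
  then have 1: "simple_integrable \<mu> (\<lambda>g. s (h + g))" by (rule simple_integrableI[OF \<mu>])
  have "measure \<mu> {g. s (h + g) = v} = measure \<mu> {g. s g = v}" for v
    using m(5)[OF sf(2)[of v], of "- h"] tr[of v] unfolding measure_def vimage_def by simp
  then have 2: "simple_integral \<mu> (\<lambda>g. s (h + g)) = simple_integral \<mu> s"
    unfolding Bochner_Integration.simple_bochner_integral_def m(2) rng by simp
  have "range (\<lambda>g. s (h + g)) \<subseteq> range (\<lambda>g. f (h + g))"
  proof -
    have "f g \<in> range (\<lambda>g. f (h + g))" for g
      by (rule image_eqI[of _ _ "- h + g"]) (simp_all flip: add.assoc)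
    then have "range f \<subseteq> range (\<lambda>g. f (h + g))" by blast
    then show ?thesis using s(2) rng by blast
  qed
  then show "\<exists>s. simple_integrable \<mu> s \<and> range s \<subseteq> range (\<lambda>g. f (h + g)) \<and>
      (\<forall>g. norm (f (h + g) - s g) \<le> \<delta>) \<and> norm (simple_integral \<mu> s - x) \<le> \<delta>"
    using 1 2 s(3,4) by (intro exI[of _ "\<lambda>g. s (h + g)"]) auto
qed

lemma sum_in_closed_subspace:
  "closed_subspace B \<Longrightarrow> (\<And>i. i \<in> A \<Longrightarrow> f i \<in> B) \<Longrightarrow> sum f A \<in> B"
  by (induction A rule: infinite_finite_induct) (auto simp: closed_subspaceD)

lemma has_uniform_integral_mem:
  assumes \<mu>: "normalized_haar_measure \<mu>" and f: "has_uniform_integral \<mu> f x"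
    and B: "closed_subspace B" "\<And>g. f g \<in> B"
  shows "x \<in> B"
proof (rule closed_approachable_mem)
  show "closed B" using B(1) unfolding closed_subspace_def by blast
  fix \<epsilon> :: real assume "\<epsilon> > 0"
  then have e: "\<epsilon> / 2 > 0" by simp
  obtain s where s: "simple_integrable \<mu> s" "range s \<subseteq> range f" "\<And>g. norm (f g - s g) \<le> \<epsilon> / 2"
      "norm (simple_integral \<mu> s - x) \<le> \<epsilon> / 2"
    by (rule has_uniform_integralE[OF f e]) (rule that)
  have "v \<in> B" if "v \<in> s ` space \<mu>" for v
  proof -
    have "v \<in> range f" using s(2) that by blast
    then show ?thesis using B(2) by blast
  qed
  then have "simple_integral \<mu> s \<in> B"
    unfolding Bochner_Integration.simple_bochner_integral_def
    by (intro sum_in_closed_subspace[OF B(1)] closed_subspaceD(4)[OF B(1)])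
  moreover have "norm (x - simple_integral \<mu> s) < \<epsilon>" using s(4) e by (simp add: norm_minus_commute)
  ultimately show "\<exists>y\<in>B. norm (x - y) < \<epsilon>" by blast
qed

lemma has_uniform_integral_norm_le:
  fixes f :: "'g::{topological_group_add,t2_space} \<Rightarrow> 'b::real_normed_vector"
  assumes \<mu>: "normalized_haar_measure \<mu>" and f: "has_uniform_integral \<mu> f x" and c: "\<And>g. norm (f g) \<le> c"
  shows "norm x \<le> c"
proof (rule field_le_epsilon)
  fix e :: real assume "e > 0"
  obtain s where s: "simple_integrable \<mu> s" "range s \<subseteq> range f" "\<And>g. norm (f g - s g) \<le> e"
      "norm (simple_integral \<mu> s - x) \<le> e"
    by (rule has_uniform_integralE[OF f \<open>e > 0\<close>]) (rule that)
  have z: "simple_integrable \<mu> (\<lambda>_. 0 :: 'b)"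
    by (rule simple_integrableI[OF \<mu>]) simp
  have z0: "simple_integral \<mu> (\<lambda>_. 0 :: 'b) = 0"
    unfolding Bochner_Integration.simple_bochner_integral_def by (rule sum.neutral) auto
  have "norm (s g - 0) \<le> c" for g 
  proof -
    have "s g \<in> range f" by (rule subsetD[OF s(2) rangeI])
    then show ?thesis using c by auto
  qed
  then have "norm (simple_integral \<mu> s - simple_integral \<mu> (\<lambda>_. 0)) \<le> c"
    by (rule norm_simple_integral_diff_le_uniform[OF \<mu> s(1) z])
  then show "norm x \<le> c + e"
    using s(4) norm_triangle_ineq4[of "simple_integral \<mu> s" "simple_integral \<mu> s - x"] z0 by simp
qed

text \<open>Connects the integral occurring in \<open>spectral_subspace\<close> with the uniform
  one: approximations in mean and uniform approximations are compared through their simple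
  integrals.\<close>

lemma has_vector_integral_unique_uniform:
  assumes \<mu>: "normalized_haar_measure \<mu>" and f: "has_vector_integral \<mu> f x" "has_uniform_integral \<mu> f y"
  shows "x = y"
proof -
  obtain t where fm: "f \<in> borel_measurable \<mu>" and t: "\<And>i. simple_integrable \<mu> (t i)"
      "(\<lambda>i. \<integral>\<^sup>+ g. norm (f g - t i g) \<partial>\<mu>) \<longlonglongrightarrow> 0" "(\<lambda>i. simple_integral \<mu> (t i)) \<longlonglongrightarrow> x"
    using f(1) unfolding has_vector_integral_def by blast
  note m = normalized_haar_measureD[OF \<mu>]
  \<comment> \<open>The algebra may be nonseparable, so measurability is checked separately for each
    of the finitely many values \<open>v\<close> of \<open>t i\<close>:
    \<open>norm (f g - v)\<close> is a continuous function of \<open>f g\<close>.\<close>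
  have meas: "(\<lambda>g. ennreal (norm (f g - t i g))) \<in> borel_measurable \<mu>" for i
  proof -
    have tm: "t i \<in> measurable \<mu> (count_space (range (t i)))"
    proof -
      have "finite (range (t i))" "\<And>v. v \<in> range (t i) \<Longrightarrow> t i -` {v} \<inter> space \<mu> \<in> sets \<mu>"
        using simple_integrableD[OF t(1)[of i]] m(2) unfolding simple_function_def by auto
      then show ?thesis by (subst measurable_count_space_eq2) auto
    qed
    have "(\<lambda>g. norm (f g - v)) \<in> borel_measurable \<mu>" for v
      by (rule borel_measurable_continuous_on[OF _ fm, of "\<lambda>y. norm (y - v)"]) (intro continuous_intros)
    moreover have "countable (range (t i))"
      using simple_integrableD[OF t(1)[of i]] m(2) unfolding simple_function_def by (simp add: countable_finite)
    ultimately have "(\<lambda>g. norm (f g - t i g)) \<in> borel_measurable \<mu>"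
      by (intro measurable_compose_countable'[OF _ tm, of "\<lambda>v g. norm (f g - v)"])
    then show ?thesis by simp
  qed
  have "norm (x - y) \<le> e" if e: "e > 0" for e
  proof -
    have e2: "e / 2 > 0" using e by simp
    obtain s where s: "simple_integrable \<mu> s" "range s \<subseteq> range f" "\<And>g. norm (f g - s g) \<le> e / 2" "norm (simple_integral \<mu> s - y) \<le> e / 2"
      by (rule has_uniform_integralE[OF f(2) e2]) (rule that)
    have le: "ennreal (norm (simple_integral \<mu> (t i) - simple_integral \<mu> s)) \<le> (\<integral>\<^sup>+ g. norm (f g - t i g) \<partial>\<mu>) + ennreal (e / 2)" for i
    proof -
      have "ennreal (norm (simple_integral \<mu> (t i) - simple_integral \<mu> s)) \<le> (\<integral>\<^sup>+ g. norm (t i g - s g) \<partial>\<mu>)"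
        by (rule norm_simple_integral_diff_le[OF t(1) s(1)])
      also have "\<dots> \<le> (\<integral>\<^sup>+ g. ennreal (norm (f g - t i g)) + ennreal (e / 2) \<partial>\<mu>)"
      proof (rule nn_integral_mono)
        fix g
        have "norm (t i g - s g) \<le> norm (f g - t i g) + e / 2"
          using norm_triangle_ineq4[of "f g - s g" "f g - t i g"] s(3)[of g] by simp
        then show "ennreal (norm (t i g - s g)) \<le> ennreal (norm (f g - t i g)) + ennreal (e / 2)"
          using e by (simp flip: ennreal_plus)
      qed
      also have "\<dots> = (\<integral>\<^sup>+ g. norm (f g - t i g) \<partial>\<mu>) + (\<integral>\<^sup>+ g. ennreal (e / 2) \<partial>\<mu>)"
        by (rule nn_integral_add[OF meas]) simp
      also have "(\<integral>\<^sup>+ g. ennreal (e / 2) \<partial>\<mu>) = ennreal (e / 2)" using m by simp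
      finally show ?thesis .
    qed
    have "(\<lambda>i. ennreal (norm (simple_integral \<mu> (t i) - simple_integral \<mu> s))) \<longlonglongrightarrow> ennreal (norm (x - simple_integral \<mu> s))"
      by (intro tendsto_ennrealI tendsto_norm tendsto_diff t tendsto_const)
    moreover have "(\<lambda>i. (\<integral>\<^sup>+ g. norm (f g - t i g) \<partial>\<mu>) + ennreal (e / 2)) \<longlonglongrightarrow> 0 + ennreal (e / 2)"
      by (intro tendsto_add t tendsto_const)
    ultimately have "ennreal (norm (x - simple_integral \<mu> s)) \<le> 0 + ennreal (e / 2)"
      using le by (intro LIMSEQ_le) blast+
    then have "norm (x - simple_integral \<mu> s) \<le> e / 2" using e by simp
    then show ?thesis using s(4) norm_triangle_ineq[of "x - simple_integral \<mu> s" "simple_integral \<mu> s - y"] by simp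
  qed
  then have "norm (x - y) \<le> 0" by (rule field_le_epsilon[of _ 0, simplified])
  then show ?thesis by simp
qed

lemma has_vector_integral_zero: "has_vector_integral \<mu> (\<lambda>_. 0 :: 'b::real_normed_vector) 0"
proof -
  have 1: "simple_integrable \<mu> (\<lambda>_. 0 :: 'b)" by (rule Bochner_Integration.simple_bochner_integrable.intros) auto
  have 2: "simple_integral \<mu> (\<lambda>_. 0 :: 'b) = 0"
    unfolding Bochner_Integration.simple_bochner_integral_def by (rule sum.neutral) auto
  show ?thesis
    unfolding has_vector_integral_def by (intro conjI exI[of _ "\<lambda>_ _. 0"]) (simp_all add: 1 2)
qed

definition haar_integral :: "'g measure \<Rightarrow> ('g \<Rightarrow> 'b::real_normed_vector) \<Rightarrow> 'b" where
  "haar_integral \<mu> f = (THE x. has_uniform_integral \<mu> f x)"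

lemma haar_integral_eq: "normalized_haar_measure \<mu> \<Longrightarrow> has_uniform_integral \<mu> f x \<Longrightarrow> haar_integral \<mu> f = x"
  unfolding haar_integral_def using has_uniform_integral_unique by (intro the_equality) blast+

context
  fixes \<mu> :: "'g::{topological_group_add,t2_space} measure"
  assumes G: "compact (UNIV :: 'g set)" and \<mu>: "normalized_haar_measure \<mu>"
begin

lemma has_haar_integral:
  fixes f :: "'g \<Rightarrow> 'b::banach"
  assumes "continuous_on UNIV f" shows "has_uniform_integral \<mu> f (haar_integral \<mu> f)"
  using has_uniform_integral_exists[OF G \<mu> assms] haar_integral_eq[OF \<mu>] by metis

lemma haar_integral_linear:
  fixes f :: "'g \<Rightarrow> 'b::banach"
  assumes "bounded_linear T" "continuous_on UNIV f"
  shows "haar_integral \<mu> (\<lambda>g. T (f g)) = T (haar_integral \<mu> f)"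
  by (rule haar_integral_eq[OF \<mu> has_uniform_integral_linear[OF assms(1) has_haar_integral[OF assms(2)]]])

text \<open>The sum of uniform approximants of \<open>f\<close> and \<open>h\<close> may leave the
  range of \<open>f + h\<close>, which \<open>has_uniform_integral\<close> forbids. Integrating the
  pair and applying linear maps to it avoids this.\<close>

lemma haar_integral_add:
  fixes f h :: "'g \<Rightarrow> 'b::banach"
  assumes f: "continuous_on UNIV f" and h: "continuous_on UNIV h"
  shows "haar_integral \<mu> (\<lambda>g. f g + h g) = haar_integral \<mu> f + haar_integral \<mu> h"
proof -
  have c: "continuous_on UNIV (\<lambda>g. (f g, h g))" by (intro continuous_intros f h)
  have "haar_integral \<mu> (\<lambda>g. f g + h g) = fst (haar_integral \<mu> (\<lambda>g. (f g, h g))) + snd (haar_integral \<mu> (\<lambda>g. (f g, h g)))"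
    using haar_integral_linear[OF bounded_linear_add[OF bounded_linear_fst bounded_linear_snd] c] by simp
  also have "fst (haar_integral \<mu> (\<lambda>g. (f g, h g))) = haar_integral \<mu> f"
    using haar_integral_linear[OF bounded_linear_fst c] by simp
  also have "snd (haar_integral \<mu> (\<lambda>g. (f g, h g))) = haar_integral \<mu> h"
    using haar_integral_linear[OF bounded_linear_snd c] by simp
  finally show ?thesis .
qed

lemma haar_integral_sum:
  fixes f :: "'i \<Rightarrow> 'g \<Rightarrow> 'b::banach"
  assumes "finite A" "\<And>i. i \<in> A \<Longrightarrow> continuous_on UNIV (f i)"
  shows "haar_integral \<mu> (\<lambda>g. \<Sum>i\<in>A. f i g) = (\<Sum>i\<in>A. haar_integral \<mu> (f i))"
  using assms
proof (induction A rule: finite_induct)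
  case empty
  have "norm (haar_integral \<mu> (\<lambda>g. 0 :: 'b)) \<le> 0"
    by (rule has_uniform_integral_norm_le[OF \<mu> has_haar_integral]) auto
  then show ?case by simp
next
  case (insert i A)
  then show ?case by (simp add: haar_integral_add continuous_on_sum)
qed

lemma haar_integral_translate:
  fixes f :: "'g \<Rightarrow> 'b::banach"
  assumes "continuous_on UNIV f" shows "haar_integral \<mu> (\<lambda>g. f (h + g)) = haar_integral \<mu> f"
  by (rule haar_integral_eq[OF \<mu> has_uniform_integral_translate[OF \<mu> has_haar_integral[OF assms]]])

lemma haar_integral_mem:
  fixes f :: "'g \<Rightarrow> 'b::cstar_algebra"
  assumes "continuous_on UNIV f" "closed_subspace B" "\<And>g. f g \<in> B"
  shows "haar_integral \<mu> f \<in> B"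
  by (rule has_uniform_integral_mem[OF \<mu> has_haar_integral[OF assms(1)] assms(2,3)])

lemma haar_integral_norm_le:
  fixes f :: "'g \<Rightarrow> 'b::banach"
  assumes "continuous_on UNIV f" "\<And>g. norm (f g) \<le> c"
  shows "norm (haar_integral \<mu> f) \<le> c"
  by (rule has_uniform_integral_norm_le[OF \<mu> has_haar_integral[OF assms(1)] assms(2)])

lemma haar_integral_eq_vector_integral:
  fixes f :: "'g \<Rightarrow> 'b::banach"
  assumes "continuous_on UNIV f" "has_vector_integral \<mu> f x"
  shows "haar_integral \<mu> f = x"
  using has_vector_integral_unique_uniform[OF \<mu> assms(2) has_haar_integral[OF assms(1)]] by simp

lemma haar_integral_const:
  fixes x :: "'b::banach"
  shows "haar_integral \<mu> (\<lambda>_. x) = x"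
proof (rule haar_integral_eq[OF \<mu>])
  have s: "simple_integrable \<mu> (\<lambda>_. x)" by (rule simple_integrableI[OF \<mu>]) simp
  have "simple_integral \<mu> (\<lambda>_. x) = measure \<mu> UNIV *\<^sub>R x"
    unfolding Bochner_Integration.simple_bochner_integral_def normalized_haar_measureD(2)[OF \<mu>] by simp
  then have "simple_integral \<mu> (\<lambda>_. x) = x"
    using normalized_haar_measureD(3)[OF \<mu>] by (simp add: measure_def)
  then show "has_uniform_integral \<mu> (\<lambda>_. x) x"
    unfolding has_uniform_integral_def using s by (intro allI impI exI[of _ "\<lambda>_. x"]) auto
qed

end

section \<open>Hereditary subalgebras that are almost fixed\<close>

lemma continuous_on_action:
  fixes \<alpha> :: "'g::topological_group_add \<Rightarrow> 'a::cstar_algebra \<Rightarrow> 'a"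
  assumes \<alpha>: "cstar_dynamical_system \<alpha>" and y: "continuous_on UNIV y"
  shows "continuous_on UNIV (\<lambda>g. \<alpha> g (y g))"
  unfolding continuous_on
proof
  note a = cstar_dynamical_systemD[OF \<alpha>]
  fix h :: 'g
  have "((\<lambda>g. \<alpha> g (y g) - \<alpha> h (y h)) \<longlongrightarrow> 0) (at h)"
  proof (rule Lim_null_comparison)
    have "norm (\<alpha> g (y g) - \<alpha> h (y h)) \<le> norm (y g - y h) + norm (\<alpha> g (y h) - \<alpha> h (y h))" for g
    proof -
      have "\<alpha> g (y g) - \<alpha> h (y h) = \<alpha> g (y g - y h) + (\<alpha> g (y h) - \<alpha> h (y h))"
        by (simp add: star_automorphismD[OF a(1)])
      then show ?thesis using norm_triangle_ineq[of "\<alpha> g (y g - y h)"] a(7) by metis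
    qed
    then show "\<forall>\<^sub>F g in at h. norm (\<alpha> g (y g) - \<alpha> h (y h)) \<le> norm (y g - y h) + norm (\<alpha> g (y h) - \<alpha> h (y h))"
      by simp
    have "(y \<longlongrightarrow> y h) (at h)" using y unfolding continuous_on by auto
    moreover have "((\<lambda>g. \<alpha> g (y h)) \<longlongrightarrow> \<alpha> h (y h)) (at h)"
      using a(3)[of "y h"] unfolding continuous_on by auto
    ultimately have "((\<lambda>g. norm (y g - y h) + norm (\<alpha> g (y h) - \<alpha> h (y h))) \<longlongrightarrow> 0 + 0) (at h)"
      by (intro tendsto_add tendsto_norm_zero LIM_zero)
    then show "((\<lambda>g. norm (y g - y h) + norm (\<alpha> g (y h) - \<alpha> h (y h))) \<longlongrightarrow> 0) (at h)" by simp
  qed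
  then show "((\<lambda>g. \<alpha> g (y g)) \<longlongrightarrow> \<alpha> h (y h)) (at h within UNIV)" by (simp add: LIM_zero_iff)
qed

lemma bounded_linear_action:
  assumes "cstar_dynamical_system \<alpha>" shows "bounded_linear (\<alpha> g)"
  by (rule bounded_linear_intro[of _ 1])
    (simp_all add: star_automorphismD[OF cstar_dynamical_systemD(1)[OF assms]] cstar_dynamical_systemD(7)[OF assms])

lemma bounded_linear_on_action:
  assumes "cstar_dynamical_system \<alpha>" "\<And>x. x \<in> J \<Longrightarrow> \<alpha> g x \<in> J"
  shows "bounded_linear_on J (\<alpha> g)"
proof -
  have "bounded_by J (\<alpha> g) 1" unfolding bounded_by_def using cstar_dynamical_systemD(7)[OF assms(1)] by simp
  then show ?thesis
    unfolding bounded_linear_on_def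
    using assms(2) star_automorphismD[OF cstar_dynamical_systemD(1)[OF assms(1)]] by blast
qed

definition averaged_operator ::
    "'g measure \<Rightarrow> ('g::topological_group_add \<Rightarrow> 'a::cstar_algebra \<Rightarrow> 'a) \<Rightarrow> ('a \<Rightarrow> 'a) \<Rightarrow> 'a \<Rightarrow> 'a" where
  "averaged_operator \<mu> \<alpha> P x = haar_integral \<mu> (\<lambda>g. \<alpha> g (P (\<alpha> (- g) x)))"

context
  fixes \<mu> :: "'g::{topological_group_add,t2_space} measure" and \<alpha> :: "'g \<Rightarrow> 'a::cstar_algebra \<Rightarrow> 'a"
    and J :: "'a set" and P :: "'a \<Rightarrow> 'a"
  assumes G: "compact (UNIV :: 'g set)" and \<mu>: "normalized_haar_measure \<mu>"
    and \<alpha>: "cstar_dynamical_system \<alpha>" and J: "closed_subspace J" "\<And>g x. x \<in> J \<Longrightarrow> \<alpha> g x \<in> J"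
    and P: "selfadjoint_on J P"
begin

lemma continuous_conjugated_operator:
  assumes x: "x \<in> J" shows "continuous_on UNIV (\<lambda>g. \<alpha> g (P (\<alpha> (- g) x)))"
proof (rule continuous_on_action[OF \<alpha>])
  note a = cstar_dynamical_systemD[OF \<alpha>] and p = selfadjoint_onD[OF J(1) P]
  obtain C where C: "bounded_by J P C" using P unfolding selfadjoint_on_def by blast
  have c: "continuous_on UNIV (\<lambda>g. \<alpha> (- g) x)"
    by (rule continuous_on_compose2[OF a(3) continuous_on_minus[OF continuous_on_id]]) simp
  show "continuous_on UNIV (\<lambda>g. P (\<alpha> (- g) x))"
    unfolding continuous_on
  proof
    fix h
    have "((\<lambda>g. P (\<alpha> (- g) x) - P (\<alpha> (- h) x)) \<longlongrightarrow> 0) (at h)"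
    proof (rule Lim_null_comparison)
      have "norm (P (\<alpha> (- g) x) - P (\<alpha> (- h) x)) \<le> C * norm (\<alpha> (- g) x - \<alpha> (- h) x)" for g
        using bounded_byD[OF C closed_subspaceD(5)[OF J(1) J(2)[OF x] J(2)[OF x]], of "- g" "- h"]
          p(5)[OF J(2)[OF x] J(2)[OF x], of "- g" "- h"] by simp
      then show "\<forall>\<^sub>F g in at h. norm (P (\<alpha> (- g) x) - P (\<alpha> (- h) x)) \<le> C * norm (\<alpha> (- g) x - \<alpha> (- h) x)"
        by simp
      have "((\<lambda>g. \<alpha> (- g) x) \<longlongrightarrow> \<alpha> (- h) x) (at h)" using c unfolding continuous_on by auto
      then show "((\<lambda>g. C * norm (\<alpha> (- g) x - \<alpha> (- h) x)) \<longlongrightarrow> 0) (at h)"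
        by (intro tendsto_mult_right_zero tendsto_norm_zero LIM_zero)
    qed
    then show "((\<lambda>g. P (\<alpha> (- g) x)) \<longlongrightarrow> P (\<alpha> (- h) x)) (at h within UNIV)" by (simp add: LIM_zero_iff)
  qed
qed

lemma averaged_operator_selfadjoint: "selfadjoint_on J (averaged_operator \<mu> \<alpha> P)"
proof -
  note a = cstar_dynamical_systemD[OF \<alpha>] and p = selfadjoint_onD[OF J(1) P]
  obtain C where C: "C \<ge> 0" "bounded_by J P C"
    using P bounded_by_nonneg unfolding selfadjoint_on_def by metis
  let ?A = "averaged_operator \<mu> \<alpha> P"
  note cont = continuous_conjugated_operator
  have mem: "?A x \<in> J" if "x \<in> J" for x
    unfolding averaged_operator_def
    by (rule haar_integral_mem[OF G \<mu> cont[OF that] J(1)]) (intro J(2) p(2) that)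
  have sym: "star (?A x) * y = star x * ?A y" if x: "x \<in> J" and y: "y \<in> J" for x y
  proof -
    have l1: "bounded_linear (\<lambda>v::'a. star v * y)"
      by (rule bounded_linear_compose[OF bounded_linear_mult_left bounded_linear_star])
    have "star (?A x) * y = haar_integral \<mu> (\<lambda>g. star (\<alpha> g (P (\<alpha> (- g) x))) * y)"
      unfolding averaged_operator_def using haar_integral_linear[OF G \<mu> l1 cont[OF x]] by simp
    also have "(\<lambda>g. star (\<alpha> g (P (\<alpha> (- g) x))) * y) = (\<lambda>g. star x * \<alpha> g (P (\<alpha> (- g) y)))"
    proof
      fix g
      have "star (\<alpha> g (P (\<alpha> (- g) x))) * y = \<alpha> g (star (P (\<alpha> (- g) x)) * \<alpha> (- g) y)"
        by (simp add: star_automorphismD[OF a(1)] a(6))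
      also have "\<dots> = \<alpha> g (star (\<alpha> (- g) x) * P (\<alpha> (- g) y))"
        using p(3)[OF J(2)[OF x] J(2)[OF y]] by simp
      also have "\<dots> = star x * \<alpha> g (P (\<alpha> (- g) y))"
        by (simp add: star_automorphismD(4)[OF a(1)] a(6) flip: star_automorphismD(5)[OF a(1)])
      finally show "star (\<alpha> g (P (\<alpha> (- g) x))) * y = star x * \<alpha> g (P (\<alpha> (- g) y))" .
    qed
    also have "haar_integral \<mu> (\<lambda>g. star x * \<alpha> g (P (\<alpha> (- g) y))) = star x * ?A y"
      unfolding averaged_operator_def using haar_integral_linear[OF G \<mu> bounded_linear_mult_right cont[OF y]] .
    finally show ?thesis .
  qed
  have "bounded_by J ?A C"
    unfolding bounded_by_def
  proof
    fix x assume x: "x \<in> J"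
    show "norm (?A x) \<le> C * norm x"
      unfolding averaged_operator_def
      by (rule haar_integral_norm_le[OF G \<mu> cont[OF x]])
        (use bounded_byD[OF C(2) J(2)[OF x]] a(7) in simp)
  qed
  then show ?thesis using mem sym unfolding selfadjoint_on_def adjoint_on_def by blast
qed

text \<open>Substituting \<open>h + g\<close> for \<open>g\<close> turns the conjugate by
  \<open>g\<close> into the conjugate by \<open>h + g\<close>, applied to
  \<open>\<alpha> h x\<close>. Everything generated by the average inherits commutation with the
  action.\<close>

lemma averaged_operator_invariant:
  assumes x: "x \<in> J" shows "\<alpha> h (averaged_operator \<mu> \<alpha> P x) = averaged_operator \<mu> \<alpha> P (\<alpha> h x)"
proof -
  note a = cstar_dynamical_systemD[OF \<alpha>]
  have "\<alpha> h (averaged_operator \<mu> \<alpha> P x) = haar_integral \<mu> (\<lambda>g. \<alpha> h (\<alpha> g (P (\<alpha> (- g) x))))"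
    unfolding averaged_operator_def
    using haar_integral_linear[OF G \<mu> bounded_linear_action[OF \<alpha>] continuous_conjugated_operator[OF x]] by simp
  also have "(\<lambda>g. \<alpha> h (\<alpha> g (P (\<alpha> (- g) x)))) = (\<lambda>g. \<alpha> (h + g) (P (\<alpha> (- (h + g)) (\<alpha> h x))))"
  proof
    fix g
    have "\<alpha> (- (h + g)) (\<alpha> h x) = \<alpha> (- g) x" by (simp flip: a(2) add: minus_add)
    then show "\<alpha> h (\<alpha> g (P (\<alpha> (- g) x))) = \<alpha> (h + g) (P (\<alpha> (- (h + g)) (\<alpha> h x)))" by (simp only: a(2))
  qed
  also have "haar_integral \<mu> \<dots> = averaged_operator \<mu> \<alpha> P (\<alpha> h x)"
    unfolding averaged_operator_def
    by (rule haar_integral_translate[OF G \<mu> continuous_conjugated_operator[OF J(2)[OF x]]])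
  finally show ?thesis .
qed

lemma averaged_operator_close:
  assumes x: "x \<in> J" and c: "\<And>g. norm (\<alpha> g (P (\<alpha> (- g) x)) - P x) \<le> c"
  shows "norm (averaged_operator \<mu> \<alpha> P x - P x) \<le> c"
proof -
  note cont = continuous_conjugated_operator[OF x]
  have "haar_integral \<mu> (\<lambda>g. \<alpha> g (P (\<alpha> (- g) x)) + (- P x)) = averaged_operator \<mu> \<alpha> P x + (- P x)"
    unfolding averaged_operator_def
    by (subst haar_integral_add[OF G \<mu> cont]) (simp_all add: haar_integral_const[OF G \<mu>])
  moreover have "norm (haar_integral \<mu> (\<lambda>g. \<alpha> g (P (\<alpha> (- g) x)) + (- P x))) \<le> c"
    by (rule haar_integral_norm_le[OF G \<mu>]) (use c in \<open>auto intro!: continuous_intros cont\<close>)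
  ultimately show ?thesis by simp
qed

end

section \<open>Estimates for an approximating multiplier\<close>

lemma bounded_by_2_of_almost_isometric:
  assumes LM: "adjoint_on J L M" and almost: "\<And>x. x \<in> J \<Longrightarrow> norm (M (L x) - x) \<le> \<epsilon> * norm x"
    and \<epsilon>: "\<epsilon> \<le> 1"
  shows "bounded_by J L 2"
  unfolding bounded_by_def
proof
  fix x assume x: "x \<in> J"
  have "norm (M (L x)) \<le> 2 * norm x"
    using norm_triangle_ineq[of "M (L x) - x" x] almost[OF x] mult_right_mono[OF \<epsilon> norm_ge_zero[of x]] by simp
  then have "norm x * norm (M (L x)) \<le> norm x * (2 * norm x)" by (intro mult_left_mono) auto
  then have "(norm (L x))\<^sup>2 \<le> norm x * (2 * norm x)"
    using norm_adjoint_square_le[OF LM x] by linarith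
  also have "\<dots> \<le> (2 * norm x)\<^sup>2" by (simp add: power2_eq_square)
  finally show "norm (L x) \<le> 2 * norm x" by (rule power2_le_imp_le) simp
qed

text \<open>The difference between conjugate and original has as adjoint the same difference formed
  with \<open>N'\<close>, and bounds pass to adjoints.\<close>

lemma conjugated_adjoint_close:
  assumes \<alpha>: "cstar_dynamical_system \<alpha>" and J: "closed_subspace J" "\<And>g x. x \<in> J \<Longrightarrow> \<alpha> g x \<in> J"
    and N: "adjoint_on J N N'" and b: "\<And>x. x \<in> J \<Longrightarrow> norm (\<alpha> g (N (\<alpha> (- g) x)) - N x) \<le> \<epsilon> * norm x"
    and x: "x \<in> J"
  shows "norm (\<alpha> g (N' (\<alpha> (- g) x)) - N' x) \<le> \<epsilon> * norm x"
proof -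
  note a = cstar_dynamical_systemD[OF \<alpha>] and n = adjoint_onD[OF N]
  define Ng Ng' where "Ng x = \<alpha> g (N (\<alpha> (- g) x))" and "Ng' x = \<alpha> g (N' (\<alpha> (- g) x))" for x
  have mem: "Ng y \<in> J" "Ng' y \<in> J" if "y \<in> J" for y unfolding Ng_def Ng'_def by (intro J(2) n(1,2) that)+
  have "star (Ng v) * w = star v * Ng' w" if "v \<in> J" "w \<in> J" for v w
  proof -
    have "star (Ng v) * w = \<alpha> g (star (N (\<alpha> (- g) v)) * \<alpha> (- g) w)"
      unfolding Ng_def by (simp add: star_automorphismD[OF a(1)] a(6))
    also have "\<dots> = \<alpha> g (star (\<alpha> (- g) v) * N' (\<alpha> (- g) w))" using n(3)[OF J(2) J(2)] that by simp
    also have "\<dots> = star v * Ng' w"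
      unfolding Ng'_def by (simp add: star_automorphismD(4)[OF a(1)] a(6) flip: star_automorphismD(5)[OF a(1)])
    finally show ?thesis .
  qed
  then have "adjoint_on J (\<lambda>y. Ng y - N y) (\<lambda>y. Ng' y - N' y)"
    unfolding adjoint_on_def using mem n closed_subspaceD(5)[OF J(1)]
    by (simp add: star_diff left_diff_distrib right_diff_distrib)
  moreover have "bounded_by J (\<lambda>y. Ng y - N y) \<epsilon>" unfolding bounded_by_def Ng_def using b by blast
  ultimately have "bounded_by J (\<lambda>y. Ng' y - N' y) \<epsilon>" by (rule bounded_by_adjoint)
  then show ?thesis using x unfolding bounded_by_def Ng'_def by blast
qed

text \<open>
  If \<open>r\<close> is an approximate eigenvalue of \<open>L + L\<^sup>*\<close>, then one of the roots of \<open>\<zeta>\<^sup>2 - r \<zeta> + 1\<close> is one of \<open>L\<close>.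
\<close>

lemma approximate_eigenvalue_unitary:
  assumes J: "closed_subspace J" "J \<noteq> {0}" and L: "adjoint_on J L M" and L2: "bounded_by J L 2"
    and LM: "\<And>x. x \<in> J \<Longrightarrow> norm (L (M x) - x) \<le> \<epsilon> * norm x" and \<epsilon>: "\<epsilon> > 0" "3 * \<epsilon> = \<sigma>\<^sup>2" "\<sigma> > 0"
  obtains \<zeta> z where "z \<in> J" "z \<noteq> 0" "norm (L z - \<zeta> *\<^sub>C z) \<le> \<sigma> * norm z"
proof -
  note l = adjoint_onD[OF L] and ll = adjoint_on_linear[OF J(1) L]
  note k = closed_subspaceD[OF J(1)]
  define H where "H x = L x + M x" for x
  have "adjoint_on J H H"
    unfolding adjoint_on_def H_def using l k(2) by (simp add: star_add distrib_left distrib_right add.commute)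
  moreover have "bounded_by J H 4"
    unfolding bounded_by_def H_def
  proof
    fix x assume x: "x \<in> J"
    show "norm (L x + M x) \<le> 4 * norm x"
      using norm_triangle_ineq[of "L x" "M x"] bounded_byD[OF L2 x] bounded_byD[OF bounded_by_adjoint[OF L L2] x] by simp
  qed
  ultimately have H: "selfadjoint_on J H" unfolding selfadjoint_on_def by blast
  obtain r y where y: "y \<in> J" "y \<noteq> 0" "norm (H y - r *\<^sub>R y) \<le> \<epsilon> * norm y"
    by (rule approximate_eigenvalue[OF J(1) H J(2) \<epsilon>(1)]) (rule that)
  define d where "d = csqrt (complex_of_real (r\<^sup>2 - 4))"
  have d2: "d * d = complex_of_real (r\<^sup>2 - 4)" unfolding d_def by (simp flip: power2_eq_square)
  define \<zeta>1 \<zeta>2 where "\<zeta>1 = (of_real r + d) / 2" and "\<zeta>2 = (of_real r - d) / 2"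
  have sum: "\<zeta>1 + \<zeta>2 = of_real r" unfolding \<zeta>1_def \<zeta>2_def by (simp add: field_simps)
  have "\<zeta>1 * \<zeta>2 = (of_real r * of_real r - d * d) / 4" unfolding \<zeta>1_def \<zeta>2_def by (simp add: field_simps)
  also have "\<dots> = 1" unfolding d2 by (simp add: power2_eq_square)
  finally have prod: "\<zeta>1 * \<zeta>2 = 1" .
  \<comment> \<open>\<open>(L - \<zeta>1) (L - \<zeta>2) y\<close> equals
    \<open>L (H y - r y) - (L (M y) - y)\<close>, of norm at most
    \<open>3 * \<epsilon> * norm y = \<sigma>^2 * norm y\<close>. Hence one of the two factors
    shrinks its argument to a \<sigma>-fraction: the second at \<open>y\<close>, or the first at
    \<open>w\<close>.\<close>
  define w where "w = L y - \<zeta>2 *\<^sub>C y"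
  have w: "w \<in> J" unfolding w_def by (intro k(5) l(1) k(3) y(1))
  have "L w - \<zeta>1 *\<^sub>C w = L (L y) - (\<zeta>1 + \<zeta>2) *\<^sub>C L y + (\<zeta>1 * \<zeta>2) *\<^sub>C y"
    unfolding w_def using ll(4)[OF l(1)[OF y(1)] k(3)[OF y(1)]] ll(2)[OF y(1)]
    by (simp add: scaleC_diff_right scaleC_add_left scaleC_scaleC)
  also have "\<dots> = L (L y) - r *\<^sub>R L y + y" unfolding sum prod by (simp add: scaleC_of_real)
  also have "\<dots> = L (H y - r *\<^sub>R y) - (L (M y) - y)"
    unfolding H_def using ll(4)[OF k(2)[OF l(1)[OF y(1)] l(2)[OF y(1)]] k(4)[OF y(1)]]
      ll(1)[OF l(1)[OF y(1)] l(2)[OF y(1)]] ll(3)[OF y(1)] by simp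
  finally have "norm (L w - \<zeta>1 *\<^sub>C w) \<le> norm (L (H y - r *\<^sub>R y)) + norm (L (M y) - y)"
    by (simp add: norm_triangle_ineq4)
  also have "norm (L (H y - r *\<^sub>R y)) \<le> 2 * norm (H y - r *\<^sub>R y)"
    unfolding H_def by (rule bounded_byD[OF L2 k(5)[OF k(2)[OF l(1)[OF y(1)] l(2)[OF y(1)]] k(4)[OF y(1)]]])
  also have "\<dots> \<le> 2 * (\<epsilon> * norm y)" using y(3) by simp
  also have "norm (L (M y) - y) \<le> \<epsilon> * norm y" by (rule LM[OF y(1)])
  finally have "norm (L w - \<zeta>1 *\<^sub>C w) \<le> 2 * (\<epsilon> * norm y) + \<epsilon> * norm y" by simp
  moreover have "3 * (\<epsilon> * norm y) = \<sigma> * (\<sigma> * norm y)" by (metis \<epsilon>(2) mult.assoc power2_eq_square)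
  ultimately have fin: "norm (L w - \<zeta>1 *\<^sub>C w) \<le> \<sigma> * (\<sigma> * norm y)"
    by linarith
  show ?thesis
  proof (cases "norm w \<le> \<sigma> * norm y")
    case True
    show ?thesis by (rule that[OF y(1,2), of \<zeta>2]) (use True in \<open>simp add: w_def\<close>)
  next
    case False
    then have "w \<noteq> 0" using \<epsilon>(3) by auto
    moreover have "norm (L w - \<zeta>1 *\<^sub>C w) \<le> \<sigma> * norm w"
      using fin False \<epsilon>(3) by (smt (verit) mult_left_mono)
    ultimately show ?thesis by (rule that[OF w])
  qed
qed

text \<open>If \<open>b = star w * w + star v * v\<close> annihilates \<open>E y\<close>, then
  \<open>star (w * E y) * (w * E y)\<close> and its counterpart for \<open>v\<close> add up to 0, so
  \<open>w * E y = 0\<close>; this is heredity. The subalgebra is nonzero because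
  \<open>D E = 0\<close>, the adjoint form of \<open>E D = 0\<close>, puts
  \<open>D x * star (D x)\<close> into it. Invariance comes from the commutation of \<open>E\<close>
  with the action.\<close>

lemma annihilator_hereditary:
  fixes J :: "'a::cstar_algebra set"
  assumes \<alpha>: "cstar_dynamical_system \<alpha>" and J: "closed_ideal J" "\<And>g x. x \<in> J \<Longrightarrow> \<alpha> g x \<in> J"
    and D: "adjoint_on J D D" and E: "adjoint_on J E E"
    and inv: "\<And>g x. x \<in> J \<Longrightarrow> \<alpha> g (E x) = E (\<alpha> g x)"
    and ED: "\<And>x. x \<in> J \<Longrightarrow> E (D x) = 0" and D0: "\<exists>x\<in>J. D x \<noteq> 0"
  shows "{x. \<forall>y\<in>J. x * E y = 0 \<and> star x * E y = 0} \<in> invariant_hereditary_subalgebras \<alpha>"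
    (is "?B \<in> _")
proof -
  note a = cstar_dynamical_systemD[OF \<alpha>] and e = adjoint_onD[OF E] and d = adjoint_onD[OF D]
  have "complex_subspace ?B"
    unfolding complex_subspace_def
    by (auto simp: star_add distrib_right mult_scaleC_left star_scaleC)
  moreover have "closed ?B"
  proof -
    have eq: "?B = (\<Inter>y\<in>J. {x. x * E y = 0} \<inter> {x. star x * E y = 0})" by auto
    have "continuous_on UNIV (star :: 'a \<Rightarrow> 'a)"
      by (rule bounded_linear.continuous_on[OF bounded_linear_star continuous_on_id])
    then show ?thesis unfolding eq
      by (intro closed_INT ballI closed_Int closed_Collect_eq continuous_intros)
  qed
  moreover have "star x \<in> ?B" if "x \<in> ?B" for x using that by (simp add: star_star)
  moreover have "x * y \<in> ?B" if xy: "x \<in> ?B" "y \<in> ?B" for x y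
  proof -
    have "x * y * E z = 0" "star (x * y) * E z = 0" if "z \<in> J" for z
      using xy that by (simp_all add: star_mult mult.assoc)
    then show ?thesis by blast
  qed
  ultimately have sub: "cstar_subalgebra ?B" unfolding cstar_subalgebra_def by blast
  have her: "x \<in> ?B" if b: "b \<in> ?B" and pos: "positive_element x" "positive_element (b - x)" for x b
  proof -
    obtain w v where w: "x = star w * w" and v: "b - x = star v * v"
      using pos unfolding positive_element_def by blast
    have "b = x + (b - x)" by simp
    then have bb: "b = star w * w + star v * v" unfolding v unfolding w .
    have x0: "x * E y = 0" if "y \<in> J" for y
    proof -
      have "star (w * E y) * (w * E y) + star (v * E y) * (v * E y) = star (E y) * (b * E y)"
        unfolding bb by (simp add: star_mult mult.assoc distrib_left distrib_right)
      also have "b * E y = 0" using b that by blast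
      finally have "star (w * E y) * (w * E y) + star (v * E y) * (v * E y) = 0" by simp
      then have "w * E y = 0" by (rule sum_star_mult_self_eq_0)
      then show ?thesis unfolding w by (simp add: mult.assoc)
    qed
    moreover have "star x = x" unfolding w by (simp add: star_mult star_star)
    ultimately show ?thesis by simp
  qed
  have DE: "D (E y) = 0" if y: "y \<in> J" for y
  proof -
    have zDE: "star z * D (E y) = 0" if z: "z \<in> J" for z
    proof -
      have "star z * D (E y) = star (D z) * E y" by (rule d(3)[OF z e(1)[OF y], symmetric])
      also have "\<dots> = star (E (D z)) * y" by (rule e(3)[OF d(1)[OF z] y, symmetric])
      finally show ?thesis using ED[OF z] by simp
    qed
    have "star (D (E y)) * D (E y) = 0" by (rule zDE[OF d(1)[OF e(1)[OF y]]])
    then show ?thesis by simp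
  qed
  obtain x1 where x1: "x1 \<in> J" "D x1 \<noteq> 0" using D0 by blast
  define b where "b = D x1 * star (D x1)"
  have "b * E y = 0" if y: "y \<in> J" for y
  proof -
    have "star (D x1) * E y = star x1 * D (E y)" by (rule d(3)[OF x1(1) e(1)[OF y]])
    then show ?thesis unfolding b_def using DE[OF y] by (simp add: mult.assoc)
  qed
  moreover have "star b = b" unfolding b_def by (simp add: star_mult star_star)
  ultimately have "b \<in> ?B" by simp
  moreover have "b \<noteq> 0"
    unfolding b_def using x1(2) star_mult_self_eq_0[of "star (D x1)"] by (simp add: star_star)
  ultimately have ne: "?B \<noteq> {0}" by blast
  have "\<alpha> g x \<in> ?B" if x: "x \<in> ?B" for g x
  proof -
    have "\<alpha> g x * E y = 0 \<and> star (\<alpha> g x) * E y = 0" if y: "y \<in> J" for y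
    proof -
      have y': "\<alpha> (- g) y \<in> J" by (rule J(2)[OF y])
      have "E y = \<alpha> g (E (\<alpha> (- g) y))" using inv[OF y', of g] a(6) by simp
      then have "\<alpha> g x * E y = \<alpha> g (x * E (\<alpha> (- g) y))" "star (\<alpha> g x) * E y = \<alpha> g (star x * E (\<alpha> (- g) y))"
        by (simp_all add: star_automorphismD(4,5)[OF a(1)])
      then show ?thesis using x y' star_automorphismD(6)[OF a(1)] by simp
    qed
    then show ?thesis by blast
  qed
  then show ?thesis
    using sub her ne unfolding invariant_hereditary_subalgebras_def hereditary_subalgebra_def by blast
qed

text \<open>
  Let \<open>N = L - \<zeta>\<close> for an approximate eigenvalue \<open>\<zeta>\<close> of the approximating multiplier \<open>L\<close>. Cutting down
  to the spectral subspace of the average of \<open>N\<^sup>* N\<close> near 0 gives an invariant hereditary subalgebra on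
  which the multiplier is nearly the scalar \<open>\<zeta>\<close>, so that the inner automorphism is nearly trivial.
\<close>

lemma almost_fixed_hereditary_subalgebra:
  fixes \<alpha> :: "'g::{topological_group_add,t2_space} \<Rightarrow> 'a::cstar_algebra \<Rightarrow> 'a" and \<mu> :: "'g measure"
  assumes G: "compact (UNIV :: 'g set)" and \<mu>: "normalized_haar_measure \<mu>" and \<alpha>: "cstar_dynamical_system \<alpha>"
    and prime: "prime_cstar_algebra TYPE('a)" and u: "mloc_unitary u" "u \<in> mloc_fixed \<alpha>"
    and inner: "\<forall>a. mloc_of (\<alpha> g\<^sub>0 a) = u * mloc_of a * star u" and \<theta>: "\<theta> > 0"
  obtains B where "B \<in> invariant_hereditary_subalgebras \<alpha>" "\<And>x. x \<in> B \<Longrightarrow> norm (\<alpha> g\<^sub>0 x - x) \<le> \<theta> * norm x"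
proof -
  note a = cstar_dynamical_systemD[OF \<alpha>]
  \<comment> \<open>The constants are fixed backwards. The last estimate needs
    \<open>2 \<epsilon> + 5 \<tau> + 5 \<sigma> <= \<theta>\<close>, smallness of \<open>N\<close>
    on the cut needs \<open>\<nu> + 10 \<epsilon> <= \<tau>^2\<close>, and a nonzero cut needs
    \<open>5 \<sigma> + 10 \<epsilon> < \<nu>\<close>. The relation
    \<open>3 \<epsilon> = \<sigma>^2\<close> comes from the quadratic equation for the approximate
    eigenvalue.\<close>
  define \<tau> where "\<tau> = \<theta> / 10"
  define \<nu> where "\<nu> = \<tau>\<^sup>2 / 2"
  have \<tau>\<nu>: "\<tau> > 0" "\<nu> > 0" unfolding \<tau>_def \<nu>_def using \<theta> by simp_all
  define \<sigma> where "\<sigma> = min 1 (min (\<theta> / 12) (\<nu> / 10))"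
  have \<sigma>: "\<sigma> > 0" "\<sigma> \<le> 1" "\<sigma> \<le> \<theta> / 12" "\<sigma> \<le> \<nu> / 10" unfolding \<sigma>_def using \<theta> \<tau>\<nu> by auto
  define \<epsilon> where "\<epsilon> = \<sigma>\<^sup>2 / 3"
  have "\<sigma>\<^sup>2 \<le> \<sigma>" using \<sigma> by (simp add: power2_eq_square mult_left_le)
  then have \<epsilon>: "\<epsilon> > 0" "3 * \<epsilon> = \<sigma>\<^sup>2" "\<epsilon> \<le> \<sigma> / 3" "\<epsilon> \<le> 1" unfolding \<epsilon>_def using \<sigma> by auto
  obtain J L M where J: "closed_ideal J" "J \<noteq> {0}" "\<And>g x. x \<in> J \<Longrightarrow> \<alpha> g x \<in> J" and LM: "adjoint_on J L M"
    and Lb: "\<exists>C. bounded_by J L C" and ML1: "\<And>x. x \<in> J \<Longrightarrow> norm (M (L x) - x) \<le> \<epsilon> * norm x"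
    and LM1: "\<And>x. x \<in> J \<Longrightarrow> norm (L (M x) - x) \<le> \<epsilon> * norm x"
    and La: "\<And>g x. x \<in> J \<Longrightarrow> norm (\<alpha> g (L (\<alpha> (- g) x)) - L x) \<le> \<epsilon> * norm x"
    and Lin: "\<And>a x. x \<in> J \<Longrightarrow> norm (L (a * M x) - \<alpha> g\<^sub>0 a * x) \<le> \<epsilon> * norm a * norm x"
    by (rule approximately_inner_on_invariant_ideal[OF G \<alpha> prime u inner \<epsilon>(1)]) (rule that)
  note Js = closed_ideal_subspace[OF J(1)]
  note k = closed_subspaceD[OF Js] and l = adjoint_onD[OF LM] and ll = adjoint_on_linear[OF Js LM]
    and ml = adjoint_on_linear[OF Js adjoint_on_sym[OF LM]]
  have L2: "bounded_by J L 2" by (rule bounded_by_2_of_almost_isometric[OF LM ML1 \<epsilon>(4)])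
  note M2 = bounded_by_adjoint[OF LM L2]
  obtain \<zeta> z where z: "z \<in> J" "z \<noteq> 0" "norm (L z - \<zeta> *\<^sub>C z) \<le> \<sigma> * norm z"
    by (rule approximate_eigenvalue_unitary[OF Js J(2) LM L2 LM1 \<epsilon>(1,2) \<sigma>(1)]) (assumption, rule that)
  have zn: "norm z > 0" using z by simp
  have lz: "\<bar>cmod \<zeta> * norm z - norm (L z)\<bar> \<le> \<sigma> * norm z"
    using norm_triangle_ineq3[of "L z" "\<zeta> *\<^sub>C z"] z(3) by (simp add: norm_scaleC abs_minus_commute)
  have "cmod \<zeta> * norm z \<le> 3 * norm z"
    using lz bounded_byD[OF L2 z(1)] mult_right_mono[OF \<sigma>(2) norm_ge_zero[of z]] by simp
  then have \<zeta>3: "cmod \<zeta> \<le> 3" using zn by simp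
  \<comment> \<open>Approximate unitarity forces the modulus of \<open>\<zeta>\<close> to be near 1:
    \<open>norm (L z)\<close> is close to \<open>norm z\<close> since \<open>M L\<close> is close to
    1, and close to \<open>cmod \<zeta> * norm z\<close> by the choice of \<open>z\<close>.\<close>
  have \<zeta>1: "\<bar>(cmod \<zeta>)\<^sup>2 - 1\<bar> \<le> 5 * \<sigma> + \<epsilon>"
  proof -
    have "\<bar>(norm (L z))\<^sup>2 - (norm z)\<^sup>2\<bar> = \<bar>norm (star z * M (L z)) - norm (star z * z)\<bar>"
      using norm_adjoint_square[OF LM z(1)] norm_star_mult[of z] by simp
    also have "\<dots> \<le> norm (star z * M (L z) - star z * z)" by (rule norm_triangle_ineq3)
    also have "\<dots> \<le> norm z * norm (M (L z) - z)"
      using norm_mult_ineq[of "star z" "M (L z) - z"] by (simp add: right_diff_distrib)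
    also have "\<dots> \<le> norm z * (\<epsilon> * norm z)" using ML1[OF z(1)] by (rule mult_left_mono) simp
    finally have 1: "\<bar>(norm (L z))\<^sup>2 - (norm z)\<^sup>2\<bar> \<le> \<epsilon> * (norm z)\<^sup>2" by (simp add: power2_eq_square mult.left_commute)
    have "\<bar>(cmod \<zeta> * norm z)\<^sup>2 - (norm (L z))\<^sup>2\<bar>
        = \<bar>cmod \<zeta> * norm z - norm (L z)\<bar> * (cmod \<zeta> * norm z + norm (L z))"
      by (simp add: power2_eq_square square_diff_square_factored abs_mult mult.commute)
    also have "\<dots> \<le> (\<sigma> * norm z) * (5 * norm z)"
      using lz \<open>cmod \<zeta> * norm z \<le> 3 * norm z\<close> bounded_byD[OF L2 z(1)] \<sigma>(1) by (intro mult_mono) auto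
    finally have "\<bar>(cmod \<zeta> * norm z)\<^sup>2 - (norm (L z))\<^sup>2\<bar> \<le> 5 * \<sigma> * (norm z)\<^sup>2" by (simp add: power2_eq_square)
    with 1 have "\<bar>(cmod \<zeta> * norm z)\<^sup>2 - (norm z)\<^sup>2\<bar> \<le> (5 * \<sigma> + \<epsilon>) * (norm z)\<^sup>2"
      by (simp add: distrib_right)
    moreover have "(cmod \<zeta> * norm z)\<^sup>2 - (norm z)\<^sup>2 = ((cmod \<zeta>)\<^sup>2 - 1) * (norm z)\<^sup>2"
      by (simp add: power_mult_distrib left_diff_distrib)
    ultimately have "\<bar>(cmod \<zeta>)\<^sup>2 - 1\<bar> * (norm z)\<^sup>2 \<le> (5 * \<sigma> + \<epsilon>) * (norm z)\<^sup>2"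
      by (simp add: abs_mult)
    then show ?thesis using zn by simp
  qed
  define N where "N x = L x - \<zeta> *\<^sub>C x" for x
  define N' where "N' x = M x - cnj \<zeta> *\<^sub>C x" for x
  have NN: "adjoint_on J N N'"
    unfolding adjoint_on_def N_def N'_def using l k
    by (simp add: star_diff star_scaleC left_diff_distrib right_diff_distrib mult_scaleC_left mult_scaleC_right)
  note n = adjoint_onD[OF NN] and nl = adjoint_on_linear[OF Js adjoint_on_sym[OF NN]]
  have N5: "bounded_by J N 5"
    unfolding bounded_by_def
  proof
    fix x assume x: "x \<in> J"
    have "norm (\<zeta> *\<^sub>C x) \<le> 3 * norm x" using \<zeta>3 by (simp add: norm_scaleC mult_right_mono)
    then show "norm (N x) \<le> 5 * norm x"
      unfolding N_def using norm_triangle_ineq4[of "L x" "\<zeta> *\<^sub>C x"] bounded_byD[OF L2 x] by simp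
  qed
  note N5' = bounded_by_adjoint[OF NN N5]
  define P0 where "P0 x = N' (N x)" for x
  have P0: "selfadjoint_on J P0" unfolding P0_def by (rule adjoint_on_comp_selfadjoint[OF NN N5])
  \<comment> \<open>The factor is 5 + 5: \<open>N\<close> and its adjoint are bounded by 5, and each
    changes by at most \<epsilon> under conjugation.\<close>
  have conj_close: "norm (\<alpha> g (P0 (\<alpha> (- g) x)) - P0 x) \<le> 10 * \<epsilon> * norm x" if x: "x \<in> J" for g x
  proof -
    define Ng Ng' where "Ng x = \<alpha> g (N (\<alpha> (- g) x))" and "Ng' x = \<alpha> g (N' (\<alpha> (- g) x))" for x
    have mem: "Ng y \<in> J" "Ng' y \<in> J" if "y \<in> J" for y unfolding Ng_def Ng'_def by (intro J(3) n(1,2) that)+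
    have NgL: "Ng y - N y = \<alpha> g (L (\<alpha> (- g) y)) - L y" for y
      unfolding Ng_def N_def by (simp add: star_automorphismD[OF a(1)] a(6))
    have c1: "norm (Ng y - N y) \<le> \<epsilon> * norm y" if "y \<in> J" for y unfolding NgL by (rule La[OF that])
    have c2: "norm (Ng' y - N' y) \<le> \<epsilon> * norm y" if "y \<in> J" for y
      unfolding Ng'_def by (rule conjugated_adjoint_close[OF \<alpha> Js J(3) NN _ that]) (use c1 Ng_def in simp_all)
    have "\<alpha> g (P0 (\<alpha> (- g) x)) = Ng' (Ng x)" unfolding P0_def Ng_def Ng'_def by (simp add: a(5))
    then have "\<alpha> g (P0 (\<alpha> (- g) x)) - P0 x = Ng' (Ng x) - N' (Ng x) + N' (Ng x - N x)"
      unfolding P0_def using nl(4)[OF mem(1)[OF x] n(1)[OF x]] by simp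
    then have "norm (\<alpha> g (P0 (\<alpha> (- g) x)) - P0 x) \<le> norm (Ng' (Ng x) - N' (Ng x)) + norm (N' (Ng x - N x))"
      by (simp add: norm_triangle_ineq)
    also have "norm (Ng' (Ng x) - N' (Ng x)) \<le> \<epsilon> * norm (Ng x)" by (rule c2[OF mem(1)[OF x]])
    also have "norm (Ng x) \<le> 5 * norm x"
      unfolding Ng_def using bounded_byD[OF N5 J(3)[OF x, of "- g"]] a(7) by simp
    also have "norm (N' (Ng x - N x)) \<le> 5 * norm (Ng x - N x)"
      by (rule bounded_byD[OF N5' k(5)[OF mem(1)[OF x] n(1)[OF x]]])
    also have "norm (Ng x - N x) \<le> \<epsilon> * norm x" by (rule c1[OF x])
    finally show ?thesis using \<epsilon>(1) by simp
  qed
  define P1 where "P1 = averaged_operator \<mu> \<alpha> P0"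
  have P1: "selfadjoint_on J P1"
    unfolding P1_def by (rule averaged_operator_selfadjoint[OF G \<mu> \<alpha> Js J(3) P0])
  have P1inv: "\<alpha> h (P1 x) = P1 (\<alpha> h x)" if "x \<in> J" for h x
    unfolding P1_def by (rule averaged_operator_invariant[OF G \<mu> \<alpha> Js J(3) P0 that])
  have P1P0: "norm (P1 x - P0 x) \<le> 10 * \<epsilon> * norm x" if "x \<in> J" for x
    unfolding P1_def by (rule averaged_operator_close[OF G \<mu> \<alpha> Js J(3) P0 that conj_close[OF that]])
  have "norm (P0 z) \<le> 5 * norm (N z)" unfolding P0_def by (rule bounded_byD[OF N5' n(1)[OF z(1)]])
  then have "norm (P0 z) \<le> 5 * (\<sigma> * norm z)" using z(3) unfolding N_def by simp
  \<comment> \<open>The vector \<open>z\<close> survives the averaging as an almost null vector;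
    this makes the cut below \<nu> nonzero.\<close>
  then have "norm (P1 z) \<le> (5 * \<sigma> + 10 * \<epsilon>) * norm z"
    using P1P0[OF z(1)] norm_triangle_ineq[of "P1 z - P0 z" "P0 z"] by (simp add: distrib_right)
  also have "\<dots> < \<nu> * norm z"
    using \<sigma> \<epsilon>(3) zn by (intro mult_strict_right_mono) auto
  finally have P1z: "norm (P1 z) < \<nu> * norm z" .
  obtain D E where DE: "selfadjoint_on J D" "selfadjoint_on J E" "generated_by J P1 D" "generated_by J P1 E"
    "\<And>x. x \<in> J \<Longrightarrow> E (D x) = 0" "\<exists>x\<in>J. D x \<noteq> 0"
    "\<And>x. x \<in> J \<Longrightarrow> E x = 0 \<Longrightarrow> norm (P1 x) \<le> \<nu> * norm x"
    by (rule spectral_cut_below[OF Js P1 \<tau>\<nu>(2) z(1) P1z]) (rule that)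
  note e = adjoint_onD[OF selfadjoint_onD(1)[OF Js DE(2)]]
  have inv: "\<alpha> g (E x) = E (\<alpha> g x)" if "x \<in> J" for g x
    by (rule generated_by_commute[of J P1 E "\<alpha> g" x, OF DE(4) bounded_linear_on_action[OF \<alpha>] _ that])
      (simp_all add: J(3) P1inv)
  define B where "B = {x. \<forall>y\<in>J. x * E y = 0 \<and> star x * E y = 0}"
  have "B \<in> invariant_hereditary_subalgebras \<alpha>"
    unfolding B_def
    by (rule annihilator_hereditary[OF \<alpha> J(1,3) selfadjoint_onD(1)[OF Js DE(1)] selfadjoint_onD(1)[OF Js DE(2)] inv DE(5,6)])
  moreover have "norm (\<alpha> g\<^sub>0 x - x) \<le> \<theta> * norm x" if x: "x \<in> B" for x
  proof -
    \<comment> \<open>\<open>E (v * y)\<close> vanishes, since \<open>star (E (v * y)) * E (v * y) =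
      star y * star v * E (E (v * y))\<close> and \<open>star v\<close> annihilates the range of
      \<open>E\<close>. Hence \<open>P1\<close>, then \<open>P0 = N' N\<close>, and by a square root
      \<open>N\<close> itself are small at \<open>v * y\<close>.\<close>
    have small: "norm (N (v * y)) \<le> \<tau> * norm (v * y)" if v: "v \<in> B" and y: "y \<in> J" for v y
    proof -
      have vy: "v * y \<in> J" by (rule closed_idealD(1)[OF J(1) y])
      have "star (E (v * y)) * E (v * y) = star y * (star v * E (E (v * y)))"
        using e vy by (simp add: star_mult mult.assoc)
      also have "star v * E (E (v * y)) = 0" using v e(1)[OF vy] unfolding B_def by blast
      finally have "E (v * y) = 0" by simp
      then have "norm (P0 (v * y)) \<le> (\<nu> + 10 * \<epsilon>) * norm (v * y)"
        using DE(7)[OF vy] P1P0[OF vy] norm_triangle_ineq4[of "P1 (v * y)" "P1 (v * y) - P0 (v * y)"]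
        by (simp add: distrib_right)
      also have "\<dots> \<le> \<tau>\<^sup>2 * norm (v * y)"
        using \<sigma> \<epsilon>(3) unfolding \<nu>_def by (intro mult_right_mono) auto
      finally have "norm (v * y) * norm (P0 (v * y)) \<le> norm (v * y) * (\<tau>\<^sup>2 * norm (v * y))"
        by (intro mult_left_mono) auto
      then have "(norm (N (v * y)))\<^sup>2 \<le> norm (v * y) * (\<tau>\<^sup>2 * norm (v * y))"
        using norm_adjoint_square_le[OF NN vy] unfolding P0_def by linarith
      also have "\<dots> = (\<tau> * norm (v * y))\<^sup>2" by (simp add: power2_eq_square)
      finally show ?thesis by (rule power2_le_imp_le) (use \<tau>\<nu> in simp)
    qed
    have sx: "star x \<in> B" using x unfolding B_def by (simp add: star_star)
    \<comment> \<open>The mirror image of the previous estimate: \<open>x\<close> times the adjoint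
      multiplier is close to \<open>cnj \<zeta>\<close> times \<open>x\<close>. It is moved to the
      left side by \<open>star q * q = star (N (star x * q)) * y\<close>, using that
      \<open>star x\<close> is in \<open>B\<close> as well.\<close>
    have right: "norm (x * M y - cnj \<zeta> *\<^sub>C (x * y)) \<le> \<tau> * norm x * norm y" if y: "y \<in> J" for y
    proof -
      define q where "q = x * M y - cnj \<zeta> *\<^sub>C (x * y)"
      have q: "q \<in> J" unfolding q_def by (intro k(5) k(3) closed_idealD(1)[OF J(1)] l(2) y)
      have sq: "star x * q \<in> J" by (rule closed_idealD(1)[OF J(1) q])
      have "star q * q = star (N (star x * q)) * y"
      proof -
        have "star q * (x * M y) = star (star x * q) * M y" by (simp add: star_mult star_star mult.assoc)
        also have "\<dots> = star (L (star x * q)) * y" using l(3)[OF sq y] by simp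
        finally have "star q * q = star (L (star x * q)) * y - cnj \<zeta> *\<^sub>C (star q * (x * y))"
          by (simp add: q_def right_diff_distrib mult_scaleC_right)
        also have "cnj \<zeta> *\<^sub>C (star q * (x * y)) = star (\<zeta> *\<^sub>C (star x * q)) * y"
          by (simp add: star_scaleC star_mult star_star mult_scaleC_left mult.assoc)
        finally show ?thesis unfolding N_def by (simp add: star_diff left_diff_distrib)
      qed
      then have "(norm q)\<^sup>2 \<le> norm (N (star x * q)) * norm y"
        using norm_star_mult[of q] norm_mult_ineq[of "star (N (star x * q))" y] by simp
      also have "\<dots> \<le> (\<tau> * (norm x * norm q)) * norm y"
      proof (rule mult_right_mono)
        have "\<tau> * norm (star x * q) \<le> \<tau> * (norm x * norm q)"
          using norm_mult_ineq[of "star x" q] \<tau>\<nu> by (intro mult_left_mono) auto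
        then show "norm (N (star x * q)) \<le> \<tau> * (norm x * norm q)" using small[OF sx q] by linarith
      qed simp
      finally have "norm q * norm q \<le> norm q * (\<tau> * norm x * norm y)"
        by (simp add: power2_eq_square algebra_simps)
      then show ?thesis unfolding q_def[symmetric] using \<tau>\<nu> by (cases "q = 0") auto
    qed
    \<comment> \<open>\<open>\<alpha> g\<^sub>0 x * y\<close> is close to
      \<open>L (x * M y)\<close>, this to \<open>\<zeta>\<close> times \<open>x * M y\<close>, this
      to \<open>(cmod \<zeta>)^2\<close> times \<open>x * y\<close>, and this to
      \<open>x * y\<close>. Relative to \<open>norm x * norm y\<close> the errors are \<epsilon>,
      \<open>2 \<tau>\<close>, \<open>3 \<tau>\<close> and
      \<open>5 \<sigma> + \<epsilon>\<close>.\<close>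
    have main: "norm ((\<alpha> g\<^sub>0 x - x) * y) \<le> (\<theta> * norm x) * norm y" if y: "y \<in> J" for y
    proof -
      define t where "t = x * M y"
      have My: "M y \<in> J" by (rule l(2)[OF y])
      have "norm t \<le> norm x * norm (M y)" unfolding t_def by (rule norm_mult_ineq)
      also have "\<dots> \<le> norm x * (2 * norm y)" using bounded_byD[OF M2 y] by (rule mult_left_mono) simp
      finally have tn: "norm t \<le> 2 * norm x * norm y" by simp
      have "norm (N t) \<le> \<tau> * norm t" unfolding t_def by (rule small[OF x My])
      also have "\<dots> \<le> \<tau> * (2 * norm x * norm y)" using tn \<tau>\<nu> by (intro mult_left_mono) auto
      finally have 1: "norm (L t - \<zeta> *\<^sub>C t) \<le> 2 * \<tau> * (norm x * norm y)" unfolding N_def by (simp add: mult.assoc)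
      have "norm (\<zeta> *\<^sub>C t - \<zeta> *\<^sub>C cnj \<zeta> *\<^sub>C (x * y)) = cmod \<zeta> * norm (t - cnj \<zeta> *\<^sub>C (x * y))"
        by (simp add: norm_scaleC flip: scaleC_diff_right)
      also have "\<dots> \<le> 3 * (\<tau> * norm x * norm y)"
        using right[OF y] \<zeta>3 unfolding t_def by (intro mult_mono) auto
      finally have 2: "norm (\<zeta> *\<^sub>C t - \<zeta> *\<^sub>C cnj \<zeta> *\<^sub>C (x * y)) \<le> 3 * \<tau> * (norm x * norm y)" by (simp add: mult.assoc)
      have "\<zeta> *\<^sub>C cnj \<zeta> *\<^sub>C (x * y) - x * y = ((cmod \<zeta>)\<^sup>2 - 1) *\<^sub>R (x * y)"
        by (simp add: scaleC_scaleC complex_norm_square[symmetric] scaleR_diff_left scaleC_of_real flip: of_real_power)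
      then have "norm (\<zeta> *\<^sub>C cnj \<zeta> *\<^sub>C (x * y) - x * y) = \<bar>(cmod \<zeta>)\<^sup>2 - 1\<bar> * norm (x * y)" by simp
      also have "\<dots> \<le> (5 * \<sigma> + \<epsilon>) * (norm x * norm y)"
        using \<zeta>1 norm_mult_ineq[of x y] \<sigma>(1) \<epsilon>(1) by (intro mult_mono) auto
      finally have 3: "norm (\<zeta> *\<^sub>C cnj \<zeta> *\<^sub>C (x * y) - x * y) \<le> (5 * \<sigma> + \<epsilon>) * (norm x * norm y)" .
      have 4: "norm (\<alpha> g\<^sub>0 x * y - L t) \<le> \<epsilon> * (norm x * norm y)"
        using Lin[OF y, of x] unfolding t_def by (simp add: norm_minus_commute mult.assoc)
      have "(\<alpha> g\<^sub>0 x - x) * y = (\<alpha> g\<^sub>0 x * y - L t) + (L t - \<zeta> *\<^sub>C t) + (\<zeta> *\<^sub>C t - \<zeta> *\<^sub>C cnj \<zeta> *\<^sub>C (x * y))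
          + (\<zeta> *\<^sub>C cnj \<zeta> *\<^sub>C (x * y) - x * y)" by (simp add: left_diff_distrib)
      also have "norm \<dots> \<le> norm (\<alpha> g\<^sub>0 x * y - L t) + norm (L t - \<zeta> *\<^sub>C t)
          + norm (\<zeta> *\<^sub>C t - \<zeta> *\<^sub>C cnj \<zeta> *\<^sub>C (x * y)) + norm (\<zeta> *\<^sub>C cnj \<zeta> *\<^sub>C (x * y) - x * y)"
        by (intro norm_triangle_mono order_refl)
      also have "\<dots> \<le> \<epsilon> * (norm x * norm y) + 2 * \<tau> * (norm x * norm y) + 3 * \<tau> * (norm x * norm y)
          + (5 * \<sigma> + \<epsilon>) * (norm x * norm y)" by (intro add_mono 1 2 3 4)
      also have "\<dots> = (2 * \<epsilon> + 5 * \<tau> + 5 * \<sigma>) * (norm x * norm y)" by (simp add: algebra_simps)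
      also have "\<dots> \<le> \<theta> * (norm x * norm y)"
        using \<sigma> \<epsilon>(3) unfolding \<tau>_def by (intro mult_right_mono) auto
      finally show ?thesis by (simp add: mult.assoc)
    qed
    show ?thesis
      by (rule norm_mult_left_le_essential_ideal[OF prime_essential_ideal[OF prime J(1,2)] main])
        (use \<theta> in auto)
  qed
  ultimately show ?thesis by (rule that)
qed

text \<open>Conjugating \<open>Ad u\<close> by \<open>\<alpha> g\<close> gives \<open>Ad\<close> of
  the image of \<open>u\<close>, which is \<open>u\<close>. For an approximant the error is
  \<open>6 \<epsilon>\<close>: \<epsilon> for each of the two uses of inner implementation, and
  \<open>2 \<epsilon>\<close> each for moving \<open>L\<close> and \<open>M\<close> past the action;
  then \<epsilon> tends to 0.\<close>

lemma inner_commutes_with_action: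
  fixes \<alpha> :: "'g::{topological_group_add,t2_space} \<Rightarrow> 'a::cstar_algebra \<Rightarrow> 'a"
  assumes G: "compact (UNIV :: 'g set)" and \<alpha>: "cstar_dynamical_system \<alpha>"
    and prime: "prime_cstar_algebra TYPE('a)" and u: "mloc_unitary u" "u \<in> mloc_fixed \<alpha>"
    and inner: "\<forall>a. mloc_of (\<alpha> g\<^sub>0 a) = u * mloc_of a * star u"
  shows "\<alpha> g (\<alpha> g\<^sub>0 a) = \<alpha> g\<^sub>0 (\<alpha> g a)"
proof -
  note A = cstar_dynamical_systemD[OF \<alpha>]
  have almost: "norm (\<alpha> g (\<alpha> g\<^sub>0 (\<alpha> (- g) a)) - \<alpha> g\<^sub>0 a) \<le> 6 * \<epsilon> * norm a" if \<epsilon>: "\<epsilon> > 0" "\<epsilon> \<le> 1" for \<epsilon> a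
  proof -
    obtain J L M where J: "closed_ideal J" "J \<noteq> {0}" "\<And>g x. x \<in> J \<Longrightarrow> \<alpha> g x \<in> J" and LM: "adjoint_on J L M"
      and Lb: "\<exists>C. bounded_by J L C" and ML1: "\<And>x. x \<in> J \<Longrightarrow> norm (M (L x) - x) \<le> \<epsilon> * norm x"
      and LM1: "\<And>x. x \<in> J \<Longrightarrow> norm (L (M x) - x) \<le> \<epsilon> * norm x"
      and La: "\<And>g x. x \<in> J \<Longrightarrow> norm (\<alpha> g (L (\<alpha> (- g) x)) - L x) \<le> \<epsilon> * norm x"
      and Lin: "\<And>a x. x \<in> J \<Longrightarrow> norm (L (a * M x) - \<alpha> g\<^sub>0 a * x) \<le> \<epsilon> * norm a * norm x"
      by (rule approximately_inner_on_invariant_ideal[OF G \<alpha> prime u inner \<epsilon>(1)]) (rule that)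
    note Js = closed_ideal_subspace[OF J(1)]
    note k = closed_subspaceD[OF Js] and l = adjoint_onD[OF LM] and ll = adjoint_on_linear[OF Js LM]
    have L2: "bounded_by J L 2" by (rule bounded_by_2_of_almost_isometric[OF LM ML1 \<epsilon>(2)])
    note M2 = bounded_by_adjoint[OF LM L2]
    have "norm ((\<alpha> g (\<alpha> g\<^sub>0 (\<alpha> (- g) a)) - \<alpha> g\<^sub>0 a) * x) \<le> (6 * \<epsilon> * norm a) * norm x" if x: "x \<in> J" for x
    proof -
      define y b m where "y = \<alpha> (- g) x" and "b = \<alpha> (- g) a" and "m = \<alpha> g (M y)"
      have y: "y \<in> J" unfolding y_def by (rule J(3)[OF x])
      have m: "m \<in> J" unfolding m_def by (intro J(3) l(2) y)
      have am: "a * m \<in> J" "a * M x \<in> J" by (intro closed_idealD(1)[OF J(1)] m l(2) x)+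
      have "norm (\<alpha> g (\<alpha> g\<^sub>0 b * y - L (b * M y))) \<le> \<epsilon> * norm b * norm y"
        using Lin[OF y, of b] A(7) by (simp add: norm_minus_commute)
      then have 1: "norm (\<alpha> g (\<alpha> g\<^sub>0 b) * x - \<alpha> g (L (b * M y))) \<le> \<epsilon> * norm a * norm x"
        unfolding y_def b_def by (simp add: star_automorphismD(4,8)[OF A(1)] A(6,7))
      have "\<alpha> (- g) (a * m) = b * M y" unfolding m_def b_def by (simp add: star_automorphismD(4)[OF A(1)] A(5))
      then have "norm (\<alpha> g (L (b * M y)) - L (a * m)) \<le> \<epsilon> * norm (a * m)" using La[OF am(1), of g] by simp
      also have "norm (a * m) \<le> norm a * (2 * norm x)"
      proof -
        have "norm m \<le> 2 * norm x" unfolding m_def using bounded_byD[OF M2 y] by (simp add: A(7) y_def)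
        then show ?thesis using norm_mult_ineq[of a m] by (meson mult_left_mono norm_ge_zero order_trans)
      qed
      finally have 2: "norm (\<alpha> g (L (b * M y)) - L (a * m)) \<le> \<epsilon> * (norm a * (2 * norm x))" using \<epsilon>(1) by simp
      have "norm (m - M x) \<le> \<epsilon> * norm x"
        unfolding m_def y_def by (rule conjugated_adjoint_close[OF \<alpha> Js J(3) LM La x])
      then have "norm (a * m - a * M x) \<le> norm a * (\<epsilon> * norm x)"
        using norm_mult_ineq[of a "m - M x"] unfolding right_diff_distrib[symmetric]
        by (meson mult_left_mono norm_ge_zero order_trans)
      moreover have "norm (L (a * m) - L (a * M x)) \<le> 2 * norm (a * m - a * M x)"
        using bounded_byD[OF L2 k(5)[OF am]] ll(4)[OF am] by simp
      ultimately have 3: "norm (L (a * m) - L (a * M x)) \<le> 2 * (norm a * (\<epsilon> * norm x))" by simp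
      have 4: "norm (L (a * M x) - \<alpha> g\<^sub>0 a * x) \<le> \<epsilon> * norm a * norm x" by (rule Lin[OF x])
      have "(\<alpha> g (\<alpha> g\<^sub>0 b) - \<alpha> g\<^sub>0 a) * x = (\<alpha> g (\<alpha> g\<^sub>0 b) * x - \<alpha> g (L (b * M y)))
          + (\<alpha> g (L (b * M y)) - L (a * m)) + (L (a * m) - L (a * M x)) + (L (a * M x) - \<alpha> g\<^sub>0 a * x)"
        by (simp add: left_diff_distrib)
      also have "norm \<dots> \<le> norm (\<alpha> g (\<alpha> g\<^sub>0 b) * x - \<alpha> g (L (b * M y))) + norm (\<alpha> g (L (b * M y)) - L (a * m))
          + norm (L (a * m) - L (a * M x)) + norm (L (a * M x) - \<alpha> g\<^sub>0 a * x)"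
        by (intro norm_triangle_mono order_refl)
      also have "\<dots> \<le> \<epsilon> * norm a * norm x + \<epsilon> * (norm a * (2 * norm x)) + 2 * (norm a * (\<epsilon> * norm x)) + \<epsilon> * norm a * norm x"
        by (intro add_mono 1 2 3 4)
      also have "\<dots> = (6 * \<epsilon> * norm a) * norm x" by (simp add: algebra_simps)
      finally show ?thesis unfolding b_def .
    qed
    then show ?thesis
      by (rule norm_mult_left_le_essential_ideal[OF prime_essential_ideal[OF prime J(1,2)]]) (use \<epsilon> in auto)
  qed
  have zero: "\<alpha> g (\<alpha> g\<^sub>0 (\<alpha> (- g) a)) = \<alpha> g\<^sub>0 a" for a
  proof -
    have "norm (\<alpha> g (\<alpha> g\<^sub>0 (\<alpha> (- g) a)) - \<alpha> g\<^sub>0 a) \<le> 0 + e" if e: "e > 0" for e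
    proof -
      define \<epsilon> where "\<epsilon> = min 1 (e / (6 * norm a + 1))"
      have \<epsilon>: "\<epsilon> > 0" "\<epsilon> \<le> 1" unfolding \<epsilon>_def using e by (auto simp: add_nonneg_pos)
      have "\<epsilon> \<le> e / (6 * norm a + 1)" unfolding \<epsilon>_def by simp
      then have "\<epsilon> * (6 * norm a + 1) \<le> e" by (simp add: le_divide_eq add_nonneg_pos)
      then have "6 * \<epsilon> * norm a \<le> e" using \<epsilon>(1) by (simp add: algebra_simps)
      then show ?thesis using almost[OF \<epsilon>, of a] by simp
    qed
    then have "norm (\<alpha> g (\<alpha> g\<^sub>0 (\<alpha> (- g) a)) - \<alpha> g\<^sub>0 a) \<le> 0" by (rule field_le_epsilon)
    then show ?thesis by simp
  qed
  show ?thesis using zero[of "\<alpha> g a"] by (simp add: A(5))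
qed

section \<open>Spectral subspaces and irreducible representations\<close>

lemma bounded_bilinear_scaleC: "bounded_bilinear (scaleC :: complex \<Rightarrow> 'a::cstar_algebra \<Rightarrow> 'a)"
proof
  show "(r *\<^sub>R c) *\<^sub>C x = r *\<^sub>R (c *\<^sub>C x)" for r c and x :: 'a
    by (metis scaleC_of_real scaleC_scaleC scaleR_conv_of_real)
  show "\<exists>K. \<forall>c (x::'a). norm (c *\<^sub>C x) \<le> norm c * norm x * K"
    by (intro exI[of _ 1]) (simp add: norm_scaleC)
qed (simp_all add: scaleC_add_left scaleC_add_right scaleC_scaleR)

lemma scaleC_sum_right: "c *\<^sub>C (\<Sum>i\<in>A. f i) = (\<Sum>i\<in>A. c *\<^sub>C (f i :: 'a::cstar_algebra))"
  by (induction A rule: infinite_finite_induct) (simp_all add: scaleC_add_right)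

lemma scaleC_sum_left: "(\<Sum>i\<in>A. c i) *\<^sub>C x = (\<Sum>i\<in>A. c i *\<^sub>C (x :: 'a::cstar_algebra))"
  by (induction A rule: infinite_finite_induct) (simp_all add: scaleC_add_left)

lemma mat_adjoint_index:
  fixes A :: "complex mat"
  assumes "A \<in> carrier_mat n n" "i < n" "j < n"
  shows "mat_adjoint A $$ (i, j) = cnj (A $$ (j, i))"
  using assms unfolding mat_adjoint_def by (simp add: mat_of_rows_index)

lemma unitary_repD:
  fixes \<pi> :: "'g::topological_group_add \<Rightarrow> complex mat"
  assumes "unitary_rep \<pi>" defines "d \<equiv> rep_dim \<pi>"
  shows "\<pi> g \<in> carrier_mat d d" "\<pi> (g + h) = \<pi> g * \<pi> h" "i < d \<Longrightarrow> j < d \<Longrightarrow> continuous_on UNIV (\<lambda>g. \<pi> g $$ (i, j))"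
    "i < d \<Longrightarrow> j < d \<Longrightarrow> \<pi> (- g) $$ (i, j) = cnj (\<pi> g $$ (j, i))"
proof -
  have u: "unitary_mat d (\<pi> g)" for g using assms unfolding unitary_rep_def by auto
  show c: "\<pi> g \<in> carrier_mat d d" for g using u unfolding unitary_mat_def by auto
  show m: "\<pi> (g + h) = \<pi> g * \<pi> h" for g h using assms unfolding unitary_rep_def by auto
  show "i < d \<Longrightarrow> j < d \<Longrightarrow> continuous_on UNIV (\<lambda>g. \<pi> g $$ (i, j))" for i j
    using assms unfolding unitary_rep_def by auto
  have ac: "mat_adjoint (\<pi> g) \<in> carrier_mat d d" for g
    using c[of g] unfolding mat_adjoint_def by auto
  have "\<pi> 0 = mat_adjoint (\<pi> 0) * \<pi> 0 * \<pi> 0"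
    using u[of 0] c[of 0] unfolding unitary_mat_def by simp
  also have "\<dots> = mat_adjoint (\<pi> 0) * (\<pi> 0 * \<pi> 0)" by (rule assoc_mult_mat[OF ac c c])
  also have "\<dots> = 1\<^sub>m d" using m[of 0 0] u[of 0] unfolding unitary_mat_def by simp
  finally have one: "\<pi> 0 = 1\<^sub>m d" .
  have "\<pi> (- g) = \<pi> (- g) * (\<pi> g * mat_adjoint (\<pi> g))"
    using u[of g] c[of "- g"] unfolding unitary_mat_def by simp
  also have "\<dots> = \<pi> (- g) * \<pi> g * mat_adjoint (\<pi> g)" by (rule assoc_mult_mat[OF c c ac, symmetric])
  also have "\<pi> (- g) * \<pi> g = 1\<^sub>m d" using m[of "- g" g] one by simp
  also have "1\<^sub>m d * mat_adjoint (\<pi> g) = mat_adjoint (\<pi> g)" by (rule left_mult_one_mat[OF ac])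
  finally have "\<pi> (- g) = mat_adjoint (\<pi> g)" .
  then show "i < d \<Longrightarrow> j < d \<Longrightarrow> \<pi> (- g) $$ (i, j) = cnj (\<pi> g $$ (j, i))"
    using mat_adjoint_index[OF c] by simp
qed

lemma complex_eigenvector_exists:
  assumes A: "A \<in> carrier_mat n n" and n: "n > 0"
  obtains c v where "v \<in> carrier_vec n" "v \<noteq> 0\<^sub>v n" "A *\<^sub>v v = (c :: complex) \<cdot>\<^sub>v v"
proof -
  obtain as where as: "char_poly A = (\<Prod>a\<leftarrow>as. [:- a, 1:])" "length as = n"
    using char_poly_factorized[OF A] by blast
  then obtain c bs where "as = c # bs" using n by (cases as) auto
  then have "poly (char_poly A) c = 0" unfolding as(1) by simp
  then have "eigenvalue A c" using eigenvalue_root_char_poly[OF A] by simp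
  then show ?thesis using that A unfolding eigenvalue_def eigenvector_def by auto
qed

text \<open>
  The coefficients \<open>X i j = \<integral> \<pi>\<^sub>i\<^sub>j(g)\<^sup>* \<alpha>\<^sub>g(a) dg\<close> satisfy \<open>\<alpha>\<^sub>h(y j v) = y j (\<pi>(h) v)\<close> for \<open>y j v = \<Sum>i. v\<^sub>i X i j\<close>, and
  by irreducibility \<open>v\<close> is determined by the \<open>y j v\<close>. Hence \<open>\<pi>(g\<^sub>0)\<close> commutes with \<open>\<pi>\<close>, and
  its eigenvalue is one of \<open>\<alpha>\<^bsub>g\<^sub>0\<^esub>\<close> on the subspace.
\<close>

lemma representation_scalar_of_almost_fixed:
  fixes \<alpha> :: "'g::{topological_group_add,t2_space} \<Rightarrow> 'a::cstar_algebra \<Rightarrow> 'a" and \<mu> :: "'g measure"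
  assumes G: "compact (UNIV :: 'g set)" and \<mu>: "normalized_haar_measure \<mu>" and \<alpha>: "cstar_dynamical_system \<alpha>"
    and B: "closed_subspace B" "\<And>g x. x \<in> B \<Longrightarrow> \<alpha> g x \<in> B"
    and \<pi>: "irreducible_unitary_rep \<pi>" and sp: "spectral_subspace \<mu> \<alpha> B \<pi> \<noteq> {0}"
    and comm: "\<And>g x. \<alpha> g (\<alpha> g\<^sub>0 x) = \<alpha> g\<^sub>0 (\<alpha> g x)"
    and \<theta>: "\<And>x. x \<in> B \<Longrightarrow> norm (\<alpha> g\<^sub>0 x - x) \<le> \<theta> * norm x"
  obtains c where "cmod (c - 1) \<le> \<theta>" "\<pi> g\<^sub>0 = c \<cdot>\<^sub>m 1\<^sub>m (rep_dim \<pi>)"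
proof -
  define d where "d = rep_dim \<pi>"
  have rep: "unitary_rep \<pi>" and d0: "d > 0"
    and irr: "\<And>W. invariant_subspace \<pi> W \<Longrightarrow> W = {0\<^sub>v d} \<or> W = carrier_vec d"
    using \<pi> unfolding irreducible_unitary_rep_def d_def by auto
  note r = unitary_repD[OF rep, folded d_def] and a = cstar_dynamical_systemD[OF \<alpha>]
  have vadd: "\<pi> g *\<^sub>v (v + w) = \<pi> g *\<^sub>v v + \<pi> g *\<^sub>v w" if "v \<in> carrier_vec d" "w \<in> carrier_vec d" for g v w
    by (rule mult_add_distrib_mat_vec[OF r(1) that])
  have vsc: "\<pi> g *\<^sub>v (c \<cdot>\<^sub>v v) = c \<cdot>\<^sub>v (\<pi> g *\<^sub>v v)" if "v \<in> carrier_vec d" for g c v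
    by (rule mult_mat_vec[OF r(1) that])
  have vc: "\<pi> g *\<^sub>v v \<in> carrier_vec d" if "v \<in> carrier_vec d" for g v
    by (rule mult_mat_vec_carrier[OF r(1) that])
  have vm: "\<pi> g *\<^sub>v (\<pi> h *\<^sub>v v) = \<pi> (g + h) *\<^sub>v v" if "v \<in> carrier_vec d" for g h v
    using assoc_mult_mat_vec[OF r(1) r(1) that] r(2) by simp
  \<comment> \<open>Being different from \<open>{0}\<close> yields a nonzero element only once 0 is
    known to belong to the set.\<close>
  have "0 \<in> spectral_subspace \<mu> \<alpha> B \<pi>"
    unfolding spectral_subspace_def
    using closed_subspaceD(1)[OF B(1)] has_vector_integral_zero
    by (auto intro!: bexI[of _ 0] simp: star_automorphismD(6)[OF a(1)])
  then obtain x a0 where x0: "x \<noteq> 0" and a0: "a0 \<in> B"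
    and int: "has_vector_integral \<mu> (\<lambda>g. (of_nat d * cnj (rep_character \<pi> g)) *\<^sub>C \<alpha> g a0) x"
    using sp unfolding spectral_subspace_def d_def by blast
  define f where "f i j g = cnj (\<pi> g $$ (i, j)) *\<^sub>C \<alpha> g a0" for i j g
  have fc: "continuous_on UNIV (f i j)" if "i < d" "j < d" for i j
    unfolding f_def
    by (intro bounded_bilinear.continuous_on[OF bounded_bilinear_scaleC] continuous_on_cnj r(3) that a(3))
  define X where "X i j = haar_integral \<mu> (f i j)" for i j
  have XB: "X i j \<in> B" if "i < d" "j < d" for i j
    unfolding X_def
    by (rule haar_integral_mem[OF G \<mu> fc[OF that] B(1)]) (simp add: f_def closed_subspaceD(3)[OF B(1)] B(2) a0)
  have "x = (\<Sum>i<d. of_nat d *\<^sub>C X i i)"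
  proof -
    have eq: "(of_nat d * cnj (rep_character \<pi> g)) *\<^sub>C \<alpha> g a0 = (\<Sum>i<d. of_nat d *\<^sub>C f i i g)" for g
      unfolding rep_character_def f_def d_def[symmetric]
      by (simp add: scaleC_scaleC scaleC_sum_left sum_distrib_left)
    have c: "continuous_on UNIV (\<lambda>g. of_nat d *\<^sub>C f i i g)" if "i < d" for i
      by (rule bounded_linear.continuous_on[OF bounded_linear_scaleC fc[OF that that]])
    have "haar_integral \<mu> (\<lambda>g. \<Sum>i<d. of_nat d *\<^sub>C f i i g) = x"
      by (rule haar_integral_eq_vector_integral[OF G \<mu>]) (use int eq c in \<open>auto intro: continuous_on_sum\<close>)
    moreover have "haar_integral \<mu> (\<lambda>g. \<Sum>i<d. of_nat d *\<^sub>C f i i g) = (\<Sum>i<d. haar_integral \<mu> (\<lambda>g. of_nat d *\<^sub>C f i i g))"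
      by (rule haar_integral_sum[OF G \<mu>]) (use c in auto)
    moreover have "haar_integral \<mu> (\<lambda>g. of_nat d *\<^sub>C f i i g) = of_nat d *\<^sub>C X i i" if "i < d" for i
      unfolding X_def by (rule haar_integral_linear[OF G \<mu> bounded_linear_scaleC fc[OF that that]])
    ultimately show ?thesis by simp
  qed
  \<comment> \<open>The character is a trace, so \<open>x\<close> is a multiple of the sum of the
    diagonal coefficients. A nonzero one keeps \<open>unit_vec d i0\<close> out of the kernel
    \<open>K\<close> below.\<close>
  then obtain i0 where i0: "i0 < d" "X i0 i0 \<noteq> 0"
    using x0 by (metis (no_types, lifting) lessThan_iff scaleC_zero_right sum.neutral)
  define y where "y j v = (\<Sum>i<d. vec_index v i *\<^sub>C X i j)" for j v
  have yB: "y j v \<in> B" if "j < d" for j v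
    unfolding y_def by (intro sum_in_closed_subspace[OF B(1)] closed_subspaceD(3)[OF B(1)] XB that) auto
  have yadd: "y j (v + w) = y j v + y j w" if "v \<in> carrier_vec d" "w \<in> carrier_vec d" for j v w
    unfolding y_def using that by (simp add: scaleC_add_left sum.distrib)
  have ysc: "y j (c \<cdot>\<^sub>v v) = c *\<^sub>C y j v" if "v \<in> carrier_vec d" for j c v
    unfolding y_def using that by (simp add: scaleC_sum_right scaleC_scaleC)
  have y0: "y j (0\<^sub>v d) = 0" for j unfolding y_def by simp
  \<comment> \<open>Writing \<open>g\<close> as \<open>- h + (h + g)\<close> expands the entry of
    \<open>\<pi> g\<close> by the matrix product, the entries of \<open>\<pi> (- h)\<close> being
    conjugates of those of \<open>\<pi> h\<close>; translation invariance of the integral does the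
    rest.\<close>
  have \<alpha>X: "\<alpha> h (X i j) = (\<Sum>k<d. \<pi> h $$ (k, i) *\<^sub>C X k j)" if ij: "i < d" "j < d" for h i j
  proof -
    define t where "t g = (\<Sum>k<d. \<pi> h $$ (k, i) *\<^sub>C f k j g)" for g
    have tc: "continuous_on UNIV t"
      unfolding t_def by (intro continuous_on_sum bounded_linear.continuous_on[OF bounded_linear_scaleC] fc ij) auto
    have tr: "\<alpha> h (f i j g) = t (h + g)" for g
    proof -
      have "\<pi> g $$ (i, j) = \<pi> (- h + (h + g)) $$ (i, j)" by (simp flip: add.assoc)
      also have "\<dots> = (\<Sum>k<d. \<pi> (- h) $$ (i, k) * \<pi> (h + g) $$ (k, j))"
        unfolding r(2)[of "- h" "h + g"] using r(1) ij
        by (simp add: scalar_prod_def lessThan_atLeast0 carrier_matD[OF r(1)])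
      also have "\<dots> = (\<Sum>k<d. cnj (\<pi> h $$ (k, i)) * \<pi> (h + g) $$ (k, j))"
        using r(4) ij by simp
      finally have "cnj (\<pi> g $$ (i, j)) = (\<Sum>k<d. \<pi> h $$ (k, i) * cnj (\<pi> (h + g) $$ (k, j)))" by simp
      moreover have "\<alpha> h (f i j g) = cnj (\<pi> g $$ (i, j)) *\<^sub>C \<alpha> (h + g) a0"
        by (simp only: f_def star_automorphismD(3)[OF a(1)] a(2))
      ultimately show ?thesis unfolding f_def t_def by (simp add: scaleC_sum_left scaleC_scaleC)
    qed
    have "\<alpha> h (X i j) = haar_integral \<mu> (\<lambda>g. \<alpha> h (f i j g))"
      unfolding X_def using haar_integral_linear[OF G \<mu> bounded_linear_action[OF \<alpha>] fc[OF ij]] by simp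
    also have "\<dots> = haar_integral \<mu> t" unfolding tr by (rule haar_integral_translate[OF G \<mu> tc])
    also have "\<dots> = (\<Sum>k<d. haar_integral \<mu> (\<lambda>g. \<pi> h $$ (k, i) *\<^sub>C f k j g))"
      unfolding t_def
      by (rule haar_integral_sum[OF G \<mu>]) (auto intro!: bounded_linear.continuous_on[OF bounded_linear_scaleC] fc ij)
    also have "\<dots> = (\<Sum>k<d. \<pi> h $$ (k, i) *\<^sub>C X k j)"
      unfolding X_def using haar_integral_linear[OF G \<mu> bounded_linear_scaleC fc] ij by (intro sum.cong) auto
    finally show ?thesis .
  qed
  have \<alpha>sum: "\<alpha> h (\<Sum>i\<in>A. F i) = (\<Sum>i\<in>A. \<alpha> h (F i))" for h A and F :: "nat \<Rightarrow> 'a"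
    by (induction A rule: infinite_finite_induct) (simp_all add: star_automorphismD[OF a(1)])
  have \<alpha>y: "\<alpha> h (y j v) = y j (\<pi> h *\<^sub>v v)" if v: "v \<in> carrier_vec d" and j: "j < d" for h j v
  proof -
    have "\<alpha> h (y j v) = (\<Sum>i<d. vec_index v i *\<^sub>C (\<Sum>k<d. \<pi> h $$ (k, i) *\<^sub>C X k j))"
      unfolding y_def \<alpha>sum using \<alpha>X j by (simp add: star_automorphismD(3)[OF a(1)])
    also have "\<dots> = (\<Sum>i<d. \<Sum>k<d. (\<pi> h $$ (k, i) * vec_index v i) *\<^sub>C X k j)"
      by (simp add: scaleC_sum_right scaleC_scaleC mult.commute)
    also have "\<dots> = (\<Sum>k<d. \<Sum>i<d. (\<pi> h $$ (k, i) * vec_index v i) *\<^sub>C X k j)" by (rule sum.swap)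
    also have "\<dots> = (\<Sum>k<d. (\<Sum>i<d. \<pi> h $$ (k, i) * vec_index v i) *\<^sub>C X k j)" by (simp add: scaleC_sum_left)
    also have "\<dots> = y j (\<pi> h *\<^sub>v v)"
      unfolding y_def using v carrier_matD[OF r(1)[of h]]
      by (intro sum.cong) (auto simp: scalar_prod_def lessThan_atLeast0)
    finally show ?thesis .
  qed
  \<comment> \<open>The vectors that no \<open>y j\<close> detects. Irreducibility makes this space
    zero, so identities between values of \<open>\<alpha>\<close> can be pulled back to
    \<open>\<pi>\<close>.\<close>
  define K where "K = {v \<in> carrier_vec d. \<forall>j<d. y j v = 0}"
  have "invariant_subspace \<pi> K"
    unfolding invariant_subspace_def K_def d_def[symmetric]
    by (auto simp: yadd ysc y0 vc star_automorphismD(6)[OF a(1)] simp flip: \<alpha>y)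
  moreover have "K \<noteq> carrier_vec d"
  proof
    assume "K = carrier_vec d"
    then have "unit_vec d i0 \<in> K" by simp
    then have "y i0 (unit_vec d i0) = 0" unfolding K_def using i0 by simp
    moreover have "y i0 (unit_vec d i0) = (\<Sum>i<d. if i = i0 then X i0 i0 else 0)"
      unfolding y_def using i0 by (intro sum.cong) (auto simp: unit_vec_def)
    ultimately show False using i0 by simp
  qed
  ultimately have K0: "K = {0\<^sub>v d}" using irr by blast
  have inj: "v = w" if v: "v \<in> carrier_vec d" and w: "w \<in> carrier_vec d" and eq: "\<And>j. j < d \<Longrightarrow> y j v = y j w" for v w
  proof -
    have mw: "- 1 \<cdot>\<^sub>v w \<in> carrier_vec d" using w by simp
    have "y j (v + - 1 \<cdot>\<^sub>v w) = 0" if "j < d" for j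
      using yadd[OF v mw] ysc[OF w] eq[OF that] by (simp add: scaleC_minus_left)
    then have "v + - 1 \<cdot>\<^sub>v w \<in> K" unfolding K_def using v w by simp
    then have "v + - 1 \<cdot>\<^sub>v w = 0\<^sub>v d" unfolding K0 by simp
    then have z: "vec_index (v + - 1 \<cdot>\<^sub>v w) i = 0" if "i < d" for i using that by simp
    show ?thesis
    proof (rule eq_vecI)
      show "vec_index v i = vec_index w i" if "i < dim_vec w" for i
        using z[of i] that v w by simp
    qed (use v w in simp)
  qed
  obtain c v where v: "v \<in> carrier_vec d" "v \<noteq> 0\<^sub>v d" "\<pi> g\<^sub>0 *\<^sub>v v = c \<cdot>\<^sub>v v"
    by (rule complex_eigenvector_exists[OF r(1) d0]) (rule that)
  have pcomm: "\<pi> g\<^sub>0 *\<^sub>v (\<pi> g *\<^sub>v w) = \<pi> g *\<^sub>v (\<pi> g\<^sub>0 *\<^sub>v w)" if w: "w \<in> carrier_vec d" for g w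
  proof (rule inj)
    fix j assume j: "j < d"
    have "y j (\<pi> g\<^sub>0 *\<^sub>v (\<pi> g *\<^sub>v w)) = \<alpha> g\<^sub>0 (\<alpha> g (y j w))" using \<alpha>y j w vc by simp
    also have "\<dots> = \<alpha> g (\<alpha> g\<^sub>0 (y j w))" by (rule comm[symmetric])
    also have "\<dots> = y j (\<pi> g *\<^sub>v (\<pi> g\<^sub>0 *\<^sub>v w))" using \<alpha>y j w vc by simp
    finally show "y j (\<pi> g\<^sub>0 *\<^sub>v (\<pi> g *\<^sub>v w)) = y j (\<pi> g *\<^sub>v (\<pi> g\<^sub>0 *\<^sub>v w))" .
  qed (use w vc in blast)+
  \<comment> \<open>Schur's argument: an eigenspace of \<open>\<pi> g\<^sub>0\<close> is invariant
    because \<open>\<pi> g\<^sub>0\<close> commutes with the representation.\<close>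
  define W where "W = {w \<in> carrier_vec d. \<pi> g\<^sub>0 *\<^sub>v w = c \<cdot>\<^sub>v w}"
  have "invariant_subspace \<pi> W"
    unfolding invariant_subspace_def d_def[symmetric]
  proof (intro conjI ballI allI)
    show "W \<subseteq> carrier_vec d" unfolding W_def by blast
    show "0\<^sub>v d \<in> W" unfolding W_def using vsc[of "0\<^sub>v d" g\<^sub>0 0] r(1)[of g\<^sub>0] by auto
    show "v + w \<in> W" if "v \<in> W" "w \<in> W" for v w
      using that unfolding W_def by (auto simp: vadd smult_add_distrib_vec[of _ d])
    show "b \<cdot>\<^sub>v w \<in> W" if "w \<in> W" for b w
      using that unfolding W_def by (simp add: vsc smult_smult_assoc mult.commute)
    show "\<pi> g *\<^sub>v w \<in> W" if "w \<in> W" for g w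
      using that unfolding W_def by (simp add: pcomm vsc vc)
  qed
  moreover have "W \<noteq> {0\<^sub>v d}" using v unfolding W_def by blast
  ultimately have W: "W = carrier_vec d" using irr by blast
  have "\<pi> g\<^sub>0 = c \<cdot>\<^sub>m 1\<^sub>m d"
  proof (rule eq_matI)
    fix i j assume ij: "i < dim_row (c \<cdot>\<^sub>m 1\<^sub>m d)" "j < dim_col (c \<cdot>\<^sub>m 1\<^sub>m d)"
    then have ij: "i < d" "j < d" by auto
    have "unit_vec d j \<in> W" unfolding W by simp
    then have "vec_index (\<pi> g\<^sub>0 *\<^sub>v unit_vec d j) i = vec_index (c \<cdot>\<^sub>v unit_vec d j) i" unfolding W_def by simp
    then show "\<pi> g\<^sub>0 $$ (i, j) = (c \<cdot>\<^sub>m 1\<^sub>m d) $$ (i, j)"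
      using ij carrier_matD[OF r(1)[of g\<^sub>0]] by (simp add: scalar_prod_right_unit split: if_splits)
  qed (use r(1) in auto)
  moreover have "cmod (c - 1) \<le> \<theta>"
  proof -
    have "\<exists>j<d. y j v \<noteq> 0"
    proof (rule ccontr)
      assume "\<not> ?thesis"
      then have "v \<in> K" unfolding K_def using v(1) by blast
      then show False using K0 v(2) by blast
    qed
    then obtain j where j: "j < d" "y j v \<noteq> 0" by blast
    have "\<alpha> g\<^sub>0 (y j v) = c *\<^sub>C y j v" using \<alpha>y[OF v(1) j(1)] ysc[OF v(1)] v(3) by simp
    then have "\<alpha> g\<^sub>0 (y j v) - y j v = (c - 1) *\<^sub>C y j v" by (simp add: scaleC_diff_left)
    then have "cmod (c - 1) * norm (y j v) \<le> \<theta> * norm (y j v)"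
      using \<theta>[OF yB[OF j(1), of v]] by (simp add: norm_scaleC)
    then show ?thesis using j(2) by simp
  qed
  ultimately show ?thesis using that unfolding d_def by blast
qed

lemma unitary_conj_scalar:
  fixes U :: "complex mat"
  assumes U: "unitary_mat n U" and A: "A \<in> carrier_mat n n"
  shows "U * A * mat_adjoint U = c \<cdot>\<^sub>m 1\<^sub>m n \<longleftrightarrow> A = c \<cdot>\<^sub>m 1\<^sub>m n"
proof -
  have u: "U \<in> carrier_mat n n" "mat_adjoint U * U = 1\<^sub>m n" "U * mat_adjoint U = 1\<^sub>m n"
    using U unfolding unitary_mat_def by auto
  have ac: "mat_adjoint U \<in> carrier_mat n n" using u(1) unfolding mat_adjoint_def by auto
  have "A = c \<cdot>\<^sub>m 1\<^sub>m n" if eq: "U * A * mat_adjoint U = c \<cdot>\<^sub>m 1\<^sub>m n"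
  proof -
    have "mat_adjoint U * (U * A * mat_adjoint U) * U = (mat_adjoint U * U) * A * (mat_adjoint U * U)"
      using u(1) ac A by (simp add: assoc_mult_mat[of _ n n _ n _ n])
    also have "\<dots> = A" using u A by simp
    finally have "A = mat_adjoint U * (c \<cdot>\<^sub>m 1\<^sub>m n) * U" unfolding eq by simp
    also have "mat_adjoint U * (c \<cdot>\<^sub>m 1\<^sub>m n) = c \<cdot>\<^sub>m mat_adjoint U"
      using mult_smult_distrib[OF ac one_carrier_mat, of c] ac by simp
    also have "c \<cdot>\<^sub>m mat_adjoint U * U = c \<cdot>\<^sub>m (mat_adjoint U * U)" by (rule mult_smult_assoc_mat[OF ac u(1)])
    finally show ?thesis using u by simp
  qed
  moreover have "U * (c \<cdot>\<^sub>m 1\<^sub>m n) * mat_adjoint U = c \<cdot>\<^sub>m 1\<^sub>m n"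
    using mult_smult_distrib[OF u(1) one_carrier_mat, of c] mult_smult_assoc_mat[OF u(1) ac, of c] u by simp
  ultimately show ?thesis by blast
qed

theorem proposition7:
  fixes \<alpha> :: "'g::{topological_group_add,t2_space} \<Rightarrow> 'a::cstar_algebra \<Rightarrow> 'a"
    and \<mu> :: "'g measure"
    and g\<^sub>0 :: 'g
    and u\<^sub>0 :: "'a mloc"
  assumes "compact (UNIV :: 'g set)"
    and "normalized_haar_measure \<mu>"
    and "cstar_dynamical_system \<alpha>"
    and "prime_cstar_algebra TYPE('a)"
    and "mloc_unitary u\<^sub>0"
    and "u\<^sub>0 \<in> mloc_fixed \<alpha>"
    and "\<forall>a. mloc_of (\<alpha> g\<^sub>0 a) = u\<^sub>0 * mloc_of a * star u\<^sub>0"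
  shows "g\<^sub>0 \<in> annihilator (weak_connes_spectrum \<mu> \<alpha>)"
  unfolding annihilator_def
proof (intro CollectI ballI)
  fix P \<pi> assume P: "P \<in> weak_connes_spectrum \<mu> \<alpha>" and \<pi>: "\<pi> \<in> P"
  note comm = inner_commutes_with_action[OF assms(1,3-7)]
  \<comment> \<open>The spectrum of \<open>\<alpha>\<close> on \<open>B\<close> involves some
    representative of the class \<open>P\<close>; conjugation by a unitary matrix transfers the
    scalar to the given \<open>\<pi>\<close>.\<close>
  have scalar: "\<exists>c. cmod (c - 1) \<le> \<theta> \<and> \<pi> g\<^sub>0 = c \<cdot>\<^sub>m 1\<^sub>m (rep_dim \<pi>) \<and> rep_dim \<pi> > 0" if \<theta>: "\<theta> > 0" for \<theta>
  proof -
    obtain B where B: "B \<in> invariant_hereditary_subalgebras \<alpha>" "\<And>x. x \<in> B \<Longrightarrow> norm (\<alpha> g\<^sub>0 x - x) \<le> \<theta> * norm x"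
      by (rule almost_fixed_hereditary_subalgebra[OF assms \<theta>]) (rule that)
    have Bs: "closed_subspace B" "\<And>g x. x \<in> B \<Longrightarrow> \<alpha> g x \<in> B"
      using B(1) unfolding invariant_hereditary_subalgebras_def hereditary_subalgebra_def cstar_subalgebra_def
        closed_subspace_def by auto
    have "P \<in> action_spectrum \<mu> \<alpha> B" using P B(1) unfolding weak_connes_spectrum_def by blast
    then obtain \<pi>' where PD: "P \<in> unitary_dual" and \<pi>': "\<pi>' \<in> P" "spectral_subspace \<mu> \<alpha> B \<pi>' \<noteq> {0}"
      unfolding action_spectrum_def by blast
    obtain \<rho> where \<rho>: "P = unitary_equivalence `` {\<rho>}" using PD unfolding unitary_dual_def by (auto elim: quotientE)
    have eqv: "irreducible_unitary_rep \<rho>" "irreducible_unitary_rep \<tau>"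
      "\<exists>U. unitary_mat (rep_dim \<rho>) U \<and> (\<forall>g. \<tau> g = U * \<rho> g * mat_adjoint U)" if "\<tau> \<in> P" for \<tau>
      using that unfolding \<rho> unitary_equivalence_def by auto
    have rc: "\<rho> g \<in> carrier_mat (rep_dim \<rho>) (rep_dim \<rho>)" for g
      using eqv(1)[OF \<pi>] unitary_repD(1) unfolding irreducible_unitary_rep_def by blast
    have tr: "rep_dim \<tau> = rep_dim \<rho> \<and> (\<tau> g\<^sub>0 = c \<cdot>\<^sub>m 1\<^sub>m (rep_dim \<rho>) \<longleftrightarrow> \<rho> g\<^sub>0 = c \<cdot>\<^sub>m 1\<^sub>m (rep_dim \<rho>))"
      if \<tau>: "\<tau> \<in> P" for \<tau> c
    proof -
      obtain U where U: "unitary_mat (rep_dim \<rho>) U" "\<And>g. \<tau> g = U * \<rho> g * mat_adjoint U" using eqv(3)[OF \<tau>] by blast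
      have "rep_dim \<tau> = rep_dim \<rho>" using U unfolding rep_dim_def[of \<tau>] unitary_mat_def by auto
      then show ?thesis using unitary_conj_scalar[OF U(1) rc] U(2) by simp
    qed
    obtain c where c: "cmod (c - 1) \<le> \<theta>" "\<pi>' g\<^sub>0 = c \<cdot>\<^sub>m 1\<^sub>m (rep_dim \<pi>')"
      by (rule representation_scalar_of_almost_fixed[OF assms(1-3) Bs eqv(2)[OF \<pi>'(1)] \<pi>'(2) comm B(2)]) (auto intro: that)
    then have "\<pi> g\<^sub>0 = c \<cdot>\<^sub>m 1\<^sub>m (rep_dim \<pi>)" using tr[OF \<pi>'(1)] tr[OF \<pi>] by metis
    moreover have "rep_dim \<pi> > 0" using eqv(2)[OF \<pi>] unfolding irreducible_unitary_rep_def by blast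
    ultimately show ?thesis using c(1) by blast
  qed
  \<comment> \<open>The dimension being positive, the entry at (0, 0) determines the scalar. The one
    found for \<theta> = 1 is therefore the one for every \<theta>, and letting \<theta> tend to 0
    gives 1.\<close>
  obtain c where c: "\<pi> g\<^sub>0 = c \<cdot>\<^sub>m 1\<^sub>m (rep_dim \<pi>)" "rep_dim \<pi> > 0" using scalar[of 1] by auto
  have "cmod (c - 1) \<le> 0 + \<theta>" if \<theta>: "\<theta> > 0" for \<theta>
  proof -
    obtain c' where c': "cmod (c' - 1) \<le> \<theta>" "\<pi> g\<^sub>0 = c' \<cdot>\<^sub>m 1\<^sub>m (rep_dim \<pi>)" using scalar[OF \<theta>] by blast
    have "(c \<cdot>\<^sub>m 1\<^sub>m (rep_dim \<pi>)) $$ (0, 0) = (c' \<cdot>\<^sub>m 1\<^sub>m (rep_dim \<pi>)) $$ (0, 0)" using c(1) c'(2) by simp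
    then have "c = c'" using c(2) by simp
    then show ?thesis using c'(1) by simp
  qed
  then have "cmod (c - 1) \<le> 0" by (rule field_le_epsilon)
  then have "c = 1" by simp
  then show "\<pi> g\<^sub>0 = 1\<^sub>m (rep_dim \<pi>)" using c(1) by (auto intro: eq_matI)
qed

end
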